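(* Let $\mathcal M$ be a Green 2-functor, let $i\colon H\to G$ be a faithful morphism of finite groupoids, and let $A(i):=i_*(\mathbf 1_H)\in\mathcal M(G)$. The object $A(i)$ inherits a canonical structure of special Frobenius algebra in the tensor category $\mathcal M(G)$ (given by the canonical monoid and comonoid structures on $A(i)$ described in the context), and this structure lifts to a commutative Frobenius algebra in the monoidal center $\mathcal Z(\mathcal M(G))$ of $\mathcal M(G)$.
   Context: $\mathsf{gpd}$ is the 2-category of finite groupoids, functors and natural transformations. $\mathsf{ADD}$ is the 2-category of (possibly large) additive categories, additive functors and natural transformations. A Mackey 2-functor is a 2-functor $\mathcal M\colon \mathsf{gpd}^{op}\to\mathsf{ADD}$ (reversing 1-cells only; write $u^*=\mathcal M(u)$) such that: (1) $\mathcal M$ sends finite coproducts to direct sums; (2) for every faithful $i\colon H\to G$, $i^*\colon\mathcal M(G)\to\mathcal M(H)$ has a left adjoint $i_!$ and a right adjoint $i_*$; (3) for every iso-comma square with projections $p\colon P\to H$, $q\colon P\to K$ and 2-cell $\gamma\colon ip\Rightarrow uq$, where $i\colon H\to G$ is faithful and $u\colon K\to G$ arbitrary, the mates $\gamma_!\colon q_!p^*\Rightarrow u^*i_!$ and $(\gamma^{-1})_*\colon u^*i_*\Rightarrow q_*p^*$ are invertible; (4) for every faithful $i$ there is an isomorphism $i_!\simeq i_*$. Convention: Mackey 2-functors are rectified, i.e. they come with chosen adjunctions $(i_!\dashv i^*,{}^\ell\eta,{}^\ell\varepsilon)$ and $(i^*\dashv i_*,{}^r\eta,{}^r\varepsilon)$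 for all faithful $i$ such that $i_!=i_*$ as functors, the two induced pseudofunctors $i\mapsto i_!$ and $i\mapsto i_*$ agree, $(\gamma_!)^{-1}=(\gamma^{-1})_*$ for every square as in (3), and ${}^r\varepsilon\circ{}^\ell\eta=\mathrm{id}$. A Green 2-functor is a Mackey 2-functor $\mathcal M$ together with a lift of the 2-functor $\mathcal M$ to additive monoidal categories $(\mathcal M(G),\otimes_G,\mathbf 1_G)$ (tensor product additive in both variables), additive strong monoidal functors $u^*$ and monoidal natural transformations, such that the external product $X\boxdot Y:=\pi_1^*X\otimes_{G_1\times G_2}\pi_2^*Y\in\mathcal M(G_1\times G_2)$ ($X\in\mathcal M(G_1)$, $Y\in\mathcal M(G_2)$, $\pi_k$ the projections) preserves inductions in both variables: for all faithful $i_1\colon H_1\to G_1$, $i_2\colon H_2\to G_2$, the right mate $(i_1)_*X\boxdot(i_2)_*Y\to(i_1\times i_2)_*(X\boxdot Y)$ of the canonical isomorphism $(i_1\times i_2)^*(-\boxdot-)\cong i_1^*(-)\boxdot i_2^*(-)$ is invertible (equivalently, the left mate $(i_1\times i_2)_!(X\boxdot Y)\to (i_1)_!X\boxdot(i_2)_!Y$ is invertible; equivalently these two mates are mutually inverse). Canonical (co)monoid structure on $A=A(i)=i_*(\mathbf 1_H)=i_!(\mathbf 1_H)$: since $i^*$ is strong monoidal, its right adjoint $i_*$ is lax monoidal via $i_*X\otimes i_*Y\xrightarrow{{}^r\eta}i_*i^*(i_*X\otimes i_*Y)\cong i_*(i^*i_*X\otimes i^*i_*Y)\xrightarrow{i_*({}^r\varepsilon\otimes{}^r\varepsilon)}i_*(X\otimes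 Y)$ and $\mathbf 1_G\xrightarrow{{}^r\eta}i_*i^*\mathbf 1_G\cong i_*\mathbf 1_H$, and dually its left adjoint $i_!$ is colax monoidal. The multiplication $\mu$ and unit $\iota$ of $A$ are the lax structure maps at $\mathbf 1_H$ (using $\mathbf 1_H\otimes\mathbf 1_H\cong\mathbf 1_H$); the comultiplication $\delta$ and counit $\epsilon$ are the colax structure maps at $\mathbf 1_H$. A Frobenius algebra in a monoidal category is an object with a monoid structure $(\mu,\iota)$ and a comonoid structure $(\delta,\epsilon)$ with $(A\otimes\mu)(\delta\otimes A)=\delta\mu=(\mu\otimes A)(A\otimes\delta)$; it is special if $\mu\circ\delta=\mathrm{id}_A$; in a braided category it is commutative if its monoid is. The monoidal (Drinfeld) center $\mathcal Z(\mathcal C)$ of a monoidal category $\mathcal C$ has as objects the pairs $(A,\sigma)$ with $\sigma=\{\sigma_X\colon A\otimes X\xrightarrow{\sim}X\otimes A\}_X$ a half-braiding (natural, with $\sigma_{X\otimes Y}=(X\otimes\sigma_Y)(\sigma_X\otimes Y)$), morphisms commuting with half-braidings, and its usual braided monoidal structure with braiding given by the half-braidings. *)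

theory Defs
  imports Main "HOL-Library.FuncSet"
begin

section \<open>Categories, functors, natural transformations\<close>

record ('o, 'm) category =
  Obj :: "'o set"
  Arr :: "'m set"
  Dom :: "'m \<Rightarrow> 'o"
  Cod :: "'m \<Rightarrow> 'o"
  Idn :: "'o \<Rightarrow> 'm"
  Comp :: "'m \<Rightarrow> 'm \<Rightarrow> 'm"  (infixr "\<cdot>\<index>" 70)

definition Hom :: "('o, 'm, 'z) category_scheme \<Rightarrow> 'o \<Rightarrow> 'o \<Rightarrow> 'm set" where
  "Hom C x y = {f \<in> Arr C. Dom C f = x \<and> Cod C f = y}"

locale category =
  fixes C :: "('o, 'm, 'z) category_scheme" (structure)
  assumes dom_closed: "f \<in> Arr C \<Longrightarrow> Dom C f \<in> Obj C"
    and cod_closed: "f \<in> Arr C \<Longrightarrow> Cod C f \<in> Obj C"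
    and idn_closed: "x \<in> Obj C \<Longrightarrow> Idn C x \<in> Hom C x x"
    and comp_closed: "\<lbrakk>f \<in> Hom C x y; g \<in> Hom C y z\<rbrakk> \<Longrightarrow> g \<cdot> f \<in> Hom C x z"
    and comp_idn_left: "f \<in> Hom C x y \<Longrightarrow> Idn C y \<cdot> f = f"
    and comp_idn_right: "f \<in> Hom C x y \<Longrightarrow> f \<cdot> Idn C x = f"
    and comp_assoc: "\<lbrakk>f \<in> Hom C w x; g \<in> Hom C x y; h \<in> Hom C y z\<rbrakk>
      \<Longrightarrow> (h \<cdot> g) \<cdot> f = h \<cdot> (g \<cdot> f)"

definition inverses :: "('o, 'm, 'z) category_scheme \<Rightarrow> 'm \<Rightarrow> 'm \<Rightarrow> bool" where
  "inverses C f g \<longleftrightarrow> f \<in> Arr C \<and> g \<in> Hom C (Cod C f) (Dom C f)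
     \<and> g \<cdot>\<^bsub>C\<^esub> f = Idn C (Dom C f) \<and> f \<cdot>\<^bsub>C\<^esub> g = Idn C (Cod C f)"

definition iso_arr :: "('o, 'm, 'z) category_scheme \<Rightarrow> 'm \<Rightarrow> bool" where
  "iso_arr C f \<longleftrightarrow> (\<exists>g. inverses C f g)"

definition inv_arr :: "('o, 'm, 'z) category_scheme \<Rightarrow> 'm \<Rightarrow> 'm" where
  "inv_arr C f = (THE g. inverses C f g)"

record ('o, 'm, 'p, 'n) functor_data =
  ob :: "'o \<Rightarrow> 'p"
  ar :: "'m \<Rightarrow> 'n"

locale is_functor =
  source: category C + target: category D
  for C :: "('o, 'm, 'y) category_scheme" and D :: "('p, 'n, 'z) category_scheme" +
  fixes F :: "('o, 'm, 'p, 'n, 'w) functor_data_scheme"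
  assumes ob_closed: "x \<in> Obj C \<Longrightarrow> ob F x \<in> Obj D"
    and ar_closed: "f \<in> Hom C x y \<Longrightarrow> ar F f \<in> Hom D (ob F x) (ob F y)"
    and ar_idn: "x \<in> Obj C \<Longrightarrow> ar F (Idn C x) = Idn D (ob F x)"
    and ar_comp: "\<lbrakk>f \<in> Hom C x y; g \<in> Hom C y z\<rbrakk>
      \<Longrightarrow> ar F (g \<cdot>\<^bsub>C\<^esub> f) = ar F g \<cdot>\<^bsub>D\<^esub> ar F f"

definition id_fun :: "('o, 'm, 'o, 'm) functor_data" where
  "id_fun = \<lparr>ob = (\<lambda>x. x), ar = (\<lambda>f. f)\<rparr>"

definition comp_fun ::
  "('p, 'n, 'q, 'k, 'v) functor_data_scheme \<Rightarrow> ('o, 'm, 'p, 'n, 'w) functor_data_scheme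
    \<Rightarrow> ('o, 'm, 'q, 'k) functor_data" where
  "comp_fun G F = \<lparr>ob = (\<lambda>x. ob G (ob F x)), ar = (\<lambda>f. ar G (ar F f))\<rparr>"

definition functors_agree ::
  "('o, 'm, 'z) category_scheme \<Rightarrow> ('o, 'm, 'p, 'n, 'v) functor_data_scheme
    \<Rightarrow> ('o, 'm, 'p, 'n, 'w) functor_data_scheme \<Rightarrow> bool" where
  "functors_agree C F G \<longleftrightarrow> (\<forall>x\<in>Obj C. ob F x = ob G x) \<and> (\<forall>f\<in>Arr C. ar F f = ar G f)"

locale nat_trans =
  F: is_functor C D F + G: is_functor C D G
  for C :: "('o, 'm, 'y) category_scheme" and D :: "('p, 'n, 'z) category_scheme"
    and F :: "('o, 'm, 'p, 'n, 'v) functor_data_scheme"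
    and G :: "('o, 'm, 'p, 'n, 'w) functor_data_scheme" +
  fixes \<tau> :: "'o \<Rightarrow> 'n"
  assumes component: "x \<in> Obj C \<Longrightarrow> \<tau> x \<in> Hom D (ob F x) (ob G x)"
    and naturality: "f \<in> Hom C x y \<Longrightarrow> \<tau> y \<cdot>\<^bsub>D\<^esub> ar F f = ar G f \<cdot>\<^bsub>D\<^esub> \<tau> x"

locale nat_iso = nat_trans +
  assumes component_iso: "x \<in> Obj C \<Longrightarrow> iso_arr D (\<tau> x)"

definition equivalence ::
  "('o, 'm, 'y) category_scheme \<Rightarrow> ('p, 'n, 'z) category_scheme
    \<Rightarrow> ('o, 'm, 'p, 'n) functor_data \<Rightarrow> bool" where
  "equivalence C D F \<longleftrightarrow> is_functor C D F \<and>
     (\<exists>(G :: ('p, 'n, 'o, 'm) functor_data) \<eta> \<epsilon>. is_functor D C G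
        \<and> nat_iso C C id_fun (comp_fun G F) \<eta> \<and> nat_iso D D (comp_fun F G) id_fun \<epsilon>)"

locale adjunction =
  L: is_functor C D L + R: is_functor D C R
  + unit: nat_trans C C id_fun "comp_fun R L" \<eta>
  + counit: nat_trans D D "comp_fun L R" id_fun \<epsilon>
  for C :: "('o, 'm, 'y) category_scheme" and D :: "('p, 'n, 'z) category_scheme"
    and L :: "('o, 'm, 'p, 'n) functor_data" and R :: "('p, 'n, 'o, 'm) functor_data"
    and \<eta> :: "'o \<Rightarrow> 'm" and \<epsilon> :: "'p \<Rightarrow> 'n" +
  assumes triangle_left: "x \<in> Obj C \<Longrightarrow> \<epsilon> (ob L x) \<cdot>\<^bsub>D\<^esub> ar L (\<eta> x) = Idn D (ob L x)"
    and triangle_right: "y \<in> Obj D \<Longrightarrow> ar R (\<epsilon> y) \<cdot>\<^bsub>C\<^esub> \<eta> (ob R y) = Idn C (ob R y)"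

text \<open>The product of the categories \<open>Cs k\<close>, \<open>k < n\<close>, and the functor into it with components
  \<open>Fs k\<close>.\<close>

definition product_category ::
  "nat \<Rightarrow> (nat \<Rightarrow> ('o, 'm, 'z) category_scheme) \<Rightarrow> (nat \<Rightarrow> 'o, nat \<Rightarrow> 'm) category" where
  "product_category n Cs =
     \<lparr>Obj = (\<Pi>\<^sub>E k\<in>{..<n}. Obj (Cs k)),
      Arr = (\<Pi>\<^sub>E k\<in>{..<n}. Arr (Cs k)),
      Dom = (\<lambda>f. \<lambda>k\<in>{..<n}. Dom (Cs k) (f k)),
      Cod = (\<lambda>f. \<lambda>k\<in>{..<n}. Cod (Cs k) (f k)),
      Idn = (\<lambda>x. \<lambda>k\<in>{..<n}. Idn (Cs k) (x k)),
      Comp = (\<lambda>g f. \<lambda>k\<in>{..<n}. g k \<cdot>\<^bsub>Cs k\<^esub> f k)\<rparr>"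

definition tuple_functor ::
  "nat \<Rightarrow> (nat \<Rightarrow> ('o, 'm, 'p, 'n) functor_data)
    \<Rightarrow> ('o, 'm, nat \<Rightarrow> 'p, nat \<Rightarrow> 'n) functor_data" where
  "tuple_functor n Fs =
     \<lparr>ob = (\<lambda>x. \<lambda>k\<in>{..<n}. ob (Fs k) x), ar = (\<lambda>f. \<lambda>k\<in>{..<n}. ar (Fs k) f)\<rparr>"


section \<open>Additive categories\<close>

record ('o, 'm) additive_category = "('o, 'm) category" +
  Plus :: "'m \<Rightarrow> 'm \<Rightarrow> 'm"
  Zero :: "'o \<Rightarrow> 'o \<Rightarrow> 'm"

locale additive_category = category C
  for C :: "('o, 'm, 'z) additive_category_scheme" (structure) +
  assumes plus_closed: "\<lbrakk>f \<in> Hom C x y; g \<in> Hom C x y\<rbrakk> \<Longrightarrow> Plus C f g \<in> Hom C x y"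
    and plus_assoc: "\<lbrakk>f \<in> Hom C x y; g \<in> Hom C x y; h \<in> Hom C x y\<rbrakk>
      \<Longrightarrow> Plus C (Plus C f g) h = Plus C f (Plus C g h)"
    and plus_commute: "\<lbrakk>f \<in> Hom C x y; g \<in> Hom C x y\<rbrakk> \<Longrightarrow> Plus C f g = Plus C g f"
    and zero_closed: "\<lbrakk>x \<in> Obj C; y \<in> Obj C\<rbrakk> \<Longrightarrow> Zero C x y \<in> Hom C x y"
    and plus_zero: "f \<in> Hom C x y \<Longrightarrow> Plus C f (Zero C x y) = f"
    and negative: "f \<in> Hom C x y \<Longrightarrow> \<exists>g\<in>Hom C x y. Plus C f g = Zero C x y"
    and comp_plus_right: "\<lbrakk>f \<in> Hom C x y; g \<in> Hom C x y; h \<in> Hom C y z\<rbrakk>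
      \<Longrightarrow> h \<cdot> Plus C f g = Plus C (h \<cdot> f) (h \<cdot> g)"
    and comp_plus_left: "\<lbrakk>f \<in> Hom C x y; g \<in> Hom C y z; h \<in> Hom C y z\<rbrakk>
      \<Longrightarrow> Plus C g h \<cdot> f = Plus C (g \<cdot> f) (h \<cdot> f)"
    and zero_object: "\<exists>z\<in>Obj C. Idn C z = Zero C z z"
    and biproduct: "\<lbrakk>x \<in> Obj C; y \<in> Obj C\<rbrakk> \<Longrightarrow>
      \<exists>s\<in>Obj C. \<exists>i\<in>Hom C x s. \<exists>j\<in>Hom C y s. \<exists>p\<in>Hom C s x. \<exists>q\<in>Hom C s y.
        p \<cdot> i = Idn C x \<and> q \<cdot> j = Idn C y \<and> q \<cdot> i = Zero C x y \<and> p \<cdot> j = Zero C y x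
        \<and> Plus C (i \<cdot> p) (j \<cdot> q) = Idn C s"

locale additive_functor = is_functor C D F + source: additive_category C + target: additive_category D
  for C :: "('o, 'm, 'y) additive_category_scheme"
    and D :: "('p, 'n, 'z) additive_category_scheme"
    and F :: "('o, 'm, 'p, 'n, 'w) functor_data_scheme" +
  assumes ar_plus: "\<lbrakk>f \<in> Hom C x y; g \<in> Hom C x y\<rbrakk>
      \<Longrightarrow> ar F (Plus C f g) = Plus D (ar F f) (ar F g)"


section \<open>Monoidal categories\<close>

text \<open>Monoidal categories are not assumed strict. The operation \<open>\<otimes>\<close> is the tensor product of
  objects and \<open>\<odot>\<close> that of arrows; the associator \<open>Assoc T x y z\<close> goes from
  \<open>(x \<otimes> y) \<otimes> z\<close> to \<open>x \<otimes> (y \<otimes> z)\<close>. The tensor structure is kept separate from the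
  category that carries it.\<close>

record ('o, 'm) tensor =
  tob :: "'o \<Rightarrow> 'o \<Rightarrow> 'o"  (infixr "\<otimes>\<index>" 75)
  tar :: "'m \<Rightarrow> 'm \<Rightarrow> 'm"  (infixr "\<odot>\<index>" 75)
  Unit :: 'o
  Assoc :: "'o \<Rightarrow> 'o \<Rightarrow> 'o \<Rightarrow> 'm"
  LUnit :: "'o \<Rightarrow> 'm"
  RUnit :: "'o \<Rightarrow> 'm"

locale monoidal_category = category C
  for C :: "('o, 'm, 'z) category_scheme" +
  fixes T :: "('o, 'm) tensor" (structure)
  assumes tob_closed: "\<lbrakk>x \<in> Obj C; y \<in> Obj C\<rbrakk> \<Longrightarrow> x \<otimes> y \<in> Obj C"
    and unit_closed: "Unit T \<in> Obj C"
    and tar_closed: "\<lbrakk>f \<in> Hom C x y; g \<in> Hom C x' y'\<rbrakk> \<Longrightarrow> f \<odot> g \<in> Hom C (x \<otimes> x') (y \<otimes> y')"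
    and tar_idn: "\<lbrakk>x \<in> Obj C; y \<in> Obj C\<rbrakk> \<Longrightarrow> Idn C x \<odot> Idn C y = Idn C (x \<otimes> y)"
    and tar_comp: "\<lbrakk>f \<in> Hom C x y; g \<in> Hom C y z; f' \<in> Hom C x' y'; g' \<in> Hom C y' z'\<rbrakk>
      \<Longrightarrow> (g \<cdot>\<^bsub>C\<^esub> f) \<odot> (g' \<cdot>\<^bsub>C\<^esub> f') = (g \<odot> g') \<cdot>\<^bsub>C\<^esub> (f \<odot> f')"
    and assoc_closed: "\<lbrakk>x \<in> Obj C; y \<in> Obj C; z \<in> Obj C\<rbrakk>
      \<Longrightarrow> Assoc T x y z \<in> Hom C ((x \<otimes> y) \<otimes> z) (x \<otimes> (y \<otimes> z))"
    and assoc_iso: "\<lbrakk>x \<in> Obj C; y \<in> Obj C; z \<in> Obj C\<rbrakk> \<Longrightarrow> iso_arr C (Assoc T x y z)"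
    and assoc_natural: "\<lbrakk>f \<in> Hom C x x'; g \<in> Hom C y y'; h \<in> Hom C z z'\<rbrakk>
      \<Longrightarrow> Assoc T x' y' z' \<cdot>\<^bsub>C\<^esub> ((f \<odot> g) \<odot> h) = (f \<odot> (g \<odot> h)) \<cdot>\<^bsub>C\<^esub> Assoc T x y z"
    and lunit_closed: "x \<in> Obj C \<Longrightarrow> LUnit T x \<in> Hom C (Unit T \<otimes> x) x"
    and lunit_iso: "x \<in> Obj C \<Longrightarrow> iso_arr C (LUnit T x)"
    and lunit_natural: "f \<in> Hom C x y
      \<Longrightarrow> LUnit T y \<cdot>\<^bsub>C\<^esub> (Idn C (Unit T) \<odot> f) = f \<cdot>\<^bsub>C\<^esub> LUnit T x"
    and runit_closed: "x \<in> Obj C \<Longrightarrow> RUnit T x \<in> Hom C (x \<otimes> Unit T) x"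
    and runit_iso: "x \<in> Obj C \<Longrightarrow> iso_arr C (RUnit T x)"
    and runit_natural: "f \<in> Hom C x y
      \<Longrightarrow> RUnit T y \<cdot>\<^bsub>C\<^esub> (f \<odot> Idn C (Unit T)) = f \<cdot>\<^bsub>C\<^esub> RUnit T x"
    and pentagon: "\<lbrakk>w \<in> Obj C; x \<in> Obj C; y \<in> Obj C; z \<in> Obj C\<rbrakk>
      \<Longrightarrow> (Idn C w \<odot> Assoc T x y z) \<cdot>\<^bsub>C\<^esub> Assoc T w (x \<otimes> y) z \<cdot>\<^bsub>C\<^esub> (Assoc T w x y \<odot> Idn C z)
        = Assoc T w x (y \<otimes> z) \<cdot>\<^bsub>C\<^esub> Assoc T (w \<otimes> x) y z"
    and triangle: "\<lbrakk>x \<in> Obj C; y \<in> Obj C\<rbrakk>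
      \<Longrightarrow> (Idn C x \<odot> LUnit T y) \<cdot>\<^bsub>C\<^esub> Assoc T x (Unit T) y = RUnit T x \<odot> Idn C y"

locale additive_monoidal_category = additive_category C + monoidal_category C T
  for C :: "('o, 'm, 'z) additive_category_scheme" and T :: "('o, 'm) tensor" (structure) +
  assumes tar_plus_left: "\<lbrakk>f \<in> Hom C x y; g \<in> Hom C x y; h \<in> Hom C x' y'\<rbrakk>
      \<Longrightarrow> Plus C f g \<odot> h = Plus C (f \<odot> h) (g \<odot> h)"
    and tar_plus_right: "\<lbrakk>h \<in> Hom C x y; f \<in> Hom C x' y'; g \<in> Hom C x' y'\<rbrakk>
      \<Longrightarrow> h \<odot> Plus C f g = Plus C (h \<odot> f) (h \<odot> g)"

text \<open>A strong monoidal structure on \<open>F\<close>: \<open>\<phi> x y : F x \<otimes> F y \<rightarrow> F (x \<otimes> y)\<close> and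
  \<open>\<phi>0 : 1 \<rightarrow> F 1\<close>.\<close>

locale strong_monoidal_functor =
  is_functor C D F + source: monoidal_category C S + target: monoidal_category D T
  for C :: "('o, 'm, 'y) category_scheme" and S :: "('o, 'm) tensor"
    and D :: "('p, 'n, 'z) category_scheme" and T :: "('p, 'n) tensor"
    and F :: "('o, 'm, 'p, 'n, 'w) functor_data_scheme" +
  fixes \<phi> :: "'o \<Rightarrow> 'o \<Rightarrow> 'n" and \<phi>0 :: 'n
  assumes mult_closed: "\<lbrakk>x \<in> Obj C; y \<in> Obj C\<rbrakk>
      \<Longrightarrow> \<phi> x y \<in> Hom D (ob F x \<otimes>\<^bsub>T\<^esub> ob F y) (ob F (x \<otimes>\<^bsub>S\<^esub> y))"
    and mult_iso: "\<lbrakk>x \<in> Obj C; y \<in> Obj C\<rbrakk> \<Longrightarrow> iso_arr D (\<phi> x y)"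
    and mult_natural: "\<lbrakk>f \<in> Hom C x x'; g \<in> Hom C y y'\<rbrakk>
      \<Longrightarrow> \<phi> x' y' \<cdot>\<^bsub>D\<^esub> (ar F f \<odot>\<^bsub>T\<^esub> ar F g) = ar F (f \<odot>\<^bsub>S\<^esub> g) \<cdot>\<^bsub>D\<^esub> \<phi> x y"
    and munit_closed: "\<phi>0 \<in> Hom D (Unit T) (ob F (Unit S))"
    and munit_iso: "iso_arr D \<phi>0"
    and mult_assoc: "\<lbrakk>x \<in> Obj C; y \<in> Obj C; z \<in> Obj C\<rbrakk>
      \<Longrightarrow> ar F (Assoc S x y z) \<cdot>\<^bsub>D\<^esub> \<phi> (x \<otimes>\<^bsub>S\<^esub> y) z \<cdot>\<^bsub>D\<^esub> (\<phi> x y \<odot>\<^bsub>T\<^esub> Idn D (ob F z))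
        = \<phi> x (y \<otimes>\<^bsub>S\<^esub> z) \<cdot>\<^bsub>D\<^esub> (Idn D (ob F x) \<odot>\<^bsub>T\<^esub> \<phi> y z) \<cdot>\<^bsub>D\<^esub> Assoc T (ob F x) (ob F y) (ob F z)"
    and mult_lunit: "x \<in> Obj C
      \<Longrightarrow> ar F (LUnit S x) \<cdot>\<^bsub>D\<^esub> \<phi> (Unit S) x \<cdot>\<^bsub>D\<^esub> (\<phi>0 \<odot>\<^bsub>T\<^esub> Idn D (ob F x)) = LUnit T (ob F x)"
    and mult_runit: "x \<in> Obj C
      \<Longrightarrow> ar F (RUnit S x) \<cdot>\<^bsub>D\<^esub> \<phi> x (Unit S) \<cdot>\<^bsub>D\<^esub> (Idn D (ob F x) \<odot>\<^bsub>T\<^esub> \<phi>0) = RUnit T (ob F x)"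


section \<open>The 2-category of finite groupoids\<close>

text \<open>The objects and arrows of all groupoids under consideration are taken from the type
  \<open>'a elem\<close>, which is closed under pairing. Being infinite, it contains an isomorphic copy of
  every finite groupoid, for every choice of \<open>'a\<close>. Values outside the carriers are fixed to be
  \<open>undefined\<close>, so that equality of groupoids, functors and natural transformations is equality
  in HOL.\<close>

datatype 'a elem = Atom 'a | Tup (tfst: "'a elem") (tsnd: "'a elem")

type_synonym 'a gpd = "('a elem, 'a elem) category"

definition finite_groupoid :: "'a gpd \<Rightarrow> bool" where
  "finite_groupoid G \<longleftrightarrow> category G \<and> finite (Obj G) \<and> finite (Arr G) \<and> (\<forall>f\<in>Arr G. iso_arr G f)
     \<and> Dom G \<in> extensional (Arr G) \<and> Cod G \<in> extensional (Arr G) \<and> Idn G \<in> extensional (Obj G)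
     \<and> (\<forall>g f. \<not> (f \<in> Arr G \<and> g \<in> Arr G \<and> Cod G f = Dom G g) \<longrightarrow> g \<cdot>\<^bsub>G\<^esub> f = undefined)"

record 'a cell1 = "('a elem, 'a elem, 'a elem, 'a elem) functor_data" +
  src :: "'a gpd"
  tgt :: "'a gpd"

definition gpd_functor :: "'a gpd \<Rightarrow> 'a gpd \<Rightarrow> 'a cell1 \<Rightarrow> bool" where
  "gpd_functor H G u \<longleftrightarrow> src u = H \<and> tgt u = G \<and> finite_groupoid H \<and> finite_groupoid G
     \<and> is_functor H G u \<and> ob u \<in> extensional (Obj H) \<and> ar u \<in> extensional (Arr H)"

definition is_cell1 :: "'a cell1 \<Rightarrow> bool" where
  "is_cell1 u \<longleftrightarrow> gpd_functor (src u) (tgt u) u"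

definition faithful :: "'a cell1 \<Rightarrow> bool" where
  "faithful u \<longleftrightarrow> (\<forall>x\<in>Obj (src u). \<forall>y\<in>Obj (src u). inj_on (ar u) (Hom (src u) x y))"

definition id1 :: "'a gpd \<Rightarrow> 'a cell1" where
  "id1 G = \<lparr>ob = (\<lambda>x\<in>Obj G. x), ar = (\<lambda>f\<in>Arr G. f), src = G, tgt = G\<rparr>"

definition comp1 :: "'a cell1 \<Rightarrow> 'a cell1 \<Rightarrow> 'a cell1"  (infixr "\<circ>1" 75) where
  "u \<circ>1 v = \<lparr>ob = (\<lambda>x\<in>Obj (src v). ob u (ob v x)), ar = (\<lambda>f\<in>Arr (src v). ar u (ar v f)),
             src = src v, tgt = tgt u\<rparr>"

record 'a cell2 =
  src2 :: "'a cell1"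
  tgt2 :: "'a cell1"
  cmp :: "'a elem \<Rightarrow> 'a elem"

definition gpd_nat_trans :: "'a cell1 \<Rightarrow> 'a cell1 \<Rightarrow> 'a cell2 \<Rightarrow> bool" where
  "gpd_nat_trans u v \<alpha> \<longleftrightarrow> src2 \<alpha> = u \<and> tgt2 \<alpha> = v \<and> is_cell1 u \<and> is_cell1 v
     \<and> src u = src v \<and> tgt u = tgt v
     \<and> nat_trans (src u) (tgt u) u v (cmp \<alpha>) \<and> cmp \<alpha> \<in> extensional (Obj (src u))"

definition id2 :: "'a cell1 \<Rightarrow> 'a cell2" where
  "id2 u = \<lparr>src2 = u, tgt2 = u, cmp = (\<lambda>x\<in>Obj (src u). Idn (tgt u) (ob u x))\<rparr>"

definition vcomp2 :: "'a cell2 \<Rightarrow> 'a cell2 \<Rightarrow> 'a cell2" where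
  "vcomp2 \<beta> \<alpha> = \<lparr>src2 = src2 \<alpha>, tgt2 = tgt2 \<beta>,
     cmp = (\<lambda>x\<in>Obj (src (src2 \<alpha>)). cmp \<beta> x \<cdot>\<^bsub>tgt (src2 \<alpha>)\<^esub> cmp \<alpha> x)\<rparr>"

text \<open>For \<open>\<alpha> : v \<Rightarrow> v'\<close> and \<open>\<beta> : u \<Rightarrow> u'\<close>, the 2-cell \<open>hcomp2 \<beta> \<alpha>\<close> goes from \<open>u \<circ>1 v\<close> to
  \<open>u' \<circ>1 v'\<close>.\<close>

definition hcomp2 :: "'a cell2 \<Rightarrow> 'a cell2 \<Rightarrow> 'a cell2" where
  "hcomp2 \<beta> \<alpha> = \<lparr>src2 = src2 \<beta> \<circ>1 src2 \<alpha>, tgt2 = tgt2 \<beta> \<circ>1 tgt2 \<alpha>,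
     cmp = (\<lambda>x\<in>Obj (src (src2 \<alpha>)).
       cmp \<beta> (ob (tgt2 \<alpha>) x) \<cdot>\<^bsub>tgt (src2 \<beta>)\<^esub> ar (src2 \<beta>) (cmp \<alpha> x))\<rparr>"

definition inv2 :: "'a cell2 \<Rightarrow> 'a cell2" where
  "inv2 \<alpha> = \<lparr>src2 = tgt2 \<alpha>, tgt2 = src2 \<alpha>,
     cmp = (\<lambda>x\<in>Obj (src (src2 \<alpha>)). inv_arr (tgt (src2 \<alpha>)) (cmp \<alpha> x))\<rparr>"

text \<open>The functors \<open>us k\<close>, \<open>k < n\<close>, exhibit \<open>G\<close> as the disjoint union of their sources.\<close>

definition gpd_coproduct :: "nat \<Rightarrow> (nat \<Rightarrow> 'a cell1) \<Rightarrow> 'a gpd \<Rightarrow> bool" where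
  "gpd_coproduct n us G \<longleftrightarrow> finite_groupoid G \<and> (\<forall>k<n. gpd_functor (src (us k)) G (us k))
     \<and> bij_betw (\<lambda>(k, x). ob (us k) x) (SIGMA k:{..<n}. Obj (src (us k))) (Obj G)
     \<and> bij_betw (\<lambda>(k, f). ar (us k) f) (SIGMA k:{..<n}. Arr (src (us k))) (Arr G)"

definition gpd_prod :: "'a gpd \<Rightarrow> 'a gpd \<Rightarrow> 'a gpd" where
  "gpd_prod G1 G2 =
    (let O' = case_prod Tup ` (Obj G1 \<times> Obj G2); A = case_prod Tup ` (Arr G1 \<times> Arr G2);
         D = (\<lambda>f\<in>A. Tup (Dom G1 (tfst f)) (Dom G2 (tsnd f)));
         E = (\<lambda>f\<in>A. Tup (Cod G1 (tfst f)) (Cod G2 (tsnd f)))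
     in \<lparr>Obj = O', Arr = A, Dom = D, Cod = E,
         Idn = (\<lambda>x\<in>O'. Tup (Idn G1 (tfst x)) (Idn G2 (tsnd x))),
         Comp = (\<lambda>g f. if f \<in> A \<and> g \<in> A \<and> E f = D g
                   then Tup (tfst g \<cdot>\<^bsub>G1\<^esub> tfst f) (tsnd g \<cdot>\<^bsub>G2\<^esub> tsnd f) else undefined)\<rparr>)"

definition proj1 :: "'a gpd \<Rightarrow> 'a gpd \<Rightarrow> 'a cell1" where
  "proj1 G1 G2 = \<lparr>ob = (\<lambda>x\<in>Obj (gpd_prod G1 G2). tfst x), ar = (\<lambda>f\<in>Arr (gpd_prod G1 G2). tfst f),
                  src = gpd_prod G1 G2, tgt = G1\<rparr>"

definition proj2 :: "'a gpd \<Rightarrow> 'a gpd \<Rightarrow> 'a cell1" where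
  "proj2 G1 G2 = \<lparr>ob = (\<lambda>x\<in>Obj (gpd_prod G1 G2). tsnd x), ar = (\<lambda>f\<in>Arr (gpd_prod G1 G2). tsnd f),
                  src = gpd_prod G1 G2, tgt = G2\<rparr>"

definition prod1 :: "'a cell1 \<Rightarrow> 'a cell1 \<Rightarrow> 'a cell1" where
  "prod1 u v =
     \<lparr>ob = (\<lambda>x\<in>Obj (gpd_prod (src u) (src v)). Tup (ob u (tfst x)) (ob v (tsnd x))),
      ar = (\<lambda>f\<in>Arr (gpd_prod (src u) (src v)). Tup (ar u (tfst f)) (ar v (tsnd f))),
      src = gpd_prod (src u) (src v), tgt = gpd_prod (tgt u) (tgt v)\<rparr>"

text \<open>The square with 2-cell \<open>\<gamma> : i \<circ>1 p \<Rightarrow> u \<circ>1 q\<close> is an iso-comma square if the comparison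
  functor from the source of \<open>p\<close> and \<open>q\<close> to the groupoid of triples
  \<open>(x, y, g : i x \<rightarrow> u y)\<close> is an isomorphism.\<close>

definition iso_comma ::
  "'a cell1 \<Rightarrow> 'a cell1 \<Rightarrow> 'a cell1 \<Rightarrow> 'a cell1 \<Rightarrow> 'a cell2 \<Rightarrow> bool" where
  "iso_comma i u p q \<gamma> \<longleftrightarrow>
     is_cell1 i \<and> is_cell1 u \<and> is_cell1 p \<and> is_cell1 q
     \<and> tgt i = tgt u \<and> src p = src q \<and> tgt p = src i \<and> tgt q = src u
     \<and> gpd_nat_trans (i \<circ>1 p) (u \<circ>1 q) \<gamma>
     \<and> bij_betw (\<lambda>z. (ob p z, ob q z, cmp \<gamma> z)) (Obj (src p))
         {(x, y, g). x \<in> Obj (src i) \<and> y \<in> Obj (src u) \<and> g \<in> Hom (tgt i) (ob i x) (ob u y)}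
     \<and> (\<forall>z\<in>Obj (src p). \<forall>w\<in>Obj (src p).
          bij_betw (\<lambda>f. (ar p f, ar q f)) (Hom (src p) z w)
            {(a, b). a \<in> Hom (src i) (ob p z) (ob p w) \<and> b \<in> Hom (src u) (ob q z) (ob q w)
               \<and> cmp \<gamma> w \<cdot>\<^bsub>tgt i\<^esub> ar i a = ar u b \<cdot>\<^bsub>tgt i\<^esub> cmp \<gamma> z})"


section \<open>Rectified Mackey 2-functors\<close>

text \<open>\<open>res M u\<close> is the functor \<open>u\<^sup>*\<close>, \<open>res2 M \<alpha>\<close> the transformation \<open>\<alpha>\<^sup>*\<close>, and
  \<open>ind M i\<close> is the functor \<open>i\<^sub>! = i\<^sub>*\<close>, with unit \<open>leta\<close> and counit \<open>leps\<close> for \<open>i\<^sub>! \<stileturn> i\<^sup>*\<close>, and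
  unit \<open>reta\<close> and counit \<open>reps\<close> for \<open>i\<^sup>* \<stileturn> i\<^sub>*\<close>. All categories \<open>cat M G\<close> draw their objects
  from one type and their arrows from another; no disjointness is required.\<close>

record ('a, 'o, 'm) mackey_data =
  cat :: "'a gpd \<Rightarrow> ('o, 'm) additive_category"
  res :: "'a cell1 \<Rightarrow> ('o, 'm, 'o, 'm) functor_data"
  res2 :: "'a cell2 \<Rightarrow> 'o \<Rightarrow> 'm"
  ind :: "'a cell1 \<Rightarrow> ('o, 'm, 'o, 'm) functor_data"
  leta :: "'a cell1 \<Rightarrow> 'o \<Rightarrow> 'm"
  leps :: "'a cell1 \<Rightarrow> 'o \<Rightarrow> 'm"
  reta :: "'a cell1 \<Rightarrow> 'o \<Rightarrow> 'm"
  reps :: "'a cell1 \<Rightarrow> 'o \<Rightarrow> 'm"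

locale gpd_2functor =
  fixes M :: "('a, 'o, 'm, 'z) mackey_data_scheme"
  assumes cat_additive: "finite_groupoid G \<Longrightarrow> additive_category (cat M G)"
    and res_functor: "gpd_functor H G u \<Longrightarrow> additive_functor (cat M G) (cat M H) (res M u)"
    and res2_nat_trans: "gpd_nat_trans u v \<alpha>
      \<Longrightarrow> nat_trans (cat M (tgt u)) (cat M (src u)) (res M u) (res M v) (res2 M \<alpha>)"
    and res_id1: "finite_groupoid G \<Longrightarrow> functors_agree (cat M G) (res M (id1 G)) id_fun"
    and res_comp1: "\<lbrakk>gpd_functor K H v; gpd_functor H G u\<rbrakk>
      \<Longrightarrow> functors_agree (cat M G) (res M (u \<circ>1 v)) (comp_fun (res M v) (res M u))"
    and res2_id2: "\<lbrakk>is_cell1 u; X \<in> Obj (cat M (tgt u))\<rbrakk>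
      \<Longrightarrow> res2 M (id2 u) X = Idn (cat M (src u)) (ob (res M u) X)"
    and res2_vcomp2: "\<lbrakk>gpd_nat_trans u v \<alpha>; gpd_nat_trans v w \<beta>; X \<in> Obj (cat M (tgt u))\<rbrakk>
      \<Longrightarrow> res2 M (vcomp2 \<beta> \<alpha>) X = res2 M \<beta> X \<cdot>\<^bsub>cat M (src u)\<^esub> res2 M \<alpha> X"
    and res2_hcomp2: "\<lbrakk>gpd_nat_trans v v' \<alpha>; gpd_nat_trans u u' \<beta>; tgt v = src u;
        X \<in> Obj (cat M (tgt u))\<rbrakk>
      \<Longrightarrow> res2 M (hcomp2 \<beta> \<alpha>) X
        = res2 M \<alpha> (ob (res M u') X) \<cdot>\<^bsub>cat M (src v)\<^esub> ar (res M v) (res2 M \<beta> X)"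

text \<open>The mates \<open>\<alpha>\<^sub>! : i'\<^sub>! \<Rightarrow> i\<^sub>!\<close> and \<open>\<alpha>\<^sub>* : i'\<^sub>* \<Rightarrow> i\<^sub>*\<close> of \<open>\<alpha>\<^sup>*\<close> for a 2-cell \<open>\<alpha> : i \<Rightarrow> i'\<close>.\<close>

definition lind2 :: "('a, 'o, 'm, 'z) mackey_data_scheme \<Rightarrow> 'a cell2 \<Rightarrow> 'o \<Rightarrow> 'm" where
  "lind2 M \<alpha> X = (let i = src2 \<alpha>; i' = tgt2 \<alpha>; C = cat M (tgt i) in
     leps M i' (ob (ind M i) X) \<cdot>\<^bsub>C\<^esub> ar (ind M i') (res2 M \<alpha> (ob (ind M i) X))
       \<cdot>\<^bsub>C\<^esub> ar (ind M i') (leta M i X))"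

definition rind2 :: "('a, 'o, 'm, 'z) mackey_data_scheme \<Rightarrow> 'a cell2 \<Rightarrow> 'o \<Rightarrow> 'm" where
  "rind2 M \<alpha> X = (let i = src2 \<alpha>; i' = tgt2 \<alpha>; C = cat M (tgt i) in
     ar (ind M i) (reps M i' X) \<cdot>\<^bsub>C\<^esub> ar (ind M i) (res2 M \<alpha> (ob (ind M i') X))
       \<cdot>\<^bsub>C\<^esub> reta M i (ob (ind M i') X))"

text \<open>The canonical maps \<open>(i \<circ>1 j)\<^sub>! \<Rightarrow> i\<^sub>! j\<^sub>!\<close> and \<open>i\<^sub>* j\<^sub>* \<Rightarrow> (i \<circ>1 j)\<^sub>*\<close>.\<close>

definition lind_comp ::
  "('a, 'o, 'm, 'z) mackey_data_scheme \<Rightarrow> 'a cell1 \<Rightarrow> 'a cell1 \<Rightarrow> 'o \<Rightarrow> 'm" where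
  "lind_comp M i j X = (let C = cat M (tgt i); Y = ob (ind M j) X in
     leps M (i \<circ>1 j) (ob (ind M i) Y) \<cdot>\<^bsub>C\<^esub> ar (ind M (i \<circ>1 j)) (ar (res M j) (leta M i Y))
       \<cdot>\<^bsub>C\<^esub> ar (ind M (i \<circ>1 j)) (leta M j X))"

definition rind_comp ::
  "('a, 'o, 'm, 'z) mackey_data_scheme \<Rightarrow> 'a cell1 \<Rightarrow> 'a cell1 \<Rightarrow> 'o \<Rightarrow> 'm" where
  "rind_comp M i j X = (let C = cat M (tgt i); Y = ob (ind M j) X in
     ar (ind M (i \<circ>1 j)) (reps M j X) \<cdot>\<^bsub>C\<^esub> ar (ind M (i \<circ>1 j)) (ar (res M j) (reps M i Y))
       \<cdot>\<^bsub>C\<^esub> reta M (i \<circ>1 j) (ob (ind M i) Y))"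

text \<open>The mate \<open>\<gamma>\<^sub>! : q\<^sub>! p\<^sup>* \<Rightarrow> u\<^sup>* i\<^sub>!\<close> of \<open>\<gamma> : i \<circ>1 p \<Rightarrow> u \<circ>1 q\<close>, and the mate
  \<open>\<theta>\<^sub>* : u\<^sup>* i\<^sub>* \<Rightarrow> q\<^sub>* p\<^sup>*\<close> of \<open>\<theta> : u \<circ>1 q \<Rightarrow> i \<circ>1 p\<close>.\<close>

definition lmate ::
  "('a, 'o, 'm, 'z) mackey_data_scheme \<Rightarrow> 'a cell1 \<Rightarrow> 'a cell1 \<Rightarrow> 'a cell1 \<Rightarrow> 'a cell1
    \<Rightarrow> 'a cell2 \<Rightarrow> 'o \<Rightarrow> 'm" where
  "lmate M i u p q \<gamma> X = (let C = cat M (src u); Y = ob (ind M i) X in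
     leps M q (ob (res M u) Y) \<cdot>\<^bsub>C\<^esub> ar (ind M q) (res2 M \<gamma> Y)
       \<cdot>\<^bsub>C\<^esub> ar (ind M q) (ar (res M p) (leta M i X)))"

definition rmate ::
  "('a, 'o, 'm, 'z) mackey_data_scheme \<Rightarrow> 'a cell1 \<Rightarrow> 'a cell1 \<Rightarrow> 'a cell1 \<Rightarrow> 'a cell1
    \<Rightarrow> 'a cell2 \<Rightarrow> 'o \<Rightarrow> 'm" where
  "rmate M i u p q \<theta> X = (let C = cat M (src u); Y = ob (ind M i) X in
     ar (ind M q) (ar (res M p) (reps M i X)) \<cdot>\<^bsub>C\<^esub> ar (ind M q) (res2 M \<theta> Y)
       \<cdot>\<^bsub>C\<^esub> reta M q (ob (res M u) Y))"

text \<open>Existence of the adjoints and ambidexterity are contained in \<open>left_adjunction\<close> and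
  \<open>right_adjunction\<close>, which share the functor \<open>ind M i\<close>; invertibility of both mates of an
  iso-comma square is contained in \<open>mackey_formula\<close>. The assumptions \<open>ind2_agree\<close>,
  \<open>ind_comp_agree\<close> and \<open>ind_id_agree\<close> say that the pseudofunctors \<open>i \<mapsto> i\<^sub>!\<close> and
  \<open>i \<mapsto> i\<^sub>*\<close> have the same action on 2-cells and the same structure isomorphisms.\<close>

locale mackey_2functor = gpd_2functor M
  for M :: "('a, 'o, 'm, 'z) mackey_data_scheme" +
  assumes additivity: "gpd_coproduct n us G
      \<Longrightarrow> equivalence (cat M G) (product_category n (\<lambda>k. cat M (src (us k))))
            (tuple_functor n (\<lambda>k. res M (us k)))"
    and left_adjunction: "\<lbrakk>gpd_functor H G i; faithful i\<rbrakk>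
      \<Longrightarrow> adjunction (cat M H) (cat M G) (ind M i) (res M i) (leta M i) (leps M i)"
    and right_adjunction: "\<lbrakk>gpd_functor H G i; faithful i\<rbrakk>
      \<Longrightarrow> adjunction (cat M G) (cat M H) (res M i) (ind M i) (reta M i) (reps M i)"
    and ind2_agree: "\<lbrakk>gpd_nat_trans i i' \<alpha>; faithful i; faithful i'; X \<in> Obj (cat M (src i))\<rbrakk>
      \<Longrightarrow> lind2 M \<alpha> X = rind2 M \<alpha> X"
    and ind_comp_agree: "\<lbrakk>gpd_functor K H j; gpd_functor H G i; faithful j; faithful i;
        X \<in> Obj (cat M K)\<rbrakk>
      \<Longrightarrow> inverses (cat M G) (lind_comp M i j X) (rind_comp M i j X)"
    and ind_id_agree: "\<lbrakk>finite_groupoid G; X \<in> Obj (cat M G)\<rbrakk>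
      \<Longrightarrow> inverses (cat M G) (leps M (id1 G) X) (reta M (id1 G) X)"
    and mackey_formula: "\<lbrakk>iso_comma i u p q \<gamma>; faithful i; X \<in> Obj (cat M (src i))\<rbrakk>
      \<Longrightarrow> inverses (cat M (src u)) (lmate M i u p q \<gamma> X) (rmate M i u p q (inv2 \<gamma>) X)"
    and special: "\<lbrakk>gpd_functor H G i; faithful i; X \<in> Obj (cat M H)\<rbrakk>
      \<Longrightarrow> reps M i X \<cdot>\<^bsub>cat M H\<^esub> leta M i X = Idn (cat M H) X"


section \<open>Green 2-functors\<close>

text \<open>\<open>mult M u X Y : u\<^sup>* X \<otimes> u\<^sup>* Y \<rightarrow> u\<^sup>* (X \<otimes> Y)\<close> and \<open>munit M u : 1 \<rightarrow> u\<^sup>* 1\<close> are the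
  monoidal structure of \<open>u\<^sup>*\<close>.\<close>

record ('a, 'o, 'm) green_data = "('a, 'o, 'm) mackey_data" +
  tens :: "'a gpd \<Rightarrow> ('o, 'm) tensor"
  mult :: "'a cell1 \<Rightarrow> 'o \<Rightarrow> 'o \<Rightarrow> 'm"
  munit :: "'a cell1 \<Rightarrow> 'm"

definition ext_ob ::
  "('a, 'o, 'm, 'z) green_data_scheme \<Rightarrow> 'a gpd \<Rightarrow> 'a gpd \<Rightarrow> 'o \<Rightarrow> 'o \<Rightarrow> 'o" where
  "ext_ob M G1 G2 X Y =
     ob (res M (proj1 G1 G2)) X \<otimes>\<^bsub>tens M (gpd_prod G1 G2)\<^esub> ob (res M (proj2 G1 G2)) Y"

definition ext_ar ::
  "('a, 'o, 'm, 'z) green_data_scheme \<Rightarrow> 'a gpd \<Rightarrow> 'a gpd \<Rightarrow> 'm \<Rightarrow> 'm \<Rightarrow> 'm" where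
  "ext_ar M G1 G2 f g =
     ar (res M (proj1 G1 G2)) f \<odot>\<^bsub>tens M (gpd_prod G1 G2)\<^esub> ar (res M (proj2 G1 G2)) g"

text \<open>The canonical isomorphism from \<open>(i1 \<times> i2)\<^sup>* (X \<boxdot> Y)\<close> to \<open>i1\<^sup>* X \<boxdot> i2\<^sup>* Y\<close>; note that
  \<open>(i1 \<times> i2)\<^sup>* \<pi>\<^sub>k\<^sup>* = \<pi>\<^sub>k\<^sup>* ik\<^sup>*\<close> strictly.\<close>

definition ext_res_iso ::
  "('a, 'o, 'm, 'z) green_data_scheme \<Rightarrow> 'a cell1 \<Rightarrow> 'a cell1 \<Rightarrow> 'o \<Rightarrow> 'o \<Rightarrow> 'm" where
  "ext_res_iso M i1 i2 X Y = inv_arr (cat M (gpd_prod (src i1) (src i2)))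
     (mult M (prod1 i1 i2) (ob (res M (proj1 (tgt i1) (tgt i2))) X)
                           (ob (res M (proj2 (tgt i1) (tgt i2))) Y))"

text \<open>The right mate \<open>i1\<^sub>* X \<boxdot> i2\<^sub>* Y \<rightarrow> (i1 \<times> i2)\<^sub>* (X \<boxdot> Y)\<close> of that isomorphism.\<close>

definition ext_rmate ::
  "('a, 'o, 'm, 'z) green_data_scheme \<Rightarrow> 'a cell1 \<Rightarrow> 'a cell1 \<Rightarrow> 'o \<Rightarrow> 'o \<Rightarrow> 'm" where
  "ext_rmate M i1 i2 X Y =
    (let C = cat M (gpd_prod (tgt i1) (tgt i2)); i = prod1 i1 i2;
         X' = ob (ind M i1) X; Y' = ob (ind M i2) Y in
     ar (ind M i) (ext_ar M (src i1) (src i2) (reps M i1 X) (reps M i2 Y))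
       \<cdot>\<^bsub>C\<^esub> ar (ind M i) (ext_res_iso M i1 i2 X' Y')
       \<cdot>\<^bsub>C\<^esub> reta M i (ext_ob M (tgt i1) (tgt i2) X' Y'))"

text \<open>The assumptions \<open>mult_id1\<close> to \<open>munit_comp1\<close> make the lift to monoidal categories a strict
  2-functor: identities go to identity monoidal functors and composites to composite monoidal
  functors.\<close>

locale green_2functor = mackey_2functor M
  for M :: "('a, 'o, 'm, 'z) green_data_scheme" +
  assumes cat_monoidal: "finite_groupoid G \<Longrightarrow> additive_monoidal_category (cat M G) (tens M G)"
    and res_monoidal: "gpd_functor H G u
      \<Longrightarrow> strong_monoidal_functor (cat M G) (tens M G) (cat M H) (tens M H) (res M u) (mult M u) (munit M u)"
    and res2_mult: "\<lbrakk>gpd_nat_trans u v \<alpha>; X \<in> Obj (cat M (tgt u)); Y \<in> Obj (cat M (tgt u))\<rbrakk>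
      \<Longrightarrow> res2 M \<alpha> (X \<otimes>\<^bsub>tens M (tgt u)\<^esub> Y) \<cdot>\<^bsub>cat M (src u)\<^esub> mult M u X Y
        = mult M v X Y \<cdot>\<^bsub>cat M (src u)\<^esub> (res2 M \<alpha> X \<odot>\<^bsub>tens M (src u)\<^esub> res2 M \<alpha> Y)"
    and res2_munit: "gpd_nat_trans u v \<alpha>
      \<Longrightarrow> res2 M \<alpha> (Unit (tens M (tgt u))) \<cdot>\<^bsub>cat M (src u)\<^esub> munit M u = munit M v"
    and mult_id1: "\<lbrakk>finite_groupoid G; X \<in> Obj (cat M G); Y \<in> Obj (cat M G)\<rbrakk>
      \<Longrightarrow> mult M (id1 G) X Y = Idn (cat M G) (X \<otimes>\<^bsub>tens M G\<^esub> Y)"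
    and munit_id1: "finite_groupoid G \<Longrightarrow> munit M (id1 G) = Idn (cat M G) (Unit (tens M G))"
    and mult_comp1: "\<lbrakk>gpd_functor K H v; gpd_functor H G u; X \<in> Obj (cat M G); Y \<in> Obj (cat M G)\<rbrakk>
      \<Longrightarrow> mult M (u \<circ>1 v) X Y
        = ar (res M v) (mult M u X Y) \<cdot>\<^bsub>cat M K\<^esub> mult M v (ob (res M u) X) (ob (res M u) Y)"
    and munit_comp1: "\<lbrakk>gpd_functor K H v; gpd_functor H G u\<rbrakk>
      \<Longrightarrow> munit M (u \<circ>1 v) = ar (res M v) (munit M u) \<cdot>\<^bsub>cat M K\<^esub> munit M v"
    and ext_preserves_ind: "\<lbrakk>gpd_functor H1 G1 i1; faithful i1; gpd_functor H2 G2 i2; faithful i2;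
        X \<in> Obj (cat M H1); Y \<in> Obj (cat M H2)\<rbrakk>
      \<Longrightarrow> iso_arr (cat M (gpd_prod G1 G2)) (ext_rmate M i1 i2 X Y)"


section \<open>The canonical monoid and comonoid structure on A(i)\<close>

text \<open>\<open>lax_mult M i X Y : i\<^sub>* X \<otimes> i\<^sub>* Y \<rightarrow> i\<^sub>* (X \<otimes> Y)\<close> and \<open>lax_unit M i : 1 \<rightarrow> i\<^sub>* 1\<close> form the lax
  structure on \<open>i\<^sub>*\<close>; \<open>colax_mult M i X Y : i\<^sub>! (X \<otimes> Y) \<rightarrow> i\<^sub>! X \<otimes> i\<^sub>! Y\<close> and
  \<open>colax_unit M i : i\<^sub>! 1 \<rightarrow> 1\<close> form the colax structure on \<open>i\<^sub>!\<close>.\<close>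

definition lax_mult :: "('a, 'o, 'm, 'z) green_data_scheme \<Rightarrow> 'a cell1 \<Rightarrow> 'o \<Rightarrow> 'o \<Rightarrow> 'm" where
  "lax_mult M i X Y =
    (let H = src i; G = tgt i; X' = ob (ind M i) X; Y' = ob (ind M i) Y in
     ar (ind M i) (reps M i X \<odot>\<^bsub>tens M H\<^esub> reps M i Y)
       \<cdot>\<^bsub>cat M G\<^esub> ar (ind M i) (inv_arr (cat M H) (mult M i X' Y'))
       \<cdot>\<^bsub>cat M G\<^esub> reta M i (X' \<otimes>\<^bsub>tens M G\<^esub> Y'))"

definition lax_unit :: "('a, 'o, 'm, 'z) green_data_scheme \<Rightarrow> 'a cell1 \<Rightarrow> 'm" where
  "lax_unit M i =
     ar (ind M i) (inv_arr (cat M (src i)) (munit M i))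
       \<cdot>\<^bsub>cat M (tgt i)\<^esub> reta M i (Unit (tens M (tgt i)))"

definition colax_mult :: "('a, 'o, 'm, 'z) green_data_scheme \<Rightarrow> 'a cell1 \<Rightarrow> 'o \<Rightarrow> 'o \<Rightarrow> 'm" where
  "colax_mult M i X Y =
    (let H = src i; G = tgt i; X' = ob (ind M i) X; Y' = ob (ind M i) Y in
     leps M i (X' \<otimes>\<^bsub>tens M G\<^esub> Y')
       \<cdot>\<^bsub>cat M G\<^esub> ar (ind M i) (mult M i X' Y')
       \<cdot>\<^bsub>cat M G\<^esub> ar (ind M i) (leta M i X \<odot>\<^bsub>tens M H\<^esub> leta M i Y))"

definition colax_unit :: "('a, 'o, 'm, 'z) green_data_scheme \<Rightarrow> 'a cell1 \<Rightarrow> 'm" where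
  "colax_unit M i =
     leps M i (Unit (tens M (tgt i))) \<cdot>\<^bsub>cat M (tgt i)\<^esub> ar (ind M i) (munit M i)"

definition A_ob :: "('a, 'o, 'm, 'z) green_data_scheme \<Rightarrow> 'a cell1 \<Rightarrow> 'o" where
  "A_ob M i = ob (ind M i) (Unit (tens M (src i)))"

definition A_mult :: "('a, 'o, 'm, 'z) green_data_scheme \<Rightarrow> 'a cell1 \<Rightarrow> 'm" where
  "A_mult M i = (let T = tens M (src i) in
     ar (ind M i) (LUnit T (Unit T)) \<cdot>\<^bsub>cat M (tgt i)\<^esub> lax_mult M i (Unit T) (Unit T))"

definition A_unit :: "('a, 'o, 'm, 'z) green_data_scheme \<Rightarrow> 'a cell1 \<Rightarrow> 'm" where
  "A_unit M i = lax_unit M i"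

definition A_comult :: "('a, 'o, 'm, 'z) green_data_scheme \<Rightarrow> 'a cell1 \<Rightarrow> 'm" where
  "A_comult M i = (let T = tens M (src i) in
     colax_mult M i (Unit T) (Unit T)
       \<cdot>\<^bsub>cat M (tgt i)\<^esub> ar (ind M i) (inv_arr (cat M (src i)) (LUnit T (Unit T))))"

definition A_counit :: "('a, 'o, 'm, 'z) green_data_scheme \<Rightarrow> 'a cell1 \<Rightarrow> 'm" where
  "A_counit M i = colax_unit M i"


section \<open>Frobenius algebras\<close>

locale monoid_object =
  fixes C :: "('o, 'm, 'z) category_scheme" and T :: "('o, 'm) tensor" (structure)
    and A :: 'o and \<mu> \<iota> :: 'm
  assumes carrier_closed: "A \<in> Obj C"
    and mu_closed: "\<mu> \<in> Hom C (A \<otimes> A) A"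
    and iota_closed: "\<iota> \<in> Hom C (Unit T) A"
    and associative: "\<mu> \<cdot>\<^bsub>C\<^esub> (\<mu> \<odot> Idn C A) = \<mu> \<cdot>\<^bsub>C\<^esub> (Idn C A \<odot> \<mu>) \<cdot>\<^bsub>C\<^esub> Assoc T A A A"
    and unital_left: "\<mu> \<cdot>\<^bsub>C\<^esub> (\<iota> \<odot> Idn C A) = LUnit T A"
    and unital_right: "\<mu> \<cdot>\<^bsub>C\<^esub> (Idn C A \<odot> \<iota>) = RUnit T A"

locale comonoid_object =
  fixes C :: "('o, 'm, 'z) category_scheme" and T :: "('o, 'm) tensor" (structure)
    and A :: 'o and \<delta> \<epsilon> :: 'm
  assumes carrier_closed: "A \<in> Obj C"
    and delta_closed: "\<delta> \<in> Hom C A (A \<otimes> A)"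
    and epsilon_closed: "\<epsilon> \<in> Hom C A (Unit T)"
    and coassociative: "Assoc T A A A \<cdot>\<^bsub>C\<^esub> (\<delta> \<odot> Idn C A) \<cdot>\<^bsub>C\<^esub> \<delta> = (Idn C A \<odot> \<delta>) \<cdot>\<^bsub>C\<^esub> \<delta>"
    and counital_left: "LUnit T A \<cdot>\<^bsub>C\<^esub> (\<epsilon> \<odot> Idn C A) \<cdot>\<^bsub>C\<^esub> \<delta> = Idn C A"
    and counital_right: "RUnit T A \<cdot>\<^bsub>C\<^esub> (Idn C A \<odot> \<epsilon>) \<cdot>\<^bsub>C\<^esub> \<delta> = Idn C A"

locale frobenius_algebra = monoid_object C T A \<mu> \<iota> + comonoid_object C T A \<delta> \<epsilon>
  for C :: "('o, 'm, 'z) category_scheme" and T :: "('o, 'm) tensor" (structure)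
    and A :: 'o and \<mu> \<iota> \<delta> \<epsilon> :: 'm +
  assumes frobenius_left:
      "(Idn C A \<odot> \<mu>) \<cdot>\<^bsub>C\<^esub> Assoc T A A A \<cdot>\<^bsub>C\<^esub> (\<delta> \<odot> Idn C A) = \<delta> \<cdot>\<^bsub>C\<^esub> \<mu>"
    and frobenius_right:
      "(\<mu> \<odot> Idn C A) \<cdot>\<^bsub>C\<^esub> inv_arr C (Assoc T A A A) \<cdot>\<^bsub>C\<^esub> (Idn C A \<odot> \<delta>) = \<delta> \<cdot>\<^bsub>C\<^esub> \<mu>"

locale special_frobenius_algebra = frobenius_algebra +
  assumes special: "\<mu> \<cdot>\<^bsub>C\<^esub> \<delta> = Idn C A"

locale commutative_frobenius_algebra = frobenius_algebra C T A \<mu> \<iota> \<delta> \<epsilon>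
  for C :: "('o, 'm, 'z) category_scheme" and T :: "('o, 'm) tensor" (structure)
    and braiding :: "'o \<Rightarrow> 'o \<Rightarrow> 'm" and A :: 'o and \<mu> \<iota> \<delta> \<epsilon> :: 'm +
  assumes commutative: "\<mu> \<cdot>\<^bsub>C\<^esub> braiding A A = \<mu>"


section \<open>The monoidal center\<close>

locale half_braiding =
  fixes C :: "('o, 'm, 'z) category_scheme" and T :: "('o, 'm) tensor" (structure)
    and A :: 'o and \<sigma> :: "'o \<Rightarrow> 'm"
  assumes carrier_closed: "A \<in> Obj C"
    and extensional: "\<sigma> \<in> extensional (Obj C)"
    and component: "X \<in> Obj C \<Longrightarrow> \<sigma> X \<in> Hom C (A \<otimes> X) (X \<otimes> A)"
    and component_iso: "X \<in> Obj C \<Longrightarrow> iso_arr C (\<sigma> X)"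
    and natural: "f \<in> Hom C X Y \<Longrightarrow> \<sigma> Y \<cdot>\<^bsub>C\<^esub> (Idn C A \<odot> f) = (f \<odot> Idn C A) \<cdot>\<^bsub>C\<^esub> \<sigma> X"
    and hexagon: "\<lbrakk>X \<in> Obj C; Y \<in> Obj C\<rbrakk>
      \<Longrightarrow> Assoc T X Y A \<cdot>\<^bsub>C\<^esub> \<sigma> (X \<otimes> Y) \<cdot>\<^bsub>C\<^esub> Assoc T A X Y
        = (Idn C X \<odot> \<sigma> Y) \<cdot>\<^bsub>C\<^esub> Assoc T X A Y \<cdot>\<^bsub>C\<^esub> (\<sigma> X \<odot> Idn C Y)"

type_synonym ('o, 'm) center_ob = "'o \<times> ('o \<Rightarrow> 'm)"

text \<open>An arrow of the center is an arrow of the underlying category together with its source and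
  target in the center.\<close>

type_synonym ('o, 'm) center_ar = "('o, 'm) center_ob \<times> ('o, 'm) center_ob \<times> 'm"

definition center ::
  "('o, 'm, 'z) category_scheme \<Rightarrow> ('o, 'm) tensor
    \<Rightarrow> (('o, 'm) center_ob, ('o, 'm) center_ar) category" where
  "center C T =
    \<lparr>Obj = {(A, \<sigma>). half_braiding C T A \<sigma>},
     Arr = {((A, \<sigma>), (B, \<tau>), f). half_braiding C T A \<sigma> \<and> half_braiding C T B \<tau> \<and> f \<in> Hom C A B
        \<and> (\<forall>X\<in>Obj C. \<tau> X \<cdot>\<^bsub>C\<^esub> (f \<odot>\<^bsub>T\<^esub> Idn C X) = (Idn C X \<odot>\<^bsub>T\<^esub> f) \<cdot>\<^bsub>C\<^esub> \<sigma> X)},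
     Dom = (\<lambda>(P, Q, f). P),
     Cod = (\<lambda>(P, Q, f). Q),
     Idn = (\<lambda>(A, \<sigma>). ((A, \<sigma>), (A, \<sigma>), Idn C A)),
     Comp = (\<lambda>(Q', R, g) (P, Q, f). (P, R, g \<cdot>\<^bsub>C\<^esub> f))\<rparr>"

definition center_tob ::
  "('o, 'm, 'z) category_scheme \<Rightarrow> ('o, 'm) tensor
    \<Rightarrow> ('o, 'm) center_ob \<Rightarrow> ('o, 'm) center_ob \<Rightarrow> ('o, 'm) center_ob" where
  "center_tob C T = (\<lambda>(A, \<sigma>) (B, \<tau>). (A \<otimes>\<^bsub>T\<^esub> B,
     \<lambda>X\<in>Obj C. Assoc T X A B \<cdot>\<^bsub>C\<^esub> (\<sigma> X \<odot>\<^bsub>T\<^esub> Idn C B) \<cdot>\<^bsub>C\<^esub> inv_arr C (Assoc T A X B)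
       \<cdot>\<^bsub>C\<^esub> (Idn C A \<odot>\<^bsub>T\<^esub> \<tau> X) \<cdot>\<^bsub>C\<^esub> Assoc T A B X))"

definition center_unit ::
  "('o, 'm, 'z) category_scheme \<Rightarrow> ('o, 'm) tensor \<Rightarrow> ('o, 'm) center_ob" where
  "center_unit C T = (Unit T, \<lambda>X\<in>Obj C. inv_arr C (RUnit T X) \<cdot>\<^bsub>C\<^esub> LUnit T X)"

definition center_tensor ::
  "('o, 'm, 'z) category_scheme \<Rightarrow> ('o, 'm) tensor
    \<Rightarrow> (('o, 'm) center_ob, ('o, 'm) center_ar) tensor" where
  "center_tensor C T =
    \<lparr>tob = center_tob C T,
     tar = (\<lambda>(P, Q, f) (P', Q', g). (center_tob C T P P', center_tob C T Q Q', f \<odot>\<^bsub>T\<^esub> g)),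
     Unit = center_unit C T,
     Assoc = (\<lambda>P Q R. (center_tob C T (center_tob C T P Q) R, center_tob C T P (center_tob C T Q R),
        Assoc T (fst P) (fst Q) (fst R))),
     LUnit = (\<lambda>P. (center_tob C T (center_unit C T) P, P, LUnit T (fst P))),
     RUnit = (\<lambda>P. (center_tob C T P (center_unit C T), P, RUnit T (fst P)))\<rparr>"

definition center_braiding ::
  "('o, 'm, 'z) category_scheme \<Rightarrow> ('o, 'm) tensor
    \<Rightarrow> ('o, 'm) center_ob \<Rightarrow> ('o, 'm) center_ob \<Rightarrow> ('o, 'm) center_ar" where
  "center_braiding C T = (\<lambda>(A, \<sigma>) (B, \<tau>).
     (center_tob C T (A, \<sigma>) (B, \<tau>), center_tob C T (B, \<tau>) (A, \<sigma>), \<sigma> B))"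

definition center_forget ::
  "(('o, 'm) center_ob, ('o, 'm) center_ar, 'o, 'm) functor_data" where
  "center_forget = \<lparr>ob = (\<lambda>(A, \<sigma>). A), ar = (\<lambda>(P, Q, f). f)\<rparr>"

end

theory Submission
  imports Defs
begin

text \<open>
  The functor \<open>i\<^sup>*\<close> is strong monoidal, so its right adjoint makes \<open>A = i\<^sub>* 1\<close> a monoid and its left
  adjoint makes \<open>A = i\<^sub>! 1\<close> a comonoid. What relates the two structures is the projection formula
  \<open>i\<^sub>* z \<otimes> b \<cong> i\<^sub>* (z \<otimes> i\<^sup>* b)\<close>, together with its mirror image, in a strong form: the isomorphism that
  is defined by the right adjoints must be inverse to the one that is defined by the left adjoints.
  The notion of an object that is induced by a pair of arrows \<open>e : i\<^sup>* b \<rightarrow> z\<close> and \<open>n : z \<rightarrow> i\<^sup>* b\<close>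
  expresses this (\<open>induced\<close>), and an arrow between induced objects that comes from an arrow \<open>h\<close> by one
  of the universal properties comes from \<open>h\<close> by the other one (\<open>induced_transfer\<close>).

  Given the projection formula (locale \<open>ambidextrous_projection\<close>), all tensor products of \<open>A\<close> with
  other objects are induced, and equations between arrows to or from them can be tested by means of
  the counit \<open>ev : i\<^sup>* A \<rightarrow> 1\<close> or the unit \<open>coev : 1 \<rightarrow> i\<^sup>* A\<close>. Every property of \<open>A\<close> then reduces to one
  of the unit object of \<open>M(H)\<close>, which is a commutative Frobenius algebra in the center in a trivial
  way. Both sides of a Frobenius relation become the idempotent \<open>coev \<cdot> ev\<close>, specialness becomes
  \<open>ev \<cdot> coev = 1\<close>, and the half-braiding \<open>A \<otimes> x \<cong> i\<^sub>* (1 \<otimes> i\<^sup>* x) \<cong> i\<^sub>* (i\<^sup>* x \<otimes> 1) \<cong> x \<otimes> A\<close> comes from that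
  of the unit object.

  The projection formula for the right adjoint alone follows from the preservation of inductions by
  the external product: the tensor product is the restriction of the external product along the
  diagonal of \<open>G\<close>, and base change along the diagonal turns \<open>i \<times> id\<close> into \<open>i\<close>
  (\<open>couniversal_base_change\<close>, \<open>couniversal_tensor\<close>). For the agreement with the left adjoint, let
  \<open>p, q : P \<rightarrow> H\<close> be the projections of the iso-comma groupoid of \<open>i\<close> with itself and \<open>d : H \<rightarrow> P\<close> its
  diagonal. By the Mackey formula, arrows \<open>z \<rightarrow> i\<^sup>* i\<^sub>* z\<close> correspond to arrows \<open>q\<^sup>* z \<rightarrow> p\<^sup>* z\<close>, and the
  unit of \<open>i\<^sub>! \<stileturn> i\<^sup>*\<close> corresponds to the trace along \<open>d\<close> of the identity (\<open>mackey_unit\<close>). As \<open>d\<close> is fully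
  faithful, an arrow that factors through the image of \<open>d\<^sub>*\<close> is the trace of its restriction along \<open>d\<close>
  (\<open>tr_of_factorization\<close>). The arrow that the projection formula compares with the unit has such a
  factorization, by the projection formula for \<open>d\<close>, and its restriction along \<open>d\<close> is the identity.
  Hence both are the same trace (\<open>induced_of_couniversal\<close>, \<open>projection_formula\<close>).
\<close>

section \<open>Typed arrows and isomorphisms\<close>

text \<open>The source and the target of an arrow as one value. Typing conditions of rewrite rules are
  equations \<open>hom_type C f = r\<close> with a variable \<open>r\<close> that is instantiated when the condition is solved,
  so that the simplifier computes the type of a composite once, by one pass over its factors. With
  separate conditions on membership, source and target, each of them would be rechecked for every
  sub-composite.\<close>

definition hom_type :: "('o, 'm, 'z) category_scheme \<Rightarrow> 'm \<Rightarrow> ('o \<times> 'o) option" where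
  "hom_type C f = (if f \<in> Arr C then Some (Dom C f, Cod C f) else None)"

definition source_of :: "('o \<times> 'o) option \<Rightarrow> 'o" where
  "source_of r = fst (the r)"

definition target_of :: "('o \<times> 'o) option \<Rightarrow> 'o" where
  "target_of r = snd (the r)"

definition composable :: "('o \<times> 'o) option \<Rightarrow> ('o \<times> 'o) option \<Rightarrow> bool" where
  "composable r s \<longleftrightarrow> r \<noteq> None \<and> s \<noteq> None \<and> target_of r = source_of s"

lemma type_simps [simp]:
  "source_of (Some (x, y)) = x" "target_of (Some (x, y)) = y"
  "composable (Some (x, y)) (Some (x', y')) \<longleftrightarrow> y = x'"
  "\<not> composable None r" "\<not> composable r None"
  by (auto simp: source_of_def target_of_def composable_def)

lemma composableE:
  assumes "composable r s"
  obtains x y z where "r = Some (x, y)" "s = Some (y, z)"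
  using assms by (cases r; cases s) auto

lemma Hom_type [simp]: "f \<in> Hom C x y \<longleftrightarrow> hom_type C f = Some (x, y)"
  by (auto simp: Hom_def hom_type_def)

lemma hom_typeD:
  assumes "hom_type C f = Some (x, y)"
  shows "f \<in> Arr C" "Dom C f = x" "Cod C f = y"
  using assms by (auto simp: hom_type_def split: if_splits)

lemma hom_type_Arr: "f \<in> Arr C \<Longrightarrow> hom_type C f = Some (Dom C f, Cod C f)"
  by (simp add: hom_type_def)

context category
begin

lemma Obj_of_type:
  assumes "hom_type C f = Some (x, y)"
  shows "x \<in> Obj C" "y \<in> Obj C"
  using hom_typeD[OF assms] dom_closed[of f] cod_closed[of f] by auto

lemma type_Idn [simp]: "x \<in> Obj C \<Longrightarrow> hom_type C (Idn C x) = Some (x, x)"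
  using idn_closed[of x] by simp

lemma type_Comp [simp]:
  "\<lbrakk>hom_type C f = r; hom_type C g = s; composable r s\<rbrakk>
    \<Longrightarrow> hom_type C (g \<cdot> f) = Some (source_of r, target_of s)"
  by (erule composableE) (use comp_closed in simp)

lemma Comp_Idn [simp]:
  "\<lbrakk>hom_type C f = r; r \<noteq> None; target_of r = x\<rbrakk> \<Longrightarrow> Idn C x \<cdot> f = f"
  "\<lbrakk>hom_type C f = r; r \<noteq> None; source_of r = x\<rbrakk> \<Longrightarrow> f \<cdot> Idn C x = f"
  using comp_idn_left comp_idn_right by (cases r; fastforce)+

lemma Comp_assoc [simp]:
  "\<lbrakk>hom_type C f = r; hom_type C g = s; hom_type C h = t; composable r s; composable s t\<rbrakk>
    \<Longrightarrow> (h \<cdot> g) \<cdot> f = h \<cdot> (g \<cdot> f)"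
  by (elim composableE) (use comp_assoc in simp)

lemma inverses_iff:
  "hom_type C f = Some (x, y) \<Longrightarrow>
    inverses C f g \<longleftrightarrow> hom_type C g = Some (y, x) \<and> g \<cdot> f = Idn C x \<and> f \<cdot> g = Idn C y"
  using hom_typeD[of C f x y] by (auto simp: inverses_def)

lemma inverses_type:
  assumes "inverses C f g"
  obtains x y where "x \<in> Obj C" "y \<in> Obj C" "hom_type C f = Some (x, y)" "hom_type C g = Some (y, x)"
    "g \<cdot> f = Idn C x" "f \<cdot> g = Idn C y"
proof -
  have "hom_type C f = Some (Dom C f, Cod C f)"
    using assms by (intro hom_type_Arr) (simp add: inverses_def)
  with that show thesis using assms Obj_of_type[of f] inverses_iff by blast
qed

lemma inverses_unique:
  assumes "inverses C f g" "inverses C f h"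
  shows "g = h"
proof -
  obtain x y where f: "hom_type C f = Some (x, y)" and g: "hom_type C g = Some (y, x)" "g \<cdot> f = Idn C x"
    using assms(1) by (elim inverses_type)
  have h: "hom_type C h = Some (y, x)" "f \<cdot> h = Idn C y"
    using assms(2) inverses_iff[OF f] by auto
  have "g = g \<cdot> (f \<cdot> h)" using g h by simp
  also have "\<dots> = (g \<cdot> f) \<cdot> h" using f g(1) h(1) by simp
  also have "\<dots> = h" unfolding g(2) using h(1) by simp
  finally show ?thesis .
qed

lemma inv_arr_eqI: "inverses C f g \<Longrightarrow> inv_arr C f = g"
  unfolding inv_arr_def by (rule the_equality) (auto intro: inverses_unique)

lemma inverses_sym: "inverses C f g \<Longrightarrow> inverses C g f"
  by (elim inverses_type) (simp add: inverses_iff)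

lemma inverses_inv_arr: "iso_arr C f \<Longrightarrow> inverses C f (inv_arr C f)"
  by (auto simp: iso_arr_def inv_arr_eqI)

lemma inverses_iso_arr: "inverses C f g \<Longrightarrow> iso_arr C f" "inverses C f g \<Longrightarrow> iso_arr C g"
  using inverses_sym unfolding iso_arr_def by blast+

lemma iso_arr_type:
  assumes "iso_arr C f"
  obtains x y where "x \<in> Obj C" "y \<in> Obj C" "hom_type C f = Some (x, y)"
    "hom_type C (inv_arr C f) = Some (y, x)" "inv_arr C f \<cdot> f = Idn C x" "f \<cdot> inv_arr C f = Idn C y"
  using inverses_type[OF inverses_inv_arr[OF assms]] that by metis

lemma inv_arr [simp]:
  assumes "iso_arr C f" "hom_type C f = r"
  shows "hom_type C (inv_arr C f) = Some (target_of r, source_of r)"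
    "inv_arr C f \<cdot> f = Idn C (source_of r)" "f \<cdot> inv_arr C f = Idn C (target_of r)"
proof -
  obtain x y where "hom_type C f = Some (x, y)" "hom_type C (inv_arr C f) = Some (y, x)"
    "inv_arr C f \<cdot> f = Idn C x" "f \<cdot> inv_arr C f = Idn C y"
    using iso_arr_type[OF assms(1)] .
  moreover from this have "r = Some (x, y)" using assms(2) by simp
  ultimately show "hom_type C (inv_arr C f) = Some (target_of r, source_of r)"
    "inv_arr C f \<cdot> f = Idn C (source_of r)" "f \<cdot> inv_arr C f = Idn C (target_of r)"
    by simp_all
qed

lemma inv_arr_inv_arr [simp]:
  assumes "iso_arr C f"
  shows "iso_arr C (inv_arr C f)" "inv_arr C (inv_arr C f) = f"
  using inverses_sym[OF inverses_inv_arr[OF assms]] inv_arr_eqI inverses_iso_arr by auto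

lemma inv_arr_cancel [simp]:
  assumes "iso_arr C f" "hom_type C f = r" "hom_type C k = s"
  shows "composable s r \<Longrightarrow> inv_arr C f \<cdot> f \<cdot> k = k"
    and "target_of s = target_of r \<Longrightarrow> s \<noteq> None \<Longrightarrow> f \<cdot> inv_arr C f \<cdot> k = k"
proof -
  obtain x y where f: "x \<in> Obj C" "y \<in> Obj C" "hom_type C f = Some (x, y)" "hom_type C (inv_arr C f) = Some (y, x)"
    using iso_arr_type[OF assms(1)] by metis
  show "inv_arr C f \<cdot> f \<cdot> k = k" if c: "composable s r"
  proof -
    obtain w where k: "hom_type C k = Some (w, x)"
      using c assms(2,3) f(3) by (cases s) auto
    have "inv_arr C f \<cdot> f \<cdot> k = (inv_arr C f \<cdot> f) \<cdot> k"
      using f k by simp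
    then show ?thesis using assms(1) f k by simp
  qed
  show "f \<cdot> inv_arr C f \<cdot> k = k" if c: "target_of s = target_of r" "s \<noteq> None"
  proof -
    obtain w where k: "hom_type C k = Some (w, y)"
      using c assms(2,3) f(3) by (cases s) auto
    have "f \<cdot> inv_arr C f \<cdot> k = (f \<cdot> inv_arr C f) \<cdot> k"
      using f k by simp
    then show ?thesis using assms(1) f k by simp
  qed
qed

lemma iso_arrI:
  "\<lbrakk>hom_type C f = Some (x, y); hom_type C g = Some (y, x); g \<cdot> f = Idn C x; f \<cdot> g = Idn C y\<rbrakk> \<Longrightarrow> iso_arr C f"
  unfolding iso_arr_def by (rule exI[of _ g]) (simp add: inverses_iff)

lemma iso_arr_Idn [simp]: "x \<in> Obj C \<Longrightarrow> iso_arr C (Idn C x)"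
  by (rule iso_arrI[of _ x x "Idn C x"]) auto

lemma inv_arr_Idn [simp]: "x \<in> Obj C \<Longrightarrow> inv_arr C (Idn C x) = Idn C x"
  by (rule inv_arr_eqI) (simp add: inverses_iff[of _ x x])

lemma inverses_Comp:
  assumes "iso_arr C f" "iso_arr C g" "hom_type C f = r" "hom_type C g = s" "composable r s"
  shows "inverses C (g \<cdot> f) (inv_arr C f \<cdot> inv_arr C g)"
proof -
  obtain x y z where [simp]: "r = Some (x, y)" "s = Some (y, z)" using assms(5) by (rule composableE)
  show ?thesis using assms by (simp add: inverses_iff[of _ x z])
qed

lemma iso_arr_Comp [simp]:
  "\<lbrakk>iso_arr C f; iso_arr C g; hom_type C f = r; hom_type C g = s; composable r s\<rbrakk> \<Longrightarrow> iso_arr C (g \<cdot> f)"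
  by (rule inverses_iso_arr(1)[OF inverses_Comp])

lemma inv_arr_Comp:
  "\<lbrakk>iso_arr C f; iso_arr C g; hom_type C f = r; hom_type C g = s; composable r s\<rbrakk>
    \<Longrightarrow> inv_arr C (g \<cdot> f) = inv_arr C f \<cdot> inv_arr C g"
  by (rule inv_arr_eqI[OF inverses_Comp])

lemma iso_cancel_left:
  assumes "iso_arr C k" "hom_type C k = Some (y, z)" "hom_type C f = Some (x, y)" "hom_type C g = Some (x, y)"
    "k \<cdot> f = k \<cdot> g"
  shows "f = g"
proof -
  have "f = inv_arr C k \<cdot> k \<cdot> f" using assms(1-3) by simp
  also have "\<dots> = inv_arr C k \<cdot> k \<cdot> g" unfolding assms(5) ..
  also have "\<dots> = g" using assms(1,2,4) by simp
  finally show ?thesis .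
qed

lemma iso_cancel_right:
  assumes "iso_arr C k" "hom_type C k = Some (x, y)" "hom_type C f = Some (y, z)" "hom_type C g = Some (y, z)"
    "f \<cdot> k = g \<cdot> k"
  shows "f = g"
proof -
  have "f = (f \<cdot> k) \<cdot> inv_arr C k" using assms(1-3) by simp
  also have "\<dots> = (g \<cdot> k) \<cdot> inv_arr C k" unfolding assms(5) ..
  also have "\<dots> = g" using assms(1,2,4) by simp
  finally show ?thesis .
qed

end

context is_functor
begin

lemma ob_Obj [simp]: "x \<in> Obj C \<Longrightarrow> ob F x \<in> Obj D"
  by (rule ob_closed)

lemma type_ar [simp]:
  "\<lbrakk>hom_type C f = r; r \<noteq> None\<rbrakk> \<Longrightarrow> hom_type D (ar F f) = Some (ob F (source_of r), ob F (target_of r))"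
  using ar_closed by (cases r) auto

lemma ar_Idn [simp]: "x \<in> Obj C \<Longrightarrow> ar F (Idn C x) = Idn D (ob F x)"
  by (rule ar_idn)

lemma ar_Comp:
  "\<lbrakk>hom_type C f = r; hom_type C g = s; composable r s\<rbrakk> \<Longrightarrow> ar F (g \<cdot>\<^bsub>C\<^esub> f) = ar F g \<cdot>\<^bsub>D\<^esub> ar F f"
  by (erule composableE) (use ar_comp in simp)

lemma ar_inverses:
  assumes "iso_arr C f"
  shows "inverses D (ar F f) (ar F (inv_arr C f))"
proof -
  obtain x y where f: "x \<in> Obj C" "y \<in> Obj C" "hom_type C f = Some (x, y)"
    using source.iso_arr_type[OF assms] by metis
  then show ?thesis using assms
    by (simp add: target.inverses_iff[of _ "ob F x" "ob F y"] ar_Comp[symmetric, of _ "Some (x, y)" _ "Some (y, x)"]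
      ar_Comp[symmetric, of _ "Some (y, x)" _ "Some (x, y)"])
qed

lemma ar_iso [simp]: "iso_arr C f \<Longrightarrow> iso_arr D (ar F f)"
  by (rule target.inverses_iso_arr(1)[OF ar_inverses])

lemma ar_inv_arr: "iso_arr C f \<Longrightarrow> ar F (inv_arr C f) = inv_arr D (ar F f)"
  using target.inv_arr_eqI[OF ar_inverses] by simp

end

lemma (in nat_trans) type_component [simp]:
  "x \<in> Obj C \<Longrightarrow> hom_type D (\<tau> x) = Some (ob F x, ob G x)"
  using component[of x] by simp

section \<open>Coherence in monoidal categories\<close>

context monoidal_category
begin

lemma tob_Obj [simp]: "\<lbrakk>x \<in> Obj C; y \<in> Obj C\<rbrakk> \<Longrightarrow> x \<otimes> y \<in> Obj C"
  by (rule tob_closed)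

lemma Unit_Obj [simp]: "Unit T \<in> Obj C"
  by (rule unit_closed)

lemma type_tar [simp]:
  "\<lbrakk>hom_type C f = r; hom_type C g = s; r \<noteq> None; s \<noteq> None\<rbrakk>
    \<Longrightarrow> hom_type C (f \<odot> g) = Some (source_of r \<otimes> source_of s, target_of r \<otimes> target_of s)"
  using tar_closed by (cases r; cases s) auto

lemma tar_Idn [simp]: "\<lbrakk>x \<in> Obj C; y \<in> Obj C\<rbrakk> \<Longrightarrow> Idn C x \<odot> Idn C y = Idn C (x \<otimes> y)"
  by (rule tar_idn)

lemma tar_Comp:
  "\<lbrakk>hom_type C f = r; hom_type C g = s; hom_type C f' = r'; hom_type C g' = s'; composable r s; composable r' s'\<rbrakk>
    \<Longrightarrow> (g \<odot> g') \<cdot>\<^bsub>C\<^esub> (f \<odot> f') = (g \<cdot>\<^bsub>C\<^esub> f) \<odot> (g' \<cdot>\<^bsub>C\<^esub> f')"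
  by (elim composableE) (use tar_comp in simp)

lemma tar_Comp_assoc:
  assumes "hom_type C f = r" "hom_type C g = s" "hom_type C f' = r'" "hom_type C g' = s'"
    "composable r s" "composable r' s'" "hom_type C k = t" "t \<noteq> None" "target_of t = source_of r \<otimes> source_of r'"
  shows "(g \<odot> g') \<cdot>\<^bsub>C\<^esub> (f \<odot> f') \<cdot>\<^bsub>C\<^esub> k = ((g \<cdot>\<^bsub>C\<^esub> f) \<odot> (g' \<cdot>\<^bsub>C\<^esub> f')) \<cdot>\<^bsub>C\<^esub> k"
proof -
  have "(g \<odot> g') \<cdot>\<^bsub>C\<^esub> (f \<odot> f') \<cdot>\<^bsub>C\<^esub> k = ((g \<odot> g') \<cdot>\<^bsub>C\<^esub> (f \<odot> f')) \<cdot>\<^bsub>C\<^esub> k"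
    using assms by (auto elim!: composableE)
  then show ?thesis using tar_Comp[OF assms(1-6)] by simp
qed

lemmas tar_merge = tar_Comp tar_Comp_assoc

lemma tar_inverses:
  assumes "iso_arr C f" "iso_arr C g"
  shows "inverses C (f \<odot> g) (inv_arr C f \<odot> inv_arr C g)"
proof -
  obtain x y where f: "x \<in> Obj C" "y \<in> Obj C" "hom_type C f = Some (x, y)"
    using iso_arr_type[OF assms(1)] by metis
  obtain z w where g: "z \<in> Obj C" "w \<in> Obj C" "hom_type C g = Some (z, w)"
    using iso_arr_type[OF assms(2)] by metis
  show ?thesis using assms f g by (simp add: inverses_iff[of _ "x \<otimes> z" "y \<otimes> w"] tar_Comp)
qed

lemma tar_iso [simp]: "\<lbrakk>iso_arr C f; iso_arr C g\<rbrakk> \<Longrightarrow> iso_arr C (f \<odot> g)"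
  by (rule inverses_iso_arr(1)[OF tar_inverses])

lemma tar_inv_arr: "\<lbrakk>iso_arr C f; iso_arr C g\<rbrakk> \<Longrightarrow> inv_arr C (f \<odot> g) = inv_arr C f \<odot> inv_arr C g"
  using inv_arr_eqI[OF tar_inverses] .

lemma constraint_iso [simp]:
  "\<lbrakk>x \<in> Obj C; y \<in> Obj C; z \<in> Obj C\<rbrakk> \<Longrightarrow> iso_arr C (Assoc T x y z)"
  "x \<in> Obj C \<Longrightarrow> iso_arr C (LUnit T x)"
  "x \<in> Obj C \<Longrightarrow> iso_arr C (RUnit T x)"
  by (auto intro: assoc_iso lunit_iso runit_iso)

lemma type_constraint [simp]:
  "\<lbrakk>x \<in> Obj C; y \<in> Obj C; z \<in> Obj C\<rbrakk> \<Longrightarrow> hom_type C (Assoc T x y z) = Some ((x \<otimes> y) \<otimes> z, x \<otimes> (y \<otimes> z))"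
  "x \<in> Obj C \<Longrightarrow> hom_type C (LUnit T x) = Some (Unit T \<otimes> x, x)"
  "x \<in> Obj C \<Longrightarrow> hom_type C (RUnit T x) = Some (x \<otimes> Unit T, x)"
  using assoc_closed[of x y z] lunit_closed[of x] runit_closed[of x] by auto

lemma tensor_unit_faithful:
  assumes "hom_type C f = Some (x, y)" "hom_type C g = Some (x, y)"
    "f \<odot> Idn C (Unit T) = g \<odot> Idn C (Unit T)"
  shows "f = g"
proof (rule iso_cancel_right)
  show "f \<cdot>\<^bsub>C\<^esub> RUnit T x = g \<cdot>\<^bsub>C\<^esub> RUnit T x"
    using runit_natural[of f x y] runit_natural[of g x y] assms by simp
qed (use assms Obj_of_type[OF assms(1)] in auto)

lemma unit_tensor_faithful:
  assumes "hom_type C f = Some (x, y)" "hom_type C g = Some (x, y)"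
    "Idn C (Unit T) \<odot> f = Idn C (Unit T) \<odot> g"
  shows "f = g"
proof (rule iso_cancel_right)
  show "f \<cdot>\<^bsub>C\<^esub> LUnit T x = g \<cdot>\<^bsub>C\<^esub> LUnit T x"
    using lunit_natural[of f x y] lunit_natural[of g x y] assms by simp
qed (use assms Obj_of_type[OF assms(1)] in auto)

text \<open>An equation between arrows \<open>f, g : x \<rightarrow> y\<close> holds as soon as it holds after tensoring with the
  unit on the right. After tensoring with an object \<open>w\<close>, every arrow can be conjugated by associators
  to one between right-nested tensor products; the following rewrite rules do so. On right-nested
  products the associators disappear, and the equation is as in a strict monoidal category.\<close>

lemma tar_tar:
  assumes "hom_type C f = r" "hom_type C g = s" "hom_type C h = t" "r \<noteq> None" "s \<noteq> None" "t \<noteq> None"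
  shows "(f \<odot> g) \<odot> h = inv_arr C (Assoc T (target_of r) (target_of s) (target_of t)) \<cdot>\<^bsub>C\<^esub> (f \<odot> (g \<odot> h))
    \<cdot>\<^bsub>C\<^esub> Assoc T (source_of r) (source_of s) (source_of t)"
proof -
  obtain x x' y y' z z' where t: "hom_type C f = Some (x, x')" "hom_type C g = Some (y, y')"
    "hom_type C h = Some (z, z')" using assms by auto
  note o = Obj_of_type[OF t(1)] Obj_of_type[OF t(2)] Obj_of_type[OF t(3)]
  have "inv_arr C (Assoc T x' y' z') \<cdot>\<^bsub>C\<^esub> Assoc T x' y' z' \<cdot>\<^bsub>C\<^esub> ((f \<odot> g) \<odot> h)
      = inv_arr C (Assoc T x' y' z') \<cdot>\<^bsub>C\<^esub> (f \<odot> (g \<odot> h)) \<cdot>\<^bsub>C\<^esub> Assoc T x y z"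
    using assoc_natural[of f x x' g y y' h z z'] t by simp
  then show ?thesis using t o assms(1-3) by auto
qed

lemma Assoc_tar:
  assumes "w \<in> Obj C" "x \<in> Obj C" "y \<in> Obj C" "z \<in> Obj C"
  shows "Assoc T w x y \<odot> Idn C z = inv_arr C (Assoc T w (x \<otimes> y) z)
    \<cdot>\<^bsub>C\<^esub> (Idn C w \<odot> inv_arr C (Assoc T x y z)) \<cdot>\<^bsub>C\<^esub> Assoc T w x (y \<otimes> z) \<cdot>\<^bsub>C\<^esub> Assoc T (w \<otimes> x) y z"
  using assms by (simp add: pentagon[symmetric] tar_merge)

lemma inv_Assoc_tar:
  assumes "w \<in> Obj C" "x \<in> Obj C" "y \<in> Obj C" "z \<in> Obj C"
  shows "inv_arr C (Assoc T w x y) \<odot> Idn C z = inv_arr C (Assoc T (w \<otimes> x) y z)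
    \<cdot>\<^bsub>C\<^esub> inv_arr C (Assoc T w x (y \<otimes> z)) \<cdot>\<^bsub>C\<^esub> (Idn C w \<odot> Assoc T x y z) \<cdot>\<^bsub>C\<^esub> Assoc T w (x \<otimes> y) z"
proof -
  have "inv_arr C (Assoc T w x y) \<odot> Idn C z = inv_arr C (Assoc T w x y \<odot> Idn C z)"
    using assms by (simp add: tar_inv_arr)
  also have "\<dots> = inv_arr C (Assoc T (w \<otimes> x) y z)
    \<cdot>\<^bsub>C\<^esub> inv_arr C (Assoc T w x (y \<otimes> z)) \<cdot>\<^bsub>C\<^esub> (Idn C w \<odot> Assoc T x y z) \<cdot>\<^bsub>C\<^esub> Assoc T w (x \<otimes> y) z"
    unfolding Assoc_tar[OF assms] using assms by (simp add: inv_arr_Comp tar_inv_arr)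
  finally show ?thesis .
qed

lemma Comp_tar:
  "\<lbrakk>hom_type C f = r; hom_type C g = s; composable r s; x \<in> Obj C\<rbrakk>
    \<Longrightarrow> (g \<cdot>\<^bsub>C\<^esub> f) \<odot> Idn C x = (g \<odot> Idn C x) \<cdot>\<^bsub>C\<^esub> (f \<odot> Idn C x)"
  by (simp add: tar_Comp)

lemma tar_Comp_right:
  "\<lbrakk>hom_type C f = r; hom_type C g = s; composable r s; x \<in> Obj C\<rbrakk>
    \<Longrightarrow> Idn C x \<odot> (g \<cdot>\<^bsub>C\<^esub> f) = (Idn C x \<odot> g) \<cdot>\<^bsub>C\<^esub> (Idn C x \<odot> f)"
  by (simp add: tar_Comp)

lemma tar_cancel:
  assumes "iso_arr C f" "x \<in> Obj C" "hom_type C f = r"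
  shows "(Idn C x \<odot> inv_arr C f) \<cdot>\<^bsub>C\<^esub> (Idn C x \<odot> f) = Idn C (x \<otimes> source_of r)"
    "(Idn C x \<odot> f) \<cdot>\<^bsub>C\<^esub> (Idn C x \<odot> inv_arr C f) = Idn C (x \<otimes> target_of r)"
    "\<lbrakk>hom_type C k = s; s \<noteq> None; target_of s = x \<otimes> source_of r\<rbrakk>
      \<Longrightarrow> (Idn C x \<odot> inv_arr C f) \<cdot>\<^bsub>C\<^esub> (Idn C x \<odot> f) \<cdot>\<^bsub>C\<^esub> k = k"
    "\<lbrakk>hom_type C k = s; s \<noteq> None; target_of s = x \<otimes> target_of r\<rbrakk>
      \<Longrightarrow> (Idn C x \<odot> f) \<cdot>\<^bsub>C\<^esub> (Idn C x \<odot> inv_arr C f) \<cdot>\<^bsub>C\<^esub> k = k"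
proof -
  obtain y z where f: "y \<in> Obj C" "z \<in> Obj C" "hom_type C f = Some (y, z)"
    using iso_arr_type[OF assms(1)] by metis
  then have r: "r = Some (y, z)" using assms(3) by simp
  show "(Idn C x \<odot> inv_arr C f) \<cdot>\<^bsub>C\<^esub> (Idn C x \<odot> f) = Idn C (x \<otimes> source_of r)"
    "(Idn C x \<odot> f) \<cdot>\<^bsub>C\<^esub> (Idn C x \<odot> inv_arr C f) = Idn C (x \<otimes> target_of r)"
    using assms(1,2) f by (simp_all add: r tar_Comp)
  show "\<lbrakk>hom_type C k = s; s \<noteq> None; target_of s = x \<otimes> source_of r\<rbrakk>
      \<Longrightarrow> (Idn C x \<odot> inv_arr C f) \<cdot>\<^bsub>C\<^esub> (Idn C x \<odot> f) \<cdot>\<^bsub>C\<^esub> k = k"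
    "\<lbrakk>hom_type C k = s; s \<noteq> None; target_of s = x \<otimes> target_of r\<rbrakk>
      \<Longrightarrow> (Idn C x \<odot> f) \<cdot>\<^bsub>C\<^esub> (Idn C x \<odot> inv_arr C f) \<cdot>\<^bsub>C\<^esub> k = k"
    using assms(1,2) f by (auto simp add: r tar_Comp_assoc)
qed

lemma tar_tar_cancel:
  assumes "iso_arr C f" "x \<in> Obj C" "y \<in> Obj C" "hom_type C f = r"
  shows "(Idn C x \<odot> (Idn C y \<odot> inv_arr C f)) \<cdot>\<^bsub>C\<^esub> (Idn C x \<odot> (Idn C y \<odot> f)) = Idn C (x \<otimes> y \<otimes> source_of r)"
    "(Idn C x \<odot> (Idn C y \<odot> f)) \<cdot>\<^bsub>C\<^esub> (Idn C x \<odot> (Idn C y \<odot> inv_arr C f)) = Idn C (x \<otimes> y \<otimes> target_of r)"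
    "\<lbrakk>hom_type C k = s; s \<noteq> None; target_of s = x \<otimes> y \<otimes> source_of r\<rbrakk>
      \<Longrightarrow> (Idn C x \<odot> (Idn C y \<odot> inv_arr C f)) \<cdot>\<^bsub>C\<^esub> (Idn C x \<odot> (Idn C y \<odot> f)) \<cdot>\<^bsub>C\<^esub> k = k"
    "\<lbrakk>hom_type C k = s; s \<noteq> None; target_of s = x \<otimes> y \<otimes> target_of r\<rbrakk>
      \<Longrightarrow> (Idn C x \<odot> (Idn C y \<odot> f)) \<cdot>\<^bsub>C\<^esub> (Idn C x \<odot> (Idn C y \<odot> inv_arr C f)) \<cdot>\<^bsub>C\<^esub> k = k"
proof -
  obtain z w where f: "z \<in> Obj C" "w \<in> Obj C" "hom_type C f = Some (z, w)"
    using iso_arr_type[OF assms(1)] by metis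
  then have r: "r = Some (z, w)" using assms(4) by simp
  have i: "iso_arr C (Idn C y \<odot> f)" "inv_arr C (Idn C y \<odot> f) = Idn C y \<odot> inv_arr C f"
    using assms(1,3) by (simp_all add: tar_inv_arr)
  show "(Idn C x \<odot> (Idn C y \<odot> inv_arr C f)) \<cdot>\<^bsub>C\<^esub> (Idn C x \<odot> (Idn C y \<odot> f)) = Idn C (x \<otimes> y \<otimes> source_of r)"
    "(Idn C x \<odot> (Idn C y \<odot> f)) \<cdot>\<^bsub>C\<^esub> (Idn C x \<odot> (Idn C y \<odot> inv_arr C f)) = Idn C (x \<otimes> y \<otimes> target_of r)"
    "\<lbrakk>hom_type C k = s; s \<noteq> None; target_of s = x \<otimes> y \<otimes> source_of r\<rbrakk>
      \<Longrightarrow> (Idn C x \<odot> (Idn C y \<odot> inv_arr C f)) \<cdot>\<^bsub>C\<^esub> (Idn C x \<odot> (Idn C y \<odot> f)) \<cdot>\<^bsub>C\<^esub> k = k"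
    "\<lbrakk>hom_type C k = s; s \<noteq> None; target_of s = x \<otimes> y \<otimes> target_of r\<rbrakk>
      \<Longrightarrow> (Idn C x \<odot> (Idn C y \<odot> f)) \<cdot>\<^bsub>C\<^esub> (Idn C x \<odot> (Idn C y \<odot> inv_arr C f)) \<cdot>\<^bsub>C\<^esub> k = k"
    using tar_cancel[OF i(1) assms(2), of "Some (y \<otimes> z, y \<otimes> w)"] f assms(3) by (auto simp: i r)
qed

lemma Idn_tob_tar:
  assumes "x \<in> Obj C" "y \<in> Obj C" "hom_type C f = r" "r \<noteq> None"
  shows "Idn C (x \<otimes> y) \<odot> f = inv_arr C (Assoc T x y (target_of r)) \<cdot>\<^bsub>C\<^esub> (Idn C x \<odot> (Idn C y \<odot> f))
    \<cdot>\<^bsub>C\<^esub> Assoc T x y (source_of r)"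
  using tar_tar[of "Idn C x" _ "Idn C y" _ f r] assms by simp

lemmas right_nested = Idn_tob_tar tar_tar Assoc_tar inv_Assoc_tar Comp_tar tar_Comp_right tar_cancel
  tar_tar_cancel

text \<open>The classical consequences of the pentagon and the triangle, due to Kelly: the unit constraints of
  a tensor product, and the equality of the two unit constraints of the unit.\<close>

lemma LUnit_tar:
  assumes x: "x \<in> Obj C" and y: "y \<in> Obj C"
  shows "LUnit T x \<odot> Idn C y = LUnit T (x \<otimes> y) \<cdot>\<^bsub>C\<^esub> Assoc T (Unit T) x y"
proof -
  let ?U = "Unit T"
  let ?b = "Assoc T ?U (?U \<otimes> x) y \<cdot>\<^bsub>C\<^esub> (Assoc T ?U ?U x \<odot> Idn C y)"
  note xy [simp] = x y
  have b: "iso_arr C ?b" by simp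
  have "(Idn C ?U \<odot> (LUnit T x \<odot> Idn C y)) \<cdot>\<^bsub>C\<^esub> ?b
      = ((Idn C ?U \<odot> (LUnit T x \<odot> Idn C y)) \<cdot>\<^bsub>C\<^esub> Assoc T ?U (?U \<otimes> x) y) \<cdot>\<^bsub>C\<^esub> (Assoc T ?U ?U x \<odot> Idn C y)"
    by simp
  also have "\<dots> = (Assoc T ?U x y \<cdot>\<^bsub>C\<^esub> ((Idn C ?U \<odot> LUnit T x) \<odot> Idn C y)) \<cdot>\<^bsub>C\<^esub> (Assoc T ?U ?U x \<odot> Idn C y)"
    using assoc_natural[of "Idn C ?U" ?U ?U "LUnit T x" "?U \<otimes> x" x "Idn C y" y y] by simp
  also have "\<dots> = Assoc T ?U x y \<cdot>\<^bsub>C\<^esub> ((RUnit T ?U \<odot> Idn C x) \<odot> Idn C y)"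
    by (simp add: tar_merge triangle)
  also have "\<dots> = (RUnit T ?U \<odot> Idn C (x \<otimes> y)) \<cdot>\<^bsub>C\<^esub> Assoc T (?U \<otimes> ?U) x y"
    using assoc_natural[of "RUnit T ?U" "?U \<otimes> ?U" ?U "Idn C x" x x "Idn C y" y y] by simp
  also have "\<dots> = (Idn C ?U \<odot> LUnit T (x \<otimes> y)) \<cdot>\<^bsub>C\<^esub> Assoc T ?U ?U (x \<otimes> y) \<cdot>\<^bsub>C\<^esub> Assoc T (?U \<otimes> ?U) x y"
    by (simp add: triangle[symmetric])
  also have "\<dots> = (Idn C ?U \<odot> LUnit T (x \<otimes> y)) \<cdot>\<^bsub>C\<^esub> (Idn C ?U \<odot> Assoc T ?U x y) \<cdot>\<^bsub>C\<^esub> ?b"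
    by (simp add: pentagon)
  also have "\<dots> = (Idn C ?U \<odot> (LUnit T (x \<otimes> y) \<cdot>\<^bsub>C\<^esub> Assoc T ?U x y)) \<cdot>\<^bsub>C\<^esub> ?b"
    by (simp add: tar_merge)
  finally have "Idn C ?U \<odot> (LUnit T x \<odot> Idn C y)
      = Idn C ?U \<odot> (LUnit T (x \<otimes> y) \<cdot>\<^bsub>C\<^esub> Assoc T ?U x y)"
    by (rule iso_cancel_right[OF b, rotated -1]) simp_all
  then show ?thesis
    by (rule unit_tensor_faithful[rotated -1]) simp_all
qed

lemma RUnit_tar:
  "\<lbrakk>x \<in> Obj C; y \<in> Obj C\<rbrakk>
    \<Longrightarrow> RUnit T x \<odot> Idn C y = (Idn C x \<odot> LUnit T y) \<cdot>\<^bsub>C\<^esub> Assoc T x (Unit T) y"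
  by (rule triangle[symmetric])

lemma LUnit_Unit_tob:
  assumes x: "x \<in> Obj C"
  shows "LUnit T (Unit T \<otimes> x) = Idn C (Unit T) \<odot> LUnit T x"
proof (rule iso_cancel_left)
  show "LUnit T x \<cdot>\<^bsub>C\<^esub> LUnit T (Unit T \<otimes> x) = LUnit T x \<cdot>\<^bsub>C\<^esub> (Idn C (Unit T) \<odot> LUnit T x)"
    using lunit_natural[of "LUnit T x" "Unit T \<otimes> x" x] x by simp
qed (use x in simp_all)

lemma LUnit_RUnit: "LUnit T (Unit T) = RUnit T (Unit T)"
proof (rule tensor_unit_faithful)
  show "LUnit T (Unit T) \<odot> Idn C (Unit T) = RUnit T (Unit T) \<odot> Idn C (Unit T)"
    by (simp add: LUnit_tar RUnit_tar LUnit_Unit_tob)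
qed simp_all

lemma RUnit_tob:
  assumes x: "x \<in> Obj C" and y: "y \<in> Obj C"
  shows "RUnit T (x \<otimes> y) = (Idn C x \<odot> RUnit T y) \<cdot>\<^bsub>C\<^esub> Assoc T x y (Unit T)"
proof (rule tensor_unit_faithful)
  show "RUnit T (x \<otimes> y) \<odot> Idn C (Unit T)
      = ((Idn C x \<odot> RUnit T y) \<cdot>\<^bsub>C\<^esub> Assoc T x y (Unit T)) \<odot> Idn C (Unit T)"
    using x y by (simp add: right_nested RUnit_tar)
qed (use x y in simp_all)

end

section \<open>Half-braidings\<close>

context monoidal_category
begin

text \<open>The component at \<open>x\<close> of a half-braiding, as an arrow \<open>a \<otimes> (x \<otimes> w) \<rightarrow> x \<otimes> (a \<otimes> w)\<close> between
  right-nested products. Such arrows compose with each other without associators in between.\<close>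

definition nested_braiding :: "'o \<Rightarrow> ('o \<Rightarrow> 'm) \<Rightarrow> 'o \<Rightarrow> 'o \<Rightarrow> 'm" where
  "nested_braiding a \<sigma> x w =
     Assoc T x a w \<cdot>\<^bsub>C\<^esub> (\<sigma> x \<odot> Idn C w) \<cdot>\<^bsub>C\<^esub> inv_arr C (Assoc T a x w)"

lemma half_braiding_simps:
  assumes "half_braiding C T a \<sigma>"
  shows "a \<in> Obj C" "x \<in> Obj C \<Longrightarrow> hom_type C (\<sigma> x) = Some (a \<otimes> x, x \<otimes> a)"
    "x \<in> Obj C \<Longrightarrow> iso_arr C (\<sigma> x)"
  using half_braiding.carrier_closed[OF assms] half_braiding.component[OF assms, of x]
    half_braiding.component_iso[OF assms, of x]
  by auto

lemma half_braiding_tob: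
  assumes "half_braiding C T a \<sigma>" "x \<in> Obj C" "y \<in> Obj C"
  shows "\<sigma> (x \<otimes> y) = inv_arr C (Assoc T x y a) \<cdot>\<^bsub>C\<^esub> (Idn C x \<odot> \<sigma> y) \<cdot>\<^bsub>C\<^esub> Assoc T x a y
    \<cdot>\<^bsub>C\<^esub> (\<sigma> x \<odot> Idn C y) \<cdot>\<^bsub>C\<^esub> inv_arr C (Assoc T a x y)"
proof -
  note [simp] = half_braiding_simps[OF assms(1)] assms(2,3)
  have "(Assoc T x y a \<cdot>\<^bsub>C\<^esub> \<sigma> (x \<otimes> y) \<cdot>\<^bsub>C\<^esub> Assoc T a x y) \<cdot>\<^bsub>C\<^esub> inv_arr C (Assoc T a x y)
      = ((Idn C x \<odot> \<sigma> y) \<cdot>\<^bsub>C\<^esub> Assoc T x a y \<cdot>\<^bsub>C\<^esub> (\<sigma> x \<odot> Idn C y)) \<cdot>\<^bsub>C\<^esub> inv_arr C (Assoc T a x y)"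
    unfolding half_braiding.hexagon[OF assms] ..
  then have "Assoc T x y a \<cdot>\<^bsub>C\<^esub> \<sigma> (x \<otimes> y)
      = (Idn C x \<odot> \<sigma> y) \<cdot>\<^bsub>C\<^esub> Assoc T x a y \<cdot>\<^bsub>C\<^esub> (\<sigma> x \<odot> Idn C y) \<cdot>\<^bsub>C\<^esub> inv_arr C (Assoc T a x y)"
    by simp
  then have "inv_arr C (Assoc T x y a) \<cdot>\<^bsub>C\<^esub> Assoc T x y a \<cdot>\<^bsub>C\<^esub> \<sigma> (x \<otimes> y)
      = inv_arr C (Assoc T x y a) \<cdot>\<^bsub>C\<^esub> (Idn C x \<odot> \<sigma> y) \<cdot>\<^bsub>C\<^esub> Assoc T x a y
    \<cdot>\<^bsub>C\<^esub> (\<sigma> x \<odot> Idn C y) \<cdot>\<^bsub>C\<^esub> inv_arr C (Assoc T a x y)"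
    by (rule arg_cong)
  then show ?thesis by simp
qed

lemma nested_braiding_arr:
  assumes "half_braiding C T a \<sigma>" "x \<in> Obj C" "w \<in> Obj C"
  shows "hom_type C (nested_braiding a \<sigma> x w) = Some (a \<otimes> (x \<otimes> w), x \<otimes> (a \<otimes> w))"
  using half_braiding_simps[OF assms(1)] assms(2,3) by (simp add: nested_braiding_def)

lemma half_braiding_tar:
  assumes "half_braiding C T a \<sigma>" "x \<in> Obj C" "w \<in> Obj C"
  shows "\<sigma> x \<odot> Idn C w = inv_arr C (Assoc T x a w) \<cdot>\<^bsub>C\<^esub> nested_braiding a \<sigma> x w \<cdot>\<^bsub>C\<^esub> Assoc T a x w"
  using half_braiding_simps[OF assms(1)] assms(2,3) by (simp add: nested_braiding_def)

lemma nested_braiding_natural: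
  assumes h: "half_braiding C T a \<sigma>" and x: "x \<in> Obj C"
    and k: "hom_type C k = r" "r \<noteq> None" "target_of r = w"
  shows "nested_braiding a \<sigma> x w \<cdot>\<^bsub>C\<^esub> (Idn C a \<odot> (Idn C x \<odot> k))
    = (Idn C x \<odot> (Idn C a \<odot> k)) \<cdot>\<^bsub>C\<^esub> nested_braiding a \<sigma> x (source_of r)"
proof -
  obtain v where r: "r = Some (v, w)" using k by (cases r) auto
  note k' = k(1)[unfolded r]
  note [simp] = half_braiding_simps[OF h] x k' Obj_of_type[OF k']
  have "nested_braiding a \<sigma> x w \<cdot>\<^bsub>C\<^esub> (Idn C a \<odot> (Idn C x \<odot> k))
      = Assoc T x a w \<cdot>\<^bsub>C\<^esub> (\<sigma> x \<odot> Idn C w) \<cdot>\<^bsub>C\<^esub> ((Idn C a \<odot> Idn C x) \<odot> k)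
        \<cdot>\<^bsub>C\<^esub> inv_arr C (Assoc T a x v)"
    by (simp add: nested_braiding_def Idn_tob_tar)
  also have "\<dots> = Assoc T x a w \<cdot>\<^bsub>C\<^esub> ((Idn C x \<odot> Idn C a) \<odot> k) \<cdot>\<^bsub>C\<^esub> (\<sigma> x \<odot> Idn C v)
        \<cdot>\<^bsub>C\<^esub> inv_arr C (Assoc T a x v)"
    by (simp add: tar_merge)
  also have "\<dots> = (Idn C x \<odot> (Idn C a \<odot> k)) \<cdot>\<^bsub>C\<^esub> nested_braiding a \<sigma> x v"
    by (simp add: nested_braiding_def Idn_tob_tar)
  finally show ?thesis by (simp add: r)
qed

lemma nested_braiding_natural_Comp:
  assumes h: "half_braiding C T a \<sigma>" and x: "x \<in> Obj C"
    and k: "hom_type C k = r" "r \<noteq> None" "target_of r = w"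
    and f: "hom_type C f = s" "s \<noteq> None" "target_of s = a \<otimes> (x \<otimes> source_of r)"
  shows "nested_braiding a \<sigma> x w \<cdot>\<^bsub>C\<^esub> (Idn C a \<odot> (Idn C x \<odot> k)) \<cdot>\<^bsub>C\<^esub> f
    = (Idn C x \<odot> (Idn C a \<odot> k)) \<cdot>\<^bsub>C\<^esub> nested_braiding a \<sigma> x (source_of r) \<cdot>\<^bsub>C\<^esub> f"
proof -
  obtain v where r: "r = Some (v, w)" using k by (cases r) auto
  obtain u where s: "s = Some (u, a \<otimes> (x \<otimes> v))" using f r by (cases s) auto
  note k' = k(1)[unfolded r] and f' = f(1)[unfolded s]
  note [simp] = half_braiding_simps[OF h] x k' Obj_of_type[OF k'] f' nested_braiding_arr[OF h]
  have "(nested_braiding a \<sigma> x w \<cdot>\<^bsub>C\<^esub> (Idn C a \<odot> (Idn C x \<odot> k))) \<cdot>\<^bsub>C\<^esub> f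
      = ((Idn C x \<odot> (Idn C a \<odot> k)) \<cdot>\<^bsub>C\<^esub> nested_braiding a \<sigma> x v) \<cdot>\<^bsub>C\<^esub> f"
    using nested_braiding_natural[OF h x k] by (simp only: r type_simps)
  then show ?thesis by (simp add: r)
qed

lemma nested_braiding_tar:
  assumes h: "half_braiding C T a \<sigma>" and x: "x \<in> Obj C" and y: "y \<in> Obj C" and w: "w \<in> Obj C"
  shows "nested_braiding a \<sigma> x y \<odot> Idn C w = inv_arr C (Assoc T x (a \<otimes> y) w)
    \<cdot>\<^bsub>C\<^esub> (Idn C x \<odot> inv_arr C (Assoc T a y w)) \<cdot>\<^bsub>C\<^esub> nested_braiding a \<sigma> x (y \<otimes> w)
    \<cdot>\<^bsub>C\<^esub> (Idn C a \<odot> Assoc T x y w) \<cdot>\<^bsub>C\<^esub> Assoc T a (x \<otimes> y) w"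
  using half_braiding_simps[OF h] x y w by (simp add: nested_braiding_def right_nested)

definition tensor_braiding :: "'o \<Rightarrow> ('o \<Rightarrow> 'm) \<Rightarrow> 'o \<Rightarrow> ('o \<Rightarrow> 'm) \<Rightarrow> 'o \<Rightarrow> 'm" where
  "tensor_braiding a \<sigma> b \<tau> x = Assoc T x a b \<cdot>\<^bsub>C\<^esub> (\<sigma> x \<odot> Idn C b) \<cdot>\<^bsub>C\<^esub> inv_arr C (Assoc T a x b)
     \<cdot>\<^bsub>C\<^esub> (Idn C a \<odot> \<tau> x) \<cdot>\<^bsub>C\<^esub> Assoc T a b x"

lemma center_tob_tensor_braiding:
  "center_tob C T (a, \<sigma>) (b, \<tau>) = (a \<otimes> b, restrict (tensor_braiding a \<sigma> b \<tau>) (Obj C))"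
  by (simp add: center_tob_def tensor_braiding_def[abs_def])

lemma tensor_braiding_arr:
  assumes "half_braiding C T a \<sigma>" "half_braiding C T b \<tau>" "x \<in> Obj C"
  shows "hom_type C (tensor_braiding a \<sigma> b \<tau> x) = Some ((a \<otimes> b) \<otimes> x, x \<otimes> (a \<otimes> b))" "iso_arr C (tensor_braiding a \<sigma> b \<tau> x)"
  using half_braiding_simps[OF assms(1)] half_braiding_simps[OF assms(2)] assms(3)
  by (simp_all add: tensor_braiding_def)

lemma tensor_braiding_tar:
  assumes h: "half_braiding C T a \<sigma>" "half_braiding C T b \<tau>" and x: "x \<in> Obj C" and w: "w \<in> Obj C"
  shows "tensor_braiding a \<sigma> b \<tau> x \<odot> Idn C w = inv_arr C (Assoc T x (a \<otimes> b) w)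
    \<cdot>\<^bsub>C\<^esub> (Idn C x \<odot> inv_arr C (Assoc T a b w)) \<cdot>\<^bsub>C\<^esub> nested_braiding a \<sigma> x (b \<otimes> w)
    \<cdot>\<^bsub>C\<^esub> (Idn C a \<odot> nested_braiding b \<tau> x w) \<cdot>\<^bsub>C\<^esub> Assoc T a b (x \<otimes> w) \<cdot>\<^bsub>C\<^esub> Assoc T (a \<otimes> b) x w"
proof -
  note [simp] = half_braiding_simps[OF h(1)] half_braiding_simps[OF h(2)]
    nested_braiding_arr[OF h(1)] nested_braiding_arr[OF h(2)] x w
  show ?thesis
    by (simp add: tensor_braiding_def right_nested half_braiding_tar[OF h(1)] half_braiding_tar[OF h(2)]
      nested_braiding_tar[OF h(1)] nested_braiding_tar[OF h(2)])
qed

lemma half_braiding_tob_nested: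
  assumes h: "half_braiding C T a \<sigma>" and x: "x \<in> Obj C" and y: "y \<in> Obj C" and w: "w \<in> Obj C"
  shows "nested_braiding a \<sigma> (x \<otimes> y) w = inv_arr C (Assoc T x y (a \<otimes> w))
    \<cdot>\<^bsub>C\<^esub> (Idn C x \<odot> nested_braiding a \<sigma> y w)
    \<cdot>\<^bsub>C\<^esub> nested_braiding a \<sigma> x (y \<otimes> w) \<cdot>\<^bsub>C\<^esub> (Idn C a \<odot> Assoc T x y w)"
proof -
  note [simp] = half_braiding_simps[OF h(1)] nested_braiding_arr[OF h(1)] x y w
  have "nested_braiding a \<sigma> (x \<otimes> y) w = Assoc T (x \<otimes> y) a w \<cdot>\<^bsub>C\<^esub> (\<sigma> (x \<otimes> y) \<odot> Idn C w)
    \<cdot>\<^bsub>C\<^esub> inv_arr C (Assoc T a (x \<otimes> y) w)"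
    by (simp only: nested_braiding_def)
  then show ?thesis
    by (simp add: half_braiding_tob[OF h] right_nested half_braiding_tar[OF h] nested_braiding_tar[OF h])
qed

text \<open>On right-nested products, the hexagon for \<open>a \<otimes> b\<close> consists of the hexagons for \<open>a\<close> and \<open>b\<close>, with
  the middle two factors interchanged by the naturality of the half-braiding of \<open>a\<close>.\<close>

lemma half_braiding_tensor:
  assumes h: "half_braiding C T a \<sigma>" "half_braiding C T b \<tau>"
  shows "half_braiding C T (a \<otimes> b) (restrict (tensor_braiding a \<sigma> b \<tau>) (Obj C))"
proof
  note hs [simp] = half_braiding_simps[OF h(1)] half_braiding_simps[OF h(2)]
  note [simp] = tensor_braiding_arr[OF h]
  show "a \<otimes> b \<in> Obj C" by simp
  show "restrict (tensor_braiding a \<sigma> b \<tau>) (Obj C) \<in> extensional (Obj C)" by simp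
  fix x assume x [simp]: "x \<in> Obj C"
  show "restrict (tensor_braiding a \<sigma> b \<tau>) (Obj C) x \<in> Hom C ((a \<otimes> b) \<otimes> x) (x \<otimes> (a \<otimes> b))"
    by simp
  show "iso_arr C (restrict (tensor_braiding a \<sigma> b \<tau>) (Obj C) x)"
    by simp
next
  note hs [simp] = half_braiding_simps[OF h(1)] half_braiding_simps[OF h(2)]
  fix f x y assume "f \<in> Hom C x y"
  then have f [simp]: "hom_type C f = Some (x, y)" by simp
  note [simp] = Obj_of_type[OF f]
  have \<sigma>: "(\<sigma> y \<odot> Idn C b) \<cdot>\<^bsub>C\<^esub> ((Idn C a \<odot> f) \<odot> Idn C b) = ((f \<odot> Idn C a) \<odot> Idn C b) \<cdot>\<^bsub>C\<^esub> (\<sigma> x \<odot> Idn C b)"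
    and \<tau>: "(Idn C a \<odot> \<tau> y) \<cdot>\<^bsub>C\<^esub> (Idn C a \<odot> (Idn C b \<odot> f)) = (Idn C a \<odot> (f \<odot> Idn C b)) \<cdot>\<^bsub>C\<^esub> (Idn C a \<odot> \<tau> x)"
    using half_braiding.natural[OF h(1), of f x y] half_braiding.natural[OF h(2), of f x y]
    by (simp_all add: tar_merge)
  have "tensor_braiding a \<sigma> b \<tau> y \<cdot>\<^bsub>C\<^esub> (Idn C (a \<otimes> b) \<odot> f)
      = Assoc T y a b \<cdot>\<^bsub>C\<^esub> (\<sigma> y \<odot> Idn C b) \<cdot>\<^bsub>C\<^esub> inv_arr C (Assoc T a y b)
        \<cdot>\<^bsub>C\<^esub> ((Idn C a \<odot> \<tau> y) \<cdot>\<^bsub>C\<^esub> (Idn C a \<odot> (Idn C b \<odot> f))) \<cdot>\<^bsub>C\<^esub> Assoc T a b x"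
    by (simp add: tensor_braiding_def Idn_tob_tar)
  also have "\<dots> = Assoc T y a b \<cdot>\<^bsub>C\<^esub> ((\<sigma> y \<odot> Idn C b) \<cdot>\<^bsub>C\<^esub> ((Idn C a \<odot> f) \<odot> Idn C b))
        \<cdot>\<^bsub>C\<^esub> inv_arr C (Assoc T a x b) \<cdot>\<^bsub>C\<^esub> (Idn C a \<odot> \<tau> x) \<cdot>\<^bsub>C\<^esub> Assoc T a b x"
    unfolding \<tau> by (simp add: tar_tar)
  also have "\<dots> = (f \<odot> Idn C (a \<otimes> b)) \<cdot>\<^bsub>C\<^esub> tensor_braiding a \<sigma> b \<tau> x"
    unfolding \<sigma> by (simp add: tensor_braiding_def tar_tar)
  finally show "restrict (tensor_braiding a \<sigma> b \<tau>) (Obj C) y \<cdot>\<^bsub>C\<^esub> (Idn C (a \<otimes> b) \<odot> f)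
      = (f \<odot> Idn C (a \<otimes> b)) \<cdot>\<^bsub>C\<^esub> restrict (tensor_braiding a \<sigma> b \<tau>) (Obj C) x"
    by simp
next
  note [simp] = half_braiding_simps[OF h(1)] half_braiding_simps[OF h(2)] tensor_braiding_arr[OF h]
    nested_braiding_arr[OF h(1)] nested_braiding_arr[OF h(2)]
  fix x y assume [simp]: "x \<in> Obj C" "y \<in> Obj C"
  have "Assoc T x y (a \<otimes> b) \<cdot>\<^bsub>C\<^esub> tensor_braiding a \<sigma> b \<tau> (x \<otimes> y) \<cdot>\<^bsub>C\<^esub> Assoc T (a \<otimes> b) x y
      = (Idn C x \<odot> tensor_braiding a \<sigma> b \<tau> y) \<cdot>\<^bsub>C\<^esub> Assoc T x (a \<otimes> b) y
        \<cdot>\<^bsub>C\<^esub> (tensor_braiding a \<sigma> b \<tau> x \<odot> Idn C y)"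
    by (rule tensor_unit_faithful)
      (simp_all add: right_nested tensor_braiding_tar[OF h] half_braiding_tob_nested[OF h(1)]
        half_braiding_tob_nested[OF h(2)] nested_braiding_tar[OF h(1)] nested_braiding_tar[OF h(2)]
        nested_braiding_natural[OF h(1)]
        nested_braiding_natural_Comp[OF h(1)])
  then show "Assoc T x y (a \<otimes> b) \<cdot>\<^bsub>C\<^esub> restrict (tensor_braiding a \<sigma> b \<tau>) (Obj C) (x \<otimes> y)
      \<cdot>\<^bsub>C\<^esub> Assoc T (a \<otimes> b) x y
      = (Idn C x \<odot> restrict (tensor_braiding a \<sigma> b \<tau>) (Obj C) y) \<cdot>\<^bsub>C\<^esub> Assoc T x (a \<otimes> b) y
        \<cdot>\<^bsub>C\<^esub> (restrict (tensor_braiding a \<sigma> b \<tau>) (Obj C) x \<odot> Idn C y)"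
    by simp
qed

lemma tensor_braiding_nested:
  assumes h: "half_braiding C T a \<sigma>" "half_braiding C T b \<tau>" and x: "x \<in> Obj C" and w: "w \<in> Obj C"
  shows "nested_braiding (a \<otimes> b) (restrict (tensor_braiding a \<sigma> b \<tau>) (Obj C)) x w
    = (Idn C x \<odot> inv_arr C (Assoc T a b w)) \<cdot>\<^bsub>C\<^esub> nested_braiding a \<sigma> x (b \<otimes> w)
    \<cdot>\<^bsub>C\<^esub> (Idn C a \<odot> nested_braiding b \<tau> x w) \<cdot>\<^bsub>C\<^esub> Assoc T a b (x \<otimes> w)"
proof -
  note [simp] = half_braiding_simps[OF h(1)] half_braiding_simps[OF h(2)]
    nested_braiding_arr[OF h(1)] nested_braiding_arr[OF h(2)] x w
  have "nested_braiding (a \<otimes> b) (restrict (tensor_braiding a \<sigma> b \<tau>) (Obj C)) x w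
    = Assoc T x (a \<otimes> b) w \<cdot>\<^bsub>C\<^esub> (tensor_braiding a \<sigma> b \<tau> x \<odot> Idn C w)
      \<cdot>\<^bsub>C\<^esub> inv_arr C (Assoc T (a \<otimes> b) x w)"
    by (simp add: nested_braiding_def[of "a \<otimes> b"])
  then show ?thesis
    by (simp add: tensor_braiding_tar[OF h])
qed

lemma tensor_braiding_Assoc:
  assumes h: "half_braiding C T a \<sigma>" "half_braiding C T b \<tau>" "half_braiding C T c \<rho>"
    and x: "x \<in> Obj C"
  shows "tensor_braiding a \<sigma> (b \<otimes> c) (restrict (tensor_braiding b \<tau> c \<rho>) (Obj C)) x \<cdot>\<^bsub>C\<^esub> (Assoc T a b c \<odot> Idn C x)
    = (Idn C x \<odot> Assoc T a b c) \<cdot>\<^bsub>C\<^esub> tensor_braiding (a \<otimes> b) (restrict (tensor_braiding a \<sigma> b \<tau>) (Obj C)) c \<rho> x"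
proof -
  note hab = half_braiding_tensor[OF h(1,2)] and hbc = half_braiding_tensor[OF h(2,3)]
  note [simp] = half_braiding_simps[OF h(1)] half_braiding_simps[OF h(2)] half_braiding_simps[OF h(3)]
    nested_braiding_arr[OF h(1)] nested_braiding_arr[OF h(2)] nested_braiding_arr[OF h(3)] x
    tensor_braiding_arr[OF h(1) hbc] tensor_braiding_arr[OF hab h(3)]
  show ?thesis
    by (rule tensor_unit_faithful)
      (simp_all add: right_nested tensor_braiding_tar[OF h(1) hbc] tensor_braiding_tar[OF hab h(3)]
        tensor_braiding_nested[OF h(1,2)] tensor_braiding_nested[OF h(2,3)]
        nested_braiding_natural[OF h(1)] nested_braiding_natural_Comp[OF h(1)])
qed

definition unit_braiding :: "'o \<Rightarrow> 'm" where
  "unit_braiding x = inv_arr C (RUnit T x) \<cdot>\<^bsub>C\<^esub> LUnit T x"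

lemma center_unit_unit_braiding: "center_unit C T = (Unit T, restrict unit_braiding (Obj C))"
  by (simp add: center_unit_def unit_braiding_def[abs_def])

lemma unit_braiding_arr [simp]:
  assumes "x \<in> Obj C"
  shows "hom_type C (unit_braiding x) = Some (Unit T \<otimes> x, x \<otimes> Unit T)" "iso_arr C (unit_braiding x)"
  using assms by (simp_all add: unit_braiding_def)

lemma half_braiding_unit: "half_braiding C T (Unit T) (restrict unit_braiding (Obj C))"
proof
  fix f x y assume "f \<in> Hom C x y"
  then have f [simp]: "hom_type C f = Some (x, y)" by simp
  note [simp] = Obj_of_type[OF f]
  have "inv_arr C (RUnit T y) \<cdot>\<^bsub>C\<^esub> f = (f \<odot> Idn C (Unit T)) \<cdot>\<^bsub>C\<^esub> inv_arr C (RUnit T x)"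
  proof -
    have "inv_arr C (RUnit T y) \<cdot>\<^bsub>C\<^esub> (f \<cdot>\<^bsub>C\<^esub> RUnit T x) \<cdot>\<^bsub>C\<^esub> inv_arr C (RUnit T x)
        = inv_arr C (RUnit T y) \<cdot>\<^bsub>C\<^esub> (RUnit T y \<cdot>\<^bsub>C\<^esub> (f \<odot> Idn C (Unit T))) \<cdot>\<^bsub>C\<^esub> inv_arr C (RUnit T x)"
      using runit_natural[of f x y] by simp
    then show ?thesis by simp
  qed
  then have "(inv_arr C (RUnit T y) \<cdot>\<^bsub>C\<^esub> f) \<cdot>\<^bsub>C\<^esub> LUnit T x
      = ((f \<odot> Idn C (Unit T)) \<cdot>\<^bsub>C\<^esub> inv_arr C (RUnit T x)) \<cdot>\<^bsub>C\<^esub> LUnit T x"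
    by (simp only:)
  then show "restrict unit_braiding (Obj C) y \<cdot>\<^bsub>C\<^esub> (Idn C (Unit T) \<odot> f)
      = (f \<odot> Idn C (Unit T)) \<cdot>\<^bsub>C\<^esub> restrict unit_braiding (Obj C) x"
    using lunit_natural[of f x y] by (simp add: unit_braiding_def)
next
  fix x y assume xy [simp]: "x \<in> Obj C" "y \<in> Obj C"
  have "Assoc T x y (Unit T) \<cdot>\<^bsub>C\<^esub> unit_braiding (x \<otimes> y) \<cdot>\<^bsub>C\<^esub> Assoc T (Unit T) x y
      = (Idn C x \<odot> unit_braiding y) \<cdot>\<^bsub>C\<^esub> Assoc T x (Unit T) y \<cdot>\<^bsub>C\<^esub> (unit_braiding x \<odot> Idn C y)"
  proof -
    have r: "inv_arr C (RUnit T (x \<otimes> y)) = inv_arr C (Assoc T x y (Unit T)) \<cdot>\<^bsub>C\<^esub> (Idn C x \<odot> inv_arr C (RUnit T y))"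
      by (simp add: RUnit_tob inv_arr_Comp tar_inv_arr)
    have l: "LUnit T (x \<otimes> y) = (LUnit T x \<odot> Idn C y) \<cdot>\<^bsub>C\<^esub> inv_arr C (Assoc T (Unit T) x y)"
      by (simp add: LUnit_tar)
    have c: "(Idn C x \<odot> LUnit T y) \<cdot>\<^bsub>C\<^esub> Assoc T x (Unit T) y \<cdot>\<^bsub>C\<^esub> (inv_arr C (RUnit T x) \<odot> Idn C y)
        = Idn C (x \<otimes> y)"
    proof -
      have "((Idn C x \<odot> LUnit T y) \<cdot>\<^bsub>C\<^esub> Assoc T x (Unit T) y) \<cdot>\<^bsub>C\<^esub> (inv_arr C (RUnit T x) \<odot> Idn C y)
          = (RUnit T x \<odot> Idn C y) \<cdot>\<^bsub>C\<^esub> (inv_arr C (RUnit T x) \<odot> Idn C y)"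
        by (simp only: triangle xy)
      then show ?thesis by (simp add: tar_Comp)
    qed
    have "(Idn C x \<odot> unit_braiding y) \<cdot>\<^bsub>C\<^esub> Assoc T x (Unit T) y \<cdot>\<^bsub>C\<^esub> (unit_braiding x \<odot> Idn C y)
      = (Idn C x \<odot> inv_arr C (RUnit T y)) \<cdot>\<^bsub>C\<^esub> ((Idn C x \<odot> LUnit T y) \<cdot>\<^bsub>C\<^esub> Assoc T x (Unit T) y
         \<cdot>\<^bsub>C\<^esub> (inv_arr C (RUnit T x) \<odot> Idn C y)) \<cdot>\<^bsub>C\<^esub> (LUnit T x \<odot> Idn C y)"
      by (simp add: unit_braiding_def Comp_tar tar_Comp_right)
    also have "\<dots> = (Idn C x \<odot> inv_arr C (RUnit T y)) \<cdot>\<^bsub>C\<^esub> (LUnit T x \<odot> Idn C y)"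
      unfolding c by simp
    finally show ?thesis
      by (simp add: unit_braiding_def r l)
  qed
  then show "Assoc T x y (Unit T) \<cdot>\<^bsub>C\<^esub> restrict unit_braiding (Obj C) (x \<otimes> y)
      \<cdot>\<^bsub>C\<^esub> Assoc T (Unit T) x y
      = (Idn C x \<odot> restrict unit_braiding (Obj C) y) \<cdot>\<^bsub>C\<^esub> Assoc T x (Unit T) y
        \<cdot>\<^bsub>C\<^esub> (restrict unit_braiding (Obj C) x \<odot> Idn C y)"
    by simp
qed simp_all

section \<open>Frobenius algebras in the center\<close>

definition central :: "'o \<times> ('o \<Rightarrow> 'm) \<Rightarrow> 'o \<times> ('o \<Rightarrow> 'm) \<Rightarrow> 'm \<Rightarrow> bool" where
  "central P Q f \<longleftrightarrow> (P, Q, f) \<in> Arr (center C T)"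

lemma central_iff:
  "central (a, \<sigma>) (b, \<tau>) f \<longleftrightarrow> half_braiding C T a \<sigma> \<and> half_braiding C T b \<tau> \<and> hom_type C f = Some (a, b)
    \<and> (\<forall>x\<in>Obj C. \<tau> x \<cdot>\<^bsub>C\<^esub> (f \<odot> Idn C x) = (Idn C x \<odot> f) \<cdot>\<^bsub>C\<^esub> \<sigma> x)"
  by (simp add: central_def center_def)

lemma Hom_center: "f \<in> Hom (center C T) P Q \<longleftrightarrow> (\<exists>g. f = (P, Q, g) \<and> central P Q g)"
  by (auto simp: hom_type_def central_def simp: center_def split: if_splits)

lemma central_inv:
  assumes c: "central (a, \<sigma>) (b, \<tau>) f" and i: "iso_arr C f"
  shows "central (b, \<tau>) (a, \<sigma>) (inv_arr C f)"
proof -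
  have h: "half_braiding C T a \<sigma>" "half_braiding C T b \<tau>" and f: "hom_type C f = Some (a, b)"
    and e: "\<And>x. x \<in> Obj C \<Longrightarrow> \<tau> x \<cdot>\<^bsub>C\<^esub> (f \<odot> Idn C x) = (Idn C x \<odot> f) \<cdot>\<^bsub>C\<^esub> \<sigma> x"
    using c by (auto simp: central_iff)
  note [simp] = half_braiding_simps[OF h(1)] half_braiding_simps[OF h(2)] f i
  have "\<sigma> x \<cdot>\<^bsub>C\<^esub> (inv_arr C f \<odot> Idn C x) = (Idn C x \<odot> inv_arr C f) \<cdot>\<^bsub>C\<^esub> \<tau> x" if [simp]: "x \<in> Obj C" for x
  proof -
    have "\<sigma> x \<cdot>\<^bsub>C\<^esub> (inv_arr C f \<odot> Idn C x)
        = (Idn C x \<odot> inv_arr C f) \<cdot>\<^bsub>C\<^esub> ((Idn C x \<odot> f) \<cdot>\<^bsub>C\<^esub> \<sigma> x) \<cdot>\<^bsub>C\<^esub> (inv_arr C f \<odot> Idn C x)"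
      by (simp add: tar_merge)
    also have "\<dots> = (Idn C x \<odot> inv_arr C f) \<cdot>\<^bsub>C\<^esub> (\<tau> x \<cdot>\<^bsub>C\<^esub> (f \<odot> Idn C x)) \<cdot>\<^bsub>C\<^esub> (inv_arr C f \<odot> Idn C x)"
      by (simp only: e that)
    also have "\<dots> = (Idn C x \<odot> inv_arr C f) \<cdot>\<^bsub>C\<^esub> \<tau> x"
      by (simp add: tar_merge)
    finally show ?thesis .
  qed
  then show ?thesis using h by (simp add: central_iff)
qed

lemma central_Assoc:
  assumes h: "half_braiding C T a \<sigma>" "half_braiding C T b \<tau>" "half_braiding C T c \<rho>"
  shows "central (center_tob C T (center_tob C T (a, \<sigma>) (b, \<tau>)) (c, \<rho>))
    (center_tob C T (a, \<sigma>) (center_tob C T (b, \<tau>) (c, \<rho>))) (Assoc T a b c)"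
  unfolding center_tob_tensor_braiding central_iff
  using half_braiding_tensor[OF half_braiding_tensor[OF h(1,2)] h(3)]
    half_braiding_tensor[OF h(1) half_braiding_tensor[OF h(2,3)]]
    half_braiding_simps(1)[OF h(1)] half_braiding_simps(1)[OF h(2)] half_braiding_simps(1)[OF h(3)]
  by (simp add: tensor_braiding_Assoc[OF h])

lemma inv_arr_center:
  assumes c: "central P Q f" and i: "iso_arr C f"
  shows "inv_arr (center C T) (P, Q, f) = (Q, P, inv_arr C f)"
proof -
  obtain a \<sigma> b \<tau> where PQ: "P = (a, \<sigma>)" "Q = (b, \<tau>)" by (cases P; cases Q) auto
  have f: "hom_type C f = Some (a, b)" using c by (simp add: PQ central_iff)
  have D: "Dom (center C T) (P, Q, f) = P" "Cod (center C T) (P, Q, f) = Q" by (simp_all add: center_def)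
  have inv: "inverses (center C T) (P, Q, f) g \<longleftrightarrow> g = (Q, P, inv_arr C f)" for g
  proof
    assume g: "inverses (center C T) (P, Q, f) g"
    then have "g \<in> Hom (center C T) Q P" unfolding inverses_def D by blast
    then obtain k where k: "g = (Q, P, k)" "central Q P k" unfolding Hom_center by blast
    have "Comp (center C T) g (P, Q, f) = Idn (center C T) P"
      "Comp (center C T) (P, Q, f) g = Idn (center C T) Q"
      using g unfolding inverses_def D by blast+
    then have "k \<cdot>\<^bsub>C\<^esub> f = Idn C a" "f \<cdot>\<^bsub>C\<^esub> k = Idn C b"
      by (simp_all add: center_def PQ k)
    then have "inverses C f k"
      using k(2) by (simp add: inverses_iff[OF f] PQ central_iff)
    then show "g = (Q, P, inv_arr C f)"
      using k inv_arr_eqI by simp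
  next
    assume "g = (Q, P, inv_arr C f)"
    moreover have "central Q P (inv_arr C f)" using central_inv c i by (simp add: PQ)
    ultimately show "inverses (center C T) (P, Q, f) g"
      using c i f unfolding inverses_def D Hom_center
      by (simp add: central_def) (simp add: center_def PQ)
  qed
  show ?thesis unfolding inv_arr_def inv by simp
qed

text \<open>The forgetful functor from the center is faithful, so that an equation between arrows of the
  center can be checked on the underlying arrows. What has to be supplied in addition is that the
  structure arrows lie in the center, and that so does the associator, whose inverse in the center
  occurs in the Frobenius relations.\<close>

lemma commutative_frobenius_algebra_center:
  fixes a \<sigma>
  defines "P \<equiv> (a, \<sigma>)"
  defines "PP \<equiv> center_tob C T P P"
  defines "I \<equiv> center_unit C T"
  assumes h: "half_braiding C T a \<sigma>" and frob: "frobenius_algebra C T a \<mu> \<iota> \<delta> \<epsilon>"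
    and central: "central PP P \<mu>" "central I P \<iota>" "central P PP \<delta>" "central P I \<epsilon>"
    and commutative: "\<mu> \<cdot>\<^bsub>C\<^esub> \<sigma> a = \<mu>"
  shows "commutative_frobenius_algebra (center C T) (center_tensor C T) (center_braiding C T) P
    (PP, P, \<mu>) (I, P, \<iota>) (P, PP, \<delta>) (P, I, \<epsilon>)"
proof -
  interpret frobenius_algebra C T a \<mu> \<iota> \<delta> \<epsilon> by (rule frob)
  note defs = P_def PP_def I_def
  have inv: "inv_arr (center C T) (center_tob C T PP P, center_tob C T P PP, Assoc T a a a)
      = (center_tob C T P PP, center_tob C T PP P, inv_arr C (Assoc T a a a))"
    using central_Assoc[OF h h h] half_braiding_simps(1)[OF h] unfolding defs by (simp add: inv_arr_center)
  note simps = center_tensor_def center_braiding_def split_def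
  have ob: "P \<in> Obj (center C T)" using h by (simp add: center_def defs)
  have [simp]: "Comp (center C T) (Q', R, g) (Q, Q'', f) = (Q, R, g \<cdot>\<^bsub>C\<^esub> f)" for Q Q' Q'' R f g
    by (simp add: center_def)
  have [simp]: "Idn (center C T) P = (P, P, Idn C a)"
    by (simp add: center_def defs)
  have [simp]: "fst P = a" "snd P = \<sigma>" by (simp_all add: defs)
  show ?thesis
  proof
    show "P \<in> Obj (center C T)" by (fact ob)
    show "(PP, P, \<mu>) \<in> Hom (center C T) (P \<otimes>\<^bsub>center_tensor C T\<^esub> P) P"
      "(I, P, \<iota>) \<in> Hom (center C T) (Unit (center_tensor C T)) P"
      "(P, PP, \<delta>) \<in> Hom (center C T) P (P \<otimes>\<^bsub>center_tensor C T\<^esub> P)"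
      "(P, I, \<epsilon>) \<in> Hom (center C T) P (Unit (center_tensor C T))"
      using central unfolding Hom_center by (simp_all add: simps PP_def I_def)
  qed (use associative unital_left unital_right coassociative counital_left counital_right
      frobenius_left frobenius_right commutative in
      \<open>simp_all add: simps inv flip: PP_def I_def\<close>)
qed

end

section \<open>The unit object in the center\<close>

context monoidal_category
begin

lemma unit_braiding_Unit: "unit_braiding (Unit T) = Idn C (Unit T \<otimes> Unit T)"
  by (simp add: unit_braiding_def LUnit_RUnit)

lemma unit_braiding_natural:
  "hom_type C f = Some (x, y) \<Longrightarrow>
    unit_braiding y \<cdot>\<^bsub>C\<^esub> (Idn C (Unit T) \<odot> f) = (f \<odot> Idn C (Unit T)) \<cdot>\<^bsub>C\<^esub> unit_braiding x"
  using half_braiding.natural[OF half_braiding_unit, of f x y] Obj_of_type[of f x y] by simp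

lemma unit_braiding_hexagon:
  "\<lbrakk>x \<in> Obj C; y \<in> Obj C\<rbrakk> \<Longrightarrow> Assoc T x y (Unit T) \<cdot>\<^bsub>C\<^esub> unit_braiding (x \<otimes> y) \<cdot>\<^bsub>C\<^esub> Assoc T (Unit T) x y
    = (Idn C x \<odot> unit_braiding y) \<cdot>\<^bsub>C\<^esub> Assoc T x (Unit T) y \<cdot>\<^bsub>C\<^esub> (unit_braiding x \<odot> Idn C y)"
  using half_braiding.hexagon[OF half_braiding_unit, of x y] by simp

lemma unit_associative:
  "LUnit T (Unit T) \<odot> Idn C (Unit T) = (Idn C (Unit T) \<odot> LUnit T (Unit T)) \<cdot>\<^bsub>C\<^esub> Assoc T (Unit T) (Unit T) (Unit T)"
  using triangle[of "Unit T" "Unit T"] by (simp add: LUnit_RUnit)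

text \<open>This is the condition for the multiplication of the unit object to lie in the center. By coherence,
  the half-braidings of \<open>1\<close> and of \<open>1 \<otimes> 1\<close> only remove unit objects on the left and insert them on
  the right.\<close>

lemma unit_braiding_LUnit:
  assumes x [simp]: "x \<in> Obj C"
  shows "unit_braiding x \<cdot>\<^bsub>C\<^esub> (LUnit T (Unit T) \<odot> Idn C x)
    = (Idn C x \<odot> LUnit T (Unit T)) \<cdot>\<^bsub>C\<^esub> tensor_braiding (Unit T) unit_braiding (Unit T) unit_braiding x"
proof -
  let ?U = "Unit T"
  have nested: "nested_braiding ?U unit_braiding x w = (Idn C x \<odot> inv_arr C (LUnit T w)) \<cdot>\<^bsub>C\<^esub> LUnit T (x \<otimes> w)"
    if [simp]: "w \<in> Obj C" for w
  proof -
    have "inv_arr C (RUnit T x) \<odot> Idn C w = inv_arr C (RUnit T x \<odot> Idn C w)"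
      by (simp add: tar_inv_arr)
    also have "\<dots> = inv_arr C (Assoc T x ?U w) \<cdot>\<^bsub>C\<^esub> (Idn C x \<odot> inv_arr C (LUnit T w))"
      by (simp add: RUnit_tar inv_arr_Comp tar_inv_arr)
    finally show ?thesis
      by (simp add: nested_braiding_def unit_braiding_def Comp_tar LUnit_tar)
  qed
  have nat: "LUnit T (x \<otimes> (?U \<otimes> w)) \<cdot>\<^bsub>C\<^esub> (Idn C ?U \<odot> (Idn C x \<odot> inv_arr C (LUnit T w))) \<cdot>\<^bsub>C\<^esub> k
      = (Idn C x \<odot> inv_arr C (LUnit T w)) \<cdot>\<^bsub>C\<^esub> LUnit T (x \<otimes> w) \<cdot>\<^bsub>C\<^esub> k"
    if w [simp]: "w \<in> Obj C" and k [simp]: "hom_type C k = Some (v, ?U \<otimes> (x \<otimes> w))" for w k v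
  proof -
    have "(LUnit T (x \<otimes> (?U \<otimes> w)) \<cdot>\<^bsub>C\<^esub> (Idn C ?U \<odot> (Idn C x \<odot> inv_arr C (LUnit T w)))) \<cdot>\<^bsub>C\<^esub> k
      = ((Idn C x \<odot> inv_arr C (LUnit T w)) \<cdot>\<^bsub>C\<^esub> LUnit T (x \<otimes> w)) \<cdot>\<^bsub>C\<^esub> k"
      using lunit_natural[of "Idn C x \<odot> inv_arr C (LUnit T w)" "x \<otimes> w" "x \<otimes> (?U \<otimes> w)"] by simp
    then show ?thesis by simp
  qed
  have tb: "tensor_braiding ?U unit_braiding ?U unit_braiding x
      = tensor_braiding ?U (restrict unit_braiding (Obj C)) ?U (restrict unit_braiding (Obj C)) x"
    by (simp add: tensor_braiding_def)
  have nr: "nested_braiding ?U (restrict unit_braiding (Obj C)) x w = nested_braiding ?U unit_braiding x w" for w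
    by (simp add: nested_braiding_def)
  have ub: "unit_braiding x \<odot> Idn C w
      = inv_arr C (Assoc T x ?U w) \<cdot>\<^bsub>C\<^esub> nested_braiding ?U unit_braiding x w \<cdot>\<^bsub>C\<^esub> Assoc T ?U x w"
    if [simp]: "w \<in> Obj C" for w
    using half_braiding_tar[OF half_braiding_unit x, of w] nr by simp
  note [simp] = tensor_braiding_arr[OF half_braiding_unit half_braiding_unit]
  show ?thesis unfolding tb
    by (rule tensor_unit_faithful)
      (simp_all add: right_nested tensor_braiding_tar[OF half_braiding_unit half_braiding_unit] nr ub nested
        nat LUnit_tar LUnit_Unit_tob)
qed

end

section \<open>Adjoints and the induced notion of induced object\<close>

lemma id_comp_fun_simps [simp]:
  "ob id_fun x = x" "ar id_fun f = f"
  "ob (comp_fun G F) x = ob G (ob F x)" "ar (comp_fun G F) f = ar G (ar F f)"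
  by (simp_all add: id_fun_def comp_fun_def)

locale ambidextrous_functor =
  C: category C + D: category D + R: is_functor C D R + I: is_functor D C I
  + left: adjunction D C I R \<eta>l \<epsilon>l + right: adjunction C D R I \<eta>r \<epsilon>r
  for C :: "('o, 'm, 'y) category_scheme" and D :: "('p, 'n, 'z) category_scheme"
    and R :: "('o, 'm, 'p, 'n) functor_data" and I :: "('p, 'n, 'o, 'm) functor_data"
    and \<eta>l :: "'p \<Rightarrow> 'n" and \<epsilon>l :: "'o \<Rightarrow> 'm" and \<eta>r :: "'o \<Rightarrow> 'm" and \<epsilon>r :: "'p \<Rightarrow> 'n" +
  assumes special: "z \<in> Obj D \<Longrightarrow> \<epsilon>r z \<cdot>\<^bsub>D\<^esub> \<eta>l z = Idn D z"
begin

lemma type_units [simp]: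
  "z \<in> Obj D \<Longrightarrow> hom_type D (\<eta>l z) = Some (z, ob R (ob I z))"
  "x \<in> Obj C \<Longrightarrow> hom_type C (\<epsilon>l x) = Some (ob I (ob R x), x)"
  "x \<in> Obj C \<Longrightarrow> hom_type C (\<eta>r x) = Some (x, ob I (ob R x))"
  "z \<in> Obj D \<Longrightarrow> hom_type D (\<epsilon>r z) = Some (ob R (ob I z), z)"
  using left.unit.component[of z] left.counit.component[of x] right.unit.component[of x]
    right.counit.component[of z]
  by simp_all

lemma unit_naturality:
  "hom_type D h = Some (z, w) \<Longrightarrow> \<eta>l w \<cdot>\<^bsub>D\<^esub> h = ar R (ar I h) \<cdot>\<^bsub>D\<^esub> \<eta>l z"
  "hom_type C f = Some (x, y) \<Longrightarrow> \<epsilon>l y \<cdot>\<^bsub>C\<^esub> ar I (ar R f) = f \<cdot>\<^bsub>C\<^esub> \<epsilon>l x"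
  "hom_type C f = Some (x, y) \<Longrightarrow> \<eta>r y \<cdot>\<^bsub>C\<^esub> f = ar I (ar R f) \<cdot>\<^bsub>C\<^esub> \<eta>r x"
  "hom_type D h = Some (z, w) \<Longrightarrow> \<epsilon>r w \<cdot>\<^bsub>D\<^esub> ar R (ar I h) = h \<cdot>\<^bsub>D\<^esub> \<epsilon>r z"
  using left.unit.naturality[of h z w] left.counit.naturality[of f x y] right.unit.naturality[of f x y]
    right.counit.naturality[of h z w]
  by simp_all

lemma right_transpose:
  assumes x: "x \<in> Obj C" and g: "hom_type D g = Some (ob R x, z)"
  shows "\<epsilon>r z \<cdot>\<^bsub>D\<^esub> ar R (ar I g \<cdot>\<^bsub>C\<^esub> \<eta>r x) = g"
proof -
  note [simp] = x g D.Obj_of_type[OF g]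
  have "\<epsilon>r z \<cdot>\<^bsub>D\<^esub> ar R (ar I g \<cdot>\<^bsub>C\<^esub> \<eta>r x) = (\<epsilon>r z \<cdot>\<^bsub>D\<^esub> ar R (ar I g)) \<cdot>\<^bsub>D\<^esub> ar R (\<eta>r x)"
    by (simp add: R.ar_Comp)
  also have "\<dots> = (g \<cdot>\<^bsub>D\<^esub> \<epsilon>r (ob R x)) \<cdot>\<^bsub>D\<^esub> ar R (\<eta>r x)"
    by (simp only: unit_naturality(4)[OF g])
  also have "\<dots> = g" using right.triangle_left[OF x] by simp
  finally show ?thesis .
qed

lemma left_transpose:
  assumes x: "x \<in> Obj C" and g: "hom_type D g = Some (z, ob R x)"
  shows "ar R (\<epsilon>l x \<cdot>\<^bsub>C\<^esub> ar I g) \<cdot>\<^bsub>D\<^esub> \<eta>l z = g"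
proof -
  note [simp] = x g D.Obj_of_type[OF g]
  have "ar R (\<epsilon>l x \<cdot>\<^bsub>C\<^esub> ar I g) \<cdot>\<^bsub>D\<^esub> \<eta>l z = ar R (\<epsilon>l x) \<cdot>\<^bsub>D\<^esub> ar R (ar I g) \<cdot>\<^bsub>D\<^esub> \<eta>l z"
    by (simp add: R.ar_Comp)
  also have "\<dots> = (ar R (\<epsilon>l x) \<cdot>\<^bsub>D\<^esub> \<eta>l (ob R x)) \<cdot>\<^bsub>D\<^esub> g"
    by (simp add: unit_naturality(1)[OF g, symmetric])
  also have "\<dots> = g" by (simp add: left.triangle_right)
  finally show ?thesis .
qed

lemma right_transpose_unique:
  assumes z: "z \<in> Obj D" and f: "hom_type C f = Some (x, ob I z)"
  shows "f = ar I (\<epsilon>r z \<cdot>\<^bsub>D\<^esub> ar R f) \<cdot>\<^bsub>C\<^esub> \<eta>r x"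
proof -
  note [simp] = z f C.Obj_of_type[OF f]
  have "ar I (\<epsilon>r z \<cdot>\<^bsub>D\<^esub> ar R f) \<cdot>\<^bsub>C\<^esub> \<eta>r x = ar I (\<epsilon>r z) \<cdot>\<^bsub>C\<^esub> ar I (ar R f) \<cdot>\<^bsub>C\<^esub> \<eta>r x"
    by (simp add: I.ar_Comp)
  also have "\<dots> = (ar I (\<epsilon>r z) \<cdot>\<^bsub>C\<^esub> \<eta>r (ob I z)) \<cdot>\<^bsub>C\<^esub> f"
    by (simp add: unit_naturality(3)[OF f, symmetric])
  also have "\<dots> = f" by (simp add: right.triangle_right)
  finally show ?thesis by (rule sym)
qed

lemma left_transpose_unique:
  assumes z: "z \<in> Obj D" and f: "hom_type C f = Some (ob I z, x)"
  shows "f = \<epsilon>l x \<cdot>\<^bsub>C\<^esub> ar I (ar R f \<cdot>\<^bsub>D\<^esub> \<eta>l z)"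
proof -
  note [simp] = z f C.Obj_of_type[OF f]
  have "\<epsilon>l x \<cdot>\<^bsub>C\<^esub> ar I (ar R f \<cdot>\<^bsub>D\<^esub> \<eta>l z) = (\<epsilon>l x \<cdot>\<^bsub>C\<^esub> ar I (ar R f)) \<cdot>\<^bsub>C\<^esub> ar I (\<eta>l z)"
    by (simp add: I.ar_Comp)
  also have "\<dots> = (f \<cdot>\<^bsub>C\<^esub> \<epsilon>l (ob I z)) \<cdot>\<^bsub>C\<^esub> ar I (\<eta>l z)"
    by (simp only: unit_naturality(2)[OF f])
  also have "\<dots> = f" using left.triangle_left[OF z] by simp
  finally show ?thesis by (rule sym)
qed

text \<open>The arrows \<open>e : R b \<rightarrow> z\<close> and \<open>n : z \<rightarrow> R b\<close> exhibit \<open>b\<close> at once as the value at \<open>z\<close> of the right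
  adjoint and as that of the left adjoint, in such a way that the two identifications of \<open>b\<close> with
  \<open>I z\<close> are the same one.\<close>

definition induced :: "'o \<Rightarrow> 'p \<Rightarrow> 'n \<Rightarrow> 'n \<Rightarrow> bool" where
  "induced b z e n \<longleftrightarrow> z \<in> Obj D \<and> hom_type D n = Some (z, ob R b) \<and>
     (\<exists>f. iso_arr C f \<and> hom_type C f = Some (b, ob I z) \<and> e = \<epsilon>r z \<cdot>\<^bsub>D\<^esub> ar R f \<and> ar R f \<cdot>\<^bsub>D\<^esub> n = \<eta>l z)"

lemma inducedE:
  assumes "induced b z e n"
  obtains f where "z \<in> Obj D" "b \<in> Obj C" "hom_type D n = Some (z, ob R b)" "hom_type D e = Some (ob R b, z)"
    "iso_arr C f" "hom_type C f = Some (b, ob I z)" "e = \<epsilon>r z \<cdot>\<^bsub>D\<^esub> ar R f" "ar R f \<cdot>\<^bsub>D\<^esub> n = \<eta>l z"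
  using assms unfolding induced_def by (auto simp: C.Obj_of_type)

lemma induced_type:
  assumes "induced b z e n"
  shows "z \<in> Obj D" "b \<in> Obj C" "hom_type D n = Some (z, ob R b)" "hom_type D e = Some (ob R b, z)"
  using inducedE[OF assms] by metis+

lemma induced_I: "z \<in> Obj D \<Longrightarrow> induced (ob I z) z (\<epsilon>r z) (\<eta>l z)"
  unfolding induced_def by (auto intro!: exI[of _ "Idn C (ob I z)"])

lemma induced_lift:
  assumes a: "induced b z e n" and w: "w \<in> Obj C" and g: "hom_type D g = Some (ob R w, z)"
  obtains f where "hom_type C f = Some (w, b)" "e \<cdot>\<^bsub>D\<^esub> ar R f = g"
proof -
  obtain k where k: "z \<in> Obj D" "b \<in> Obj C" "iso_arr C k" "hom_type C k = Some (b, ob I z)"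
    "e = \<epsilon>r z \<cdot>\<^bsub>D\<^esub> ar R k" using a by (elim inducedE)
  note [simp] = k(1-4) w g
  let ?f = "inv_arr C k \<cdot>\<^bsub>C\<^esub> ar I g \<cdot>\<^bsub>C\<^esub> \<eta>r w"
  have "e \<cdot>\<^bsub>D\<^esub> ar R ?f = \<epsilon>r z \<cdot>\<^bsub>D\<^esub> ar R (k \<cdot>\<^bsub>C\<^esub> ?f)"
    by (simp add: k(5) R.ar_Comp R.ar_inv_arr)
  also have "\<dots> = g" using right_transpose[OF w g] by simp
  finally show thesis by (rule that[rotated]) simp
qed

lemma induced_unique:
  assumes a: "induced b z e n" and f: "hom_type C f = Some (w, b)" "hom_type C g = Some (w, b)"
    and eq: "e \<cdot>\<^bsub>D\<^esub> ar R f = e \<cdot>\<^bsub>D\<^esub> ar R g"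
  shows "f = g"
proof -
  obtain k where k: "z \<in> Obj D" "b \<in> Obj C" "iso_arr C k" "hom_type C k = Some (b, ob I z)"
    "e = \<epsilon>r z \<cdot>\<^bsub>D\<^esub> ar R k" using a by (elim inducedE)
  note [simp] = k(1-4) f C.Obj_of_type[OF f(1)]
  have "k \<cdot>\<^bsub>C\<^esub> f = ar I (\<epsilon>r z \<cdot>\<^bsub>D\<^esub> ar R (k \<cdot>\<^bsub>C\<^esub> f)) \<cdot>\<^bsub>C\<^esub> \<eta>r w"
    by (rule right_transpose_unique) simp_all
  also have "\<epsilon>r z \<cdot>\<^bsub>D\<^esub> ar R (k \<cdot>\<^bsub>C\<^esub> f) = e \<cdot>\<^bsub>D\<^esub> ar R f" by (simp add: k(5) R.ar_Comp)
  also have "\<dots> = e \<cdot>\<^bsub>D\<^esub> ar R g" by (rule eq)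
  also have "\<dots> = \<epsilon>r z \<cdot>\<^bsub>D\<^esub> ar R (k \<cdot>\<^bsub>C\<^esub> g)" by (simp add: k(5) R.ar_Comp)
  also have "ar I (\<epsilon>r z \<cdot>\<^bsub>D\<^esub> ar R (k \<cdot>\<^bsub>C\<^esub> g)) \<cdot>\<^bsub>C\<^esub> \<eta>r w = k \<cdot>\<^bsub>C\<^esub> g"
    by (rule right_transpose_unique[symmetric]) simp_all
  finally show ?thesis by (rule C.iso_cancel_left[OF k(3,4) f])
qed

lemma induced_counique:
  assumes a: "induced b z e n" and f: "hom_type C f = Some (b, w)" "hom_type C g = Some (b, w)"
    and eq: "ar R f \<cdot>\<^bsub>D\<^esub> n = ar R g \<cdot>\<^bsub>D\<^esub> n"
  shows "f = g"
proof -
  obtain k where k: "z \<in> Obj D" "b \<in> Obj C" "iso_arr C k" "hom_type C k = Some (b, ob I z)"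
    "hom_type D n = Some (z, ob R b)" "ar R k \<cdot>\<^bsub>D\<^esub> n = \<eta>l z" using a by (elim inducedE)
  note [simp] = k(1-5) f C.Obj_of_type[OF f(1)]
  have n: "ar R (inv_arr C k) \<cdot>\<^bsub>D\<^esub> \<eta>l z = n"
    unfolding k(6)[symmetric] by (simp add: R.ar_inv_arr)
  have i: "iso_arr C (inv_arr C k)" "hom_type C (inv_arr C k) = Some (ob I z, b)" by simp_all
  have "f \<cdot>\<^bsub>C\<^esub> inv_arr C k = \<epsilon>l w \<cdot>\<^bsub>C\<^esub> ar I (ar R (f \<cdot>\<^bsub>C\<^esub> inv_arr C k) \<cdot>\<^bsub>D\<^esub> \<eta>l z)"
    by (rule left_transpose_unique) simp_all
  also have "ar R (f \<cdot>\<^bsub>C\<^esub> inv_arr C k) \<cdot>\<^bsub>D\<^esub> \<eta>l z = ar R f \<cdot>\<^bsub>D\<^esub> n"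
    unfolding n[symmetric] by (simp add: R.ar_Comp)
  also have "\<dots> = ar R g \<cdot>\<^bsub>D\<^esub> n" by (rule eq)
  also have "\<dots> = ar R (g \<cdot>\<^bsub>C\<^esub> inv_arr C k) \<cdot>\<^bsub>D\<^esub> \<eta>l z"
    unfolding n[symmetric] by (simp add: R.ar_Comp)
  also have "\<epsilon>l w \<cdot>\<^bsub>C\<^esub> ar I (ar R (g \<cdot>\<^bsub>C\<^esub> inv_arr C k) \<cdot>\<^bsub>D\<^esub> \<eta>l z) = g \<cdot>\<^bsub>C\<^esub> inv_arr C k"
    by (rule left_transpose_unique[symmetric]) simp_all
  finally show ?thesis by (rule C.iso_cancel_right[OF i f])
qed

text \<open>Since the two identifications with \<open>I\<close> agree, an arrow between induced objects that comes from
  \<open>h\<close> by one of the two universal properties also comes from \<open>h\<close> by the other one.\<close>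

lemma induced_transfer:
  assumes a: "induced b z e n" and a': "induced b' z' e' n'"
    and f: "hom_type C f = Some (b, b')" and h: "hom_type D h = Some (z, z')"
    and eq: "e' \<cdot>\<^bsub>D\<^esub> ar R f = h \<cdot>\<^bsub>D\<^esub> e"
  shows "ar R f \<cdot>\<^bsub>D\<^esub> n = n' \<cdot>\<^bsub>D\<^esub> h"
proof -
  obtain k where k: "z \<in> Obj D" "b \<in> Obj C" "iso_arr C k" "hom_type C k = Some (b, ob I z)"
    "hom_type D n = Some (z, ob R b)" "e = \<epsilon>r z \<cdot>\<^bsub>D\<^esub> ar R k" "ar R k \<cdot>\<^bsub>D\<^esub> n = \<eta>l z"
    using a by (elim inducedE)
  obtain k' where k': "z' \<in> Obj D" "b' \<in> Obj C" "iso_arr C k'" "hom_type C k' = Some (b', ob I z')"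
    "hom_type D n' = Some (z', ob R b')" "e' = \<epsilon>r z' \<cdot>\<^bsub>D\<^esub> ar R k'" "ar R k' \<cdot>\<^bsub>D\<^esub> n' = \<eta>l z'"
    using a' by (elim inducedE)
  note [simp] = k(1-5) k'(1-5) f h
  have kf: "k' \<cdot>\<^bsub>C\<^esub> f = ar I h \<cdot>\<^bsub>C\<^esub> k"
  proof (rule induced_unique[OF induced_I[OF k'(1)]])
    have "\<epsilon>r z' \<cdot>\<^bsub>D\<^esub> ar R (k' \<cdot>\<^bsub>C\<^esub> f) = h \<cdot>\<^bsub>D\<^esub> e"
      using eq by (simp add: k' R.ar_Comp)
    also have "\<dots> = (h \<cdot>\<^bsub>D\<^esub> \<epsilon>r z) \<cdot>\<^bsub>D\<^esub> ar R k" by (simp add: k(6))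
    also have "\<dots> = (\<epsilon>r z' \<cdot>\<^bsub>D\<^esub> ar R (ar I h)) \<cdot>\<^bsub>D\<^esub> ar R k" by (simp only: unit_naturality(4)[OF h])
    also have "\<dots> = \<epsilon>r z' \<cdot>\<^bsub>D\<^esub> ar R (ar I h \<cdot>\<^bsub>C\<^esub> k)" by (simp add: R.ar_Comp)
    finally show "\<epsilon>r z' \<cdot>\<^bsub>D\<^esub> ar R (k' \<cdot>\<^bsub>C\<^esub> f) = \<epsilon>r z' \<cdot>\<^bsub>D\<^esub> ar R (ar I h \<cdot>\<^bsub>C\<^esub> k)" .
  qed simp_all
  show ?thesis
  proof (rule D.iso_cancel_left[of "ar R k'"])
    have "ar R k' \<cdot>\<^bsub>D\<^esub> ar R f \<cdot>\<^bsub>D\<^esub> n = ar R (k' \<cdot>\<^bsub>C\<^esub> f) \<cdot>\<^bsub>D\<^esub> n" by (simp add: R.ar_Comp)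
    also have "\<dots> = ar R (ar I h) \<cdot>\<^bsub>D\<^esub> ar R k \<cdot>\<^bsub>D\<^esub> n" unfolding kf by (simp add: R.ar_Comp)
    also have "\<dots> = \<eta>l z' \<cdot>\<^bsub>D\<^esub> h" unfolding k(7) by (simp add: unit_naturality(1)[OF h])
    also have "\<dots> = (ar R k' \<cdot>\<^bsub>D\<^esub> n') \<cdot>\<^bsub>D\<^esub> h" unfolding k'(7) ..
    also have "\<dots> = ar R k' \<cdot>\<^bsub>D\<^esub> n' \<cdot>\<^bsub>D\<^esub> h" by simp
    finally show "ar R k' \<cdot>\<^bsub>D\<^esub> ar R f \<cdot>\<^bsub>D\<^esub> n = ar R k' \<cdot>\<^bsub>D\<^esub> n' \<cdot>\<^bsub>D\<^esub> h" .
  qed simp_all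
qed

lemma induced_transfer_converse:
  assumes a: "induced b z e n" and a': "induced b' z' e' n'"
    and f: "hom_type C f = Some (b, b')" and h: "hom_type D h = Some (z, z')"
    and eq: "ar R f \<cdot>\<^bsub>D\<^esub> n = n' \<cdot>\<^bsub>D\<^esub> h"
  shows "e' \<cdot>\<^bsub>D\<^esub> ar R f = h \<cdot>\<^bsub>D\<^esub> e"
proof -
  have "hom_type D (h \<cdot>\<^bsub>D\<^esub> e) = Some (ob R b, z')"
    using h induced_type[OF a] by simp
  then obtain g where g: "hom_type C g = Some (b, b')" "e' \<cdot>\<^bsub>D\<^esub> ar R g = h \<cdot>\<^bsub>D\<^esub> e"
    using induced_lift[OF a' induced_type(2)[OF a]] by metis
  have "ar R g \<cdot>\<^bsub>D\<^esub> n = ar R f \<cdot>\<^bsub>D\<^esub> n"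
    unfolding eq by (rule induced_transfer[OF a a' g(1) h g(2)])
  then have "g = f" by (rule induced_counique[OF a g(1) f])
  then show ?thesis using g(2) by simp
qed

lemma induced_iso:
  assumes a: "induced b z e n" and a': "induced b' z' e' n'"
    and f: "hom_type C f = Some (b, b')" and h: "hom_type D h = Some (z, z')" "iso_arr D h"
    and eq: "e' \<cdot>\<^bsub>D\<^esub> ar R f = h \<cdot>\<^bsub>D\<^esub> e"
  shows "iso_arr C f"
proof -
  note [simp] = induced_type[OF a] induced_type[OF a'] f h
  obtain g where g [simp]: "hom_type C g = Some (b', b)" and e: "e \<cdot>\<^bsub>D\<^esub> ar R g = inv_arr D h \<cdot>\<^bsub>D\<^esub> e'"
    using induced_lift[OF a, of b' "inv_arr D h \<cdot>\<^bsub>D\<^esub> e'"] by auto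
  have "e \<cdot>\<^bsub>D\<^esub> ar R (g \<cdot>\<^bsub>C\<^esub> f) = (e \<cdot>\<^bsub>D\<^esub> ar R g) \<cdot>\<^bsub>D\<^esub> ar R f" by (simp add: R.ar_Comp)
  also have "\<dots> = inv_arr D h \<cdot>\<^bsub>D\<^esub> e' \<cdot>\<^bsub>D\<^esub> ar R f" unfolding e by simp
  also have "\<dots> = e \<cdot>\<^bsub>D\<^esub> ar R (Idn C b)" unfolding eq by simp
  finally have gf: "g \<cdot>\<^bsub>C\<^esub> f = Idn C b"
    by (rule induced_unique[OF a, rotated -1]) simp_all
  have "e' \<cdot>\<^bsub>D\<^esub> ar R (f \<cdot>\<^bsub>C\<^esub> g) = (e' \<cdot>\<^bsub>D\<^esub> ar R f) \<cdot>\<^bsub>D\<^esub> ar R g" by (simp add: R.ar_Comp)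
  also have "\<dots> = h \<cdot>\<^bsub>D\<^esub> e \<cdot>\<^bsub>D\<^esub> ar R g" unfolding eq by simp
  also have "\<dots> = e' \<cdot>\<^bsub>D\<^esub> ar R (Idn C b')" unfolding e by simp
  finally have fg: "f \<cdot>\<^bsub>C\<^esub> g = Idn C b'"
    by (rule induced_unique[OF a', rotated -1]) simp_all
  show ?thesis using gf fg by (rule C.iso_arrI[OF f g])
qed

end

section \<open>Pairings along a strong monoidal functor\<close>

context strong_monoidal_functor
begin

lemma mult_simps [simp]:
  assumes "x \<in> Obj C" "y \<in> Obj C"
  shows "hom_type D (\<phi> x y) = Some (ob F x \<otimes>\<^bsub>T\<^esub> ob F y, ob F (x \<otimes>\<^bsub>S\<^esub> y))" "iso_arr D (\<phi> x y)"
  using mult_closed[OF assms] mult_iso[OF assms] by auto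

lemma munit_simps [simp]:
  "hom_type D \<phi>0 = Some (Unit T, ob F (Unit S))" "iso_arr D \<phi>0"
  using munit_closed munit_iso by auto

text \<open>The product of \<open>x : F b \<rightarrow> z\<close> and \<open>y : F c \<rightarrow> w\<close>, as an arrow \<open>F (b \<otimes> c) \<rightarrow> z \<otimes> w\<close>, and the
  product of \<open>x : z \<rightarrow> F b\<close> and \<open>y : w \<rightarrow> F c\<close>, as an arrow \<open>z \<otimes> w \<rightarrow> F (b \<otimes> c)\<close>. They are the
  tensor products of the comma categories of \<open>F\<close>.\<close>

definition pair :: "'o \<Rightarrow> 'o \<Rightarrow> 'n \<Rightarrow> 'n \<Rightarrow> 'n" where
  "pair b c x y = (x \<odot>\<^bsub>T\<^esub> y) \<cdot>\<^bsub>D\<^esub> inv_arr D (\<phi> b c)"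

definition copair :: "'o \<Rightarrow> 'o \<Rightarrow> 'n \<Rightarrow> 'n \<Rightarrow> 'n" where
  "copair b c x y = \<phi> b c \<cdot>\<^bsub>D\<^esub> (x \<odot>\<^bsub>T\<^esub> y)"

lemma type_pair [simp]:
  "\<lbrakk>b \<in> Obj C; c \<in> Obj C; hom_type D x = r; hom_type D y = s; r \<noteq> None; s \<noteq> None;
    source_of r = ob F b; source_of s = ob F c\<rbrakk>
    \<Longrightarrow> hom_type D (pair b c x y) = Some (ob F (b \<otimes>\<^bsub>S\<^esub> c), target_of r \<otimes>\<^bsub>T\<^esub> target_of s)"
  by (simp add: pair_def)

lemma type_copair [simp]:
  "\<lbrakk>b \<in> Obj C; c \<in> Obj C; hom_type D x = r; hom_type D y = s; r \<noteq> None; s \<noteq> None;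
    target_of r = ob F b; target_of s = ob F c\<rbrakk>
    \<Longrightarrow> hom_type D (copair b c x y) = Some (source_of r \<otimes>\<^bsub>T\<^esub> source_of s, ob F (b \<otimes>\<^bsub>S\<^esub> c))"
  by (simp add: copair_def)

lemma inv_mult_natural:
  assumes f: "hom_type C f = Some (b, b')" and g: "hom_type C g = Some (c, c')"
  shows "inv_arr D (\<phi> b' c') \<cdot>\<^bsub>D\<^esub> ar F (f \<odot>\<^bsub>S\<^esub> g) = (ar F f \<odot>\<^bsub>T\<^esub> ar F g) \<cdot>\<^bsub>D\<^esub> inv_arr D (\<phi> b c)"
proof -
  note [simp] = f g source.Obj_of_type[OF f] source.Obj_of_type[OF g]
  have "inv_arr D (\<phi> b' c') \<cdot>\<^bsub>D\<^esub> (ar F (f \<odot>\<^bsub>S\<^esub> g) \<cdot>\<^bsub>D\<^esub> \<phi> b c) \<cdot>\<^bsub>D\<^esub> inv_arr D (\<phi> b c)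
      = inv_arr D (\<phi> b' c') \<cdot>\<^bsub>D\<^esub> (\<phi> b' c' \<cdot>\<^bsub>D\<^esub> (ar F f \<odot>\<^bsub>T\<^esub> ar F g)) \<cdot>\<^bsub>D\<^esub> inv_arr D (\<phi> b c)"
    using mult_natural[of f b b' g c c'] by simp
  then show ?thesis by simp
qed

lemma pair_ar:
  assumes "hom_type C f = r" "r \<noteq> None" "target_of r = b'" "hom_type C g = s" "s \<noteq> None" "target_of s = c'"
    and "hom_type D x = t" "t \<noteq> None" "source_of t = ob F b'" "hom_type D y = u" "u \<noteq> None" "source_of u = ob F c'"
  shows "pair b' c' x y \<cdot>\<^bsub>D\<^esub> ar F (f \<odot>\<^bsub>S\<^esub> g) = pair (source_of r) (source_of s) (x \<cdot>\<^bsub>D\<^esub> ar F f) (y \<cdot>\<^bsub>D\<^esub> ar F g)"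
proof -
  obtain b c where r: "r = Some (b, b')" "s = Some (c, c')" using assms by (cases r; cases s) auto
  obtain z w where t: "t = Some (ob F b', z)" "u = Some (ob F c', w)" using assms by (cases t; cases u) auto
  have f: "hom_type C f = Some (b, b')" and g: "hom_type C g = Some (c, c')" using assms r by auto
  have x: "hom_type D x = Some (ob F b', z)" "hom_type D y = Some (ob F c', w)" using assms t by auto
  note [simp] = f g x source.Obj_of_type[OF f] source.Obj_of_type[OF g] inv_mult_natural[OF f g]
  show ?thesis by (simp add: r pair_def target.tar_merge)
qed

lemma copair_ar:
  assumes "hom_type C f = r" "r \<noteq> None" "source_of r = b" "hom_type C g = s" "s \<noteq> None" "source_of s = c"
    and "hom_type D x = t" "t \<noteq> None" "target_of t = ob F b" "hom_type D y = u" "u \<noteq> None" "target_of u = ob F c"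
  shows "ar F (f \<odot>\<^bsub>S\<^esub> g) \<cdot>\<^bsub>D\<^esub> copair b c x y = copair (target_of r) (target_of s) (ar F f \<cdot>\<^bsub>D\<^esub> x) (ar F g \<cdot>\<^bsub>D\<^esub> y)"
proof -
  obtain b' c' where r: "r = Some (b, b')" "s = Some (c, c')" using assms by (cases r; cases s) auto
  obtain z w where t: "t = Some (z, ob F b)" "u = Some (w, ob F c)" using assms by (cases t; cases u) auto
  have f: "hom_type C f = Some (b, b')" and g: "hom_type C g = Some (c, c')" using assms r by auto
  have x: "hom_type D x = Some (z, ob F b)" "hom_type D y = Some (w, ob F c)" using assms t by auto
  note [simp] = f g x source.Obj_of_type[OF f] source.Obj_of_type[OF g]
  have "ar F (f \<odot>\<^bsub>S\<^esub> g) \<cdot>\<^bsub>D\<^esub> copair b c x y = (ar F (f \<odot>\<^bsub>S\<^esub> g) \<cdot>\<^bsub>D\<^esub> \<phi> b c) \<cdot>\<^bsub>D\<^esub> (x \<odot>\<^bsub>T\<^esub> y)"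
    by (simp add: copair_def)
  also have "\<dots> = (\<phi> b' c' \<cdot>\<^bsub>D\<^esub> (ar F f \<odot>\<^bsub>T\<^esub> ar F g)) \<cdot>\<^bsub>D\<^esub> (x \<odot>\<^bsub>T\<^esub> y)"
    using mult_natural[of f b b' g c c'] by simp
  finally show ?thesis by (simp add: r copair_def target.tar_merge)
qed

lemma pair_Comp:
  assumes "b \<in> Obj C" "c \<in> Obj C" "hom_type D x = r" "hom_type D y = s" "source_of r = ob F b" "source_of s = ob F c"
    and "hom_type D h = t" "composable r t" "hom_type D k = u" "composable s u"
  shows "pair b c (h \<cdot>\<^bsub>D\<^esub> x) (k \<cdot>\<^bsub>D\<^esub> y) = (h \<odot>\<^bsub>T\<^esub> k) \<cdot>\<^bsub>D\<^esub> pair b c x y"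
  using assms by (auto elim!: composableE simp: pair_def target.tar_merge)

lemma pair_Assoc:
  assumes bcd: "b \<in> Obj C" "c \<in> Obj C" "d \<in> Obj C"
    and "hom_type D x = r" "hom_type D y = s" "hom_type D z = t" "r \<noteq> None" "s \<noteq> None" "t \<noteq> None"
    "source_of r = ob F b" "source_of s = ob F c" "source_of t = ob F d"
  shows "pair b (c \<otimes>\<^bsub>S\<^esub> d) x (pair c d y z) \<cdot>\<^bsub>D\<^esub> ar F (Assoc S b c d)
    = Assoc T (target_of r) (target_of s) (target_of t) \<cdot>\<^bsub>D\<^esub> pair (b \<otimes>\<^bsub>S\<^esub> c) d (pair b c x y) z"
proof -
  obtain b' c' d' where r: "r = Some (ob F b, b')" "s = Some (ob F c, c')" "t = Some (ob F d, d')"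
    using assms by (cases r; cases s; cases t) auto
  have x: "hom_type D x = Some (ob F b, b')" and y: "hom_type D y = Some (ob F c, c')"
    and z: "hom_type D z = Some (ob F d, d')" using assms r by auto
  note [simp] = bcd x y z target.Obj_of_type[OF x] target.Obj_of_type[OF y] target.Obj_of_type[OF z]
  let ?B = "ob F b" let ?C = "ob F c" let ?D = "ob F d"
  let ?m = "\<phi> (b \<otimes>\<^bsub>S\<^esub> c) d \<cdot>\<^bsub>D\<^esub> (\<phi> b c \<odot>\<^bsub>T\<^esub> Idn D ?D)"
  let ?n = "\<phi> b (c \<otimes>\<^bsub>S\<^esub> d) \<cdot>\<^bsub>D\<^esub> (Idn D ?B \<odot>\<^bsub>T\<^esub> \<phi> c d)"
  have m: "iso_arr D ?m" "hom_type D ?m = Some ((?B \<otimes>\<^bsub>T\<^esub> ?C) \<otimes>\<^bsub>T\<^esub> ?D, ob F ((b \<otimes>\<^bsub>S\<^esub> c) \<otimes>\<^bsub>S\<^esub> d))"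
    by simp_all
  have n: "iso_arr D ?n" "hom_type D ?n = Some (?B \<otimes>\<^bsub>T\<^esub> (?C \<otimes>\<^bsub>T\<^esub> ?D), ob F (b \<otimes>\<^bsub>S\<^esub> (c \<otimes>\<^bsub>S\<^esub> d)))"
    by simp_all
  have nm: "inv_arr D ?n \<cdot>\<^bsub>D\<^esub> ar F (Assoc S b c d) = Assoc T ?B ?C ?D \<cdot>\<^bsub>D\<^esub> inv_arr D ?m"
  proof -
    have "inv_arr D ?n \<cdot>\<^bsub>D\<^esub> (ar F (Assoc S b c d) \<cdot>\<^bsub>D\<^esub> ?m) \<cdot>\<^bsub>D\<^esub> inv_arr D ?m
        = inv_arr D ?n \<cdot>\<^bsub>D\<^esub> (?n \<cdot>\<^bsub>D\<^esub> Assoc T ?B ?C ?D) \<cdot>\<^bsub>D\<^esub> inv_arr D ?m"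
      using mult_assoc[OF bcd] by simp
    moreover have "(ar F (Assoc S b c d) \<cdot>\<^bsub>D\<^esub> ?m) \<cdot>\<^bsub>D\<^esub> inv_arr D ?m = ar F (Assoc S b c d)"
      by (simp add: target.inv_arr_Comp target.tar_inv_arr target.tar_merge)
    moreover have "inv_arr D ?n \<cdot>\<^bsub>D\<^esub> (?n \<cdot>\<^bsub>D\<^esub> Assoc T ?B ?C ?D) \<cdot>\<^bsub>D\<^esub> inv_arr D ?m
        = Assoc T ?B ?C ?D \<cdot>\<^bsub>D\<^esub> inv_arr D ?m"
      by (simp add: target.inv_arr_Comp target.tar_inv_arr target.tar_merge)
    ultimately show ?thesis by simp
  qed
  have invm: "inv_arr D ?m = (inv_arr D (\<phi> b c) \<odot>\<^bsub>T\<^esub> Idn D ?D) \<cdot>\<^bsub>D\<^esub> inv_arr D (\<phi> (b \<otimes>\<^bsub>S\<^esub> c) d)"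
    and invn: "inv_arr D ?n = (Idn D ?B \<odot>\<^bsub>T\<^esub> inv_arr D (\<phi> c d)) \<cdot>\<^bsub>D\<^esub> inv_arr D (\<phi> b (c \<otimes>\<^bsub>S\<^esub> d))"
    by (simp_all add: target.inv_arr_Comp target.tar_inv_arr)
  have "pair b (c \<otimes>\<^bsub>S\<^esub> d) x (pair c d y z) = (x \<odot>\<^bsub>T\<^esub> (y \<odot>\<^bsub>T\<^esub> z)) \<cdot>\<^bsub>D\<^esub> inv_arr D ?n"
    unfolding invn by (simp add: pair_def target.tar_merge)
  then have "pair b (c \<otimes>\<^bsub>S\<^esub> d) x (pair c d y z) \<cdot>\<^bsub>D\<^esub> ar F (Assoc S b c d)
      = (x \<odot>\<^bsub>T\<^esub> (y \<odot>\<^bsub>T\<^esub> z)) \<cdot>\<^bsub>D\<^esub> (inv_arr D ?n \<cdot>\<^bsub>D\<^esub> ar F (Assoc S b c d))"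
    using m n by simp
  also have "\<dots> = ((x \<odot>\<^bsub>T\<^esub> (y \<odot>\<^bsub>T\<^esub> z)) \<cdot>\<^bsub>D\<^esub> Assoc T ?B ?C ?D) \<cdot>\<^bsub>D\<^esub> inv_arr D ?m"
    unfolding nm using m by simp
  also have "\<dots> = (Assoc T b' c' d' \<cdot>\<^bsub>D\<^esub> ((x \<odot>\<^bsub>T\<^esub> y) \<odot>\<^bsub>T\<^esub> z)) \<cdot>\<^bsub>D\<^esub> inv_arr D ?m"
    using target.assoc_natural[of x ?B b' y ?C c' z ?D d'] by simp
  also have "\<dots> = Assoc T b' c' d' \<cdot>\<^bsub>D\<^esub> pair (b \<otimes>\<^bsub>S\<^esub> c) d (pair b c x y) z"
    unfolding invm by (simp add: pair_def target.tar_merge)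
  finally show ?thesis by (simp add: r)
qed

lemma copair_Assoc:
  assumes bcd: "b \<in> Obj C" "c \<in> Obj C" "d \<in> Obj C"
    and "hom_type D x = r" "hom_type D y = s" "hom_type D z = t" "r \<noteq> None" "s \<noteq> None" "t \<noteq> None"
    "target_of r = ob F b" "target_of s = ob F c" "target_of t = ob F d"
  shows "ar F (Assoc S b c d) \<cdot>\<^bsub>D\<^esub> copair (b \<otimes>\<^bsub>S\<^esub> c) d (copair b c x y) z
    = copair b (c \<otimes>\<^bsub>S\<^esub> d) x (copair c d y z) \<cdot>\<^bsub>D\<^esub> Assoc T (source_of r) (source_of s) (source_of t)"
proof -
  obtain b' c' d' where r: "r = Some (b', ob F b)" "s = Some (c', ob F c)" "t = Some (d', ob F d)"
    using assms by (cases r; cases s; cases t) auto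
  have x: "hom_type D x = Some (b', ob F b)" and y: "hom_type D y = Some (c', ob F c)"
    and z: "hom_type D z = Some (d', ob F d)" using assms r by auto
  note [simp] = bcd x y z target.Obj_of_type[OF x] target.Obj_of_type[OF y] target.Obj_of_type[OF z]
  let ?B = "ob F b" let ?C = "ob F c" let ?D = "ob F d"
  have "copair (b \<otimes>\<^bsub>S\<^esub> c) d (copair b c x y) z
      = \<phi> (b \<otimes>\<^bsub>S\<^esub> c) d \<cdot>\<^bsub>D\<^esub> (\<phi> b c \<odot>\<^bsub>T\<^esub> Idn D ?D) \<cdot>\<^bsub>D\<^esub> ((x \<odot>\<^bsub>T\<^esub> y) \<odot>\<^bsub>T\<^esub> z)"
    by (simp add: copair_def target.tar_merge)
  then have "ar F (Assoc S b c d) \<cdot>\<^bsub>D\<^esub> copair (b \<otimes>\<^bsub>S\<^esub> c) d (copair b c x y) z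
      = (ar F (Assoc S b c d) \<cdot>\<^bsub>D\<^esub> \<phi> (b \<otimes>\<^bsub>S\<^esub> c) d \<cdot>\<^bsub>D\<^esub> (\<phi> b c \<odot>\<^bsub>T\<^esub> Idn D ?D)) \<cdot>\<^bsub>D\<^esub> ((x \<odot>\<^bsub>T\<^esub> y) \<odot>\<^bsub>T\<^esub> z)"
    by simp
  also have "\<dots> = \<phi> b (c \<otimes>\<^bsub>S\<^esub> d) \<cdot>\<^bsub>D\<^esub> (Idn D ?B \<odot>\<^bsub>T\<^esub> \<phi> c d) \<cdot>\<^bsub>D\<^esub> (Assoc T ?B ?C ?D \<cdot>\<^bsub>D\<^esub> ((x \<odot>\<^bsub>T\<^esub> y) \<odot>\<^bsub>T\<^esub> z))"
    using mult_assoc[OF bcd] by simp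
  also have "Assoc T ?B ?C ?D \<cdot>\<^bsub>D\<^esub> ((x \<odot>\<^bsub>T\<^esub> y) \<odot>\<^bsub>T\<^esub> z) = (x \<odot>\<^bsub>T\<^esub> (y \<odot>\<^bsub>T\<^esub> z)) \<cdot>\<^bsub>D\<^esub> Assoc T b' c' d'"
    using target.assoc_natural[of x b' ?B y c' ?C z d' ?D] by simp
  also have "\<phi> b (c \<otimes>\<^bsub>S\<^esub> d) \<cdot>\<^bsub>D\<^esub> (Idn D ?B \<odot>\<^bsub>T\<^esub> \<phi> c d) \<cdot>\<^bsub>D\<^esub> (x \<odot>\<^bsub>T\<^esub> (y \<odot>\<^bsub>T\<^esub> z)) \<cdot>\<^bsub>D\<^esub> Assoc T b' c' d'
      = copair b (c \<otimes>\<^bsub>S\<^esub> d) x (copair c d y z) \<cdot>\<^bsub>D\<^esub> Assoc T b' c' d'"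
    by (simp add: copair_def target.tar_merge)
  finally show ?thesis by (simp add: r)
qed

lemma pair_unit:
  assumes b: "b \<in> Obj C" and x: "hom_type D x = Some (ob F b, z)"
  shows "LUnit T z \<cdot>\<^bsub>D\<^esub> pair (Unit S) b (inv_arr D \<phi>0) x = x \<cdot>\<^bsub>D\<^esub> ar F (LUnit S b)"
    and "RUnit T z \<cdot>\<^bsub>D\<^esub> pair b (Unit S) x (inv_arr D \<phi>0) = x \<cdot>\<^bsub>D\<^esub> ar F (RUnit S b)"
proof -
  note [simp] = b x target.Obj_of_type[OF x]
  have "LUnit T z \<cdot>\<^bsub>D\<^esub> pair (Unit S) b (inv_arr D \<phi>0) x
      = (LUnit T z \<cdot>\<^bsub>D\<^esub> (Idn D (Unit T) \<odot>\<^bsub>T\<^esub> x)) \<cdot>\<^bsub>D\<^esub> (inv_arr D \<phi>0 \<odot>\<^bsub>T\<^esub> Idn D (ob F b)) \<cdot>\<^bsub>D\<^esub> inv_arr D (\<phi> (Unit S) b)"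
    by (simp add: pair_def target.tar_merge)
  also have "\<dots> = (x \<cdot>\<^bsub>D\<^esub> LUnit T (ob F b)) \<cdot>\<^bsub>D\<^esub> (inv_arr D \<phi>0 \<odot>\<^bsub>T\<^esub> Idn D (ob F b)) \<cdot>\<^bsub>D\<^esub> inv_arr D (\<phi> (Unit S) b)"
    using target.lunit_natural[of x "ob F b" z] by simp
  also have "\<dots> = x \<cdot>\<^bsub>D\<^esub> ar F (LUnit S b)"
    unfolding mult_lunit[OF b, symmetric] by (simp add: target.tar_merge)
  finally show "LUnit T z \<cdot>\<^bsub>D\<^esub> pair (Unit S) b (inv_arr D \<phi>0) x = x \<cdot>\<^bsub>D\<^esub> ar F (LUnit S b)" .
  have "RUnit T z \<cdot>\<^bsub>D\<^esub> pair b (Unit S) x (inv_arr D \<phi>0)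
      = (RUnit T z \<cdot>\<^bsub>D\<^esub> (x \<odot>\<^bsub>T\<^esub> Idn D (Unit T))) \<cdot>\<^bsub>D\<^esub> (Idn D (ob F b) \<odot>\<^bsub>T\<^esub> inv_arr D \<phi>0) \<cdot>\<^bsub>D\<^esub> inv_arr D (\<phi> b (Unit S))"
    by (simp add: pair_def target.tar_merge)
  also have "\<dots> = (x \<cdot>\<^bsub>D\<^esub> RUnit T (ob F b)) \<cdot>\<^bsub>D\<^esub> (Idn D (ob F b) \<odot>\<^bsub>T\<^esub> inv_arr D \<phi>0) \<cdot>\<^bsub>D\<^esub> inv_arr D (\<phi> b (Unit S))"
    using target.runit_natural[of x "ob F b" z] by simp
  also have "\<dots> = x \<cdot>\<^bsub>D\<^esub> ar F (RUnit S b)"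
    unfolding mult_runit[OF b, symmetric] by (simp add: target.tar_merge)
  finally show "RUnit T z \<cdot>\<^bsub>D\<^esub> pair b (Unit S) x (inv_arr D \<phi>0) = x \<cdot>\<^bsub>D\<^esub> ar F (RUnit S b)" .
qed

lemma copair_unit:
  assumes b: "b \<in> Obj C" and x: "hom_type D x = Some (z, ob F b)"
  shows "ar F (LUnit S b) \<cdot>\<^bsub>D\<^esub> copair (Unit S) b \<phi>0 x = x \<cdot>\<^bsub>D\<^esub> LUnit T z"
    and "ar F (RUnit S b) \<cdot>\<^bsub>D\<^esub> copair b (Unit S) x \<phi>0 = x \<cdot>\<^bsub>D\<^esub> RUnit T z"
proof -
  note [simp] = b x target.Obj_of_type[OF x]
  have "ar F (LUnit S b) \<cdot>\<^bsub>D\<^esub> copair (Unit S) b \<phi>0 x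
      = (ar F (LUnit S b) \<cdot>\<^bsub>D\<^esub> \<phi> (Unit S) b \<cdot>\<^bsub>D\<^esub> (\<phi>0 \<odot>\<^bsub>T\<^esub> Idn D (ob F b))) \<cdot>\<^bsub>D\<^esub> (Idn D (Unit T) \<odot>\<^bsub>T\<^esub> x)"
    by (simp add: copair_def target.tar_merge)
  also have "\<dots> = x \<cdot>\<^bsub>D\<^esub> LUnit T z"
    unfolding mult_lunit[OF b] using target.lunit_natural[of x z "ob F b"] by simp
  finally show "ar F (LUnit S b) \<cdot>\<^bsub>D\<^esub> copair (Unit S) b \<phi>0 x = x \<cdot>\<^bsub>D\<^esub> LUnit T z" .
  have "ar F (RUnit S b) \<cdot>\<^bsub>D\<^esub> copair b (Unit S) x \<phi>0
      = (ar F (RUnit S b) \<cdot>\<^bsub>D\<^esub> \<phi> b (Unit S) \<cdot>\<^bsub>D\<^esub> (Idn D (ob F b) \<odot>\<^bsub>T\<^esub> \<phi>0)) \<cdot>\<^bsub>D\<^esub> (x \<odot>\<^bsub>T\<^esub> Idn D (Unit T))"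
    by (simp add: copair_def target.tar_merge)
  also have "\<dots> = x \<cdot>\<^bsub>D\<^esub> RUnit T z"
    unfolding mult_runit[OF b] using target.runit_natural[of x z "ob F b"] by simp
  finally show "ar F (RUnit S b) \<cdot>\<^bsub>D\<^esub> copair b (Unit S) x \<phi>0 = x \<cdot>\<^bsub>D\<^esub> RUnit T z" .
qed

lemma pair_Idn: "\<lbrakk>b \<in> Obj C; c \<in> Obj C\<rbrakk> \<Longrightarrow> pair b c (Idn D (ob F b)) (Idn D (ob F c)) = inv_arr D (\<phi> b c)"
  by (simp add: pair_def)

end

context strong_monoidal_functor
begin

text \<open>As composites are kept associated to the right, every rule for a composite of two arrows is needed a
  second time, with a further factor \<open>k\<close> behind it.\<close>

lemma pair_ar_Comp:
  assumes "hom_type C f = r" "r \<noteq> None" "target_of r = b'" "hom_type C g = s" "s \<noteq> None" "target_of s = c'"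
    and "hom_type D x = t" "t \<noteq> None" "source_of t = ob F b'" "hom_type D y = u" "u \<noteq> None" "source_of u = ob F c'"
    and "hom_type D k = v" "v \<noteq> None" "target_of v = ob F (source_of r \<otimes>\<^bsub>S\<^esub> source_of s)"
  shows "pair b' c' x y \<cdot>\<^bsub>D\<^esub> ar F (f \<odot>\<^bsub>S\<^esub> g) \<cdot>\<^bsub>D\<^esub> k
    = pair (source_of r) (source_of s) (x \<cdot>\<^bsub>D\<^esub> ar F f) (y \<cdot>\<^bsub>D\<^esub> ar F g) \<cdot>\<^bsub>D\<^esub> k"
proof -
  obtain b c where r: "r = Some (b, b')" "s = Some (c, c')" using assms by (cases r; cases s) auto
  obtain z w where t: "t = Some (ob F b', z)" "u = Some (ob F c', w)" using assms by (cases t; cases u) auto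
  obtain q where q: "v = Some (q, ob F (b \<otimes>\<^bsub>S\<^esub> c))" using assms by (cases v) (auto simp: r)
  have f: "hom_type C f = Some (b, b')" and g: "hom_type C g = Some (c, c')" using assms r by auto
  have x: "hom_type D x = Some (ob F b', z)" "hom_type D y = Some (ob F c', w)" using assms t by auto
  have k: "hom_type D k = Some (q, ob F (b \<otimes>\<^bsub>S\<^esub> c))" using assms q by auto
  note [simp] = f g x k source.Obj_of_type[OF f] source.Obj_of_type[OF g]
  have "(pair b' c' x y \<cdot>\<^bsub>D\<^esub> ar F (f \<odot>\<^bsub>S\<^esub> g)) \<cdot>\<^bsub>D\<^esub> k
      = pair (source_of r) (source_of s) (x \<cdot>\<^bsub>D\<^esub> ar F f) (y \<cdot>\<^bsub>D\<^esub> ar F g) \<cdot>\<^bsub>D\<^esub> k"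
    by (simp only: pair_ar[OF assms(1-12)])
  then show ?thesis by simp
qed

lemma pair_Assoc_Comp:
  assumes bcd: "b \<in> Obj C" "c \<in> Obj C" "d \<in> Obj C"
    and "hom_type D x = r" "hom_type D y = s" "hom_type D z = t" "r \<noteq> None" "s \<noteq> None" "t \<noteq> None"
    "source_of r = ob F b" "source_of s = ob F c" "source_of t = ob F d"
    and "hom_type D k = v" "v \<noteq> None" "target_of v = ob F ((b \<otimes>\<^bsub>S\<^esub> c) \<otimes>\<^bsub>S\<^esub> d)"
  shows "pair b (c \<otimes>\<^bsub>S\<^esub> d) x (pair c d y z) \<cdot>\<^bsub>D\<^esub> ar F (Assoc S b c d) \<cdot>\<^bsub>D\<^esub> k
    = Assoc T (target_of r) (target_of s) (target_of t) \<cdot>\<^bsub>D\<^esub> pair (b \<otimes>\<^bsub>S\<^esub> c) d (pair b c x y) z \<cdot>\<^bsub>D\<^esub> k"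
proof -
  obtain b' c' d' where r: "r = Some (ob F b, b')" "s = Some (ob F c, c')" "t = Some (ob F d, d')"
    using assms by (cases r; cases s; cases t) auto
  have x: "hom_type D x = Some (ob F b, b')" and y: "hom_type D y = Some (ob F c, c')"
    and z: "hom_type D z = Some (ob F d, d')" using assms r by auto
  obtain q where k: "hom_type D k = Some (q, ob F ((b \<otimes>\<^bsub>S\<^esub> c) \<otimes>\<^bsub>S\<^esub> d))" using assms by (cases v) auto
  note [simp] = bcd x y z k target.Obj_of_type[OF x] target.Obj_of_type[OF y] target.Obj_of_type[OF z]
  have "(pair b (c \<otimes>\<^bsub>S\<^esub> d) x (pair c d y z) \<cdot>\<^bsub>D\<^esub> ar F (Assoc S b c d)) \<cdot>\<^bsub>D\<^esub> k
    = (Assoc T (target_of r) (target_of s) (target_of t) \<cdot>\<^bsub>D\<^esub> pair (b \<otimes>\<^bsub>S\<^esub> c) d (pair b c x y) z) \<cdot>\<^bsub>D\<^esub> k"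
    by (simp only: pair_Assoc[OF assms(1-12)])
  then show ?thesis by (simp add: r)
qed

lemma pair_inv_Assoc:
  assumes bcd: "b \<in> Obj C" "c \<in> Obj C" "d \<in> Obj C"
    and "hom_type D x = r" "hom_type D y = s" "hom_type D z = t" "r \<noteq> None" "s \<noteq> None" "t \<noteq> None"
    "source_of r = ob F b" "source_of s = ob F c" "source_of t = ob F d"
  shows "pair (b \<otimes>\<^bsub>S\<^esub> c) d (pair b c x y) z \<cdot>\<^bsub>D\<^esub> ar F (inv_arr C (Assoc S b c d))
    = inv_arr D (Assoc T (target_of r) (target_of s) (target_of t)) \<cdot>\<^bsub>D\<^esub> pair b (c \<otimes>\<^bsub>S\<^esub> d) x (pair c d y z)"
proof -
  obtain b' c' d' where r: "r = Some (ob F b, b')" "s = Some (ob F c, c')" "t = Some (ob F d, d')"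
    using assms by (cases r; cases s; cases t) auto
  have x: "hom_type D x = Some (ob F b, b')" and y: "hom_type D y = Some (ob F c, c')"
    and z: "hom_type D z = Some (ob F d, d')" using assms r by auto
  note [simp] = bcd x y z target.Obj_of_type[OF x] target.Obj_of_type[OF y] target.Obj_of_type[OF z]
  have "inv_arr D (Assoc T b' c' d') \<cdot>\<^bsub>D\<^esub> (pair b (c \<otimes>\<^bsub>S\<^esub> d) x (pair c d y z) \<cdot>\<^bsub>D\<^esub> ar F (Assoc S b c d))
      \<cdot>\<^bsub>D\<^esub> ar F (inv_arr C (Assoc S b c d))
    = inv_arr D (Assoc T b' c' d') \<cdot>\<^bsub>D\<^esub> (Assoc T b' c' d' \<cdot>\<^bsub>D\<^esub> pair (b \<otimes>\<^bsub>S\<^esub> c) d (pair b c x y) z)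
      \<cdot>\<^bsub>D\<^esub> ar F (inv_arr C (Assoc S b c d))"
    by (simp only: pair_Assoc[OF assms] r type_simps)
  then show ?thesis by (simp add: r ar_inv_arr)
qed

lemma pair_inv_Assoc_Comp:
  assumes bcd: "b \<in> Obj C" "c \<in> Obj C" "d \<in> Obj C"
    and "hom_type D x = r" "hom_type D y = s" "hom_type D z = t" "r \<noteq> None" "s \<noteq> None" "t \<noteq> None"
    "source_of r = ob F b" "source_of s = ob F c" "source_of t = ob F d"
    and "hom_type D k = v" "v \<noteq> None" "target_of v = ob F (b \<otimes>\<^bsub>S\<^esub> (c \<otimes>\<^bsub>S\<^esub> d))"
  shows "pair (b \<otimes>\<^bsub>S\<^esub> c) d (pair b c x y) z \<cdot>\<^bsub>D\<^esub> ar F (inv_arr C (Assoc S b c d)) \<cdot>\<^bsub>D\<^esub> k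
    = inv_arr D (Assoc T (target_of r) (target_of s) (target_of t)) \<cdot>\<^bsub>D\<^esub> pair b (c \<otimes>\<^bsub>S\<^esub> d) x (pair c d y z) \<cdot>\<^bsub>D\<^esub> k"
proof -
  obtain b' c' d' where r: "r = Some (ob F b, b')" "s = Some (ob F c, c')" "t = Some (ob F d, d')"
    using assms by (cases r; cases s; cases t) auto
  have x: "hom_type D x = Some (ob F b, b')" and y: "hom_type D y = Some (ob F c, c')"
    and z: "hom_type D z = Some (ob F d, d')" using assms r by auto
  obtain q where k: "hom_type D k = Some (q, ob F (b \<otimes>\<^bsub>S\<^esub> (c \<otimes>\<^bsub>S\<^esub> d)))" using assms by (cases v) auto
  note [simp] = bcd x y z k target.Obj_of_type[OF x] target.Obj_of_type[OF y] target.Obj_of_type[OF z]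
  have "(pair (b \<otimes>\<^bsub>S\<^esub> c) d (pair b c x y) z \<cdot>\<^bsub>D\<^esub> ar F (inv_arr C (Assoc S b c d))) \<cdot>\<^bsub>D\<^esub> k
    = (inv_arr D (Assoc T (target_of r) (target_of s) (target_of t)) \<cdot>\<^bsub>D\<^esub> pair b (c \<otimes>\<^bsub>S\<^esub> d) x (pair c d y z)) \<cdot>\<^bsub>D\<^esub> k"
    by (simp only: pair_inv_Assoc[OF assms(1-12)])
  then show ?thesis by (simp add: r ar_inv_arr)
qed

lemma pair_Comp_left:
  assumes "b \<in> Obj C" "c \<in> Obj C" "hom_type D x = r" "hom_type D y = s" "source_of r = ob F b" "source_of s = ob F c"
    and "hom_type D h = t" "composable r t" "s \<noteq> None"
  shows "pair b c (h \<cdot>\<^bsub>D\<^esub> x) y = (h \<odot>\<^bsub>T\<^esub> Idn D (target_of s)) \<cdot>\<^bsub>D\<^esub> pair b c x y"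
  using assms target.Obj_of_type[of y] by (auto elim!: composableE simp: pair_def target.tar_merge)

lemma pair_Comp_right:
  assumes "b \<in> Obj C" "c \<in> Obj C" "hom_type D x = r" "hom_type D y = s" "source_of r = ob F b" "source_of s = ob F c"
    and "hom_type D k = u" "composable s u" "r \<noteq> None"
  shows "pair b c x (k \<cdot>\<^bsub>D\<^esub> y) = (Idn D (target_of r) \<odot>\<^bsub>T\<^esub> k) \<cdot>\<^bsub>D\<^esub> pair b c x y"
  using assms target.Obj_of_type[of x] by (auto elim!: composableE simp: pair_def target.tar_merge)

lemma copair_Comp_left:
  assumes "b \<in> Obj C" "c \<in> Obj C" "hom_type D x = r" "hom_type D y = s" "target_of r = ob F b" "target_of s = ob F c"
    and "hom_type D h = t" "composable t r" "s \<noteq> None"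
  shows "copair b c (x \<cdot>\<^bsub>D\<^esub> h) y = copair b c x y \<cdot>\<^bsub>D\<^esub> (h \<odot>\<^bsub>T\<^esub> Idn D (source_of s))"
  using assms target.Obj_of_type[of y] by (auto elim!: composableE simp: copair_def target.tar_merge)

lemma copair_Comp_right:
  assumes "b \<in> Obj C" "c \<in> Obj C" "hom_type D x = r" "hom_type D y = s" "target_of r = ob F b" "target_of s = ob F c"
    and "hom_type D k = u" "composable u s" "r \<noteq> None"
  shows "copair b c x (y \<cdot>\<^bsub>D\<^esub> k) = copair b c x y \<cdot>\<^bsub>D\<^esub> (Idn D (source_of r) \<odot>\<^bsub>T\<^esub> k)"
  using assms target.Obj_of_type[of x] by (auto elim!: composableE simp: copair_def target.tar_merge)

lemma copair_inv_Assoc: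
  assumes bcd: "b \<in> Obj C" "c \<in> Obj C" "d \<in> Obj C"
    and "hom_type D x = r" "hom_type D y = s" "hom_type D z = t" "r \<noteq> None" "s \<noteq> None" "t \<noteq> None"
    "target_of r = ob F b" "target_of s = ob F c" "target_of t = ob F d"
  shows "ar F (inv_arr C (Assoc S b c d)) \<cdot>\<^bsub>D\<^esub> copair b (c \<otimes>\<^bsub>S\<^esub> d) x (copair c d y z)
    = copair (b \<otimes>\<^bsub>S\<^esub> c) d (copair b c x y) z \<cdot>\<^bsub>D\<^esub> inv_arr D (Assoc T (source_of r) (source_of s) (source_of t))"
proof -
  obtain b' c' d' where r: "r = Some (b', ob F b)" "s = Some (c', ob F c)" "t = Some (d', ob F d)"
    using assms by (cases r; cases s; cases t) auto
  have x: "hom_type D x = Some (b', ob F b)" and y: "hom_type D y = Some (c', ob F c)"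
    and z: "hom_type D z = Some (d', ob F d)" using assms r by auto
  note [simp] = bcd x y z target.Obj_of_type[OF x] target.Obj_of_type[OF y] target.Obj_of_type[OF z]
  have "ar F (inv_arr C (Assoc S b c d)) \<cdot>\<^bsub>D\<^esub> (ar F (Assoc S b c d) \<cdot>\<^bsub>D\<^esub> copair (b \<otimes>\<^bsub>S\<^esub> c) d (copair b c x y) z)
      \<cdot>\<^bsub>D\<^esub> inv_arr D (Assoc T b' c' d')
    = ar F (inv_arr C (Assoc S b c d)) \<cdot>\<^bsub>D\<^esub> (copair b (c \<otimes>\<^bsub>S\<^esub> d) x (copair c d y z) \<cdot>\<^bsub>D\<^esub> Assoc T b' c' d')
      \<cdot>\<^bsub>D\<^esub> inv_arr D (Assoc T b' c' d')"
    by (simp only: copair_Assoc[OF assms] r type_simps)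
  then show ?thesis by (simp add: r ar_inv_arr)
qed

lemma copair_ar_Comp:
  assumes "hom_type C f = r" "r \<noteq> None" "source_of r = b" "hom_type C g = s" "s \<noteq> None" "source_of s = c"
    and "hom_type D x = t" "t \<noteq> None" "target_of t = ob F b" "hom_type D y = u" "u \<noteq> None" "target_of u = ob F c"
    and "hom_type D k = v" "v \<noteq> None" "target_of v = source_of t \<otimes>\<^bsub>T\<^esub> source_of u"
  shows "ar F (f \<odot>\<^bsub>S\<^esub> g) \<cdot>\<^bsub>D\<^esub> copair b c x y \<cdot>\<^bsub>D\<^esub> k
    = copair (target_of r) (target_of s) (ar F f \<cdot>\<^bsub>D\<^esub> x) (ar F g \<cdot>\<^bsub>D\<^esub> y) \<cdot>\<^bsub>D\<^esub> k"
proof -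
  obtain b' c' where r: "r = Some (b, b')" "s = Some (c, c')" using assms by (cases r; cases s) auto
  obtain z w where t: "t = Some (z, ob F b)" "u = Some (w, ob F c)" using assms by (cases t; cases u) auto
  obtain q where q: "v = Some (q, z \<otimes>\<^bsub>T\<^esub> w)" using assms by (cases v) (auto simp: t)
  have f: "hom_type C f = Some (b, b')" and g: "hom_type C g = Some (c, c')" using assms r by auto
  have x: "hom_type D x = Some (z, ob F b)" "hom_type D y = Some (w, ob F c)" using assms t by auto
  have k: "hom_type D k = Some (q, z \<otimes>\<^bsub>T\<^esub> w)" using assms q by auto
  note [simp] = f g x k source.Obj_of_type[OF f] source.Obj_of_type[OF g]
  have "(ar F (f \<odot>\<^bsub>S\<^esub> g) \<cdot>\<^bsub>D\<^esub> copair b c x y) \<cdot>\<^bsub>D\<^esub> k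
    = copair (target_of r) (target_of s) (ar F f \<cdot>\<^bsub>D\<^esub> x) (ar F g \<cdot>\<^bsub>D\<^esub> y) \<cdot>\<^bsub>D\<^esub> k"
    by (simp only: copair_ar[OF assms(1-12)])
  then show ?thesis by simp
qed

lemma copair_Assoc_Comp:
  assumes bcd: "b \<in> Obj C" "c \<in> Obj C" "d \<in> Obj C"
    and "hom_type D x = r" "hom_type D y = s" "hom_type D z = t" "r \<noteq> None" "s \<noteq> None" "t \<noteq> None"
    "target_of r = ob F b" "target_of s = ob F c" "target_of t = ob F d"
    and "hom_type D k = v" "v \<noteq> None" "target_of v = (source_of r \<otimes>\<^bsub>T\<^esub> source_of s) \<otimes>\<^bsub>T\<^esub> source_of t"
  shows "ar F (Assoc S b c d) \<cdot>\<^bsub>D\<^esub> copair (b \<otimes>\<^bsub>S\<^esub> c) d (copair b c x y) z \<cdot>\<^bsub>D\<^esub> k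
    = copair b (c \<otimes>\<^bsub>S\<^esub> d) x (copair c d y z) \<cdot>\<^bsub>D\<^esub> Assoc T (source_of r) (source_of s) (source_of t) \<cdot>\<^bsub>D\<^esub> k"
proof -
  obtain b' c' d' where r: "r = Some (b', ob F b)" "s = Some (c', ob F c)" "t = Some (d', ob F d)"
    using assms by (cases r; cases s; cases t) auto
  have x: "hom_type D x = Some (b', ob F b)" and y: "hom_type D y = Some (c', ob F c)"
    and z: "hom_type D z = Some (d', ob F d)" using assms r by auto
  obtain q where k: "hom_type D k = Some (q, (b' \<otimes>\<^bsub>T\<^esub> c') \<otimes>\<^bsub>T\<^esub> d')" using assms by (cases v) (auto simp: r)
  note [simp] = bcd x y z k target.Obj_of_type[OF x] target.Obj_of_type[OF y] target.Obj_of_type[OF z]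
  have "(ar F (Assoc S b c d) \<cdot>\<^bsub>D\<^esub> copair (b \<otimes>\<^bsub>S\<^esub> c) d (copair b c x y) z) \<cdot>\<^bsub>D\<^esub> k
    = (copair b (c \<otimes>\<^bsub>S\<^esub> d) x (copair c d y z) \<cdot>\<^bsub>D\<^esub> Assoc T (source_of r) (source_of s) (source_of t)) \<cdot>\<^bsub>D\<^esub> k"
    by (simp only: copair_Assoc[OF assms(1-12)])
  then show ?thesis by (simp add: r)
qed

lemma copair_inv_Assoc_Comp:
  assumes bcd: "b \<in> Obj C" "c \<in> Obj C" "d \<in> Obj C"
    and "hom_type D x = r" "hom_type D y = s" "hom_type D z = t" "r \<noteq> None" "s \<noteq> None" "t \<noteq> None"
    "target_of r = ob F b" "target_of s = ob F c" "target_of t = ob F d"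
    and "hom_type D k = v" "v \<noteq> None" "target_of v = source_of r \<otimes>\<^bsub>T\<^esub> (source_of s \<otimes>\<^bsub>T\<^esub> source_of t)"
  shows "ar F (inv_arr C (Assoc S b c d)) \<cdot>\<^bsub>D\<^esub> copair b (c \<otimes>\<^bsub>S\<^esub> d) x (copair c d y z) \<cdot>\<^bsub>D\<^esub> k
    = copair (b \<otimes>\<^bsub>S\<^esub> c) d (copair b c x y) z
      \<cdot>\<^bsub>D\<^esub> inv_arr D (Assoc T (source_of r) (source_of s) (source_of t)) \<cdot>\<^bsub>D\<^esub> k"
proof -
  obtain b' c' d' where r: "r = Some (b', ob F b)" "s = Some (c', ob F c)" "t = Some (d', ob F d)"
    using assms by (cases r; cases s; cases t) auto
  have x: "hom_type D x = Some (b', ob F b)" and y: "hom_type D y = Some (c', ob F c)"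
    and z: "hom_type D z = Some (d', ob F d)" using assms r by auto
  obtain q where k: "hom_type D k = Some (q, b' \<otimes>\<^bsub>T\<^esub> (c' \<otimes>\<^bsub>T\<^esub> d'))" using assms by (cases v) (auto simp: r)
  note [simp] = bcd x y z k target.Obj_of_type[OF x] target.Obj_of_type[OF y] target.Obj_of_type[OF z]
  have "(ar F (inv_arr C (Assoc S b c d)) \<cdot>\<^bsub>D\<^esub> copair b (c \<otimes>\<^bsub>S\<^esub> d) x (copair c d y z)) \<cdot>\<^bsub>D\<^esub> k
    = (copair (b \<otimes>\<^bsub>S\<^esub> c) d (copair b c x y) z
      \<cdot>\<^bsub>D\<^esub> inv_arr D (Assoc T (source_of r) (source_of s) (source_of t))) \<cdot>\<^bsub>D\<^esub> k"
    by (simp only: copair_inv_Assoc[OF assms(1-12)])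
  then show ?thesis by (simp add: r ar_inv_arr)
qed

lemmas pair_rules = ar_Comp pair_ar pair_ar_Comp pair_Assoc pair_Assoc_Comp pair_inv_Assoc pair_inv_Assoc_Comp
  pair_Comp_left pair_Comp_right

lemmas copair_rules = ar_Comp copair_ar copair_ar_Comp copair_Assoc copair_Assoc_Comp
  copair_inv_Assoc copair_inv_Assoc_Comp copair_Comp_left copair_Comp_right

end

section \<open>The Frobenius algebra of an ambidextrous functor with projection formulas\<close>

text \<open>The projection formulas say that \<open>I z \<otimes> b\<close> is induced from \<open>z \<otimes> R b\<close>, and \<open>b \<otimes> I z\<close> from
  \<open>R b \<otimes> z\<close>, by the evident arrows. Being induced includes that the identification by means of the
  right adjoint is the one by means of the left adjoint. The former concerns the monoid structure of
  \<open>I 1\<close> and the latter its comonoid structure; that they agree is what relates the two structures.\<close>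

locale ambidextrous_projection =
  ambidextrous_functor C D R I \<eta>l \<epsilon>l \<eta>r \<epsilon>r + CM: monoidal_category C S + DM: monoidal_category D T
  + strong_monoidal_functor C S D T R \<phi> \<phi>0
  for C :: "('o, 'm, 'y) category_scheme" and S :: "('o, 'm) tensor"
    and D :: "('p, 'n, 'z) category_scheme" and T :: "('p, 'n) tensor"
    and R :: "('o, 'm, 'p, 'n) functor_data" and \<phi> and \<phi>0 and I :: "('p, 'n, 'o, 'm) functor_data"
    and \<eta>l :: "'p \<Rightarrow> 'n" and \<epsilon>l :: "'o \<Rightarrow> 'm" and \<eta>r :: "'o \<Rightarrow> 'm" and \<epsilon>r :: "'p \<Rightarrow> 'n" +
  assumes projection_right: "\<lbrakk>z \<in> Obj D; b \<in> Obj C\<rbrakk> \<Longrightarrow> induced (ob I z \<otimes>\<^bsub>S\<^esub> b) (z \<otimes>\<^bsub>T\<^esub> ob R b)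
      (pair (ob I z) b (\<epsilon>r z) (Idn D (ob R b))) (copair (ob I z) b (\<eta>l z) (Idn D (ob R b)))"
    and projection_left: "\<lbrakk>z \<in> Obj D; b \<in> Obj C\<rbrakk> \<Longrightarrow> induced (b \<otimes>\<^bsub>S\<^esub> ob I z) (ob R b \<otimes>\<^bsub>T\<^esub> z)
      (pair b (ob I z) (Idn D (ob R b)) (\<epsilon>r z)) (copair b (ob I z) (Idn D (ob R b)) (\<eta>l z))"
begin

abbreviation "A \<equiv> ob I (Unit T)"
abbreviation "ev \<equiv> \<epsilon>r (Unit T)"
abbreviation "coev \<equiv> \<eta>l (Unit T)"
abbreviation "m \<equiv> LUnit T (Unit T)"

definition mu :: 'm where
  "mu = ar I m \<cdot>\<^bsub>C\<^esub> ar I (ev \<odot>\<^bsub>T\<^esub> ev) \<cdot>\<^bsub>C\<^esub> ar I (inv_arr D (\<phi> A A)) \<cdot>\<^bsub>C\<^esub> \<eta>r (A \<otimes>\<^bsub>S\<^esub> A)"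

definition iota :: 'm where
  "iota = ar I (inv_arr D \<phi>0) \<cdot>\<^bsub>C\<^esub> \<eta>r (Unit S)"

definition delta :: 'm where
  "delta = (\<epsilon>l (A \<otimes>\<^bsub>S\<^esub> A) \<cdot>\<^bsub>C\<^esub> ar I (\<phi> A A) \<cdot>\<^bsub>C\<^esub> ar I (coev \<odot>\<^bsub>T\<^esub> coev)) \<cdot>\<^bsub>C\<^esub> ar I (inv_arr D m)"

definition epsilon :: 'm where
  "epsilon = \<epsilon>l (Unit S) \<cdot>\<^bsub>C\<^esub> ar I \<phi>0"

lemma ind_A: "induced A (Unit T) ev coev"
  by (rule induced_I) simp

lemma ev_coev: "ev \<cdot>\<^bsub>D\<^esub> coev = Idn D (Unit T)"
  by (rule special) simp

lemma type_structure [simp]: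
  "hom_type C mu = Some (A \<otimes>\<^bsub>S\<^esub> A, A)" "hom_type C iota = Some (Unit S, A)"
  "hom_type C delta = Some (A, A \<otimes>\<^bsub>S\<^esub> A)" "hom_type C epsilon = Some (A, Unit S)"
  by (simp_all add: mu_def iota_def delta_def epsilon_def)

text \<open>The multiplication and the unit are determined by their composites with \<open>ev\<close>, and the
  comultiplication and the counit by theirs with \<open>coev\<close>.\<close>

lemma ev_mu: "ev \<cdot>\<^bsub>D\<^esub> ar R mu = m \<cdot>\<^bsub>D\<^esub> pair A A ev ev"
proof -
  have "mu = ar I (m \<cdot>\<^bsub>D\<^esub> pair A A ev ev) \<cdot>\<^bsub>C\<^esub> \<eta>r (A \<otimes>\<^bsub>S\<^esub> A)"
    by (simp add: mu_def pair_def I.ar_Comp)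
  then show ?thesis by (simp only:) (rule right_transpose; simp)
qed

lemma ev_iota: "ev \<cdot>\<^bsub>D\<^esub> ar R iota = inv_arr D \<phi>0"
  unfolding iota_def by (rule right_transpose) simp_all

lemma delta_coev: "ar R delta \<cdot>\<^bsub>D\<^esub> coev = copair A A coev coev \<cdot>\<^bsub>D\<^esub> inv_arr D m"
proof -
  have "delta = \<epsilon>l (A \<otimes>\<^bsub>S\<^esub> A) \<cdot>\<^bsub>C\<^esub> ar I (copair A A coev coev \<cdot>\<^bsub>D\<^esub> inv_arr D m)"
    by (simp add: delta_def copair_def I.ar_Comp)
  then show ?thesis by (simp only:) (rule left_transpose; simp)
qed

lemma epsilon_coev: "ar R epsilon \<cdot>\<^bsub>D\<^esub> coev = \<phi>0"
  unfolding epsilon_def by (rule left_transpose) simp_all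

lemma ind_A_right: "b \<in> Obj C \<Longrightarrow> induced (A \<otimes>\<^bsub>S\<^esub> b) (Unit T \<otimes>\<^bsub>T\<^esub> ob R b)
    (pair A b ev (Idn D (ob R b))) (copair A b coev (Idn D (ob R b)))"
  by (rule projection_right) simp_all

lemma ind_A_left: "b \<in> Obj C \<Longrightarrow> induced (b \<otimes>\<^bsub>S\<^esub> A) (ob R b \<otimes>\<^bsub>T\<^esub> Unit T)
    (pair b A (Idn D (ob R b)) ev) (copair b A (Idn D (ob R b)) coev)"
  by (rule projection_left) simp_all

text \<open>Transferring these formulas along the projection formulas gives the other half of the
  information about \<open>mu\<close> and \<open>delta\<close>.\<close>

lemma mu_coev:
  "ar R mu \<cdot>\<^bsub>D\<^esub> copair A A coev (Idn D (ob R A)) = coev \<cdot>\<^bsub>D\<^esub> m \<cdot>\<^bsub>D\<^esub> (Idn D (Unit T) \<odot>\<^bsub>T\<^esub> ev)"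
  "ar R mu \<cdot>\<^bsub>D\<^esub> copair A A (Idn D (ob R A)) coev = coev \<cdot>\<^bsub>D\<^esub> m \<cdot>\<^bsub>D\<^esub> (ev \<odot>\<^bsub>T\<^esub> Idn D (Unit T))"
proof -
  have "ev \<cdot>\<^bsub>D\<^esub> ar R mu = (m \<cdot>\<^bsub>D\<^esub> (Idn D (Unit T) \<odot>\<^bsub>T\<^esub> ev)) \<cdot>\<^bsub>D\<^esub> pair A A ev (Idn D (ob R A))"
    by (simp add: ev_mu pair_Comp[symmetric])
  then show "ar R mu \<cdot>\<^bsub>D\<^esub> copair A A coev (Idn D (ob R A)) = coev \<cdot>\<^bsub>D\<^esub> m \<cdot>\<^bsub>D\<^esub> (Idn D (Unit T) \<odot>\<^bsub>T\<^esub> ev)"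
    by (rule induced_transfer[OF ind_A_right ind_A, rotated -1]) simp_all
  have "ev \<cdot>\<^bsub>D\<^esub> ar R mu = (m \<cdot>\<^bsub>D\<^esub> (ev \<odot>\<^bsub>T\<^esub> Idn D (Unit T))) \<cdot>\<^bsub>D\<^esub> pair A A (Idn D (ob R A)) ev"
    by (simp add: ev_mu pair_Comp[symmetric])
  then show "ar R mu \<cdot>\<^bsub>D\<^esub> copair A A (Idn D (ob R A)) coev = coev \<cdot>\<^bsub>D\<^esub> m \<cdot>\<^bsub>D\<^esub> (ev \<odot>\<^bsub>T\<^esub> Idn D (Unit T))"
    by (rule induced_transfer[OF ind_A_left ind_A, rotated -1]) simp_all
qed

lemma ev_delta:
  "pair A A ev (Idn D (ob R A)) \<cdot>\<^bsub>D\<^esub> ar R delta = (Idn D (Unit T) \<odot>\<^bsub>T\<^esub> coev) \<cdot>\<^bsub>D\<^esub> inv_arr D m \<cdot>\<^bsub>D\<^esub> ev"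
  "pair A A (Idn D (ob R A)) ev \<cdot>\<^bsub>D\<^esub> ar R delta = (coev \<odot>\<^bsub>T\<^esub> Idn D (Unit T)) \<cdot>\<^bsub>D\<^esub> inv_arr D m \<cdot>\<^bsub>D\<^esub> ev"
proof -
  have "ar R delta \<cdot>\<^bsub>D\<^esub> coev = copair A A coev (Idn D (ob R A)) \<cdot>\<^bsub>D\<^esub> (Idn D (Unit T) \<odot>\<^bsub>T\<^esub> coev) \<cdot>\<^bsub>D\<^esub> inv_arr D m"
    unfolding delta_coev by (simp add: copair_def DM.tar_merge)
  then have "pair A A ev (Idn D (ob R A)) \<cdot>\<^bsub>D\<^esub> ar R delta = ((Idn D (Unit T) \<odot>\<^bsub>T\<^esub> coev) \<cdot>\<^bsub>D\<^esub> inv_arr D m) \<cdot>\<^bsub>D\<^esub> ev"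
    by (rule induced_transfer_converse[OF ind_A ind_A_right, rotated -1]) simp_all
  then show "pair A A ev (Idn D (ob R A)) \<cdot>\<^bsub>D\<^esub> ar R delta = (Idn D (Unit T) \<odot>\<^bsub>T\<^esub> coev) \<cdot>\<^bsub>D\<^esub> inv_arr D m \<cdot>\<^bsub>D\<^esub> ev"
    by simp
  have "ar R delta \<cdot>\<^bsub>D\<^esub> coev = copair A A (Idn D (ob R A)) coev \<cdot>\<^bsub>D\<^esub> (coev \<odot>\<^bsub>T\<^esub> Idn D (Unit T)) \<cdot>\<^bsub>D\<^esub> inv_arr D m"
    unfolding delta_coev by (simp add: copair_def DM.tar_merge)
  then have "pair A A (Idn D (ob R A)) ev \<cdot>\<^bsub>D\<^esub> ar R delta = ((coev \<odot>\<^bsub>T\<^esub> Idn D (Unit T)) \<cdot>\<^bsub>D\<^esub> inv_arr D m) \<cdot>\<^bsub>D\<^esub> ev"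
    by (rule induced_transfer_converse[OF ind_A ind_A_left, rotated -1]) simp_all
  then show "pair A A (Idn D (ob R A)) ev \<cdot>\<^bsub>D\<^esub> ar R delta = (coev \<odot>\<^bsub>T\<^esub> Idn D (Unit T)) \<cdot>\<^bsub>D\<^esub> inv_arr D m \<cdot>\<^bsub>D\<^esub> ev"
    by simp
qed

lemma m_associative:
  "m \<cdot>\<^bsub>D\<^esub> (m \<odot>\<^bsub>T\<^esub> Idn D (Unit T)) = m \<cdot>\<^bsub>D\<^esub> (Idn D (Unit T) \<odot>\<^bsub>T\<^esub> m) \<cdot>\<^bsub>D\<^esub> Assoc T (Unit T) (Unit T) (Unit T)"
  unfolding DM.unit_associative ..

lemma inv_m_coassociative:
  "Assoc T (Unit T) (Unit T) (Unit T) \<cdot>\<^bsub>D\<^esub> (inv_arr D m \<odot>\<^bsub>T\<^esub> Idn D (Unit T)) = Idn D (Unit T) \<odot>\<^bsub>T\<^esub> inv_arr D m"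
proof -
  have "(Idn D (Unit T) \<odot>\<^bsub>T\<^esub> m) \<cdot>\<^bsub>D\<^esub> (Assoc T (Unit T) (Unit T) (Unit T) \<cdot>\<^bsub>D\<^esub> (inv_arr D m \<odot>\<^bsub>T\<^esub> Idn D (Unit T)))
      = ((Idn D (Unit T) \<odot>\<^bsub>T\<^esub> m) \<cdot>\<^bsub>D\<^esub> Assoc T (Unit T) (Unit T) (Unit T)) \<cdot>\<^bsub>D\<^esub> (inv_arr D m \<odot>\<^bsub>T\<^esub> Idn D (Unit T))"
    by simp
  also have "\<dots> = (Idn D (Unit T) \<odot>\<^bsub>T\<^esub> m) \<cdot>\<^bsub>D\<^esub> (Idn D (Unit T) \<odot>\<^bsub>T\<^esub> inv_arr D m)"
    unfolding DM.unit_associative[symmetric] by (simp add: DM.tar_merge)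
  finally show ?thesis
    by (rule D.iso_cancel_left[rotated -1, of "Idn D (Unit T) \<odot>\<^bsub>T\<^esub> m"]) simp_all
qed

text \<open>Each axiom is an equation between arrows to \<open>A\<close>. After composition with \<open>ev\<close> it becomes the
  corresponding axiom for the monoid \<open>1\<close> of \<open>D\<close>.\<close>

lemma monoid_A: "monoid_object C S A mu iota"
proof
  show "A \<in> Obj C" "mu \<in> Hom C (A \<otimes>\<^bsub>S\<^esub> A) A" "iota \<in> Hom C (Unit S) A" by simp_all
  show "mu \<cdot>\<^bsub>C\<^esub> (mu \<odot>\<^bsub>S\<^esub> Idn C A) = mu \<cdot>\<^bsub>C\<^esub> (Idn C A \<odot>\<^bsub>S\<^esub> mu) \<cdot>\<^bsub>C\<^esub> Assoc S A A A"
  proof (rule induced_unique[OF ind_A])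
    have "ev \<cdot>\<^bsub>D\<^esub> ar R (mu \<cdot>\<^bsub>C\<^esub> (mu \<odot>\<^bsub>S\<^esub> Idn C A)) = (ev \<cdot>\<^bsub>D\<^esub> ar R mu) \<cdot>\<^bsub>D\<^esub> ar R (mu \<odot>\<^bsub>S\<^esub> Idn C A)"
      by (simp add: R.ar_Comp)
    also have "\<dots> = (m \<cdot>\<^bsub>D\<^esub> (m \<odot>\<^bsub>T\<^esub> Idn D (Unit T))) \<cdot>\<^bsub>D\<^esub> pair (A \<otimes>\<^bsub>S\<^esub> A) A (pair A A ev ev) ev"
      by (simp add: ev_mu pair_rules)
    also have "\<dots> = (ev \<cdot>\<^bsub>D\<^esub> ar R mu) \<cdot>\<^bsub>D\<^esub> ar R (Idn C A \<odot>\<^bsub>S\<^esub> mu) \<cdot>\<^bsub>D\<^esub> ar R (Assoc S A A A)"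
      unfolding m_associative by (simp add: ev_mu pair_rules)
    also have "\<dots> = ev \<cdot>\<^bsub>D\<^esub> ar R (mu \<cdot>\<^bsub>C\<^esub> (Idn C A \<odot>\<^bsub>S\<^esub> mu) \<cdot>\<^bsub>C\<^esub> Assoc S A A A)"
      by (simp add: R.ar_Comp)
    finally show "ev \<cdot>\<^bsub>D\<^esub> ar R (mu \<cdot>\<^bsub>C\<^esub> (mu \<odot>\<^bsub>S\<^esub> Idn C A))
      = ev \<cdot>\<^bsub>D\<^esub> ar R (mu \<cdot>\<^bsub>C\<^esub> (Idn C A \<odot>\<^bsub>S\<^esub> mu) \<cdot>\<^bsub>C\<^esub> Assoc S A A A)" .
  qed simp_all
  show "mu \<cdot>\<^bsub>C\<^esub> (iota \<odot>\<^bsub>S\<^esub> Idn C A) = LUnit S A"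
  proof (rule induced_unique[OF ind_A])
    have "ev \<cdot>\<^bsub>D\<^esub> ar R (mu \<cdot>\<^bsub>C\<^esub> (iota \<odot>\<^bsub>S\<^esub> Idn C A)) = (ev \<cdot>\<^bsub>D\<^esub> ar R mu) \<cdot>\<^bsub>D\<^esub> ar R (iota \<odot>\<^bsub>S\<^esub> Idn C A)"
      by (simp add: R.ar_Comp)
    also have "\<dots> = m \<cdot>\<^bsub>D\<^esub> pair (Unit S) A (inv_arr D \<phi>0) ev"
      unfolding ev_mu by (simp add: ev_iota pair_ar)
    also have "\<dots> = ev \<cdot>\<^bsub>D\<^esub> ar R (LUnit S A)"
      by (rule pair_unit) simp_all
    finally show "ev \<cdot>\<^bsub>D\<^esub> ar R (mu \<cdot>\<^bsub>C\<^esub> (iota \<odot>\<^bsub>S\<^esub> Idn C A)) = ev \<cdot>\<^bsub>D\<^esub> ar R (LUnit S A)" .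
  qed simp_all
  show "mu \<cdot>\<^bsub>C\<^esub> (Idn C A \<odot>\<^bsub>S\<^esub> iota) = RUnit S A"
  proof (rule induced_unique[OF ind_A])
    have "ev \<cdot>\<^bsub>D\<^esub> ar R (mu \<cdot>\<^bsub>C\<^esub> (Idn C A \<odot>\<^bsub>S\<^esub> iota)) = (ev \<cdot>\<^bsub>D\<^esub> ar R mu) \<cdot>\<^bsub>D\<^esub> ar R (Idn C A \<odot>\<^bsub>S\<^esub> iota)"
      by (simp add: R.ar_Comp)
    also have "\<dots> = RUnit T (Unit T) \<cdot>\<^bsub>D\<^esub> pair A (Unit S) ev (inv_arr D \<phi>0)"
      unfolding ev_mu by (simp add: ev_iota pair_ar DM.LUnit_RUnit)
    also have "\<dots> = ev \<cdot>\<^bsub>D\<^esub> ar R (RUnit S A)"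
      by (rule pair_unit) simp_all
    finally show "ev \<cdot>\<^bsub>D\<^esub> ar R (mu \<cdot>\<^bsub>C\<^esub> (Idn C A \<odot>\<^bsub>S\<^esub> iota)) = ev \<cdot>\<^bsub>D\<^esub> ar R (RUnit S A)" .
  qed simp_all
qed

text \<open>Dually, after composition with \<open>coev\<close> only the comonoid \<open>1\<close> of \<open>D\<close> is left.\<close>

lemma comonoid_A: "comonoid_object C S A delta epsilon"
proof
  show "A \<in> Obj C" "delta \<in> Hom C A (A \<otimes>\<^bsub>S\<^esub> A)" "epsilon \<in> Hom C A (Unit S)" by simp_all
  show "Assoc S A A A \<cdot>\<^bsub>C\<^esub> (delta \<odot>\<^bsub>S\<^esub> Idn C A) \<cdot>\<^bsub>C\<^esub> delta = (Idn C A \<odot>\<^bsub>S\<^esub> delta) \<cdot>\<^bsub>C\<^esub> delta"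
  proof (rule induced_counique[OF ind_A])
    have "ar R (Assoc S A A A \<cdot>\<^bsub>C\<^esub> (delta \<odot>\<^bsub>S\<^esub> Idn C A) \<cdot>\<^bsub>C\<^esub> delta) \<cdot>\<^bsub>D\<^esub> coev
      = copair A (A \<otimes>\<^bsub>S\<^esub> A) coev (copair A A coev coev)
        \<cdot>\<^bsub>D\<^esub> (Assoc T (Unit T) (Unit T) (Unit T) \<cdot>\<^bsub>D\<^esub> (inv_arr D m \<odot>\<^bsub>T\<^esub> Idn D (Unit T))) \<cdot>\<^bsub>D\<^esub> inv_arr D m"
      by (simp add: delta_coev copair_rules)
    also have "\<dots> = ar R ((Idn C A \<odot>\<^bsub>S\<^esub> delta) \<cdot>\<^bsub>C\<^esub> delta) \<cdot>\<^bsub>D\<^esub> coev"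
      unfolding inv_m_coassociative by (simp add: delta_coev copair_rules)
    finally show "ar R (Assoc S A A A \<cdot>\<^bsub>C\<^esub> (delta \<odot>\<^bsub>S\<^esub> Idn C A) \<cdot>\<^bsub>C\<^esub> delta) \<cdot>\<^bsub>D\<^esub> coev
      = ar R ((Idn C A \<odot>\<^bsub>S\<^esub> delta) \<cdot>\<^bsub>C\<^esub> delta) \<cdot>\<^bsub>D\<^esub> coev" .
  qed simp_all
  show "LUnit S A \<cdot>\<^bsub>C\<^esub> (epsilon \<odot>\<^bsub>S\<^esub> Idn C A) \<cdot>\<^bsub>C\<^esub> delta = Idn C A"
  proof (rule induced_counique[OF ind_A])
    have "ar R (LUnit S A \<cdot>\<^bsub>C\<^esub> (epsilon \<odot>\<^bsub>S\<^esub> Idn C A) \<cdot>\<^bsub>C\<^esub> delta) \<cdot>\<^bsub>D\<^esub> coev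
      = (ar R (LUnit S A) \<cdot>\<^bsub>D\<^esub> copair (Unit S) A \<phi>0 coev) \<cdot>\<^bsub>D\<^esub> inv_arr D m"
      by (simp add: delta_coev epsilon_coev R.ar_Comp copair_ar_Comp)
    also have "\<dots> = ar R (Idn C A) \<cdot>\<^bsub>D\<^esub> coev"
      by (simp add: copair_unit(1)[of A coev "Unit T"])
    finally show "ar R (LUnit S A \<cdot>\<^bsub>C\<^esub> (epsilon \<odot>\<^bsub>S\<^esub> Idn C A) \<cdot>\<^bsub>C\<^esub> delta) \<cdot>\<^bsub>D\<^esub> coev = ar R (Idn C A) \<cdot>\<^bsub>D\<^esub> coev" .
  qed simp_all
  show "RUnit S A \<cdot>\<^bsub>C\<^esub> (Idn C A \<odot>\<^bsub>S\<^esub> epsilon) \<cdot>\<^bsub>C\<^esub> delta = Idn C A"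
  proof (rule induced_counique[OF ind_A])
    have "ar R (RUnit S A \<cdot>\<^bsub>C\<^esub> (Idn C A \<odot>\<^bsub>S\<^esub> epsilon) \<cdot>\<^bsub>C\<^esub> delta) \<cdot>\<^bsub>D\<^esub> coev
      = (ar R (RUnit S A) \<cdot>\<^bsub>D\<^esub> copair A (Unit S) coev \<phi>0) \<cdot>\<^bsub>D\<^esub> inv_arr D m"
      by (simp add: delta_coev epsilon_coev R.ar_Comp copair_ar_Comp)
    also have "\<dots> = ar R (Idn C A) \<cdot>\<^bsub>D\<^esub> coev"
      by (simp add: copair_unit(2)[of A coev "Unit T"] DM.LUnit_RUnit)
    finally show "ar R (RUnit S A \<cdot>\<^bsub>C\<^esub> (Idn C A \<odot>\<^bsub>S\<^esub> epsilon) \<cdot>\<^bsub>C\<^esub> delta) \<cdot>\<^bsub>D\<^esub> coev = ar R (Idn C A) \<cdot>\<^bsub>D\<^esub> coev" .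
  qed simp_all
qed

text \<open>By \<open>mu_coev\<close>, this is the equation \<open>ev \<cdot> coev = 1\<close>, that is, the assumption \<open>special\<close> on the two
  adjunctions.\<close>

lemma mu_delta: "mu \<cdot>\<^bsub>C\<^esub> delta = Idn C A"
proof (rule induced_counique[OF ind_A])
  have "ar R (mu \<cdot>\<^bsub>C\<^esub> delta) \<cdot>\<^bsub>D\<^esub> coev = ar R mu \<cdot>\<^bsub>D\<^esub> copair A A coev coev \<cdot>\<^bsub>D\<^esub> inv_arr D m"
    by (simp add: R.ar_Comp delta_coev)
  also have "\<dots> = (ar R mu \<cdot>\<^bsub>D\<^esub> copair A A coev (Idn D (ob R A))) \<cdot>\<^bsub>D\<^esub> (Idn D (Unit T) \<odot>\<^bsub>T\<^esub> coev) \<cdot>\<^bsub>D\<^esub> inv_arr D m"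
    by (simp add: copair_def DM.tar_merge)
  also have "\<dots> = ar R (Idn C A) \<cdot>\<^bsub>D\<^esub> coev"
    unfolding mu_coev by (simp add: DM.tar_merge ev_coev)
  finally show "ar R (mu \<cdot>\<^bsub>C\<^esub> delta) \<cdot>\<^bsub>D\<^esub> coev = ar R (Idn C A) \<cdot>\<^bsub>D\<^esub> coev" .
qed simp_all

text \<open>Both sides of each Frobenius relation are the endomorphism of \<open>A \<otimes> A\<close> that the projection
  formula associates with the idempotent \<open>coev \<cdot> ev\<close>.\<close>

lemma frobenius_left: "(Idn C A \<odot>\<^bsub>S\<^esub> mu) \<cdot>\<^bsub>C\<^esub> Assoc S A A A \<cdot>\<^bsub>C\<^esub> (delta \<odot>\<^bsub>S\<^esub> Idn C A) = delta \<cdot>\<^bsub>C\<^esub> mu"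
proof (rule induced_unique[OF ind_A_right[of A]])
  let ?w = "Idn D (ob R A)" and ?U = "Idn D (Unit T)"
  have mu': "ar R mu = (ar R mu \<cdot>\<^bsub>D\<^esub> \<phi> A A) \<cdot>\<^bsub>D\<^esub> pair A A ?w ?w"
    by (simp add: pair_Idn)
  have muphi: "(ar R mu \<cdot>\<^bsub>D\<^esub> \<phi> A A) \<cdot>\<^bsub>D\<^esub> (coev \<odot>\<^bsub>T\<^esub> ?w) = coev \<cdot>\<^bsub>D\<^esub> m \<cdot>\<^bsub>D\<^esub> (?U \<odot>\<^bsub>T\<^esub> ev)"
    using mu_coev(1) by (simp add: copair_def)
  have unit: "(?U \<odot>\<^bsub>T\<^esub> (m \<cdot>\<^bsub>D\<^esub> (?U \<odot>\<^bsub>T\<^esub> ev))) \<cdot>\<^bsub>D\<^esub> Assoc T (Unit T) (Unit T) (ob R A) \<cdot>\<^bsub>D\<^esub> (inv_arr D m \<odot>\<^bsub>T\<^esub> ?w)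
      = ?U \<odot>\<^bsub>T\<^esub> ev"
  proof -
    have "m \<cdot>\<^bsub>D\<^esub> (?U \<odot>\<^bsub>T\<^esub> ev) = ev \<cdot>\<^bsub>D\<^esub> LUnit T (ob R A)"
      using DM.lunit_natural[of ev "ob R A" "Unit T"] by simp
    then have "(?U \<odot>\<^bsub>T\<^esub> (m \<cdot>\<^bsub>D\<^esub> (?U \<odot>\<^bsub>T\<^esub> ev))) \<cdot>\<^bsub>D\<^esub> Assoc T (Unit T) (Unit T) (ob R A) \<cdot>\<^bsub>D\<^esub> (inv_arr D m \<odot>\<^bsub>T\<^esub> ?w)
      = (?U \<odot>\<^bsub>T\<^esub> ev) \<cdot>\<^bsub>D\<^esub> ((?U \<odot>\<^bsub>T\<^esub> LUnit T (ob R A)) \<cdot>\<^bsub>D\<^esub> Assoc T (Unit T) (Unit T) (ob R A)) \<cdot>\<^bsub>D\<^esub> (inv_arr D m \<odot>\<^bsub>T\<^esub> ?w)"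
      by (simp add: DM.tar_Comp_right)
    also have "\<dots> = ?U \<odot>\<^bsub>T\<^esub> ev"
      unfolding DM.triangle[OF DM.Unit_Obj R.ob_Obj[OF I.ob_Obj[OF DM.Unit_Obj]]]
      by (simp add: DM.tar_merge DM.LUnit_RUnit)
    finally show ?thesis .
  qed
  have "pair A A ev ?w \<cdot>\<^bsub>D\<^esub> ar R ((Idn C A \<odot>\<^bsub>S\<^esub> mu) \<cdot>\<^bsub>C\<^esub> Assoc S A A A \<cdot>\<^bsub>C\<^esub> (delta \<odot>\<^bsub>S\<^esub> Idn C A))
      = pair A (A \<otimes>\<^bsub>S\<^esub> A) ev (ar R mu) \<cdot>\<^bsub>D\<^esub> ar R (Assoc S A A A) \<cdot>\<^bsub>D\<^esub> ar R (delta \<odot>\<^bsub>S\<^esub> Idn C A)"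
    by (simp add: R.ar_Comp pair_ar_Comp)
  also have "pair A (A \<otimes>\<^bsub>S\<^esub> A) ev (ar R mu)
      = (?U \<odot>\<^bsub>T\<^esub> (ar R mu \<cdot>\<^bsub>D\<^esub> \<phi> A A)) \<cdot>\<^bsub>D\<^esub> pair A (A \<otimes>\<^bsub>S\<^esub> A) ev (pair A A ?w ?w)"
    by (subst mu') (simp add: pair_Comp_right del: D.Comp_assoc)
  also have "((?U \<odot>\<^bsub>T\<^esub> (ar R mu \<cdot>\<^bsub>D\<^esub> \<phi> A A)) \<cdot>\<^bsub>D\<^esub> pair A (A \<otimes>\<^bsub>S\<^esub> A) ev (pair A A ?w ?w))
        \<cdot>\<^bsub>D\<^esub> ar R (Assoc S A A A) \<cdot>\<^bsub>D\<^esub> ar R (delta \<odot>\<^bsub>S\<^esub> Idn C A)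
      = (?U \<odot>\<^bsub>T\<^esub> (ar R mu \<cdot>\<^bsub>D\<^esub> \<phi> A A)) \<cdot>\<^bsub>D\<^esub> Assoc T (Unit T) (ob R A) (ob R A)
        \<cdot>\<^bsub>D\<^esub> pair A A ((?U \<odot>\<^bsub>T\<^esub> coev) \<cdot>\<^bsub>D\<^esub> inv_arr D m \<cdot>\<^bsub>D\<^esub> ev) ?w"
    by (simp add: pair_Assoc_Comp pair_ar ev_delta)
  also have "\<dots> = (?U \<odot>\<^bsub>T\<^esub> (ar R mu \<cdot>\<^bsub>D\<^esub> \<phi> A A)) \<cdot>\<^bsub>D\<^esub> (Assoc T (Unit T) (ob R A) (ob R A)
        \<cdot>\<^bsub>D\<^esub> ((?U \<odot>\<^bsub>T\<^esub> coev) \<odot>\<^bsub>T\<^esub> ?w)) \<cdot>\<^bsub>D\<^esub> (inv_arr D m \<odot>\<^bsub>T\<^esub> ?w) \<cdot>\<^bsub>D\<^esub> pair A A ev ?w"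
    by (simp add: pair_Comp_left)
  also have "Assoc T (Unit T) (ob R A) (ob R A) \<cdot>\<^bsub>D\<^esub> ((?U \<odot>\<^bsub>T\<^esub> coev) \<odot>\<^bsub>T\<^esub> ?w)
      = (?U \<odot>\<^bsub>T\<^esub> (coev \<odot>\<^bsub>T\<^esub> ?w)) \<cdot>\<^bsub>D\<^esub> Assoc T (Unit T) (Unit T) (ob R A)"
    using DM.assoc_natural[of ?U "Unit T" "Unit T" coev "Unit T" "ob R A" ?w "ob R A" "ob R A"] by simp
  also have "(?U \<odot>\<^bsub>T\<^esub> (ar R mu \<cdot>\<^bsub>D\<^esub> \<phi> A A)) \<cdot>\<^bsub>D\<^esub> ((?U \<odot>\<^bsub>T\<^esub> (coev \<odot>\<^bsub>T\<^esub> ?w)) \<cdot>\<^bsub>D\<^esub> Assoc T (Unit T) (Unit T) (ob R A))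
        \<cdot>\<^bsub>D\<^esub> (inv_arr D m \<odot>\<^bsub>T\<^esub> ?w) \<cdot>\<^bsub>D\<^esub> pair A A ev ?w
      = (?U \<odot>\<^bsub>T\<^esub> ((ar R mu \<cdot>\<^bsub>D\<^esub> \<phi> A A) \<cdot>\<^bsub>D\<^esub> (coev \<odot>\<^bsub>T\<^esub> ?w))) \<cdot>\<^bsub>D\<^esub> Assoc T (Unit T) (Unit T) (ob R A)
        \<cdot>\<^bsub>D\<^esub> (inv_arr D m \<odot>\<^bsub>T\<^esub> ?w) \<cdot>\<^bsub>D\<^esub> pair A A ev ?w"
    by (simp add: DM.tar_merge)
  also have "\<dots> = (?U \<odot>\<^bsub>T\<^esub> coev) \<cdot>\<^bsub>D\<^esub> ((?U \<odot>\<^bsub>T\<^esub> (m \<cdot>\<^bsub>D\<^esub> (?U \<odot>\<^bsub>T\<^esub> ev))) \<cdot>\<^bsub>D\<^esub> Assoc T (Unit T) (Unit T) (ob R A)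
        \<cdot>\<^bsub>D\<^esub> (inv_arr D m \<odot>\<^bsub>T\<^esub> ?w)) \<cdot>\<^bsub>D\<^esub> pair A A ev ?w"
    unfolding muphi by (simp add: DM.tar_Comp_right)
  also have "\<dots> = (?U \<odot>\<^bsub>T\<^esub> coev) \<cdot>\<^bsub>D\<^esub> (?U \<odot>\<^bsub>T\<^esub> ev) \<cdot>\<^bsub>D\<^esub> pair A A ev ?w"
    unfolding unit ..
  also have "\<dots> = (?U \<odot>\<^bsub>T\<^esub> coev) \<cdot>\<^bsub>D\<^esub> inv_arr D m \<cdot>\<^bsub>D\<^esub> ev \<cdot>\<^bsub>D\<^esub> ar R mu"
    unfolding ev_mu by (simp add: pair_Comp[symmetric])
  also have "\<dots> = (pair A A ev ?w \<cdot>\<^bsub>D\<^esub> ar R delta) \<cdot>\<^bsub>D\<^esub> ar R mu"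
    unfolding ev_delta by simp
  also have "\<dots> = pair A A ev ?w \<cdot>\<^bsub>D\<^esub> ar R (delta \<cdot>\<^bsub>C\<^esub> mu)"
    by (simp add: R.ar_Comp)
  finally show "pair A A ev ?w \<cdot>\<^bsub>D\<^esub> ar R ((Idn C A \<odot>\<^bsub>S\<^esub> mu) \<cdot>\<^bsub>C\<^esub> Assoc S A A A \<cdot>\<^bsub>C\<^esub> (delta \<odot>\<^bsub>S\<^esub> Idn C A))
      = pair A A ev ?w \<cdot>\<^bsub>D\<^esub> ar R (delta \<cdot>\<^bsub>C\<^esub> mu)" .
qed simp_all

lemma frobenius_right:
  "(mu \<odot>\<^bsub>S\<^esub> Idn C A) \<cdot>\<^bsub>C\<^esub> inv_arr C (Assoc S A A A) \<cdot>\<^bsub>C\<^esub> (Idn C A \<odot>\<^bsub>S\<^esub> delta) = delta \<cdot>\<^bsub>C\<^esub> mu"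
proof (rule induced_unique[OF ind_A_left[of A]])
  let ?w = "Idn D (ob R A)" and ?U = "Idn D (Unit T)"
  have mu': "ar R mu = (ar R mu \<cdot>\<^bsub>D\<^esub> \<phi> A A) \<cdot>\<^bsub>D\<^esub> pair A A ?w ?w"
    by (simp add: pair_Idn)
  have muphi: "(ar R mu \<cdot>\<^bsub>D\<^esub> \<phi> A A) \<cdot>\<^bsub>D\<^esub> (?w \<odot>\<^bsub>T\<^esub> coev) = coev \<cdot>\<^bsub>D\<^esub> m \<cdot>\<^bsub>D\<^esub> (ev \<odot>\<^bsub>T\<^esub> ?U)"
    using mu_coev(2) by (simp add: copair_def)
  have unit: "((m \<cdot>\<^bsub>D\<^esub> (ev \<odot>\<^bsub>T\<^esub> ?U)) \<odot>\<^bsub>T\<^esub> ?U) \<cdot>\<^bsub>D\<^esub> inv_arr D (Assoc T (ob R A) (Unit T) (Unit T)) \<cdot>\<^bsub>D\<^esub> (?w \<odot>\<^bsub>T\<^esub> inv_arr D m)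
      = ev \<odot>\<^bsub>T\<^esub> ?U"
  proof -
    have r: "m \<cdot>\<^bsub>D\<^esub> (ev \<odot>\<^bsub>T\<^esub> ?U) = ev \<cdot>\<^bsub>D\<^esub> RUnit T (ob R A)"
      using DM.runit_natural[of ev "ob R A" "Unit T"] by (simp add: DM.LUnit_RUnit)
    have "inv_arr D (Assoc T (ob R A) (Unit T) (Unit T)) \<cdot>\<^bsub>D\<^esub> (?w \<odot>\<^bsub>T\<^esub> inv_arr D m)
        = inv_arr D ((?w \<odot>\<^bsub>T\<^esub> m) \<cdot>\<^bsub>D\<^esub> Assoc T (ob R A) (Unit T) (Unit T))"
      by (simp add: D.inv_arr_Comp DM.tar_inv_arr)
    also have "\<dots> = inv_arr D (RUnit T (ob R A)) \<odot>\<^bsub>T\<^esub> ?U"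
      unfolding DM.triangle[OF R.ob_Obj[OF I.ob_Obj[OF DM.Unit_Obj]] DM.Unit_Obj] by (simp add: DM.tar_inv_arr)
    finally have a: "inv_arr D (Assoc T (ob R A) (Unit T) (Unit T)) \<cdot>\<^bsub>D\<^esub> (?w \<odot>\<^bsub>T\<^esub> inv_arr D m)
        = inv_arr D (RUnit T (ob R A)) \<odot>\<^bsub>T\<^esub> ?U" .
    show ?thesis unfolding r a by (simp add: DM.tar_merge)
  qed
  have "pair A A ?w ev \<cdot>\<^bsub>D\<^esub> ar R ((mu \<odot>\<^bsub>S\<^esub> Idn C A) \<cdot>\<^bsub>C\<^esub> inv_arr C (Assoc S A A A) \<cdot>\<^bsub>C\<^esub> (Idn C A \<odot>\<^bsub>S\<^esub> delta))
      = pair (A \<otimes>\<^bsub>S\<^esub> A) A (ar R mu) ev \<cdot>\<^bsub>D\<^esub> ar R (inv_arr C (Assoc S A A A)) \<cdot>\<^bsub>D\<^esub> ar R (Idn C A \<odot>\<^bsub>S\<^esub> delta)"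
    by (simp add: R.ar_Comp pair_ar_Comp)
  also have "pair (A \<otimes>\<^bsub>S\<^esub> A) A (ar R mu) ev
      = ((ar R mu \<cdot>\<^bsub>D\<^esub> \<phi> A A) \<odot>\<^bsub>T\<^esub> ?U) \<cdot>\<^bsub>D\<^esub> pair (A \<otimes>\<^bsub>S\<^esub> A) A (pair A A ?w ?w) ev"
    by (subst mu') (simp add: pair_Comp_left del: D.Comp_assoc)
  also have "(((ar R mu \<cdot>\<^bsub>D\<^esub> \<phi> A A) \<odot>\<^bsub>T\<^esub> ?U) \<cdot>\<^bsub>D\<^esub> pair (A \<otimes>\<^bsub>S\<^esub> A) A (pair A A ?w ?w) ev)
        \<cdot>\<^bsub>D\<^esub> ar R (inv_arr C (Assoc S A A A)) \<cdot>\<^bsub>D\<^esub> ar R (Idn C A \<odot>\<^bsub>S\<^esub> delta)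
      = ((ar R mu \<cdot>\<^bsub>D\<^esub> \<phi> A A) \<odot>\<^bsub>T\<^esub> ?U) \<cdot>\<^bsub>D\<^esub> inv_arr D (Assoc T (ob R A) (ob R A) (Unit T))
        \<cdot>\<^bsub>D\<^esub> pair A A ?w ((coev \<odot>\<^bsub>T\<^esub> ?U) \<cdot>\<^bsub>D\<^esub> inv_arr D m \<cdot>\<^bsub>D\<^esub> ev)"
    by (simp add: pair_inv_Assoc_Comp pair_ar ev_delta)
  also have "\<dots> = ((ar R mu \<cdot>\<^bsub>D\<^esub> \<phi> A A) \<odot>\<^bsub>T\<^esub> ?U) \<cdot>\<^bsub>D\<^esub> (inv_arr D (Assoc T (ob R A) (ob R A) (Unit T))
        \<cdot>\<^bsub>D\<^esub> (?w \<odot>\<^bsub>T\<^esub> (coev \<odot>\<^bsub>T\<^esub> ?U))) \<cdot>\<^bsub>D\<^esub> (?w \<odot>\<^bsub>T\<^esub> inv_arr D m) \<cdot>\<^bsub>D\<^esub> pair A A ?w ev"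
    by (simp add: pair_Comp_right)
  also have "inv_arr D (Assoc T (ob R A) (ob R A) (Unit T)) \<cdot>\<^bsub>D\<^esub> (?w \<odot>\<^bsub>T\<^esub> (coev \<odot>\<^bsub>T\<^esub> ?U))
      = ((?w \<odot>\<^bsub>T\<^esub> coev) \<odot>\<^bsub>T\<^esub> ?U) \<cdot>\<^bsub>D\<^esub> inv_arr D (Assoc T (ob R A) (Unit T) (Unit T))"
    by (simp add: DM.tar_tar)
  also have "((ar R mu \<cdot>\<^bsub>D\<^esub> \<phi> A A) \<odot>\<^bsub>T\<^esub> ?U) \<cdot>\<^bsub>D\<^esub> (((?w \<odot>\<^bsub>T\<^esub> coev) \<odot>\<^bsub>T\<^esub> ?U) \<cdot>\<^bsub>D\<^esub> inv_arr D (Assoc T (ob R A) (Unit T) (Unit T)))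
        \<cdot>\<^bsub>D\<^esub> (?w \<odot>\<^bsub>T\<^esub> inv_arr D m) \<cdot>\<^bsub>D\<^esub> pair A A ?w ev
      = (((ar R mu \<cdot>\<^bsub>D\<^esub> \<phi> A A) \<cdot>\<^bsub>D\<^esub> (?w \<odot>\<^bsub>T\<^esub> coev)) \<odot>\<^bsub>T\<^esub> ?U) \<cdot>\<^bsub>D\<^esub> inv_arr D (Assoc T (ob R A) (Unit T) (Unit T))
        \<cdot>\<^bsub>D\<^esub> (?w \<odot>\<^bsub>T\<^esub> inv_arr D m) \<cdot>\<^bsub>D\<^esub> pair A A ?w ev"
    by (simp add: DM.tar_merge)
  also have "\<dots> = (coev \<odot>\<^bsub>T\<^esub> ?U) \<cdot>\<^bsub>D\<^esub> (((m \<cdot>\<^bsub>D\<^esub> (ev \<odot>\<^bsub>T\<^esub> ?U)) \<odot>\<^bsub>T\<^esub> ?U) \<cdot>\<^bsub>D\<^esub> inv_arr D (Assoc T (ob R A) (Unit T) (Unit T))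
        \<cdot>\<^bsub>D\<^esub> (?w \<odot>\<^bsub>T\<^esub> inv_arr D m)) \<cdot>\<^bsub>D\<^esub> pair A A ?w ev"
    unfolding muphi by (simp add: DM.Comp_tar)
  also have "\<dots> = (coev \<odot>\<^bsub>T\<^esub> ?U) \<cdot>\<^bsub>D\<^esub> (ev \<odot>\<^bsub>T\<^esub> ?U) \<cdot>\<^bsub>D\<^esub> pair A A ?w ev"
    unfolding unit ..
  also have "\<dots> = (coev \<odot>\<^bsub>T\<^esub> ?U) \<cdot>\<^bsub>D\<^esub> inv_arr D m \<cdot>\<^bsub>D\<^esub> ev \<cdot>\<^bsub>D\<^esub> ar R mu"
    unfolding ev_mu by (simp add: pair_Comp[symmetric])
  also have "\<dots> = (pair A A ?w ev \<cdot>\<^bsub>D\<^esub> ar R delta) \<cdot>\<^bsub>D\<^esub> ar R mu"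
    unfolding ev_delta by simp
  also have "\<dots> = pair A A ?w ev \<cdot>\<^bsub>D\<^esub> ar R (delta \<cdot>\<^bsub>C\<^esub> mu)"
    by (simp add: R.ar_Comp)
  finally show "pair A A ?w ev \<cdot>\<^bsub>D\<^esub> ar R ((mu \<odot>\<^bsub>S\<^esub> Idn C A) \<cdot>\<^bsub>C\<^esub> inv_arr C (Assoc S A A A) \<cdot>\<^bsub>C\<^esub> (Idn C A \<odot>\<^bsub>S\<^esub> delta))
      = pair A A ?w ev \<cdot>\<^bsub>D\<^esub> ar R (delta \<cdot>\<^bsub>C\<^esub> mu)" .
qed simp_all

theorem special_frobenius_A: "special_frobenius_algebra C S A mu iota delta epsilon"
proof -
  interpret monoid_object C S A mu iota by (rule monoid_A)
  interpret comonoid_object C S A delta epsilon by (rule comonoid_A)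
  show ?thesis
    by unfold_locales (fact frobenius_left frobenius_right mu_delta)+
qed

subsection \<open>The half-braiding\<close>

abbreviation "u \<equiv> DM.unit_braiding"

text \<open>Both \<open>A \<otimes> x\<close> and \<open>x \<otimes> A\<close> are induced from \<open>R x\<close>, up to unit constraints. The half-braiding of \<open>A\<close>
  is the isomorphism between them that lies over the half-braiding of the unit object of \<open>D\<close>.\<close>

definition braid :: "'o \<Rightarrow> 'm" where
  "braid x = (THE f. hom_type C f = Some (A \<otimes>\<^bsub>S\<^esub> x, x \<otimes>\<^bsub>S\<^esub> A)
     \<and> pair x A (Idn D (ob R x)) ev \<cdot>\<^bsub>D\<^esub> ar R f = u (ob R x) \<cdot>\<^bsub>D\<^esub> pair A x ev (Idn D (ob R x)))"

lemma braid:
  assumes x: "x \<in> Obj C"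
  shows "hom_type C (braid x) = Some (A \<otimes>\<^bsub>S\<^esub> x, x \<otimes>\<^bsub>S\<^esub> A)"
    "pair x A (Idn D (ob R x)) ev \<cdot>\<^bsub>D\<^esub> ar R (braid x) = u (ob R x) \<cdot>\<^bsub>D\<^esub> pair A x ev (Idn D (ob R x))"
proof -
  let ?P = "\<lambda>f. hom_type C f = Some (A \<otimes>\<^bsub>S\<^esub> x, x \<otimes>\<^bsub>S\<^esub> A)
     \<and> pair x A (Idn D (ob R x)) ev \<cdot>\<^bsub>D\<^esub> ar R f = u (ob R x) \<cdot>\<^bsub>D\<^esub> pair A x ev (Idn D (ob R x))"
  have g: "hom_type D (u (ob R x) \<cdot>\<^bsub>D\<^esub> pair A x ev (Idn D (ob R x))) = Some (ob R (A \<otimes>\<^bsub>S\<^esub> x), ob R x \<otimes>\<^bsub>T\<^esub> Unit T)"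
    using x by simp
  have "A \<otimes>\<^bsub>S\<^esub> x \<in> Obj C" using x by simp
  then have "\<exists>f. ?P f"
    by (rule induced_lift[OF ind_A_left[OF x] _ g]) blast
  moreover have "f = g" if "?P f" "?P g" for f g
    by (rule induced_unique[OF ind_A_left[OF x]]) (use that in \<open>simp_all only:\<close>)
  ultimately have "\<exists>!f. ?P f" by blast
  from theI'[OF this] show "hom_type C (braid x) = Some (A \<otimes>\<^bsub>S\<^esub> x, x \<otimes>\<^bsub>S\<^esub> A)"
    "pair x A (Idn D (ob R x)) ev \<cdot>\<^bsub>D\<^esub> ar R (braid x) = u (ob R x) \<cdot>\<^bsub>D\<^esub> pair A x ev (Idn D (ob R x))"
    by (simp_all add: braid_def)
qed

lemma braid_type [simp]: "x \<in> Obj C \<Longrightarrow> hom_type C (braid x) = Some (A \<otimes>\<^bsub>S\<^esub> x, x \<otimes>\<^bsub>S\<^esub> A)"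
  by (rule braid)

lemma braid_iso [simp]: "x \<in> Obj C \<Longrightarrow> iso_arr C (braid x)"
  by (rule induced_iso[OF ind_A_right ind_A_left braid(1) _ _ braid(2)]) simp_all

lemma braid_coev:
  "x \<in> Obj C \<Longrightarrow> ar R (braid x) \<cdot>\<^bsub>D\<^esub> copair A x coev (Idn D (ob R x))
    = copair x A (Idn D (ob R x)) coev \<cdot>\<^bsub>D\<^esub> u (ob R x)"
  by (rule induced_transfer[OF ind_A_right ind_A_left braid(1) _ braid(2)]) simp_all

lemma braid_Comp:
  assumes x [simp]: "x \<in> Obj C" and k: "hom_type D k = r" "r \<noteq> None" "target_of r = ob R (A \<otimes>\<^bsub>S\<^esub> x)"
  shows "pair x A (Idn D (ob R x)) ev \<cdot>\<^bsub>D\<^esub> ar R (braid x) \<cdot>\<^bsub>D\<^esub> k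
    = u (ob R x) \<cdot>\<^bsub>D\<^esub> pair A x ev (Idn D (ob R x)) \<cdot>\<^bsub>D\<^esub> k"
proof -
  obtain q where q [simp]: "hom_type D k = Some (q, ob R (A \<otimes>\<^bsub>S\<^esub> x))" using k by (cases r) auto
  have "(pair x A (Idn D (ob R x)) ev \<cdot>\<^bsub>D\<^esub> ar R (braid x)) \<cdot>\<^bsub>D\<^esub> k
    = (u (ob R x) \<cdot>\<^bsub>D\<^esub> pair A x ev (Idn D (ob R x))) \<cdot>\<^bsub>D\<^esub> k"
    unfolding braid(2)[OF x] ..
  then show ?thesis by simp
qed

end

context ambidextrous_projection
begin

lemma braid_natural:
  assumes f [simp]: "hom_type C f = Some (x, y)"
  shows "braid y \<cdot>\<^bsub>C\<^esub> (Idn C A \<odot>\<^bsub>S\<^esub> f) = (f \<odot>\<^bsub>S\<^esub> Idn C A) \<cdot>\<^bsub>C\<^esub> braid x"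
proof -
  note xy [simp] = C.Obj_of_type[OF f]
  show ?thesis
  proof (rule induced_unique[OF ind_A_left[OF xy(2)]])
    have "pair y A (Idn D (ob R y)) ev \<cdot>\<^bsub>D\<^esub> ar R (braid y \<cdot>\<^bsub>C\<^esub> (Idn C A \<odot>\<^bsub>S\<^esub> f))
        = u (ob R y) \<cdot>\<^bsub>D\<^esub> pair A x ev (ar R f \<cdot>\<^bsub>D\<^esub> Idn D (ob R x))"
      by (simp add: R.ar_Comp braid_Comp pair_ar)
    also have "\<dots> = (u (ob R y) \<cdot>\<^bsub>D\<^esub> (Idn D (Unit T) \<odot>\<^bsub>T\<^esub> ar R f)) \<cdot>\<^bsub>D\<^esub> pair A x ev (Idn D (ob R x))"
      by (subst pair_Comp_right) (auto simp del: D.Comp_Idn)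
    also have "\<dots> = (ar R f \<odot>\<^bsub>T\<^esub> Idn D (Unit T)) \<cdot>\<^bsub>D\<^esub> u (ob R x) \<cdot>\<^bsub>D\<^esub> pair A x ev (Idn D (ob R x))"
      using DM.unit_braiding_natural[of "ar R f" "ob R x" "ob R y"] by simp
    also have "\<dots> = ((ar R f \<odot>\<^bsub>T\<^esub> Idn D (Unit T)) \<cdot>\<^bsub>D\<^esub> pair x A (Idn D (ob R x)) ev) \<cdot>\<^bsub>D\<^esub> ar R (braid x)"
      by (simp add: braid)
    also have "(ar R f \<odot>\<^bsub>T\<^esub> Idn D (Unit T)) \<cdot>\<^bsub>D\<^esub> pair x A (Idn D (ob R x)) ev = pair x A (ar R f) ev"
      by (simp add: pair_Comp[symmetric])
    also have "pair x A (ar R f) ev \<cdot>\<^bsub>D\<^esub> ar R (braid x)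
        = pair y A (Idn D (ob R y)) ev \<cdot>\<^bsub>D\<^esub> ar R ((f \<odot>\<^bsub>S\<^esub> Idn C A) \<cdot>\<^bsub>C\<^esub> braid x)"
      by (simp add: R.ar_Comp pair_ar_Comp)
    finally show "pair y A (Idn D (ob R y)) ev \<cdot>\<^bsub>D\<^esub> ar R (braid y \<cdot>\<^bsub>C\<^esub> (Idn C A \<odot>\<^bsub>S\<^esub> f))
        = pair y A (Idn D (ob R y)) ev \<cdot>\<^bsub>D\<^esub> ar R ((f \<odot>\<^bsub>S\<^esub> Idn C A) \<cdot>\<^bsub>C\<^esub> braid x)" .
  qed simp_all
qed

text \<open>Through \<open>ev\<close>, the hexagon for \<open>braid\<close> becomes the hexagon for the half-braiding of the unit
  object.\<close>

lemma braid_hexagon: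
  assumes x [simp]: "x \<in> Obj C" and y [simp]: "y \<in> Obj C"
  shows "Assoc S x y A \<cdot>\<^bsub>C\<^esub> braid (x \<otimes>\<^bsub>S\<^esub> y) \<cdot>\<^bsub>C\<^esub> Assoc S A x y
    = (Idn C x \<odot>\<^bsub>S\<^esub> braid y) \<cdot>\<^bsub>C\<^esub> Assoc S x A y \<cdot>\<^bsub>C\<^esub> (braid x \<odot>\<^bsub>S\<^esub> Idn C y)"
    (is "?l = ?r")
proof -
  let ?X = "Idn D (ob R x)" and ?Y = "Idn D (ob R y)" and ?U = "Idn D (Unit T)"
  let ?p = "pair x (y \<otimes>\<^bsub>S\<^esub> A) ?X (pair y A ?Y ev)"
  have types: "hom_type C ?l = Some ((A \<otimes>\<^bsub>S\<^esub> x) \<otimes>\<^bsub>S\<^esub> y, x \<otimes>\<^bsub>S\<^esub> (y \<otimes>\<^bsub>S\<^esub> A))"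
    "hom_type C ?r = Some ((A \<otimes>\<^bsub>S\<^esub> x) \<otimes>\<^bsub>S\<^esub> y, x \<otimes>\<^bsub>S\<^esub> (y \<otimes>\<^bsub>S\<^esub> A))" by simp_all
  have xy: "x \<otimes>\<^bsub>S\<^esub> y \<in> Obj C" by simp
  have phi: "pair x y ?X ?Y = inv_arr D (\<phi> x y) \<cdot>\<^bsub>D\<^esub> Idn D (ob R (x \<otimes>\<^bsub>S\<^esub> y))"
    by (simp add: pair_Idn)
  have pA: "?p \<cdot>\<^bsub>D\<^esub> ar R (Assoc S x y A) = Assoc T (ob R x) (ob R y) (Unit T) \<cdot>\<^bsub>D\<^esub>
      (inv_arr D (\<phi> x y) \<odot>\<^bsub>T\<^esub> ?U) \<cdot>\<^bsub>D\<^esub> pair (x \<otimes>\<^bsub>S\<^esub> y) A (Idn D (ob R (x \<otimes>\<^bsub>S\<^esub> y))) ev"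
  proof -
    have "pair (x \<otimes>\<^bsub>S\<^esub> y) A (pair x y ?X ?Y) ev
        = (inv_arr D (\<phi> x y) \<odot>\<^bsub>T\<^esub> ?U) \<cdot>\<^bsub>D\<^esub> pair (x \<otimes>\<^bsub>S\<^esub> y) A (Idn D (ob R (x \<otimes>\<^bsub>S\<^esub> y))) ev"
      unfolding phi by (subst pair_Comp_left) (auto simp del: D.Comp_Idn)
    then show ?thesis by (simp add: pair_Assoc)
  qed
  have Ap: "(?U \<odot>\<^bsub>T\<^esub> inv_arr D (\<phi> x y)) \<cdot>\<^bsub>D\<^esub> pair A (x \<otimes>\<^bsub>S\<^esub> y) ev (Idn D (ob R (x \<otimes>\<^bsub>S\<^esub> y)))
      = pair A (x \<otimes>\<^bsub>S\<^esub> y) ev (pair x y ?X ?Y)"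
    unfolding phi by (subst pair_Comp_right) (auto simp del: D.Comp_Idn)
  have unique: "f = g" if fg [simp]: "hom_type C f = Some (w, x \<otimes>\<^bsub>S\<^esub> (y \<otimes>\<^bsub>S\<^esub> A))"
      "hom_type C g = Some (w, x \<otimes>\<^bsub>S\<^esub> (y \<otimes>\<^bsub>S\<^esub> A))" and eq: "?p \<cdot>\<^bsub>D\<^esub> ar R f = ?p \<cdot>\<^bsub>D\<^esub> ar R g" for f g w
  proof -
    let ?a = "Assoc S x y A"
    let ?k = "Assoc T (ob R x) (ob R y) (Unit T) \<cdot>\<^bsub>D\<^esub> (inv_arr D (\<phi> x y) \<odot>\<^bsub>T\<^esub> ?U)"
    let ?q = "pair (x \<otimes>\<^bsub>S\<^esub> y) A (Idn D (ob R (x \<otimes>\<^bsub>S\<^esub> y))) ev"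
    note [simp] = C.Obj_of_type(1)[OF fg(1)]
    have test: "?p \<cdot>\<^bsub>D\<^esub> ar R h = ?k \<cdot>\<^bsub>D\<^esub> ?q \<cdot>\<^bsub>D\<^esub> ar R (inv_arr C ?a \<cdot>\<^bsub>C\<^esub> h)"
      if [simp]: "hom_type C h = Some (w, x \<otimes>\<^bsub>S\<^esub> (y \<otimes>\<^bsub>S\<^esub> A))" for h
    proof -
      have "?p \<cdot>\<^bsub>D\<^esub> ar R h = (?p \<cdot>\<^bsub>D\<^esub> ar R ?a) \<cdot>\<^bsub>D\<^esub> ar R (inv_arr C ?a \<cdot>\<^bsub>C\<^esub> h)"
        by (simp add: R.ar_Comp R.ar_inv_arr)
      then show ?thesis unfolding pA by simp
    qed
    have "?q \<cdot>\<^bsub>D\<^esub> ar R (inv_arr C ?a \<cdot>\<^bsub>C\<^esub> f) = ?q \<cdot>\<^bsub>D\<^esub> ar R (inv_arr C ?a \<cdot>\<^bsub>C\<^esub> g)"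
      using eq unfolding test[OF fg(1)] test[OF fg(2)]
      by (rule D.iso_cancel_left[rotated -1]) simp_all
    then have "inv_arr C ?a \<cdot>\<^bsub>C\<^esub> f = inv_arr C ?a \<cdot>\<^bsub>C\<^esub> g"
      by (rule induced_unique[OF ind_A_left[OF xy], rotated -1]) simp_all
    then show ?thesis
      by (rule C.iso_cancel_left[rotated -1]) simp_all
  qed
  have "?p \<cdot>\<^bsub>D\<^esub> ar R ?l = (?p \<cdot>\<^bsub>D\<^esub> ar R (Assoc S x y A)) \<cdot>\<^bsub>D\<^esub> ar R (braid (x \<otimes>\<^bsub>S\<^esub> y)) \<cdot>\<^bsub>D\<^esub> ar R (Assoc S A x y)"
    by (simp add: R.ar_Comp)
  also have "\<dots> = Assoc T (ob R x) (ob R y) (Unit T) \<cdot>\<^bsub>D\<^esub> ((inv_arr D (\<phi> x y) \<odot>\<^bsub>T\<^esub> ?U) \<cdot>\<^bsub>D\<^esub> u (ob R (x \<otimes>\<^bsub>S\<^esub> y)))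
      \<cdot>\<^bsub>D\<^esub> pair A (x \<otimes>\<^bsub>S\<^esub> y) ev (Idn D (ob R (x \<otimes>\<^bsub>S\<^esub> y))) \<cdot>\<^bsub>D\<^esub> ar R (Assoc S A x y)"
    unfolding pA by (simp add: braid_Comp)
  also have "(inv_arr D (\<phi> x y) \<odot>\<^bsub>T\<^esub> ?U) \<cdot>\<^bsub>D\<^esub> u (ob R (x \<otimes>\<^bsub>S\<^esub> y))
      = u (ob R x \<otimes>\<^bsub>T\<^esub> ob R y) \<cdot>\<^bsub>D\<^esub> (?U \<odot>\<^bsub>T\<^esub> inv_arr D (\<phi> x y))"
    by (rule DM.unit_braiding_natural[symmetric]) simp
  also have "Assoc T (ob R x) (ob R y) (Unit T) \<cdot>\<^bsub>D\<^esub> (u (ob R x \<otimes>\<^bsub>T\<^esub> ob R y) \<cdot>\<^bsub>D\<^esub> (?U \<odot>\<^bsub>T\<^esub> inv_arr D (\<phi> x y)))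
      \<cdot>\<^bsub>D\<^esub> pair A (x \<otimes>\<^bsub>S\<^esub> y) ev (Idn D (ob R (x \<otimes>\<^bsub>S\<^esub> y))) \<cdot>\<^bsub>D\<^esub> ar R (Assoc S A x y)
      = Assoc T (ob R x) (ob R y) (Unit T) \<cdot>\<^bsub>D\<^esub> u (ob R x \<otimes>\<^bsub>T\<^esub> ob R y) \<cdot>\<^bsub>D\<^esub> ((?U \<odot>\<^bsub>T\<^esub> inv_arr D (\<phi> x y))
      \<cdot>\<^bsub>D\<^esub> pair A (x \<otimes>\<^bsub>S\<^esub> y) ev (Idn D (ob R (x \<otimes>\<^bsub>S\<^esub> y)))) \<cdot>\<^bsub>D\<^esub> ar R (Assoc S A x y)"
    by simp
  also have "\<dots> = (Assoc T (ob R x) (ob R y) (Unit T) \<cdot>\<^bsub>D\<^esub> u (ob R x \<otimes>\<^bsub>T\<^esub> ob R y)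
      \<cdot>\<^bsub>D\<^esub> Assoc T (Unit T) (ob R x) (ob R y)) \<cdot>\<^bsub>D\<^esub> pair (A \<otimes>\<^bsub>S\<^esub> x) y (pair A x ev ?X) ?Y"
    unfolding Ap by (simp add: pair_Assoc)
  also have "\<dots> = ((?X \<odot>\<^bsub>T\<^esub> u (ob R y)) \<cdot>\<^bsub>D\<^esub> Assoc T (ob R x) (Unit T) (ob R y)
      \<cdot>\<^bsub>D\<^esub> (u (ob R x) \<odot>\<^bsub>T\<^esub> ?Y)) \<cdot>\<^bsub>D\<^esub> pair (A \<otimes>\<^bsub>S\<^esub> x) y (pair A x ev ?X) ?Y"
    by (simp only: DM.unit_braiding_hexagon R.ob_Obj x y)
  also have "\<dots> = ?p \<cdot>\<^bsub>D\<^esub> ar R ?r"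
    by (simp add: pair_rules braid)
  finally show ?thesis by (rule unique[OF types])
qed

lemma half_braiding_braid: "half_braiding C S A (restrict braid (Obj C))"
proof
  fix f x y assume "f \<in> Hom C x y"
  then have f: "hom_type C f = Some (x, y)" by simp
  show "restrict braid (Obj C) y \<cdot>\<^bsub>C\<^esub> (Idn C A \<odot>\<^bsub>S\<^esub> f) = (f \<odot>\<^bsub>S\<^esub> Idn C A) \<cdot>\<^bsub>C\<^esub> restrict braid (Obj C) x"
    using braid_natural[OF f] C.Obj_of_type[OF f] by simp
next
  fix x y assume "x \<in> Obj C" "y \<in> Obj C"
  then show "Assoc S x y A \<cdot>\<^bsub>C\<^esub> restrict braid (Obj C) (x \<otimes>\<^bsub>S\<^esub> y) \<cdot>\<^bsub>C\<^esub> Assoc S A x y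
    = (Idn C x \<odot>\<^bsub>S\<^esub> restrict braid (Obj C) y) \<cdot>\<^bsub>C\<^esub> Assoc S x A y \<cdot>\<^bsub>C\<^esub> (restrict braid (Obj C) x \<odot>\<^bsub>S\<^esub> Idn C y)"
    using braid_hexagon by simp
qed simp_all

text \<open>In the same way, that the structure arrows of \<open>A\<close> lie in the center follows from the
  corresponding fact about the structure arrows of the unit object.\<close>

lemma mu_central:
  assumes x [simp]: "x \<in> Obj C"
  shows "braid x \<cdot>\<^bsub>C\<^esub> (mu \<odot>\<^bsub>S\<^esub> Idn C x) = (Idn C x \<odot>\<^bsub>S\<^esub> mu) \<cdot>\<^bsub>C\<^esub> CM.tensor_braiding A braid A braid x"
    (is "?l = ?r")
proof (rule induced_unique[OF ind_A_left[OF x]])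
  let ?X = "Idn D (ob R x)" and ?U = "Idn D (Unit T)"
  show t: "hom_type C ?l = Some ((A \<otimes>\<^bsub>S\<^esub> A) \<otimes>\<^bsub>S\<^esub> x, x \<otimes>\<^bsub>S\<^esub> A)"
    "hom_type C ?r = Some ((A \<otimes>\<^bsub>S\<^esub> A) \<otimes>\<^bsub>S\<^esub> x, x \<otimes>\<^bsub>S\<^esub> A)"
    by (simp_all add: CM.tensor_braiding_def)
  have "pair x A ?X ev \<cdot>\<^bsub>D\<^esub> ar R ?l = (u (ob R x) \<cdot>\<^bsub>D\<^esub> (m \<odot>\<^bsub>T\<^esub> ?X)) \<cdot>\<^bsub>D\<^esub> pair (A \<otimes>\<^bsub>S\<^esub> A) x (pair A A ev ev) ?X"
    by (simp add: pair_rules braid_Comp ev_mu)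
  also have "\<dots> = ((?X \<odot>\<^bsub>T\<^esub> m) \<cdot>\<^bsub>D\<^esub> DM.tensor_braiding (Unit T) u (Unit T) u (ob R x))
      \<cdot>\<^bsub>D\<^esub> pair (A \<otimes>\<^bsub>S\<^esub> A) x (pair A A ev ev) ?X"
    by (simp only: DM.unit_braiding_LUnit R.ob_Obj x)
  also have "\<dots> = pair x A ?X ev \<cdot>\<^bsub>D\<^esub> ar R ?r"
    by (simp add: CM.tensor_braiding_def DM.tensor_braiding_def pair_rules ev_mu braid)
  finally show "pair x A ?X ev \<cdot>\<^bsub>D\<^esub> ar R ?l = pair x A ?X ev \<cdot>\<^bsub>D\<^esub> ar R ?r" .
qed

lemma iota_central:
  assumes x [simp]: "x \<in> Obj C"
  shows "braid x \<cdot>\<^bsub>C\<^esub> (iota \<odot>\<^bsub>S\<^esub> Idn C x) = (Idn C x \<odot>\<^bsub>S\<^esub> iota) \<cdot>\<^bsub>C\<^esub> CM.unit_braiding x"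
    (is "?l = ?r")
proof (rule induced_unique[OF ind_A_left[OF x]])
  let ?X = "Idn D (ob R x)"
  show "hom_type C ?l = Some (Unit S \<otimes>\<^bsub>S\<^esub> x, x \<otimes>\<^bsub>S\<^esub> A)" "hom_type C ?r = Some (Unit S \<otimes>\<^bsub>S\<^esub> x, x \<otimes>\<^bsub>S\<^esub> A)"
    by simp_all
  have l: "LUnit T (ob R x) \<cdot>\<^bsub>D\<^esub> pair (Unit S) x (inv_arr D \<phi>0) ?X = ar R (LUnit S x)"
    and r: "RUnit T (ob R x) \<cdot>\<^bsub>D\<^esub> pair x (Unit S) ?X (inv_arr D \<phi>0) = ar R (RUnit S x)"
    using pair_unit[of x ?X "ob R x"] by simp_all
  have "pair x A ?X ev \<cdot>\<^bsub>D\<^esub> ar R ?l = inv_arr D (RUnit T (ob R x)) \<cdot>\<^bsub>D\<^esub> ar R (LUnit S x)"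
    unfolding l[symmetric] by (simp add: pair_rules braid_Comp ev_iota DM.unit_braiding_def)
  also have "\<dots> = inv_arr D (RUnit T (ob R x)) \<cdot>\<^bsub>D\<^esub> ar R (RUnit S x) \<cdot>\<^bsub>D\<^esub> ar R (CM.unit_braiding x)"
    by (simp add: CM.unit_braiding_def R.ar_Comp R.ar_inv_arr)
  also have "\<dots> = pair x A ?X ev \<cdot>\<^bsub>D\<^esub> ar R ?r"
    unfolding r[symmetric] by (simp add: pair_rules ev_iota)
  finally show "pair x A ?X ev \<cdot>\<^bsub>D\<^esub> ar R ?l = pair x A ?X ev \<cdot>\<^bsub>D\<^esub> ar R ?r" .
qed

lemma delta_central:
  assumes x [simp]: "x \<in> Obj C"
  shows "CM.tensor_braiding A braid A braid x \<cdot>\<^bsub>C\<^esub> (delta \<odot>\<^bsub>S\<^esub> Idn C x) = (Idn C x \<odot>\<^bsub>S\<^esub> delta) \<cdot>\<^bsub>C\<^esub> braid x"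
    (is "?l = ?r")
proof (rule induced_counique[OF ind_A_right[OF x]])
  let ?X = "Idn D (ob R x)" and ?U = "Idn D (Unit T)"
  let ?t = "DM.tensor_braiding (Unit T) u (Unit T) u (ob R x)"
  show t: "hom_type C ?l = Some (A \<otimes>\<^bsub>S\<^esub> x, x \<otimes>\<^bsub>S\<^esub> (A \<otimes>\<^bsub>S\<^esub> A))"
    "hom_type C ?r = Some (A \<otimes>\<^bsub>S\<^esub> x, x \<otimes>\<^bsub>S\<^esub> (A \<otimes>\<^bsub>S\<^esub> A))"
    by (simp_all add: CM.tensor_braiding_def)
  have t [simp]: "hom_type D ?t = Some ((Unit T \<otimes>\<^bsub>T\<^esub> Unit T) \<otimes>\<^bsub>T\<^esub> ob R x, ob R x \<otimes>\<^bsub>T\<^esub> (Unit T \<otimes>\<^bsub>T\<^esub> Unit T))"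
    by (simp add: DM.tensor_braiding_def)
  have inv: "?t \<cdot>\<^bsub>D\<^esub> (inv_arr D m \<odot>\<^bsub>T\<^esub> ?X) = (?X \<odot>\<^bsub>T\<^esub> inv_arr D m) \<cdot>\<^bsub>D\<^esub> u (ob R x)"
  proof (rule D.iso_cancel_left[of "?X \<odot>\<^bsub>T\<^esub> m"])
    have "(?X \<odot>\<^bsub>T\<^esub> m) \<cdot>\<^bsub>D\<^esub> ?t \<cdot>\<^bsub>D\<^esub> (inv_arr D m \<odot>\<^bsub>T\<^esub> ?X) = ((?X \<odot>\<^bsub>T\<^esub> m) \<cdot>\<^bsub>D\<^esub> ?t) \<cdot>\<^bsub>D\<^esub> (inv_arr D m \<odot>\<^bsub>T\<^esub> ?X)"
      by simp
    also have "\<dots> = (u (ob R x) \<cdot>\<^bsub>D\<^esub> (m \<odot>\<^bsub>T\<^esub> ?X)) \<cdot>\<^bsub>D\<^esub> (inv_arr D m \<odot>\<^bsub>T\<^esub> ?X)"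
      by (simp only: DM.unit_braiding_LUnit R.ob_Obj x)
    also have "\<dots> = (?X \<odot>\<^bsub>T\<^esub> m) \<cdot>\<^bsub>D\<^esub> (?X \<odot>\<^bsub>T\<^esub> inv_arr D m) \<cdot>\<^bsub>D\<^esub> u (ob R x)"
      by (simp add: DM.tar_merge)
    finally show "(?X \<odot>\<^bsub>T\<^esub> m) \<cdot>\<^bsub>D\<^esub> ?t \<cdot>\<^bsub>D\<^esub> (inv_arr D m \<odot>\<^bsub>T\<^esub> ?X) = (?X \<odot>\<^bsub>T\<^esub> m) \<cdot>\<^bsub>D\<^esub> (?X \<odot>\<^bsub>T\<^esub> inv_arr D m) \<cdot>\<^bsub>D\<^esub> u (ob R x)" .
  qed simp_all
  have "ar R ?l \<cdot>\<^bsub>D\<^esub> copair A x coev ?X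
      = copair x (A \<otimes>\<^bsub>S\<^esub> A) ?X (copair A A coev coev) \<cdot>\<^bsub>D\<^esub> ?t \<cdot>\<^bsub>D\<^esub> (inv_arr D m \<odot>\<^bsub>T\<^esub> ?X)"
    by (simp add: CM.tensor_braiding_def DM.tensor_braiding_def copair_rules delta_coev braid_coev)
  also have "\<dots> = ar R ?r \<cdot>\<^bsub>D\<^esub> copair A x coev ?X"
    unfolding inv by (simp add: copair_rules delta_coev braid_coev)
  finally show "ar R ?l \<cdot>\<^bsub>D\<^esub> copair A x coev ?X = ar R ?r \<cdot>\<^bsub>D\<^esub> copair A x coev ?X" .
qed

lemma epsilon_central:
  assumes x [simp]: "x \<in> Obj C"
  shows "CM.unit_braiding x \<cdot>\<^bsub>C\<^esub> (epsilon \<odot>\<^bsub>S\<^esub> Idn C x) = (Idn C x \<odot>\<^bsub>S\<^esub> epsilon) \<cdot>\<^bsub>C\<^esub> braid x"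
    (is "?l = ?r")
proof (rule induced_counique[OF ind_A_right[OF x]])
  let ?X = "Idn D (ob R x)"
  show "hom_type C ?l = Some (A \<otimes>\<^bsub>S\<^esub> x, x \<otimes>\<^bsub>S\<^esub> Unit S)" "hom_type C ?r = Some (A \<otimes>\<^bsub>S\<^esub> x, x \<otimes>\<^bsub>S\<^esub> Unit S)"
    by simp_all
  have l: "ar R (LUnit S x) \<cdot>\<^bsub>D\<^esub> copair (Unit S) x \<phi>0 ?X = LUnit T (ob R x)"
    and r: "ar R (RUnit S x) \<cdot>\<^bsub>D\<^esub> copair x (Unit S) ?X \<phi>0 = RUnit T (ob R x)"
    using copair_unit[of x ?X "ob R x"] by simp_all
  have "ar R ?l \<cdot>\<^bsub>D\<^esub> copair A x coev ?X = ar R (inv_arr C (RUnit S x)) \<cdot>\<^bsub>D\<^esub> LUnit T (ob R x)"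
    unfolding l[symmetric] by (simp add: copair_rules CM.unit_braiding_def epsilon_coev)
  also have "\<dots> = ar R (inv_arr C (RUnit S x)) \<cdot>\<^bsub>D\<^esub> RUnit T (ob R x) \<cdot>\<^bsub>D\<^esub> u (ob R x)"
    by (simp add: DM.unit_braiding_def)
  also have "\<dots> = ar R ?r \<cdot>\<^bsub>D\<^esub> copair A x coev ?X"
    unfolding r[symmetric] by (simp add: copair_rules epsilon_coev braid_coev R.ar_inv_arr)
  finally show "ar R ?l \<cdot>\<^bsub>D\<^esub> copair A x coev ?X = ar R ?r \<cdot>\<^bsub>D\<^esub> copair A x coev ?X" .
qed

text \<open>The half-braiding of the unit object is natural, and its component at the unit is the identity.\<close>

lemma mu_commutative: "mu \<cdot>\<^bsub>C\<^esub> braid A = mu"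
proof (rule induced_unique[OF ind_A])
  let ?w = "Idn D (ob R A)" and ?U = "Idn D (Unit T)"
  have "ev \<cdot>\<^bsub>D\<^esub> ar R (mu \<cdot>\<^bsub>C\<^esub> braid A) = (ev \<cdot>\<^bsub>D\<^esub> ar R mu) \<cdot>\<^bsub>D\<^esub> ar R (braid A)"
    by (simp add: R.ar_Comp)
  also have "ev \<cdot>\<^bsub>D\<^esub> ar R mu = (m \<cdot>\<^bsub>D\<^esub> (ev \<odot>\<^bsub>T\<^esub> ?U)) \<cdot>\<^bsub>D\<^esub> pair A A ?w ev"
    by (simp add: ev_mu pair_Comp[symmetric])
  also have "((m \<cdot>\<^bsub>D\<^esub> (ev \<odot>\<^bsub>T\<^esub> ?U)) \<cdot>\<^bsub>D\<^esub> pair A A ?w ev) \<cdot>\<^bsub>D\<^esub> ar R (braid A)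
      = m \<cdot>\<^bsub>D\<^esub> ((ev \<odot>\<^bsub>T\<^esub> ?U) \<cdot>\<^bsub>D\<^esub> u (ob R A)) \<cdot>\<^bsub>D\<^esub> pair A A ev ?w"
    by (simp add: braid)
  also have "(ev \<odot>\<^bsub>T\<^esub> ?U) \<cdot>\<^bsub>D\<^esub> u (ob R A) = u (Unit T) \<cdot>\<^bsub>D\<^esub> (?U \<odot>\<^bsub>T\<^esub> ev)"
    by (rule DM.unit_braiding_natural[symmetric]) simp
  also have "m \<cdot>\<^bsub>D\<^esub> (u (Unit T) \<cdot>\<^bsub>D\<^esub> (?U \<odot>\<^bsub>T\<^esub> ev)) \<cdot>\<^bsub>D\<^esub> pair A A ev ?w = ev \<cdot>\<^bsub>D\<^esub> ar R mu"
    by (simp add: ev_mu DM.unit_braiding_Unit pair_Comp[symmetric])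
  finally show "ev \<cdot>\<^bsub>D\<^esub> ar R (mu \<cdot>\<^bsub>C\<^esub> braid A) = ev \<cdot>\<^bsub>D\<^esub> ar R mu" .
qed simp_all

theorem commutative_frobenius_A:
  defines "P \<equiv> (A, restrict braid (Obj C))"
  shows "commutative_frobenius_algebra (center C S) (center_tensor C S) (center_braiding C S) P
    (center_tob C S P P, P, mu) (center_unit C S, P, iota) (P, center_tob C S P P, delta) (P, center_unit C S, epsilon)"
proof -
  interpret special_frobenius_algebra C S A mu iota delta epsilon by (rule special_frobenius_A)
  note hb = half_braiding_braid
  have t: "CM.tensor_braiding A (restrict braid (Obj C)) A (restrict braid (Obj C)) x = CM.tensor_braiding A braid A braid x"
    if "x \<in> Obj C" for x
    using that by (simp add: CM.tensor_braiding_def)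
  have central: "CM.central (center_tob C S P P) P mu" "CM.central (center_unit C S) P iota"
    "CM.central P (center_tob C S P P) delta" "CM.central P (center_unit C S) epsilon"
    using CM.half_braiding_tensor[OF hb hb] CM.half_braiding_unit hb
    by (simp_all add: P_def CM.center_tob_tensor_braiding CM.center_unit_unit_braiding CM.central_iff t
        mu_central iota_central delta_central epsilon_central)
  show ?thesis
    unfolding P_def
    by (rule CM.commutative_frobenius_algebra_center[OF hb frobenius_algebra_axioms])
      (use central mu_commutative in \<open>simp_all add: P_def\<close>)
qed

end

section \<open>Constructions with finite groupoids\<close>

text \<open>A groupoid from total functions: what the definition of finite groupoids requires outside of the
  carriers is supplied here.\<close>

definition mk_gpd ::
  "'a elem set \<Rightarrow> 'a elem set \<Rightarrow> ('a elem \<Rightarrow> 'a elem) \<Rightarrow> ('a elem \<Rightarrow> 'a elem) \<Rightarrow> ('a elem \<Rightarrow> 'a elem)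
    \<Rightarrow> ('a elem \<Rightarrow> 'a elem \<Rightarrow> 'a elem) \<Rightarrow> 'a gpd" where
  "mk_gpd O' A d c i m = \<lparr>Obj = O', Arr = A, Dom = restrict d A, Cod = restrict c A, Idn = restrict i O',
     Comp = (\<lambda>g f. if f \<in> A \<and> g \<in> A \<and> c f = d g then m g f else undefined)\<rparr>"

lemma hom_type_mk_gpd [simp]:
  "hom_type (mk_gpd O' A d c i m) f = (if f \<in> A then Some (d f, c f) else None)"
  by (simp add: hom_type_def mk_gpd_def)

lemma finite_groupoid_mk_gpd:
  assumes fin: "finite O'" "finite A"
    and d: "\<And>f. f \<in> A \<Longrightarrow> d f \<in> O'" and c: "\<And>f. f \<in> A \<Longrightarrow> c f \<in> O'"
    and i: "\<And>x. x \<in> O' \<Longrightarrow> i x \<in> A \<and> d (i x) = x \<and> c (i x) = x"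
    and m: "\<And>f g. \<lbrakk>f \<in> A; g \<in> A; c f = d g\<rbrakk> \<Longrightarrow> m g f \<in> A \<and> d (m g f) = d f \<and> c (m g f) = c g"
    and l: "\<And>f. f \<in> A \<Longrightarrow> m (i (c f)) f = f" and r: "\<And>f. f \<in> A \<Longrightarrow> m f (i (d f)) = f"
    and a: "\<And>f g h. \<lbrakk>f \<in> A; g \<in> A; h \<in> A; c f = d g; c g = d h\<rbrakk> \<Longrightarrow> m (m h g) f = m h (m g f)"
    and inv: "\<And>f. f \<in> A \<Longrightarrow> \<exists>g\<in>A. d g = c f \<and> c g = d f \<and> m g f = i (d f) \<and> m f g = i (c f)"
  shows "finite_groupoid (mk_gpd O' A d c i m)"
proof -
  let ?G = "mk_gpd O' A d c i m"
  have cat: "category ?G"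
  proof
    fix f g x y z
    assume "f \<in> Hom ?G x y" "g \<in> Hom ?G y z"
    then show "g \<cdot>\<^bsub>?G\<^esub> f \<in> Hom ?G x z"
      using m[of f g] by (auto simp: mk_gpd_def Hom_def simp del: Hom_type)
  next
    fix f x y assume "f \<in> Hom ?G x y"
    then show "Idn ?G y \<cdot>\<^bsub>?G\<^esub> f = f" "f \<cdot>\<^bsub>?G\<^esub> Idn ?G x = f"
      using i[of x] i[of y] d[of f] c[of f] l[of f] r[of f]
      by (auto simp: mk_gpd_def Hom_def simp del: Hom_type)
  next
    fix f g h w x y z assume "f \<in> Hom ?G w x" "g \<in> Hom ?G x y" "h \<in> Hom ?G y z"
    then show "(h \<cdot>\<^bsub>?G\<^esub> g) \<cdot>\<^bsub>?G\<^esub> f = h \<cdot>\<^bsub>?G\<^esub> (g \<cdot>\<^bsub>?G\<^esub> f)"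
      using m[of f g] m[of g h] a[of f g h] by (auto simp: mk_gpd_def Hom_def simp del: Hom_type)
  next
    fix x assume "x \<in> Obj ?G"
    then show "Idn ?G x \<in> Hom ?G x x"
      using i[of x] by (auto simp: mk_gpd_def Hom_def simp del: Hom_type)
  qed (auto simp: mk_gpd_def d c)
  have iso: "iso_arr ?G f" if "f \<in> Arr ?G" for f
  proof -
    have f: "f \<in> A" using that by (simp add: mk_gpd_def)
    obtain g where "g \<in> A" "d g = c f" "c g = d f" "m g f = i (d f)" "m f g = i (c f)"
      using inv[OF f] by auto
    then have "inverses ?G f g"
      using f d[OF f] c[OF f] by (auto simp: inverses_def mk_gpd_def Hom_def simp del: Hom_type)
    then show ?thesis by (auto simp: iso_arr_def)
  qed
  show ?thesis
    unfolding finite_groupoid_def using cat iso fin by (auto simp: mk_gpd_def)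
qed

lemma finite_groupoidD:
  assumes "finite_groupoid G"
  shows "category G" "finite (Obj G)" "finite (Arr G)"
    "hom_type G f \<noteq> None \<Longrightarrow> iso_arr G f"
  using assms by (auto simp: finite_groupoid_def hom_type_def split: if_splits)

lemma gpd_functorD:
  assumes "gpd_functor H G u"
  shows "finite_groupoid H" "finite_groupoid G" "is_functor H G u" "src u = H" "tgt u = G"
    "category H" "category G" "is_cell1 u"
  using assms by (auto simp: gpd_functor_def finite_groupoid_def is_cell1_def)

lemma gpd_functorI:
  assumes "finite_groupoid H" "finite_groupoid G" "src u = H" "tgt u = G"
    "ob u \<in> extensional (Obj H)" "ar u \<in> extensional (Arr H)"
    and "\<And>x. x \<in> Obj H \<Longrightarrow> ob u x \<in> Obj G"
    and "\<And>f x y. hom_type H f = Some (x, y) \<Longrightarrow> hom_type G (ar u f) = Some (ob u x, ob u y)"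
    and "\<And>x. x \<in> Obj H \<Longrightarrow> ar u (Idn H x) = Idn G (ob u x)"
    and "\<And>f g x y z. \<lbrakk>hom_type H f = Some (x, y); hom_type H g = Some (y, z)\<rbrakk>
      \<Longrightarrow> ar u (g \<cdot>\<^bsub>H\<^esub> f) = ar u g \<cdot>\<^bsub>G\<^esub> ar u f"
  shows "gpd_functor H G u"
  unfolding gpd_functor_def is_functor_def is_functor_axioms_def
  using assms by (auto dest: finite_groupoidD)

lemma cell1_eqI:
  assumes "gpd_functor H G u" "gpd_functor H G v"
    and "\<And>x. x \<in> Obj H \<Longrightarrow> ob u x = ob v x"
    and "\<And>f x y. hom_type H f = Some (x, y) \<Longrightarrow> ar u f = ar v f"
  shows "u = v"
proof -
  have "ob u = ob v"
    using assms(1-3) unfolding gpd_functor_def by (intro extensionalityI[of _ "Obj H"]) auto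
  moreover have "ar u = ar v"
    using assms(1,2,4) unfolding gpd_functor_def
    by (intro extensionalityI[of _ "Arr H"]) (auto simp: hom_type_Arr)
  ultimately show ?thesis
    using assms(1,2) unfolding gpd_functor_def by (cases u; cases v) auto
qed

lemma id1_simps [simp]:
  "src (id1 G) = G" "tgt (id1 G) = G" "x \<in> Obj G \<Longrightarrow> ob (id1 G) x = x"
  "hom_type G f = r \<Longrightarrow> r \<noteq> None \<Longrightarrow> ar (id1 G) f = f"
  by (auto simp: id1_def hom_type_def split: if_splits)

lemma comp1_simps [simp]:
  "src (u \<circ>1 v) = src v" "tgt (u \<circ>1 v) = tgt u"
  "x \<in> Obj (src v) \<Longrightarrow> ob (u \<circ>1 v) x = ob u (ob v x)"
  "hom_type (src v) f = r \<Longrightarrow> r \<noteq> None \<Longrightarrow> ar (u \<circ>1 v) f = ar u (ar v f)"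
  by (auto simp: comp1_def hom_type_def split: if_splits)

lemma gpd_functor_id1: "finite_groupoid G \<Longrightarrow> gpd_functor G G (id1 G)"
proof -
  assume G: "finite_groupoid G"
  interpret category G using G by (simp add: finite_groupoidD)
  show ?thesis by (rule gpd_functorI[OF G G]) (auto simp: Obj_of_type, auto simp: id1_def)
qed

lemma gpd_functor_comp1:
  assumes v: "gpd_functor K H v" and u: "gpd_functor H G u"
  shows "gpd_functor K G (u \<circ>1 v)"
proof -
  interpret v: is_functor K H v using gpd_functorD[OF v] by simp
  interpret u: is_functor H G u using gpd_functorD[OF u] by simp
  have [simp]: "src v = K" "tgt u = G" using u v by (simp_all add: gpd_functorD)
  show ?thesis
    by (rule gpd_functorI)
      (use gpd_functorD[OF v] gpd_functorD[OF u] v.source.Obj_of_type in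
        \<open>auto simp: v.ar_Comp u.ar_Comp\<close>, auto simp: comp1_def)
qed

subsection \<open>Products\<close>

lemma gpd_prod_eq:
  "gpd_prod G1 G2 = mk_gpd (case_prod Tup ` (Obj G1 \<times> Obj G2)) (case_prod Tup ` (Arr G1 \<times> Arr G2))
     (\<lambda>f. Tup (Dom G1 (tfst f)) (Dom G2 (tsnd f))) (\<lambda>f. Tup (Cod G1 (tfst f)) (Cod G2 (tsnd f)))
     (\<lambda>x. Tup (Idn G1 (tfst x)) (Idn G2 (tsnd x)))
     (\<lambda>g f. Tup (tfst g \<cdot>\<^bsub>G1\<^esub> tfst f) (tsnd g \<cdot>\<^bsub>G2\<^esub> tsnd f))"
  unfolding gpd_prod_def mk_gpd_def Let_def by (auto simp: fun_eq_iff)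

lemma gpd_prod_simps [simp]:
  "Tup x y \<in> Obj (gpd_prod G1 G2) \<longleftrightarrow> x \<in> Obj G1 \<and> y \<in> Obj G2"
  "hom_type (gpd_prod G1 G2) (Tup f g) = Some (z, w) \<longleftrightarrow>
    (\<exists>x y x' y'. z = Tup x y \<and> w = Tup x' y' \<and> hom_type G1 f = Some (x, x') \<and> hom_type G2 g = Some (y, y'))"
  "x \<in> Obj G1 \<Longrightarrow> y \<in> Obj G2 \<Longrightarrow> Idn (gpd_prod G1 G2) (Tup x y) = Tup (Idn G1 x) (Idn G2 y)"
  "\<lbrakk>hom_type G1 f = Some (x, x'); hom_type G1 f' = Some (x', x''); hom_type G2 g = Some (y, y');
    hom_type G2 g' = Some (y', y'')\<rbrakk>
    \<Longrightarrow> Tup f' g' \<cdot>\<^bsub>gpd_prod G1 G2\<^esub> Tup f g = Tup (f' \<cdot>\<^bsub>G1\<^esub> f) (g' \<cdot>\<^bsub>G2\<^esub> g)"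
  unfolding gpd_prod_eq by (auto simp: image_iff hom_type_def mk_gpd_def split: if_splits)

lemma gpd_prod_ObjE:
  assumes "z \<in> Obj (gpd_prod G1 G2)"
  obtains x y where "z = Tup x y" "x \<in> Obj G1" "y \<in> Obj G2"
  using assms unfolding gpd_prod_eq by (auto simp: mk_gpd_def)

lemma gpd_prod_typeE:
  assumes "hom_type (gpd_prod G1 G2) h = Some (z, w)"
  obtains f g x x' y y' where "h = Tup f g" "z = Tup x y" "w = Tup x' y'"
    "hom_type G1 f = Some (x, x')" "hom_type G2 g = Some (y, y')"
proof -
  obtain f g where h: "h = Tup f g"
    using assms unfolding gpd_prod_eq by (auto split: if_splits)
  show thesis using assms that unfolding h by (auto simp: h)
qed

lemma finite_groupoid_prod:
  assumes "finite_groupoid G1" "finite_groupoid G2"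
  shows "finite_groupoid (gpd_prod G1 G2)"
proof -
  interpret G1: category G1 using assms by (simp add: finite_groupoidD)
  interpret G2: category G2 using assms by (simp add: finite_groupoidD)
  have arr [simp]: "f \<in> Arr G1 \<Longrightarrow> hom_type G1 f = Some (Dom G1 f, Cod G1 f)"
    "g \<in> Arr G2 \<Longrightarrow> hom_type G2 g = Some (Dom G2 g, Cod G2 g)" for f g
    by (simp_all add: hom_type_Arr)
  have Id1: "Idn G1 x \<in> Arr G1 \<and> Dom G1 (Idn G1 x) = x \<and> Cod G1 (Idn G1 x) = x" if "x \<in> Obj G1" for x
    using hom_typeD[OF G1.type_Idn[OF that]] by simp
  have Id2: "Idn G2 x \<in> Arr G2 \<and> Dom G2 (Idn G2 x) = x \<and> Cod G2 (Idn G2 x) = x" if "x \<in> Obj G2" for x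
    using hom_typeD[OF G2.type_Idn[OF that]] by simp
  have C1: "g \<cdot>\<^bsub>G1\<^esub> f \<in> Arr G1 \<and> Dom G1 (g \<cdot>\<^bsub>G1\<^esub> f) = Dom G1 f \<and> Cod G1 (g \<cdot>\<^bsub>G1\<^esub> f) = Cod G1 g"
    if "f \<in> Arr G1" "g \<in> Arr G1" "Cod G1 f = Dom G1 g" for f g
  proof -
    have "hom_type G1 (g \<cdot>\<^bsub>G1\<^esub> f) = Some (Dom G1 f, Cod G1 g)" using that by simp
    from hom_typeD[OF this] show ?thesis by blast
  qed
  have C2: "g \<cdot>\<^bsub>G2\<^esub> f \<in> Arr G2 \<and> Dom G2 (g \<cdot>\<^bsub>G2\<^esub> f) = Dom G2 f \<and> Cod G2 (g \<cdot>\<^bsub>G2\<^esub> f) = Cod G2 g"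
    if "f \<in> Arr G2" "g \<in> Arr G2" "Cod G2 f = Dom G2 g" for f g
  proof -
    have "hom_type G2 (g \<cdot>\<^bsub>G2\<^esub> f) = Some (Dom G2 f, Cod G2 g)" using that by simp
    from hom_typeD[OF this] show ?thesis by blast
  qed
  have inv: "\<exists>h. h \<in> Arr G \<and> Dom G h = Cod G f \<and> Cod G h = Dom G f \<and> h \<cdot>\<^bsub>G\<^esub> f = Idn G (Dom G f) \<and> f \<cdot>\<^bsub>G\<^esub> h = Idn G (Cod G f)"
    if "f \<in> Arr G" "finite_groupoid G" for f and G :: "'a gpd"
    using that unfolding finite_groupoid_def iso_arr_def inverses_def Hom_def by blast
  show ?thesis
    unfolding gpd_prod_eq
  proof (rule finite_groupoid_mk_gpd)
    fix f assume "f \<in> case_prod Tup ` (Arr G1 \<times> Arr G2)"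
    then obtain f1 f2 where f: "f = Tup f1 f2" "f1 \<in> Arr G1" "f2 \<in> Arr G2" by auto
    obtain h1 where "h1 \<in> Arr G1" "Dom G1 h1 = Cod G1 f1" "Cod G1 h1 = Dom G1 f1"
      "h1 \<cdot>\<^bsub>G1\<^esub> f1 = Idn G1 (Dom G1 f1)" "f1 \<cdot>\<^bsub>G1\<^esub> h1 = Idn G1 (Cod G1 f1)"
      using inv[OF f(2) assms(1)] by auto
    moreover obtain h2 where "h2 \<in> Arr G2" "Dom G2 h2 = Cod G2 f2" "Cod G2 h2 = Dom G2 f2"
      "h2 \<cdot>\<^bsub>G2\<^esub> f2 = Idn G2 (Dom G2 f2)" "f2 \<cdot>\<^bsub>G2\<^esub> h2 = Idn G2 (Cod G2 f2)"
      using inv[OF f(3) assms(2)] by auto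
    ultimately show "\<exists>g\<in>case_prod Tup ` (Arr G1 \<times> Arr G2).
      Tup (Dom G1 (tfst g)) (Dom G2 (tsnd g)) = Tup (Cod G1 (tfst f)) (Cod G2 (tsnd f)) \<and>
      Tup (Cod G1 (tfst g)) (Cod G2 (tsnd g)) = Tup (Dom G1 (tfst f)) (Dom G2 (tsnd f)) \<and>
      Tup (tfst g \<cdot>\<^bsub>G1\<^esub> tfst f) (tsnd g \<cdot>\<^bsub>G2\<^esub> tsnd f) =
      Tup (Idn G1 (tfst (Tup (Dom G1 (tfst f)) (Dom G2 (tsnd f))))) (Idn G2 (tsnd (Tup (Dom G1 (tfst f)) (Dom G2 (tsnd f))))) \<and>
      Tup (tfst f \<cdot>\<^bsub>G1\<^esub> tfst g) (tsnd f \<cdot>\<^bsub>G2\<^esub> tsnd g) =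
      Tup (Idn G1 (tfst (Tup (Cod G1 (tfst f)) (Cod G2 (tsnd f))))) (Idn G2 (tsnd (Tup (Cod G1 (tfst f)) (Cod G2 (tsnd f)))))"
      unfolding f(1) by (intro bexI[of _ "Tup h1 h2"]) auto
  qed (use assms finite_groupoidD(2,3) in \<open>auto simp: Id1 Id2 C1 C2 image_iff G1.dom_closed G2.dom_closed
      G1.cod_closed G2.cod_closed\<close>)
qed

lemma proj_simps [simp]:
  "src (proj1 G1 G2) = gpd_prod G1 G2" "tgt (proj1 G1 G2) = G1"
  "src (proj2 G1 G2) = gpd_prod G1 G2" "tgt (proj2 G1 G2) = G2"
  "x \<in> Obj G1 \<Longrightarrow> y \<in> Obj G2 \<Longrightarrow> ob (proj1 G1 G2) (Tup x y) = x"
  "x \<in> Obj G1 \<Longrightarrow> y \<in> Obj G2 \<Longrightarrow> ob (proj2 G1 G2) (Tup x y) = y"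
  "hom_type G1 f = r \<Longrightarrow> hom_type G2 g = s \<Longrightarrow> r \<noteq> None \<Longrightarrow> s \<noteq> None \<Longrightarrow> ar (proj1 G1 G2) (Tup f g) = f"
  "hom_type G1 f = r \<Longrightarrow> hom_type G2 g = s \<Longrightarrow> r \<noteq> None \<Longrightarrow> s \<noteq> None \<Longrightarrow> ar (proj2 G1 G2) (Tup f g) = g"
  by (auto simp: proj1_def proj2_def gpd_prod_eq mk_gpd_def hom_type_def image_iff split: if_splits)

lemma prod1_simps [simp]:
  "src (prod1 u v) = gpd_prod (src u) (src v)" "tgt (prod1 u v) = gpd_prod (tgt u) (tgt v)"
  "x \<in> Obj (src u) \<Longrightarrow> y \<in> Obj (src v) \<Longrightarrow> ob (prod1 u v) (Tup x y) = Tup (ob u x) (ob v y)"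
  "hom_type (src u) f = r \<Longrightarrow> hom_type (src v) g = s \<Longrightarrow> r \<noteq> None \<Longrightarrow> s \<noteq> None
    \<Longrightarrow> ar (prod1 u v) (Tup f g) = Tup (ar u f) (ar v g)"
  by (auto simp: prod1_def gpd_prod_eq mk_gpd_def hom_type_def image_iff split: if_splits)

lemma gpd_functor_proj:
  assumes "finite_groupoid G1" "finite_groupoid G2"
  shows "gpd_functor (gpd_prod G1 G2) G1 (proj1 G1 G2)" "gpd_functor (gpd_prod G1 G2) G2 (proj2 G1 G2)"
proof -
  interpret G1: category G1 using assms by (simp add: finite_groupoidD)
  interpret G2: category G2 using assms by (simp add: finite_groupoidD)
  note G = finite_groupoid_prod[OF assms]
  show "gpd_functor (gpd_prod G1 G2) G1 (proj1 G1 G2)"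
    by (rule gpd_functorI[OF G assms(1)])
      (auto elim!: gpd_prod_ObjE gpd_prod_typeE simp: G1.Obj_of_type G2.Obj_of_type, auto simp: proj1_def)
  show "gpd_functor (gpd_prod G1 G2) G2 (proj2 G1 G2)"
    by (rule gpd_functorI[OF G assms(2)])
      (auto elim!: gpd_prod_ObjE gpd_prod_typeE simp: G1.Obj_of_type G2.Obj_of_type, auto simp: proj2_def)
qed

lemma gpd_functor_prod1:
  assumes u: "gpd_functor H1 G1 u" and v: "gpd_functor H2 G2 v"
  shows "gpd_functor (gpd_prod H1 H2) (gpd_prod G1 G2) (prod1 u v)"
proof -
  interpret u: is_functor H1 G1 u using gpd_functorD[OF u] by simp
  interpret v: is_functor H2 G2 v using gpd_functorD[OF v] by simp
  have [simp]: "src u = H1" "tgt u = G1" "src v = H2" "tgt v = G2" using u v by (simp_all add: gpd_functorD)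
  show ?thesis
    by (rule gpd_functorI)
      (use finite_groupoid_prod gpd_functorD[OF u] gpd_functorD[OF v] in
        \<open>auto elim!: gpd_prod_ObjE gpd_prod_typeE simp: u.ar_Comp v.ar_Comp u.source.Obj_of_type v.source.Obj_of_type\<close>, auto simp: prod1_def)
qed

definition pairing :: "'a cell1 \<Rightarrow> 'a cell1 \<Rightarrow> 'a cell1" where
  "pairing u v = \<lparr>ob = (\<lambda>x\<in>Obj (src u). Tup (ob u x) (ob v x)),
     ar = (\<lambda>f\<in>Arr (src u). Tup (ar u f) (ar v f)), src = src u, tgt = gpd_prod (tgt u) (tgt v)\<rparr>"

lemma pairing_simps [simp]:
  "src (pairing u v) = src u" "tgt (pairing u v) = gpd_prod (tgt u) (tgt v)"
  "x \<in> Obj (src u) \<Longrightarrow> ob (pairing u v) x = Tup (ob u x) (ob v x)"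
  "hom_type (src u) f = r \<Longrightarrow> r \<noteq> None \<Longrightarrow> ar (pairing u v) f = Tup (ar u f) (ar v f)"
  by (auto simp: pairing_def hom_type_def split: if_splits)

lemma gpd_functor_pairing:
  assumes u: "gpd_functor L G1 u" and v: "gpd_functor L G2 v"
  shows "gpd_functor L (gpd_prod G1 G2) (pairing u v)"
proof -
  interpret u: is_functor L G1 u using gpd_functorD[OF u] by simp
  interpret v: is_functor L G2 v using gpd_functorD[OF v] by simp
  have [simp]: "src u = L" "tgt u = G1" "src v = L" "tgt v = G2" using u v by (simp_all add: gpd_functorD)
  show ?thesis
    by (rule gpd_functorI)
      (use finite_groupoid_prod gpd_functorD[OF u] gpd_functorD[OF v] in
        \<open>auto simp: u.source.Obj_of_type u.ar_Comp v.ar_Comp\<close>, auto simp: pairing_def)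
qed

subsection \<open>Iso-comma groupoids\<close>

text \<open>The object \<open>(x, y, g : i x \<rightarrow> u y)\<close> is encoded as \<open>Tup (Tup x y) g\<close>. An arrow \<open>(a, b)\<close> carries its
  source and its target along, since these are not determined by \<open>a\<close> and \<open>b\<close>.\<close>

definition comma_Obj :: "'a cell1 \<Rightarrow> 'a cell1 \<Rightarrow> 'a elem set" where
  "comma_Obj i u = {z. \<exists>x y g. z = Tup (Tup x y) g \<and> x \<in> Obj (src i) \<and> y \<in> Obj (src u)
     \<and> hom_type (tgt i) g = Some (ob i x, ob u y)}"

definition comma_Arr :: "'a cell1 \<Rightarrow> 'a cell1 \<Rightarrow> 'a elem set" where
  "comma_Arr i u = {f. \<exists>x y g x' y' g' a b. f = Tup (Tup (Tup (Tup x y) g) (Tup (Tup x' y') g')) (Tup a b)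
     \<and> hom_type (src i) a = Some (x, x') \<and> hom_type (src u) b = Some (y, y')
     \<and> hom_type (tgt i) g = Some (ob i x, ob u y) \<and> hom_type (tgt i) g' = Some (ob i x', ob u y')
     \<and> g' \<cdot>\<^bsub>tgt i\<^esub> ar i a = ar u b \<cdot>\<^bsub>tgt i\<^esub> g}"

definition comma :: "'a cell1 \<Rightarrow> 'a cell1 \<Rightarrow> 'a gpd" where
  "comma i u = mk_gpd (comma_Obj i u) (comma_Arr i u) (\<lambda>f. tfst (tfst f)) (\<lambda>f. tsnd (tfst f))
     (\<lambda>z. Tup (Tup z z) (Tup (Idn (src i) (tfst (tfst z))) (Idn (src u) (tsnd (tfst z)))))
     (\<lambda>g f. Tup (Tup (tfst (tfst f)) (tsnd (tfst g)))
       (Tup (tfst (tsnd g) \<cdot>\<^bsub>src i\<^esub> tfst (tsnd f)) (tsnd (tsnd g) \<cdot>\<^bsub>src u\<^esub> tsnd (tsnd f))))"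

definition comma1 :: "'a cell1 \<Rightarrow> 'a cell1 \<Rightarrow> 'a cell1" where
  "comma1 i u = \<lparr>ob = (\<lambda>z\<in>comma_Obj i u. tfst (tfst z)), ar = (\<lambda>f\<in>comma_Arr i u. tfst (tsnd f)),
     src = comma i u, tgt = src i\<rparr>"

definition comma2 :: "'a cell1 \<Rightarrow> 'a cell1 \<Rightarrow> 'a cell1" where
  "comma2 i u = \<lparr>ob = (\<lambda>z\<in>comma_Obj i u. tsnd (tfst z)), ar = (\<lambda>f\<in>comma_Arr i u. tsnd (tsnd f)),
     src = comma i u, tgt = src u\<rparr>"

definition comma_cell :: "'a cell1 \<Rightarrow> 'a cell1 \<Rightarrow> 'a cell2" where
  "comma_cell i u = \<lparr>src2 = i \<circ>1 comma1 i u, tgt2 = u \<circ>1 comma2 i u, cmp = (\<lambda>z\<in>comma_Obj i u. tsnd z)\<rparr>"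

text \<open>The functor into the iso-comma groupoid that is induced by a strictly commuting square.\<close>

definition comma_into :: "'a cell1 \<Rightarrow> 'a cell1 \<Rightarrow> 'a cell1 \<Rightarrow> 'a cell1 \<Rightarrow> 'a cell1" where
  "comma_into i u p q =
     (let o' = (\<lambda>x. Tup (Tup (ob p x) (ob q x)) (Idn (tgt i) (ob i (ob p x)))) in
     \<lparr>ob = restrict o' (Obj (src p)),
      ar = (\<lambda>f\<in>Arr (src p). Tup (Tup (o' (Dom (src p) f)) (o' (Cod (src p) f))) (Tup (ar p f) (ar q f))),
      src = src p, tgt = comma i u\<rparr>)"

locale cospan =
  fixes i u :: "'a cell1" and H K G :: "'a gpd"
  assumes i: "gpd_functor H G i" and u: "gpd_functor K G u"
begin

sublocale i: is_functor H G i using i by (simp add: gpd_functorD)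
sublocale u: is_functor K G u using u by (simp add: gpd_functorD)

lemma src_tgt [simp]: "src i = H" "tgt i = G" "src u = K" "tgt u = G"
  using i u by (simp_all add: gpd_functorD)

lemma gpds: "finite_groupoid H" "finite_groupoid K" "finite_groupoid G"
  using i u by (simp_all add: gpd_functorD)

lemma iso [simp]: "\<lbrakk>hom_type G f = r; r \<noteq> None\<rbrakk> \<Longrightarrow> iso_arr G f" "\<lbrakk>hom_type H f = r; r \<noteq> None\<rbrakk> \<Longrightarrow> iso_arr H f"
  "\<lbrakk>hom_type K f = r; r \<noteq> None\<rbrakk> \<Longrightarrow> iso_arr K f"
  using gpds by (auto simp: finite_groupoidD)

lemma comma_ObjI [intro]:
  "\<lbrakk>x \<in> Obj H; y \<in> Obj K; hom_type G g = Some (ob i x, ob u y)\<rbrakk> \<Longrightarrow> Tup (Tup x y) g \<in> comma_Obj i u"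
  by (auto simp: comma_Obj_def)

lemma comma_ObjE:
  assumes "z \<in> comma_Obj i u"
  obtains x y g where "z = Tup (Tup x y) g" "x \<in> Obj H" "y \<in> Obj K" "hom_type G g = Some (ob i x, ob u y)"
  using assms by (auto simp: comma_Obj_def)

lemma comma_ArrE:
  assumes "f \<in> comma_Arr i u"
  obtains x y g x' y' g' a b where "f = Tup (Tup (Tup (Tup x y) g) (Tup (Tup x' y') g')) (Tup a b)"
    "hom_type H a = Some (x, x')" "hom_type K b = Some (y, y')" "hom_type G g = Some (ob i x, ob u y)"
    "hom_type G g' = Some (ob i x', ob u y')" "g' \<cdot>\<^bsub>G\<^esub> ar i a = ar u b \<cdot>\<^bsub>G\<^esub> g"
    "x \<in> Obj H" "x' \<in> Obj H" "y \<in> Obj K" "y' \<in> Obj K"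
  using assms by (auto simp: comma_Arr_def i.source.Obj_of_type u.source.Obj_of_type)

lemma comma_mem [simp]:
  "Tup (Tup x y) g \<in> comma_Obj i u \<longleftrightarrow> x \<in> Obj H \<and> y \<in> Obj K \<and> hom_type G g = Some (ob i x, ob u y)"
  "Tup (Tup (Tup (Tup x y) g) (Tup (Tup x' y') g')) (Tup a b) \<in> comma_Arr i u \<longleftrightarrow>
    hom_type H a = Some (x, x') \<and> hom_type K b = Some (y, y') \<and> hom_type G g = Some (ob i x, ob u y)
     \<and> hom_type G g' = Some (ob i x', ob u y') \<and> g' \<cdot>\<^bsub>G\<^esub> ar i a = ar u b \<cdot>\<^bsub>G\<^esub> g"
  by (auto simp: comma_Obj_def comma_Arr_def)

lemma finite_groupoid_comma: "finite_groupoid (comma i u)"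
  unfolding comma_def
proof (rule finite_groupoid_mk_gpd)
  have "comma_Obj i u \<subseteq> (\<lambda>((x, y), g). Tup (Tup x y) g) ` ((Obj H \<times> Obj K) \<times> Arr G)"
    by (force elim!: comma_ObjE dest: hom_typeD)
  then show fin: "finite (comma_Obj i u)"
    by (rule finite_subset) (intro finite_imageI finite_cartesian_product gpds[THEN finite_groupoidD(2)]
      gpds[THEN finite_groupoidD(3)])
  have "comma_Arr i u \<subseteq> (\<lambda>((z, w), (a, b)). Tup (Tup z w) (Tup a b)) `
      ((comma_Obj i u \<times> comma_Obj i u) \<times> (Arr H \<times> Arr K))"
  proof
    fix f assume "f \<in> comma_Arr i u"
    then obtain x y g x' y' g' a b where f: "f = Tup (Tup (Tup (Tup x y) g) (Tup (Tup x' y') g')) (Tup a b)"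
      and t: "hom_type H a = Some (x, x')" "hom_type K b = Some (y, y')" "hom_type G g = Some (ob i x, ob u y)"
      "hom_type G g' = Some (ob i x', ob u y')" "x \<in> Obj H" "x' \<in> Obj H" "y \<in> Obj K" "y' \<in> Obj K"
      by (elim comma_ArrE)
    have "((Tup (Tup x y) g, Tup (Tup x' y') g'), (a, b)) \<in> (comma_Obj i u \<times> comma_Obj i u) \<times> (Arr H \<times> Arr K)"
      using t hom_typeD(1)[OF t(1)] hom_typeD(1)[OF t(2)] by auto
    then show "f \<in> (\<lambda>((z, w), (a, b)). Tup (Tup z w) (Tup a b)) `
        ((comma_Obj i u \<times> comma_Obj i u) \<times> (Arr H \<times> Arr K))"
      unfolding f by (rule rev_image_eqI) simp
  qed
  then show "finite (comma_Arr i u)"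
    by (rule finite_subset) (intro finite_imageI finite_cartesian_product fin gpds[THEN finite_groupoidD(3)])
  fix f assume f: "f \<in> comma_Arr i u"
  then show "tfst (tfst f) \<in> comma_Obj i u" "tsnd (tfst f) \<in> comma_Obj i u"
    by (auto elim!: comma_ArrE)
  obtain x y g x' y' g' a b where f': "f = Tup (Tup (Tup (Tup x y) g) (Tup (Tup x' y') g')) (Tup a b)"
      and t: "hom_type H a = Some (x, x')" "hom_type K b = Some (y, y')" "hom_type G g = Some (ob i x, ob u y)"
      "hom_type G g' = Some (ob i x', ob u y')" "g' \<cdot>\<^bsub>G\<^esub> ar i a = ar u b \<cdot>\<^bsub>G\<^esub> g"
      "x \<in> Obj H" "x' \<in> Obj H" "y \<in> Obj K" "y' \<in> Obj K"
    using f by (elim comma_ArrE)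
  have e: "g \<cdot>\<^bsub>G\<^esub> ar i (inv_arr H a) = ar u (inv_arr K b) \<cdot>\<^bsub>G\<^esub> g'"
  proof -
    have "ar u (inv_arr K b) \<cdot>\<^bsub>G\<^esub> (g' \<cdot>\<^bsub>G\<^esub> ar i a) \<cdot>\<^bsub>G\<^esub> ar i (inv_arr H a)
        = ar u (inv_arr K b) \<cdot>\<^bsub>G\<^esub> (ar u b \<cdot>\<^bsub>G\<^esub> g) \<cdot>\<^bsub>G\<^esub> ar i (inv_arr H a)"
      unfolding t(5) ..
    then show ?thesis using t(1-4) by (simp add: i.ar_inv_arr u.ar_inv_arr)
  qed
  show "\<exists>h\<in>comma_Arr i u.
     tfst (tfst h) = tsnd (tfst f) \<and> tsnd (tfst h) = tfst (tfst f) \<and>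
     Tup (Tup (tfst (tfst f)) (tsnd (tfst h)))
      (Tup (tfst (tsnd h) \<cdot>\<^bsub>src i\<^esub> tfst (tsnd f)) (tsnd (tsnd h) \<cdot>\<^bsub>src u\<^esub> tsnd (tsnd f))) =
     Tup (Tup (tfst (tfst f)) (tfst (tfst f)))
      (Tup (Idn (src i) (tfst (tfst (tfst (tfst f))))) (Idn (src u) (tsnd (tfst (tfst (tfst f)))))) \<and>
     Tup (Tup (tfst (tfst h)) (tsnd (tfst f)))
      (Tup (tfst (tsnd f) \<cdot>\<^bsub>src i\<^esub> tfst (tsnd h)) (tsnd (tsnd f) \<cdot>\<^bsub>src u\<^esub> tsnd (tsnd h))) =
     Tup (Tup (tsnd (tfst f)) (tsnd (tfst f)))
      (Tup (Idn (src i) (tfst (tfst (tsnd (tfst f))))) (Idn (src u) (tsnd (tfst (tsnd (tfst f))))))"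
    using t e unfolding f'
    by (intro bexI[of _ "Tup (Tup (Tup (Tup x' y') g') (Tup (Tup x y) g)) (Tup (inv_arr H a) (inv_arr K b))"])
      auto
next
  fix f k assume "f \<in> comma_Arr i u" "k \<in> comma_Arr i u" "tsnd (tfst f) = tfst (tfst k)"
  then obtain x y g x' y' g' x'' y'' g'' a b a' b'
    where fk: "f = Tup (Tup (Tup (Tup x y) g) (Tup (Tup x' y') g')) (Tup a b)"
      "k = Tup (Tup (Tup (Tup x' y') g') (Tup (Tup x'' y'') g'')) (Tup a' b')"
      and t: "hom_type H a = Some (x, x')" "hom_type K b = Some (y, y')" "hom_type G g = Some (ob i x, ob u y)"
      "hom_type G g' = Some (ob i x', ob u y')" "g' \<cdot>\<^bsub>G\<^esub> ar i a = ar u b \<cdot>\<^bsub>G\<^esub> g"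
      "hom_type H a' = Some (x', x'')" "hom_type K b' = Some (y', y'')"
      "hom_type G g'' = Some (ob i x'', ob u y'')" "g'' \<cdot>\<^bsub>G\<^esub> ar i a' = ar u b' \<cdot>\<^bsub>G\<^esub> g'"
    by (auto elim!: comma_ArrE)
  have "g'' \<cdot>\<^bsub>G\<^esub> ar i (a' \<cdot>\<^bsub>H\<^esub> a) = (g'' \<cdot>\<^bsub>G\<^esub> ar i a') \<cdot>\<^bsub>G\<^esub> ar i a"
    using t(1-4,6-8) by (simp add: i.ar_Comp)
  also have "\<dots> = ar u b' \<cdot>\<^bsub>G\<^esub> (g' \<cdot>\<^bsub>G\<^esub> ar i a)" unfolding t(9) using t(1-4,6-8) by simp
  also have "\<dots> = ar u (b' \<cdot>\<^bsub>K\<^esub> b) \<cdot>\<^bsub>G\<^esub> g" unfolding t(5) using t(1-4,6-8) by (simp add: u.ar_Comp)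
  finally show "Tup (Tup (tfst (tfst f)) (tsnd (tfst k)))
       (Tup (tfst (tsnd k) \<cdot>\<^bsub>src i\<^esub> tfst (tsnd f)) (tsnd (tsnd k) \<cdot>\<^bsub>src u\<^esub> tsnd (tsnd f))) \<in> comma_Arr i u \<and>
     tfst (tfst (Tup (Tup (tfst (tfst f)) (tsnd (tfst k)))
         (Tup (tfst (tsnd k) \<cdot>\<^bsub>src i\<^esub> tfst (tsnd f)) (tsnd (tsnd k) \<cdot>\<^bsub>src u\<^esub> tsnd (tsnd f))))) = tfst (tfst f) \<and>
     tsnd (tfst (Tup (Tup (tfst (tfst f)) (tsnd (tfst k)))
         (Tup (tfst (tsnd k) \<cdot>\<^bsub>src i\<^esub> tfst (tsnd f)) (tsnd (tsnd k) \<cdot>\<^bsub>src u\<^esub> tsnd (tsnd f))))) = tsnd (tfst k)"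
    unfolding fk using t by auto
qed (auto elim!: comma_ArrE comma_ObjE)

lemma comma_simps [simp]:
  "Obj (comma i u) = comma_Obj i u" "Arr (comma i u) = comma_Arr i u"
  "hom_type (comma i u) f = (if f \<in> comma_Arr i u then Some (tfst (tfst f), tsnd (tfst f)) else None)"
  by (simp_all only: comma_def hom_type_mk_gpd) (simp_all add: mk_gpd_def)

lemma comma_Idn: "Tup (Tup x y) g \<in> comma_Obj i u \<Longrightarrow> Idn (comma i u) (Tup (Tup x y) g)
    = Tup (Tup (Tup (Tup x y) g) (Tup (Tup x y) g)) (Tup (Idn H x) (Idn K y))"
  by (simp add: comma_def mk_gpd_def)

lemma comma_Comp:
  "\<lbrakk>Tup (Tup z w) (Tup a b) \<in> comma_Arr i u; Tup (Tup w v) (Tup a' b') \<in> comma_Arr i u\<rbrakk>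
    \<Longrightarrow> Tup (Tup w v) (Tup a' b') \<cdot>\<^bsub>comma i u\<^esub> Tup (Tup z w) (Tup a b)
      = Tup (Tup z v) (Tup (a' \<cdot>\<^bsub>H\<^esub> a) (b' \<cdot>\<^bsub>K\<^esub> b))"
  by (simp add: comma_def mk_gpd_def)

lemma comma_proj_simps [simp]:
  "src (comma1 i u) = comma i u" "tgt (comma1 i u) = H" "src (comma2 i u) = comma i u" "tgt (comma2 i u) = K"
  "z \<in> comma_Obj i u \<Longrightarrow> ob (comma1 i u) z = tfst (tfst z)" "z \<in> comma_Obj i u \<Longrightarrow> ob (comma2 i u) z = tsnd (tfst z)"
  "f \<in> comma_Arr i u \<Longrightarrow> ar (comma1 i u) f = tfst (tsnd f)" "f \<in> comma_Arr i u \<Longrightarrow> ar (comma2 i u) f = tsnd (tsnd f)"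
  by (simp_all add: comma1_def comma2_def)

lemma comma_CompE:
  assumes "hom_type (comma i u) f = Some (z, w)" "hom_type (comma i u) k = Some (w, v)"
  obtains a b a' b' where "f = Tup (Tup z w) (Tup a b)" "k = Tup (Tup w v) (Tup a' b')"
    "f \<in> comma_Arr i u" "k \<in> comma_Arr i u" "k \<cdot>\<^bsub>comma i u\<^esub> f = Tup (Tup z v) (Tup (a' \<cdot>\<^bsub>H\<^esub> a) (b' \<cdot>\<^bsub>K\<^esub> b))"
    "k \<cdot>\<^bsub>comma i u\<^esub> f \<in> comma_Arr i u"
proof -
  interpret P: category "comma i u" using finite_groupoid_comma by (rule finite_groupoidD)
  have f: "f \<in> comma_Arr i u" "z = tfst (tfst f)" "w = tsnd (tfst f)"
    and k: "k \<in> comma_Arr i u" "w = tfst (tfst k)" "v = tsnd (tfst k)"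
    using assms by (auto split: if_splits)
  obtain a b where f': "f = Tup (Tup z w) (Tup a b)" using f by (elim comma_ArrE) auto
  obtain a' b' where k': "k = Tup (Tup w v) (Tup a' b')" using k by (elim comma_ArrE) auto
  have "k \<cdot>\<^bsub>comma i u\<^esub> f = Tup (Tup z v) (Tup (a' \<cdot>\<^bsub>H\<^esub> a) (b' \<cdot>\<^bsub>K\<^esub> b))"
    using comma_Comp[of z w a b v a' b'] f(1) k(1) unfolding f' k' by blast
  moreover have "k \<cdot>\<^bsub>comma i u\<^esub> f \<in> comma_Arr i u"
    using P.comp_closed[of f z w k v] assms by (simp split: if_splits)
  ultimately show thesis by (rule that[OF f' k' f(1) k(1)])
qed

lemma comma_Idn_mem: "z \<in> comma_Obj i u \<Longrightarrow> Idn (comma i u) z \<in> comma_Arr i u"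
proof -
  assume z: "z \<in> comma_Obj i u"
  interpret P: category "comma i u" using finite_groupoid_comma by (rule finite_groupoidD)
  show ?thesis using P.idn_closed[of z] z by (simp split: if_splits)
qed

lemma gpd_functor_comma: "gpd_functor (comma i u) H (comma1 i u)" "gpd_functor (comma i u) K (comma2 i u)"
proof -
  show "gpd_functor (comma i u) H (comma1 i u)"
  proof (rule gpd_functorI[OF finite_groupoid_comma gpds(1)])
    fix x assume x: "x \<in> Obj (comma i u)"
    then show "ar (comma1 i u) (Idn (comma i u) x) = Idn H (ob (comma1 i u) x)"
      using comma_Idn_mem[of x] by (auto elim!: comma_ObjE simp: comma_Idn)
  next
    fix f g x y z assume "hom_type (comma i u) f = Some (x, y)" "hom_type (comma i u) g = Some (y, z)"
    then show "ar (comma1 i u) (g \<cdot>\<^bsub>comma i u\<^esub> f) = ar (comma1 i u) g \<cdot>\<^bsub>H\<^esub> ar (comma1 i u) f"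
      by (rule comma_CompE) simp
  qed (auto elim!: comma_ArrE comma_ObjE split: if_splits, auto simp: comma1_def)
  show "gpd_functor (comma i u) K (comma2 i u)"
  proof (rule gpd_functorI[OF finite_groupoid_comma gpds(2)])
    fix x assume x: "x \<in> Obj (comma i u)"
    then show "ar (comma2 i u) (Idn (comma i u) x) = Idn K (ob (comma2 i u) x)"
      using comma_Idn_mem[of x] by (auto elim!: comma_ObjE simp: comma_Idn)
  next
    fix f g x y z assume "hom_type (comma i u) f = Some (x, y)" "hom_type (comma i u) g = Some (y, z)"
    then show "ar (comma2 i u) (g \<cdot>\<^bsub>comma i u\<^esub> f) = ar (comma2 i u) g \<cdot>\<^bsub>K\<^esub> ar (comma2 i u) f"
      by (rule comma_CompE) simp
  qed (auto elim!: comma_ArrE comma_ObjE split: if_splits, auto simp: comma2_def)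
qed

end

lemma comp1_assoc:
  assumes w: "gpd_functor L K w" and v: "gpd_functor K H v" and u: "gpd_functor H G u"
  shows "(u \<circ>1 v) \<circ>1 w = u \<circ>1 (v \<circ>1 w)"
proof -
  interpret w: is_functor L K w using w by (rule gpd_functorD)
  have [simp]: "src w = L" "src v = K" "src u = H" using u v w by (simp_all add: gpd_functorD)
  show ?thesis
    by (rule cell1_eqI[OF gpd_functor_comp1[OF w gpd_functor_comp1[OF v u]]
          gpd_functor_comp1[OF gpd_functor_comp1[OF w v] u]]) simp_all
qed

lemma gpd_nat_transI:
  assumes "src2 \<alpha> = u" "tgt2 \<alpha> = v" and u: "gpd_functor L G u" and v: "gpd_functor L G v"
    and "cmp \<alpha> \<in> extensional (Obj L)"
    and "\<And>x. x \<in> Obj L \<Longrightarrow> hom_type G (cmp \<alpha> x) = Some (ob u x, ob v x)"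
    and "\<And>f x y. hom_type L f = Some (x, y) \<Longrightarrow> cmp \<alpha> y \<cdot>\<^bsub>G\<^esub> ar u f = ar v f \<cdot>\<^bsub>G\<^esub> cmp \<alpha> x"
  shows "gpd_nat_trans u v \<alpha>"
  using assms gpd_functorD[OF u] gpd_functorD[OF v]
  by (simp add: gpd_nat_trans_def nat_trans_def nat_trans_axioms_def)

lemma gpd_nat_transD:
  assumes "gpd_nat_trans u v \<alpha>"
  shows "src2 \<alpha> = u" "tgt2 \<alpha> = v" "gpd_functor (src u) (tgt u) u" "gpd_functor (src u) (tgt u) v"
    "nat_trans (src u) (tgt u) u v (cmp \<alpha>)" "src v = src u" "tgt v = tgt u"
    "cmp \<alpha> \<in> extensional (Obj (src u))"
  using assms by (auto simp: gpd_nat_trans_def is_cell1_def)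

lemma cell2_eqI:
  assumes "gpd_nat_trans u v \<alpha>" "gpd_nat_trans u v \<beta>" "\<And>x. x \<in> Obj (src u) \<Longrightarrow> cmp \<alpha> x = cmp \<beta> x"
  shows "\<alpha> = \<beta>"
proof -
  have "cmp \<alpha> = cmp \<beta>"
    using gpd_nat_transD[OF assms(1)] gpd_nat_transD[OF assms(2)] assms(3)
    by (intro extensionalityI[of _ "Obj (src u)"]) auto
  then show ?thesis
    using gpd_nat_transD[OF assms(1)] gpd_nat_transD[OF assms(2)] by (cases \<alpha>; cases \<beta>) auto
qed

lemma gpd_nat_trans_id2:
  assumes u: "gpd_functor L G u"
  shows "gpd_nat_trans u u (id2 u)"
proof -
  interpret u: is_functor L G u using gpd_functorD[OF u] by simp
  have [simp]: "src u = L" "tgt u = G" using u by (simp_all add: gpd_functorD)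
  show ?thesis
    by (rule gpd_nat_transI[OF _ _ u u]) (auto simp: id2_def u.source.Obj_of_type)
qed

lemma gpd_nat_trans_inv2:
  assumes a: "gpd_nat_trans u v \<alpha>"
  shows "gpd_nat_trans v u (inv2 \<alpha>)" "vcomp2 (inv2 \<alpha>) \<alpha> = id2 u" "vcomp2 \<alpha> (inv2 \<alpha>) = id2 v"
proof -
  note D = gpd_nat_transD[OF a]
  define L where "L = src u"
  define G where "G = tgt u"
  have u: "gpd_functor L G u" and v: "gpd_functor L G v" using D by (simp_all add: L_def G_def)
  interpret a: nat_trans L G u v "cmp \<alpha>" using D by (simp add: L_def G_def)
  have iso [simp]: "iso_arr G (cmp \<alpha> x)" if "x \<in> Obj L" for x
    using that gpd_functorD[OF u] by (simp add: finite_groupoidD)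
  have [simp]: "src u = L" "tgt u = G" "src v = L" "tgt v = G" "src2 \<alpha> = u" "tgt2 \<alpha> = v"
    using D by (simp_all add: L_def G_def)
  show i: "gpd_nat_trans v u (inv2 \<alpha>)"
  proof (rule gpd_nat_transI[OF _ _ v u])
    fix f x y assume f: "hom_type L f = Some (x, y)"
    note [simp] = f a.F.source.Obj_of_type[OF f]
    have "inv_arr G (cmp \<alpha> y) \<cdot>\<^bsub>G\<^esub> (cmp \<alpha> y \<cdot>\<^bsub>G\<^esub> ar u f) \<cdot>\<^bsub>G\<^esub> inv_arr G (cmp \<alpha> x)
        = inv_arr G (cmp \<alpha> y) \<cdot>\<^bsub>G\<^esub> (ar v f \<cdot>\<^bsub>G\<^esub> cmp \<alpha> x) \<cdot>\<^bsub>G\<^esub> inv_arr G (cmp \<alpha> x)"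
      using a.naturality[of f x y] by simp
    then show "cmp (inv2 \<alpha>) y \<cdot>\<^bsub>G\<^esub> ar v f = ar u f \<cdot>\<^bsub>G\<^esub> cmp (inv2 \<alpha>) x"
      by (simp add: inv2_def)
  qed (auto simp: inv2_def)
  show "vcomp2 (inv2 \<alpha>) \<alpha> = id2 u" "vcomp2 \<alpha> (inv2 \<alpha>) = id2 v"
    by (auto simp: vcomp2_def inv2_def id2_def fun_eq_iff)
qed

lemma gpd_nat_trans_whisker:
  assumes a: "gpd_nat_trans u v \<alpha>" and w: "gpd_functor K (src u) w"
  shows "gpd_nat_trans (u \<circ>1 w) (v \<circ>1 w) (hcomp2 \<alpha> (id2 w))"
    "x \<in> Obj K \<Longrightarrow> cmp (hcomp2 \<alpha> (id2 w)) x = cmp \<alpha> (ob w x)"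
proof -
  note D = gpd_nat_transD[OF a]
  define L where "L = src u"
  define G where "G = tgt u"
  have u: "gpd_functor L G u" and v: "gpd_functor L G v" using D by (simp_all add: L_def G_def)
  have w': "gpd_functor K L w" using w by (simp add: L_def)
  interpret a: nat_trans L G u v "cmp \<alpha>" using D by (simp add: L_def G_def)
  interpret w: is_functor K L w using gpd_functorD[OF w'] by simp
  have [simp]: "src u = L" "tgt u = G" "src v = L" "tgt v = G" "src2 \<alpha> = u" "tgt2 \<alpha> = v" "src w = K" "tgt w = L"
    using D w' gpd_functorD by (auto simp add: L_def G_def)
  show c: "x \<in> Obj K \<Longrightarrow> cmp (hcomp2 \<alpha> (id2 w)) x = cmp \<alpha> (ob w x)" for x
    by (simp add: hcomp2_def id2_def)
  show "gpd_nat_trans (u \<circ>1 w) (v \<circ>1 w) (hcomp2 \<alpha> (id2 w))"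
  proof (rule gpd_nat_transI[OF _ _ gpd_functor_comp1[OF w' u] gpd_functor_comp1[OF w' v]])
    fix f x y assume f: "hom_type K f = Some (x, y)"
    note [simp] = f w.source.Obj_of_type[OF f]
    show "cmp (hcomp2 \<alpha> (id2 w)) y \<cdot>\<^bsub>G\<^esub> ar (u \<circ>1 w) f = ar (v \<circ>1 w) f \<cdot>\<^bsub>G\<^esub> cmp (hcomp2 \<alpha> (id2 w)) x"
      using a.naturality[of "ar w f" "ob w x" "ob w y"] by (simp add: c)
  qed (auto simp: c, auto simp: hcomp2_def id2_def)
qed

context cospan
begin

lemma comma_cell_simps [simp]:
  "src2 (comma_cell i u) = i \<circ>1 comma1 i u" "tgt2 (comma_cell i u) = u \<circ>1 comma2 i u"
  "z \<in> comma_Obj i u \<Longrightarrow> cmp (comma_cell i u) z = tsnd z"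
  by (simp_all add: comma_cell_def)

lemma gpd_nat_trans_comma_cell: "gpd_nat_trans (i \<circ>1 comma1 i u) (u \<circ>1 comma2 i u) (comma_cell i u)"
proof (rule gpd_nat_transI[OF _ _ gpd_functor_comp1[OF gpd_functor_comma(1) i] gpd_functor_comp1[OF gpd_functor_comma(2) u]])
  fix f x y assume "hom_type (comma i u) f = Some (x, y)"
  then have f: "f \<in> comma_Arr i u" "x = tfst (tfst f)" "y = tsnd (tfst f)" by (auto split: if_splits)
  show "cmp (comma_cell i u) y \<cdot>\<^bsub>G\<^esub> ar (i \<circ>1 comma1 i u) f = ar (u \<circ>1 comma2 i u) f \<cdot>\<^bsub>G\<^esub> cmp (comma_cell i u) x"
    using f(1) unfolding f(2,3) by (rule comma_ArrE) simp
qed (auto elim!: comma_ObjE, auto simp: comma_cell_def)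

lemma iso_comma_comma: "iso_comma i u (comma1 i u) (comma2 i u) (comma_cell i u)"
proof -
  have objs: "bij_betw (\<lambda>z. (ob (comma1 i u) z, ob (comma2 i u) z, cmp (comma_cell i u) z)) (comma_Obj i u)
         {(x, y, g). x \<in> Obj H \<and> y \<in> Obj K \<and> g \<in> Hom G (ob i x) (ob u y)}"
    by (rule bij_betw_byWitness[of _ "\<lambda>(x, y, g). Tup (Tup x y) g"]) (auto elim!: comma_ObjE)
  have arrs: "bij_betw (\<lambda>f. (ar (comma1 i u) f, ar (comma2 i u) f)) (Hom (comma i u) z w)
            {(a, b). a \<in> Hom H (ob (comma1 i u) z) (ob (comma1 i u) w) \<and> b \<in> Hom K (ob (comma2 i u) z) (ob (comma2 i u) w)
               \<and> cmp (comma_cell i u) w \<cdot>\<^bsub>G\<^esub> ar i a = ar u b \<cdot>\<^bsub>G\<^esub> cmp (comma_cell i u) z}"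
    if "z \<in> comma_Obj i u" "w \<in> comma_Obj i u" for z w
  proof (rule bij_betw_byWitness[of _ "\<lambda>(a, b). Tup (Tup z w) (Tup a b)"])
    show "\<forall>f\<in>Hom (comma i u) z w. (\<lambda>(a, b). Tup (Tup z w) (Tup a b)) (ar (comma1 i u) f, ar (comma2 i u) f) = f"
      by (auto elim!: comma_ArrE split: if_splits)
    show "\<forall>p\<in>{(a, b). a \<in> Hom H (ob (comma1 i u) z) (ob (comma1 i u) w) \<and> b \<in> Hom K (ob (comma2 i u) z) (ob (comma2 i u) w)
               \<and> cmp (comma_cell i u) w \<cdot>\<^bsub>G\<^esub> ar i a = ar u b \<cdot>\<^bsub>G\<^esub> cmp (comma_cell i u) z}.
      (\<lambda>f. (ar (comma1 i u) f, ar (comma2 i u) f)) ((\<lambda>(a, b). Tup (Tup z w) (Tup a b)) p) = p"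
      using that by (auto elim!: comma_ObjE)
    show "(\<lambda>f. (ar (comma1 i u) f, ar (comma2 i u) f)) ` Hom (comma i u) z w
      \<subseteq> {(a, b). a \<in> Hom H (ob (comma1 i u) z) (ob (comma1 i u) w) \<and> b \<in> Hom K (ob (comma2 i u) z) (ob (comma2 i u) w)
               \<and> cmp (comma_cell i u) w \<cdot>\<^bsub>G\<^esub> ar i a = ar u b \<cdot>\<^bsub>G\<^esub> cmp (comma_cell i u) z}"
      by (auto elim!: comma_ArrE split: if_splits)
    show "(\<lambda>(a, b). Tup (Tup z w) (Tup a b)) ` {(a, b). a \<in> Hom H (ob (comma1 i u) z) (ob (comma1 i u) w) \<and> b \<in> Hom K (ob (comma2 i u) z) (ob (comma2 i u) w)
               \<and> cmp (comma_cell i u) w \<cdot>\<^bsub>G\<^esub> ar i a = ar u b \<cdot>\<^bsub>G\<^esub> cmp (comma_cell i u) z} \<subseteq> Hom (comma i u) z w"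
      using that by (auto elim!: comma_ObjE)
  qed
  show ?thesis
    unfolding iso_comma_def
    using gpd_functorD(8)[OF i] gpd_functorD(8)[OF u] gpd_functorD(8)[OF gpd_functor_comma(1)]
      gpd_functorD(8)[OF gpd_functor_comma(2)] gpd_nat_trans_comma_cell objs arrs
    by (simp del: Hom_type)
qed

lemma faithfulD: "\<lbrakk>faithful i; hom_type H a = Some (x, y); hom_type H b = Some (x, y); ar i a = ar i b\<rbrakk> \<Longrightarrow> a = b"
  using i.source.Obj_of_type[of a x y] by (auto simp: faithful_def inj_on_def)

lemma faithful_comma2:
  assumes f: "faithful i"
  shows "faithful (comma2 i u)"
proof -
  have "h = k" if h: "h \<in> comma_Arr i u" and k: "k \<in> comma_Arr i u" and eq: "tfst (tfst h) = tfst (tfst k)" "tsnd (tfst h) = tsnd (tfst k)" "tsnd (tsnd h) = tsnd (tsnd k)" for h k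
  proof -
    obtain x y g x' y' g' a b where h': "h = Tup (Tup (Tup (Tup x y) g) (Tup (Tup x' y') g')) (Tup a b)"
      "hom_type H a = Some (x, x')" "hom_type G g' = Some (ob i x', ob u y')" "g' \<cdot>\<^bsub>G\<^esub> ar i a = ar u b \<cdot>\<^bsub>G\<^esub> g"
      using h by (elim comma_ArrE)
    obtain a' where k': "k = Tup (Tup (Tup (Tup x y) g) (Tup (Tup x' y') g')) (Tup a' b)"
      using k eq unfolding h'(1) by (auto elim!: comma_ArrE)
    have a': "hom_type H a' = Some (x, x')" "g' \<cdot>\<^bsub>G\<^esub> ar i a' = ar u b \<cdot>\<^bsub>G\<^esub> g"
      using k unfolding k' by simp_all
    have "g' \<cdot>\<^bsub>G\<^esub> ar i a = g' \<cdot>\<^bsub>G\<^esub> ar i a'" unfolding a'(2) h'(4) ..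
    then have "ar i a = ar i a'"
      by (rule i.target.iso_cancel_left[rotated -1]) (use h' a' in auto)
    then have "a = a'" using faithfulD[OF f h'(2) a'(1)] by simp
    then show ?thesis unfolding h'(1) k' by simp
  qed
  then show ?thesis
    unfolding faithful_def inj_on_def by (auto split: if_splits)
qed

end

subsection \<open>Equivalences\<close>

text \<open>The objects of \<open>P\<close> are lifted along \<open>w\<close> by a choice, and then the arrows between them uniquely.\<close>

lemma quasi_inverse:
  assumes w: "gpd_functor L P w"
    and ff: "\<And>x y. \<lbrakk>x \<in> Obj L; y \<in> Obj L\<rbrakk> \<Longrightarrow> bij_betw (ar w) (Hom L x y) (Hom P (ob w x) (ob w y))"
    and es: "\<And>z. z \<in> Obj P \<Longrightarrow> \<exists>x\<in>Obj L. \<exists>t. hom_type P t = Some (ob w x, z)"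
  obtains v \<theta> \<rho> where "gpd_functor P L v" "gpd_nat_trans (w \<circ>1 v) (id1 P) \<theta>" "gpd_nat_trans (v \<circ>1 w) (id1 L) \<rho>"
proof -
  interpret w: is_functor L P w using gpd_functorD[OF w] by simp
  note gL = gpd_functorD(1)[OF w] and gP = gpd_functorD(2)[OF w]
  have [simp]: "src w = L" "tgt w = P" using w by (simp_all add: gpd_functorD)
  have isoP [simp]: "iso_arr P f" if "hom_type P f = r" "r \<noteq> None" for f r
    using gP that by (auto simp: finite_groupoidD)
  have "\<forall>z\<in>Obj P. \<exists>p. fst p \<in> Obj L \<and> hom_type P (snd p) = Some (ob w (fst p), z)"
    using es by fastforce
  then obtain c where c: "\<And>z. z \<in> Obj P \<Longrightarrow> fst (c z) \<in> Obj L \<and> hom_type P (snd (c z)) = Some (ob w (fst (c z)), z)"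
    by (meson bchoice)
  define vo where "vo z = fst (c z)" for z
  define t where "t z = snd (c z)" for z
  have vo [simp]: "vo z \<in> Obj L" and t [simp]: "hom_type P (t z) = Some (ob w (vo z), z)" if "z \<in> Obj P" for z
    using c[OF that] by (simp_all add: vo_def t_def)
  have lift: "\<exists>g. hom_type L g = Some (x, y) \<and> ar w g = h"
    if "x \<in> Obj L" "y \<in> Obj L" "hom_type P h = Some (ob w x, ob w y)" for x y h
    using bij_betw_imp_surj_on[OF ff[OF that(1,2)]] that(3) by (force simp: image_iff)
  have inj: "g = h" if "hom_type L g = Some (x, y)" "hom_type L h = Some (x, y)" "ar w g = ar w h" for g h x y
  proof -
    have "x \<in> Obj L" "y \<in> Obj L" using that(1) by (simp_all add: w.source.Obj_of_type)
    from bij_betw_imp_inj_on[OF ff[OF this]] show ?thesis using that by (auto dest: inj_onD)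
  qed
  define va where "va f = (SOME g. hom_type L g = Some (vo (Dom P f), vo (Cod P f))
    \<and> ar w g = inv_arr P (t (Cod P f)) \<cdot>\<^bsub>P\<^esub> f \<cdot>\<^bsub>P\<^esub> t (Dom P f))" for f
  have va: "hom_type L (va f) = Some (vo x, vo y)" "ar w (va f) = inv_arr P (t y) \<cdot>\<^bsub>P\<^esub> f \<cdot>\<^bsub>P\<^esub> t x"
    if f: "hom_type P f = Some (x, y)" for f x y
  proof -
    have xy [simp]: "x \<in> Obj P" "y \<in> Obj P" using f by (simp_all add: w.target.Obj_of_type)
    have "\<exists>g. hom_type L g = Some (vo x, vo y) \<and> ar w g = inv_arr P (t y) \<cdot>\<^bsub>P\<^esub> f \<cdot>\<^bsub>P\<^esub> t x"
      by (rule lift) (simp_all add: f)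
    from someI_ex[OF this] show "hom_type L (va f) = Some (vo x, vo y)" "ar w (va f) = inv_arr P (t y) \<cdot>\<^bsub>P\<^esub> f \<cdot>\<^bsub>P\<^esub> t x"
      using hom_typeD[OF f] by (simp_all add: va_def)
  qed
  define v where "v = \<lparr>ob = restrict vo (Obj P), ar = restrict va (Arr P), src = P, tgt = L\<rparr>"
  have v_simps [simp]: "src v = P" "tgt v = L" "z \<in> Obj P \<Longrightarrow> ob v z = vo z"
    "hom_type P f = r \<Longrightarrow> r \<noteq> None \<Longrightarrow> ar v f = va f" for z f r
    by (auto simp: v_def hom_type_def split: if_splits)
  have v: "gpd_functor P L v"
  proof (rule gpd_functorI[OF gP gL])
    fix x assume x [simp]: "x \<in> Obj P"
    show "ar v (Idn P x) = Idn L (ob v x)"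
      by (rule inj[of _ "vo x" "vo x"]) (simp_all add: va[OF w.target.type_Idn[OF x]])
  next
    fix f g x y z assume f: "hom_type P f = Some (x, y)" and g: "hom_type P g = Some (y, z)"
    note [simp] = f g w.target.Obj_of_type[OF f] w.target.Obj_of_type[OF g] va[OF f] va[OF g]
    have gf: "hom_type P (g \<cdot>\<^bsub>P\<^esub> f) = Some (x, z)" by simp
    note [simp] = va[OF gf]
    show "ar v (g \<cdot>\<^bsub>P\<^esub> f) = ar v g \<cdot>\<^bsub>L\<^esub> ar v f"
      by (rule inj[of _ "vo x" "vo z"]) (simp_all add: w.ar_Comp)
  qed (use va w.target.Obj_of_type in \<open>auto simp: v_def hom_typeD\<close>)
  have wv: "gpd_functor P P (w \<circ>1 v)" and vw: "gpd_functor L L (v \<circ>1 w)"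
    using gpd_functor_comp1[OF v w] gpd_functor_comp1[OF w v] .
  define \<theta> where "\<theta> = \<lparr>src2 = w \<circ>1 v, tgt2 = id1 P, cmp = restrict t (Obj P)\<rparr>"
  have \<theta>: "gpd_nat_trans (w \<circ>1 v) (id1 P) \<theta>"
  proof (rule gpd_nat_transI[OF _ _ wv gpd_functor_id1[OF gP]])
    fix f x y assume f: "hom_type P f = Some (x, y)"
    note [simp] = f w.target.Obj_of_type[OF f] va[OF f]
    show "cmp \<theta> y \<cdot>\<^bsub>P\<^esub> ar (w \<circ>1 v) f = ar (id1 P) f \<cdot>\<^bsub>P\<^esub> cmp \<theta> x"
      by (simp add: \<theta>_def)
  qed (auto simp: \<theta>_def)
  define ro where "ro x = (SOME g. hom_type L g = Some (vo (ob w x), x) \<and> ar w g = t (ob w x))" for x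
  have ro: "hom_type L (ro x) = Some (vo (ob w x), x)" "ar w (ro x) = t (ob w x)" if x: "x \<in> Obj L" for x
  proof -
    have "\<exists>g. hom_type L g = Some (vo (ob w x), x) \<and> ar w g = t (ob w x)"
      by (rule lift) (simp_all add: x)
    from someI_ex[OF this] show "hom_type L (ro x) = Some (vo (ob w x), x)" "ar w (ro x) = t (ob w x)"
      by (simp_all add: ro_def)
  qed
  define \<rho> where "\<rho> = \<lparr>src2 = v \<circ>1 w, tgt2 = id1 L, cmp = restrict ro (Obj L)\<rparr>"
  have \<rho>: "gpd_nat_trans (v \<circ>1 w) (id1 L) \<rho>"
  proof (rule gpd_nat_transI[OF _ _ vw gpd_functor_id1[OF gL]])
    fix f x y assume f: "hom_type L f = Some (x, y)"
    note xy [simp] = f w.source.Obj_of_type[OF f]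
    have wf: "hom_type P (ar w f) = Some (ob w x, ob w y)" by simp
    note [simp] = va[OF wf] ro[OF xy(2)] ro[OF xy(3)]
    show "cmp \<rho> y \<cdot>\<^bsub>L\<^esub> ar (v \<circ>1 w) f = ar (id1 L) f \<cdot>\<^bsub>L\<^esub> cmp \<rho> x"
      by (rule inj[of _ "vo (ob w x)" y]) (simp_all add: \<rho>_def w.ar_Comp)
  qed (auto simp: \<rho>_def ro)
  show thesis by (rule that[OF v \<theta> \<rho>])
qed

subsection \<open>Strictly commuting squares equivalent to iso-comma squares\<close>

locale commuting_square = cospan i u H K G
  for i u :: "'a cell1" and H K G :: "'a gpd" +
  fixes p q :: "'a cell1" and L :: "'a gpd"
  assumes p: "gpd_functor L H p" and q: "gpd_functor L K q" and commutes: "i \<circ>1 p = u \<circ>1 q"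
begin

sublocale p: is_functor L H p using p by (simp add: gpd_functorD)
sublocale q: is_functor L K q using q by (simp add: gpd_functorD)

lemma src_tgt_pq [simp]: "src p = L" "tgt p = H" "src q = L" "tgt q = K"
  using p q by (simp_all add: gpd_functorD)

lemma gpd_L: "finite_groupoid L" using p by (rule gpd_functorD)

lemma commutes_ob: "x \<in> Obj L \<Longrightarrow> ob u (ob q x) = ob i (ob p x)"
  using arg_cong[OF commutes, of "\<lambda>c. ob c x"] by simp

lemma commutes_ar: "hom_type L f = Some (x, y) \<Longrightarrow> ar u (ar q f) = ar i (ar p f)"
  using arg_cong[OF commutes, of "\<lambda>c. ar c f"] by simp

abbreviation "w \<equiv> comma_into i u p q"

lemma w_simps [simp]:
  "src w = L" "tgt w = comma i u"
  "x \<in> Obj L \<Longrightarrow> ob w x = Tup (Tup (ob p x) (ob q x)) (Idn G (ob i (ob p x)))"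
  "hom_type L f = Some (x, y) \<Longrightarrow> ar w f = Tup (Tup (ob w x) (ob w y)) (Tup (ar p f) (ar q f))"
  by (auto simp: comma_into_def Let_def p.source.Obj_of_type hom_typeD)

lemma gpd_functor_w: "gpd_functor L (comma i u) w"
proof (rule gpd_functorI[OF gpd_L finite_groupoid_comma])
  fix x assume x [simp]: "x \<in> Obj L"
  have t: "hom_type L (Idn L x) = Some (x, x)" by simp
  show "ar w (Idn L x) = Idn (comma i u) (ob w x)"
    by (simp add: w_simps(4)[OF t] commutes_ob comma_Idn)
next
  fix f g x y z assume f: "hom_type L f = Some (x, y)" and g: "hom_type L g = Some (y, z)"
  have gf: "hom_type L (g \<cdot>\<^bsub>L\<^esub> f) = Some (x, z)" using f g by simp
  note [simp] = f g p.source.Obj_of_type[OF f] p.source.Obj_of_type[OF g] commutes_ob commutes_ar[OF f] commutes_ar[OF g]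
  show "ar w (g \<cdot>\<^bsub>L\<^esub> f) = ar w g \<cdot>\<^bsub>comma i u\<^esub> ar w f"
    by (simp add: w_simps(4)[OF f] w_simps(4)[OF g] w_simps(4)[OF gf] comma_Comp p.ar_Comp q.ar_Comp)
next
  fix f x y assume f: "hom_type L f = Some (x, y)"
  note [simp] = f p.source.Obj_of_type[OF f] commutes_ob commutes_ar[OF f]
  show "hom_type (comma i u) (ar w f) = Some (ob w x, ob w y)"
    by (simp add: w_simps(4)[OF f])
qed (auto simp: commutes_ob, auto simp: comma_into_def Let_def)

lemma comma_w: "comma1 i u \<circ>1 w = p" "comma2 i u \<circ>1 w = q"
proof -
  note w = gpd_functor_w
  have mem: "ob w x \<in> comma_Obj i u" if "x \<in> Obj L" for x using that by (simp add: commutes_ob)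
  have mem': "ar w f \<in> comma_Arr i u" if f: "hom_type L f = Some (x, y)" for f x y
    using f p.source.Obj_of_type[OF f] by (simp add: w_simps(4)[OF f] commutes_ob commutes_ar)
  show "comma1 i u \<circ>1 w = p"
    by (rule cell1_eqI[OF gpd_functor_comp1[OF w gpd_functor_comma(1)] p])
      (use mem mem' in \<open>auto simp: w_simps(4)\<close>)
  show "comma2 i u \<circ>1 w = q"
    by (rule cell1_eqI[OF gpd_functor_comp1[OF w gpd_functor_comma(2)] q])
      (use mem mem' in \<open>auto simp: w_simps(4)\<close>)
qed

lemma comma_cell_w: "hcomp2 (inv2 (comma_cell i u)) (id2 w) = id2 (u \<circ>1 q)"
proof -
  note c = gpd_nat_trans_inv2(1)[OF gpd_nat_trans_comma_cell]
  have w: "gpd_functor L (src (u \<circ>1 comma2 i u)) w" using gpd_functor_w by simp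
  have uq: "(u \<circ>1 comma2 i u) \<circ>1 w = u \<circ>1 q"
    using comp1_assoc[OF gpd_functor_w gpd_functor_comma(2) u] by (simp add: comma_w)
  have ip: "(i \<circ>1 comma1 i u) \<circ>1 w = u \<circ>1 q"
    using comp1_assoc[OF gpd_functor_w gpd_functor_comma(1) i] by (simp add: comma_w commutes)
  show ?thesis
  proof (rule cell2_eqI)
    show "gpd_nat_trans (u \<circ>1 q) (u \<circ>1 q) (hcomp2 (inv2 (comma_cell i u)) (id2 w))"
      using gpd_nat_trans_whisker(1)[OF c w] unfolding uq ip .
    show "gpd_nat_trans (u \<circ>1 q) (u \<circ>1 q) (id2 (u \<circ>1 q))"
      by (rule gpd_nat_trans_id2[OF gpd_functor_comp1[OF q u]])
    fix x assume "x \<in> Obj (src (u \<circ>1 q))"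
    then have x [simp]: "x \<in> Obj L" by simp
    have mem: "ob w x \<in> comma_Obj i u" by (simp add: commutes_ob)
    show "cmp (hcomp2 (inv2 (comma_cell i u)) (id2 w)) x = cmp (id2 (u \<circ>1 q)) x"
      using gpd_nat_trans_whisker(2)[OF c w x] mem by (simp add: inv2_def id2_def commutes_ob)
  qed
qed

end

text \<open>The square is a weak pullback if the induced functor into the iso-comma groupoid is an
  equivalence. The external product and the diagonal of a faithful functor lead to squares that
  commute strictly and are not iso-comma squares, but weak pullbacks.\<close>

locale weak_pullback = commuting_square +
  assumes fully_faithful: "\<lbrakk>x \<in> Obj L; y \<in> Obj L; hom_type H a = Some (ob p x, ob p y);
        hom_type K b = Some (ob q x, ob q y); ar i a = ar u b\<rbrakk>
      \<Longrightarrow> \<exists>!f. hom_type L f = Some (x, y) \<and> ar p f = a \<and> ar q f = b"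
    and essentially_surjective: "\<lbrakk>x \<in> Obj H; y \<in> Obj K; hom_type G g = Some (ob i x, ob u y)\<rbrakk>
      \<Longrightarrow> \<exists>z a b. z \<in> Obj L \<and> hom_type H a = Some (ob p z, x) \<and> hom_type K b = Some (ob q z, y)
          \<and> g \<cdot>\<^bsub>G\<^esub> ar i a = ar u b"
begin

lemma w_fully_faithful:
  assumes x: "x \<in> Obj L" and y: "y \<in> Obj L"
  shows "bij_betw (ar w) (Hom L x y) (Hom (comma i u) (ob w x) (ob w y))"
proof (rule bij_betwI')
  fix f g assume f: "f \<in> Hom L x y" and g: "g \<in> Hom L x y"
  then have f: "hom_type L f = Some (x, y)" and g: "hom_type L g = Some (x, y)" by simp_all
  show "ar w f = ar w g \<longleftrightarrow> f = g"
  proof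
    assume "ar w f = ar w g"
    then have "ar p f = ar p g" "ar q f = ar q g" unfolding w_simps(4)[OF f] w_simps(4)[OF g] by simp_all
    then show "f = g"
      using fully_faithful[OF x y, of "ar p f" "ar q f"] f g commutes_ar[OF f] by auto
  qed simp
next
  fix f assume "f \<in> Hom L x y"
  then have f: "hom_type L f = Some (x, y)" by simp
  interpret w: is_functor L "comma i u" w using gpd_functor_w by (rule gpd_functorD)
  show "ar w f \<in> Hom (comma i u) (ob w x) (ob w y)"
    using w.ar_closed[of f x y] f by simp
next
  fix h assume "h \<in> Hom (comma i u) (ob w x) (ob w y)"
  then have h: "h \<in> comma_Arr i u" "tfst (tfst h) = ob w x" "tsnd (tfst h) = ob w y"
    by (auto split: if_splits)
  then obtain a b where h': "h = Tup (Tup (ob w x) (ob w y)) (Tup a b)"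
    by (elim comma_ArrE) auto
  have ab: "hom_type H a = Some (ob p x, ob p y)" "hom_type K b = Some (ob q x, ob q y)" "ar i a = ar u b"
    using h(1) x y unfolding h' by (auto simp: commutes_ob)
  obtain f where f: "hom_type L f = Some (x, y)" "ar p f = a" "ar q f = b"
    using fully_faithful[OF x y ab] by blast
  show "\<exists>f\<in>Hom L x y. h = ar w f"
    by (rule bexI[of _ f]) (simp_all only: w_simps(4)[OF f(1)] f h' Hom_type)
qed

lemma w_essentially_surjective:
  assumes z: "z \<in> Obj (comma i u)"
  shows "\<exists>x\<in>Obj L. \<exists>t. hom_type (comma i u) t = Some (ob w x, z)"
proof -
  obtain x y g where z': "z = Tup (Tup x y) g" "x \<in> Obj H" "y \<in> Obj K" "hom_type G g = Some (ob i x, ob u y)"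
    using z by (auto elim: comma_ObjE)
  obtain l a b where l [simp]: "l \<in> Obj L" and ab: "hom_type H a = Some (ob p l, x)" "hom_type K b = Some (ob q l, y)"
    "g \<cdot>\<^bsub>G\<^esub> ar i a = ar u b"
    using essentially_surjective[OF z'(2-4)] by blast
  have "hom_type (comma i u) (Tup (Tup (ob w l) z) (Tup a b)) = Some (ob w l, z)"
    using ab z' by (simp add: commutes_ob)
  then show ?thesis using l by blast
qed

lemmas w_quasi_inverse = quasi_inverse[OF gpd_functor_w w_fully_faithful w_essentially_surjective]

end

lemma faithfulD:
  assumes i: "gpd_functor H G i" and f: "faithful i"
    and "hom_type H a = Some (x, y)" "hom_type H b = Some (x, y)" "ar i a = ar i b"
  shows "a = b"
proof -
  interpret is_functor H G i using i by (rule gpd_functorD)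
  have "x \<in> Obj H" "y \<in> Obj H" using assms(3) by (simp_all add: source.Obj_of_type)
  then show ?thesis using assms gpd_functorD(4)[OF i] by (auto simp: faithful_def inj_on_def)
qed

lemma faithfulI:
  assumes i: "gpd_functor H G i"
    and "\<And>a b x y. \<lbrakk>hom_type H a = Some (x, y); hom_type H b = Some (x, y); ar i a = ar i b\<rbrakk> \<Longrightarrow> a = b"
  shows "faithful i"
  using assms gpd_functorD(4)[OF i] unfolding faithful_def inj_on_def by auto

lemma comp1_id1:
  assumes u: "gpd_functor H G u"
  shows "u \<circ>1 id1 H = u" "id1 G \<circ>1 u = u"
proof -
  interpret is_functor H G u using u by (rule gpd_functorD)
  have [simp]: "src u = H" "tgt u = G" using u by (simp_all add: gpd_functorD)
  note H = gpd_functorD(1)[OF u] and G = gpd_functorD(2)[OF u]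
  show "u \<circ>1 id1 H = u"
    by (rule cell1_eqI[OF gpd_functor_comp1[OF gpd_functor_id1[OF H] u] u]) simp_all
  show "id1 G \<circ>1 u = u"
    by (rule cell1_eqI[OF gpd_functor_comp1[OF u gpd_functor_id1[OF G]] u]) simp_all
qed

lemma faithful_id1: "finite_groupoid G \<Longrightarrow> faithful (id1 G)"
  by (rule faithfulI[OF gpd_functor_id1]) simp_all

lemma faithful_prod1:
  assumes u: "gpd_functor H1 G1 u" "faithful u" and v: "gpd_functor H2 G2 v" "faithful v"
  shows "faithful (prod1 u v)"
proof (rule faithfulI[OF gpd_functor_prod1[OF u(1) v(1)]])
  have [simp]: "src u = H1" "src v = H2" using u v by (simp_all add: gpd_functorD)
  fix a b x y
  assume a: "hom_type (gpd_prod H1 H2) a = Some (x, y)" and b: "hom_type (gpd_prod H1 H2) b = Some (x, y)"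
    and eq: "ar (prod1 u v) a = ar (prod1 u v) b"
  obtain a1 a2 x1 x2 y1 y2 where a': "a = Tup a1 a2" "x = Tup x1 x2" "y = Tup y1 y2"
    "hom_type H1 a1 = Some (x1, y1)" "hom_type H2 a2 = Some (x2, y2)"
    using a by (rule gpd_prod_typeE)
  obtain b1 b2 where b': "b = Tup b1 b2" "hom_type H1 b1 = Some (x1, y1)" "hom_type H2 b2 = Some (x2, y2)"
    using b a'(2,3) by (elim gpd_prod_typeE) auto
  have "ar u a1 = ar u b1" "ar v a2 = ar v b2" using eq a' b' by simp_all
  then show "a = b"
    using faithfulD[OF u a'(4) b'(2)] faithfulD[OF v a'(5) b'(3)] a' b' by simp
qed

abbreviation diag :: "'a gpd \<Rightarrow> 'a cell1" where
  "diag G \<equiv> pairing (id1 G) (id1 G)"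

lemma gpd_functor_diag: "finite_groupoid G \<Longrightarrow> gpd_functor G (gpd_prod G G) (diag G)"
  by (intro gpd_functor_pairing gpd_functor_id1)

lemma proj_pairing:
  assumes u: "gpd_functor L G1 u" and v: "gpd_functor L G2 v"
  shows "proj1 G1 G2 \<circ>1 pairing u v = u" "proj2 G1 G2 \<circ>1 pairing u v = v"
proof -
  interpret u: is_functor L G1 u using u by (rule gpd_functorD)
  interpret v: is_functor L G2 v using v by (rule gpd_functorD)
  have [simp]: "src u = L" "tgt u = G1" "src v = L" "tgt v = G2" using u v by (simp_all add: gpd_functorD)
  note G = gpd_functorD(2)[OF u] gpd_functorD(2)[OF v]
  show "proj1 G1 G2 \<circ>1 pairing u v = u"
    by (rule cell1_eqI[OF gpd_functor_comp1[OF gpd_functor_pairing[OF u v] gpd_functor_proj(1)[OF G]] u]) simp_all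
  show "proj2 G1 G2 \<circ>1 pairing u v = v"
    by (rule cell1_eqI[OF gpd_functor_comp1[OF gpd_functor_pairing[OF u v] gpd_functor_proj(2)[OF G]] v]) simp_all
qed

lemma proj_prod1:
  assumes u: "gpd_functor H1 G1 u" and v: "gpd_functor H2 G2 v"
  shows "proj1 G1 G2 \<circ>1 prod1 u v = u \<circ>1 proj1 H1 H2" "proj2 G1 G2 \<circ>1 prod1 u v = v \<circ>1 proj2 H1 H2"
proof -
  interpret u: is_functor H1 G1 u using u by (rule gpd_functorD)
  interpret v: is_functor H2 G2 v using v by (rule gpd_functorD)
  have [simp]: "src u = H1" "tgt u = G1" "src v = H2" "tgt v = G2" using u v by (simp_all add: gpd_functorD)
  note G = gpd_functorD(2)[OF u] gpd_functorD(2)[OF v] and H = gpd_functorD(1)[OF u] gpd_functorD(1)[OF v]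
  note uv = gpd_functor_prod1[OF u v]
  show "proj1 G1 G2 \<circ>1 prod1 u v = u \<circ>1 proj1 H1 H2"
    by (rule cell1_eqI[OF gpd_functor_comp1[OF uv gpd_functor_proj(1)[OF G]] gpd_functor_comp1[OF gpd_functor_proj(1)[OF H] u]])
      (auto elim!: gpd_prod_ObjE gpd_prod_typeE)
  show "proj2 G1 G2 \<circ>1 prod1 u v = v \<circ>1 proj2 H1 H2"
    by (rule cell1_eqI[OF gpd_functor_comp1[OF uv gpd_functor_proj(2)[OF G]] gpd_functor_comp1[OF gpd_functor_proj(2)[OF H] v]])
      (auto elim!: gpd_prod_ObjE gpd_prod_typeE)
qed

text \<open>A fibre product over \<open>G\<close> is the preimage of the diagonal under a map between products. As the tensor
  product of \<open>M(G)\<close> is the restriction of the external product along the diagonal, this is how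
  properties of external products become properties of tensor products.\<close>

context weak_pullback
begin

lemma prod_commutes: "prod1 i u \<circ>1 pairing p q = diag G \<circ>1 (i \<circ>1 p)"
proof -
  note [simp] = commutes_ob commutes_ar
  show ?thesis
    by (rule cell1_eqI[OF gpd_functor_comp1[OF gpd_functor_pairing[OF p q] gpd_functor_prod1[OF i u]]
          gpd_functor_comp1[OF gpd_functor_comp1[OF p i] gpd_functor_diag[OF gpds(3)]]]) simp_all
qed

lemma weak_pullback_diag:
  "weak_pullback (prod1 i u) (diag G) (gpd_prod H K) G (gpd_prod G G) (pairing p q) (i \<circ>1 p) L"
proof
  show "gpd_functor (gpd_prod H K) (gpd_prod G G) (prod1 i u)" by (rule gpd_functor_prod1[OF i u])
  show "gpd_functor G (gpd_prod G G) (diag G)" by (rule gpd_functor_diag[OF gpds(3)])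
  show "gpd_functor L (gpd_prod H K) (pairing p q)" by (rule gpd_functor_pairing[OF p q])
  show "gpd_functor L G (i \<circ>1 p)" by (rule gpd_functor_comp1[OF p i])
  show "prod1 i u \<circ>1 pairing p q = diag G \<circ>1 (i \<circ>1 p)" by (rule prod_commutes)
next
  fix x y a b assume x: "x \<in> Obj L" and y: "y \<in> Obj L"
    and a: "hom_type (gpd_prod H K) a = Some (ob (pairing p q) x, ob (pairing p q) y)"
    and b: "hom_type G b = Some (ob (i \<circ>1 p) x, ob (i \<circ>1 p) y)"
    and eq: "ar (prod1 i u) a = ar (diag G) b"
  obtain a1 a2 where a': "a = Tup a1 a2" and t: "hom_type H a1 = Some (ob p x, ob p y)" "hom_type K a2 = Some (ob q x, ob q y)"
    using a x y by (elim gpd_prod_typeE) auto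
  have b12: "ar i a1 = b" "ar u a2 = b" using eq b t by (simp_all add: a')
  have "\<exists>!f. hom_type L f = Some (x, y) \<and> ar p f = a1 \<and> ar q f = a2"
    by (rule fully_faithful[OF x y t]) (simp only: b12)
  then obtain f where f: "hom_type L f = Some (x, y)" "ar p f = a1" "ar q f = a2"
    and unique: "\<And>g. \<lbrakk>hom_type L g = Some (x, y); ar p g = a1; ar q g = a2\<rbrakk> \<Longrightarrow> g = f"
    by (elim ex1E) blast
  show "\<exists>!f. hom_type L f = Some (x, y) \<and> ar (pairing p q) f = a \<and> ar (i \<circ>1 p) f = b"
  proof (rule ex1I[of _ f])
    show "hom_type L f = Some (x, y) \<and> ar (pairing p q) f = a \<and> ar (i \<circ>1 p) f = b"
      using f b12 by (simp add: a')
    show "g = f" if "hom_type L g = Some (x, y) \<and> ar (pairing p q) g = a \<and> ar (i \<circ>1 p) g = b" for g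
      using that by (intro unique) (auto simp: a')
  qed
next
  fix z y g assume z: "z \<in> Obj (gpd_prod H K)" and y: "y \<in> Obj G"
    and g: "hom_type (gpd_prod G G) g = Some (ob (prod1 i u) z, ob (diag G) y)"
  obtain x1 x2 where z': "z = Tup x1 x2" and x: "x1 \<in> Obj H" "x2 \<in> Obj K" using z by (rule gpd_prod_ObjE)
  obtain g1 g2 where g': "g = Tup g1 g2" "hom_type G g1 = Some (ob i x1, y)" "hom_type G g2 = Some (ob u x2, y)"
    using g y x by (elim gpd_prod_typeE) (auto simp: z')
  have t: "hom_type G (inv_arr G g2 \<cdot>\<^bsub>G\<^esub> g1) = Some (ob i x1, ob u x2)" using g' by simp
  obtain l a b where l [simp]: "l \<in> Obj L" and ab: "hom_type H a = Some (ob p l, x1)" "hom_type K b = Some (ob q l, x2)"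
    and eq: "(inv_arr G g2 \<cdot>\<^bsub>G\<^esub> g1) \<cdot>\<^bsub>G\<^esub> ar i a = ar u b"
    using essentially_surjective[OF x t] by blast
  have "g2 \<cdot>\<^bsub>G\<^esub> ar u b = g1 \<cdot>\<^bsub>G\<^esub> ar i a" unfolding eq[symmetric] using g' ab by simp
  then show "\<exists>l a b. l \<in> Obj L \<and> hom_type (gpd_prod H K) a = Some (ob (pairing p q) l, z)
      \<and> hom_type G b = Some (ob (i \<circ>1 p) l, y) \<and> g \<cdot>\<^bsub>gpd_prod G G\<^esub> ar (prod1 i u) a = ar (diag G) b"
    using ab g' x commutes_ob[OF l]
    by (intro exI[of _ l] exI[of _ "Tup a b"] exI[of _ "g1 \<cdot>\<^bsub>G\<^esub> ar i a"]) (simp add: z')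
qed

end

lemma weak_pullback_id:
  assumes i: "gpd_functor H G i"
  shows "weak_pullback i (id1 G) H G G (id1 H) i H" "weak_pullback (id1 G) i G H G i (id1 H) H"
proof -
  interpret is_functor H G i using i by (rule gpd_functorD)
  note H = gpd_functorD(1)[OF i] and G = gpd_functorD(2)[OF i]
  have isoG [simp]: "hom_type G f = r \<Longrightarrow> r \<noteq> None \<Longrightarrow> iso_arr G f" for f r
    using finite_groupoidD(4)[OF G] by auto
  show "weak_pullback i (id1 G) H G G (id1 H) i H"
  proof
    fix x y a b assume xy: "x \<in> Obj H" "y \<in> Obj H" and a: "hom_type H a = Some (ob (id1 H) x, ob (id1 H) y)"
      and b: "hom_type G b = Some (ob i x, ob i y)" and eq: "ar i a = ar (id1 G) b"
    have a': "hom_type H a = Some (x, y)" using a xy by simp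
    have b': "ar i a = b" using eq b by simp
    show "\<exists>!f. hom_type H f = Some (x, y) \<and> ar (id1 H) f = a \<and> ar i f = b"
    proof (rule ex1I[of _ a])
      show "hom_type H a = Some (x, y) \<and> ar (id1 H) a = a \<and> ar i a = b" using a' b' by simp
      show "f = a" if "hom_type H f = Some (x, y) \<and> ar (id1 H) f = a \<and> ar i f = b" for f
        using that id1_simps(4)[of H f] by simp
    qed
  next
    fix x y g assume x: "x \<in> Obj H" and y: "y \<in> Obj G" and g: "hom_type G g = Some (ob i x, ob (id1 G) y)"
    have "x \<in> Obj H \<and> hom_type H (Idn H x) = Some (ob (id1 H) x, x) \<and> hom_type G g = Some (ob i x, y)
        \<and> g \<cdot>\<^bsub>G\<^esub> ar i (Idn H x) = ar (id1 G) g"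
      using x y g by simp
    then show "\<exists>z a b. z \<in> Obj H \<and> hom_type H a = Some (ob (id1 H) z, x) \<and> hom_type G b = Some (ob i z, y)
          \<and> g \<cdot>\<^bsub>G\<^esub> ar i a = ar (id1 G) b"
      by blast
  qed (simp_all add: i gpd_functor_id1 H G comp1_id1[OF i])
  show "weak_pullback (id1 G) i G H G i (id1 H) H"
  proof
    fix x y a b assume xy: "x \<in> Obj H" "y \<in> Obj H" and b: "hom_type H b = Some (ob (id1 H) x, ob (id1 H) y)"
      and a: "hom_type G a = Some (ob i x, ob i y)" and eq: "ar (id1 G) a = ar i b"
    have b': "hom_type H b = Some (x, y)" using b xy by simp
    have a': "ar i b = a" using eq a by simp
    show "\<exists>!f. hom_type H f = Some (x, y) \<and> ar i f = a \<and> ar (id1 H) f = b"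
    proof (rule ex1I[of _ b])
      show "hom_type H b = Some (x, y) \<and> ar i b = a \<and> ar (id1 H) b = b" using a' b' by simp
      show "f = b" if "hom_type H f = Some (x, y) \<and> ar i f = a \<and> ar (id1 H) f = b" for f
        using that id1_simps(4)[of H f] by simp
    qed
  next
    fix x y g assume x: "x \<in> Obj G" and y: "y \<in> Obj H" and g: "hom_type G g = Some (ob (id1 G) x, ob i y)"
    have "y \<in> Obj H \<and> hom_type G (inv_arr G g) = Some (ob i y, x) \<and> hom_type H (Idn H y) = Some (ob (id1 H) y, y)
        \<and> g \<cdot>\<^bsub>G\<^esub> ar (id1 G) (inv_arr G g) = ar i (Idn H y)"
      using x y g by simp
    then show "\<exists>z a b. z \<in> Obj H \<and> hom_type G a = Some (ob i z, x) \<and> hom_type H b = Some (ob (id1 H) z, y)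
          \<and> g \<cdot>\<^bsub>G\<^esub> ar (id1 G) a = ar i b"
      by blast
  qed (simp_all add: i gpd_functor_id1 H G comp1_id1[OF i])
qed

subsection \<open>The diagonal of a faithful functor\<close>

locale diagonal = cospan i i H H G
  for i :: "'a cell1" and H G :: "'a gpd" +
  assumes faithful: "faithful i"
begin

sublocale sq: commuting_square i i H H G "id1 H" "id1 H" H
  by unfold_locales (simp_all add: gpd_functor_id1 gpds)

abbreviation "d \<equiv> comma_into i i (id1 H) (id1 H)"

lemma d_simps:
  "x \<in> Obj H \<Longrightarrow> ob d x = Tup (Tup x x) (Idn G (ob i x))"
  "hom_type H f = Some (x, y) \<Longrightarrow> ar d f = Tup (Tup (ob d x) (ob d y)) (Tup f f)"
  using sq.w_simps(4)[of f x y] by simp_all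

lemma faithful_d: "faithful d"
  by (rule faithfulI[OF sq.gpd_functor_w]) (simp add: d_simps(2))

text \<open>As \<open>i\<close> is faithful, its diagonal is fully faithful. Hence the pullback of the diagonal along itself
  is trivial.\<close>

lemma weak_pullback_d: "weak_pullback d d H H (comma i i) (id1 H) (id1 H) H"
proof
  show "gpd_functor H (comma i i) d" by (rule sq.gpd_functor_w)
  show "gpd_functor H H (id1 H)" by (rule gpd_functor_id1[OF gpds(1)])
  show "d \<circ>1 id1 H = d \<circ>1 id1 H" ..
next
  fix x y a b assume xy: "x \<in> Obj H" "y \<in> Obj H" and a: "hom_type H a = Some (ob (id1 H) x, ob (id1 H) y)"
    and b: "hom_type H b = Some (ob (id1 H) x, ob (id1 H) y)" and eq: "ar d a = ar d b"
  have t: "hom_type H a = Some (x, y)" "hom_type H b = Some (x, y)" using a b xy by simp_all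
  have "a = b" using eq unfolding d_simps(2)[OF t(1)] d_simps(2)[OF t(2)] by simp
  show "\<exists>!f. hom_type H f = Some (x, y) \<and> ar (id1 H) f = a \<and> ar (id1 H) f = b"
  proof (rule ex1I[of _ a])
    show "hom_type H a = Some (x, y) \<and> ar (id1 H) a = a \<and> ar (id1 H) a = b" using t \<open>a = b\<close> by simp
    show "f = a" if "hom_type H f = Some (x, y) \<and> ar (id1 H) f = a \<and> ar (id1 H) f = b" for f
      using that id1_simps(4)[of H f] by simp
  qed
next
  fix x y g assume x: "x \<in> Obj H" and y: "y \<in> Obj H" and g: "hom_type (comma i i) g = Some (ob d x, ob d y)"
  then have g': "g \<in> comma_Arr i i" "tfst (tfst g) = ob d x" "tsnd (tfst g) = ob d y" by (auto split: if_splits)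
  obtain a b where gab: "g = Tup (Tup (ob d x) (ob d y)) (Tup a b)" using g' by (elim comma_ArrE) auto
  have c: "hom_type H a = Some (x, y)" "hom_type H b = Some (x, y)"
    "Idn G (ob i y) \<cdot>\<^bsub>G\<^esub> ar i a = ar i b \<cdot>\<^bsub>G\<^esub> Idn G (ob i x)"
    using g'(1) x y unfolding gab by (simp_all add: d_simps(1))
  then have ab: "hom_type H a = Some (x, y)" "hom_type H b = Some (x, y)" "ar i a = ar i b"
    by simp_all
  have "a = b" by (rule faithfulD[OF faithful ab])
  then have "g = ar d a" using gab d_simps(2)[OF ab(1)] by simp
  interpret d: is_functor H "comma i i" d using sq.gpd_functor_w by (rule gpd_functorD)
  have "g \<cdot>\<^bsub>comma i i\<^esub> ar d (Idn H x) = ar d a"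
    using x g \<open>g = ar d a\<close> d.ar_idn[OF x] d.target.comp_idn_right[of g "ob d x" "ob d y"]
    by (simp only: Hom_type)
  moreover have "hom_type H (Idn H x) = Some (ob (id1 H) x, x)" "hom_type H a = Some (ob (id1 H) x, y)"
    using x ab(1) by simp_all
  ultimately show "\<exists>z a b. z \<in> Obj H \<and> hom_type H a = Some (ob (id1 H) z, x) \<and> hom_type H b = Some (ob (id1 H) z, y)
          \<and> g \<cdot>\<^bsub>comma i i\<^esub> ar d a = ar d b"
    using x by blast
qed

end

section \<open>Couniversal arrows\<close>

text \<open>A couniversal arrow identifies \<open>b\<close> with the value at \<open>z\<close> of a right adjoint of \<open>F\<close>, and says nothing
  about a left adjoint. This weaker notion can be carried along weak pullbacks and tensor products.\<close>

definition couniversal ::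
  "('o, 'm, 'y) category_scheme \<Rightarrow> ('p, 'n, 'z) category_scheme \<Rightarrow> ('o, 'm, 'p, 'n, 'w) functor_data_scheme
    \<Rightarrow> 'o \<Rightarrow> 'p \<Rightarrow> 'n \<Rightarrow> bool" where
  "couniversal C D F b z e \<longleftrightarrow> b \<in> Obj C \<and> z \<in> Obj D \<and> hom_type D e = Some (ob F b, z) \<and>
     (\<forall>w g. w \<in> Obj C \<longrightarrow> hom_type D g = Some (ob F w, z)
        \<longrightarrow> (\<exists>!f. hom_type C f = Some (w, b) \<and> e \<cdot>\<^bsub>D\<^esub> ar F f = g))"

lemma couniversal_type:
  assumes "couniversal C D F b z e"
  shows "b \<in> Obj C" "z \<in> Obj D" "hom_type D e = Some (ob F b, z)"
  using assms unfolding couniversal_def by blast+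

lemma couniversal_lift:
  assumes "couniversal C D F b z e" "w \<in> Obj C" "hom_type D g = Some (ob F w, z)"
  obtains f where "hom_type C f = Some (w, b)" "e \<cdot>\<^bsub>D\<^esub> ar F f = g"
  using assms unfolding couniversal_def by blast

lemma (in is_functor) couniversal_unique:
  assumes e: "couniversal C D F b z e" and f: "hom_type C f = Some (w, b)" "hom_type C g = Some (w, b)"
    and eq: "e \<cdot>\<^bsub>D\<^esub> ar F f = e \<cdot>\<^bsub>D\<^esub> ar F g"
  shows "f = g"
proof -
  have w: "w \<in> Obj C" by (rule source.Obj_of_type(1)[OF f(1)])
  have "hom_type D (e \<cdot>\<^bsub>D\<^esub> ar F g) = Some (ob F w, z)"
    using couniversal_type[OF e] f by simp
  then have "\<exists>!h. hom_type C h = Some (w, b) \<and> e \<cdot>\<^bsub>D\<^esub> ar F h = e \<cdot>\<^bsub>D\<^esub> ar F g"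
    using e w unfolding couniversal_def by blast
  then show ?thesis using f eq by blast
qed

lemma (in is_functor) couniversalI:
  assumes "b \<in> Obj C" "z \<in> Obj D" "hom_type D e = Some (ob F b, z)"
    and "\<And>w g. \<lbrakk>w \<in> Obj C; hom_type D g = Some (ob F w, z)\<rbrakk> \<Longrightarrow> \<exists>f. hom_type C f = Some (w, b) \<and> e \<cdot>\<^bsub>D\<^esub> ar F f = g"
    and "\<And>w f g. \<lbrakk>hom_type C f = Some (w, b); hom_type C g = Some (w, b); e \<cdot>\<^bsub>D\<^esub> ar F f = e \<cdot>\<^bsub>D\<^esub> ar F g\<rbrakk> \<Longrightarrow> f = g"
  shows "couniversal C D F b z e"
  unfolding couniversal_def
proof (intro conjI allI impI)
  fix w g assume "w \<in> Obj C" "hom_type D g = Some (ob F w, z)"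
  then obtain f where f: "hom_type C f = Some (w, b)" "e \<cdot>\<^bsub>D\<^esub> ar F f = g" using assms(4) by blast
  show "\<exists>!f. hom_type C f = Some (w, b) \<and> e \<cdot>\<^bsub>D\<^esub> ar F f = g"
  proof (rule ex1I[of _ f])
    show "hom_type C f = Some (w, b) \<and> e \<cdot>\<^bsub>D\<^esub> ar F f = g" using f by blast
    show "h = f" if "hom_type C h = Some (w, b) \<and> e \<cdot>\<^bsub>D\<^esub> ar F h = g" for h
      using that f by (intro assms(5)[of h w f]) simp_all
  qed
qed (fact assms(1-3))+

lemma (in is_functor) couniversal_transport:
  assumes e: "couniversal C D F b z e" and k: "iso_arr C k" "hom_type C k = Some (b', b)"
    and h: "iso_arr D h" "hom_type D h = Some (z, z')"
  shows "couniversal C D F b' z' (h \<cdot>\<^bsub>D\<^esub> e \<cdot>\<^bsub>D\<^esub> ar F k)"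
proof -
  note [simp] = couniversal_type[OF e] k h source.Obj_of_type[OF k(2)] target.Obj_of_type[OF h(2)]
  have shift: "(h \<cdot>\<^bsub>D\<^esub> e \<cdot>\<^bsub>D\<^esub> ar F k) \<cdot>\<^bsub>D\<^esub> ar F f = h \<cdot>\<^bsub>D\<^esub> e \<cdot>\<^bsub>D\<^esub> ar F (k \<cdot>\<^bsub>C\<^esub> f)"
    if "hom_type C f = Some (w, b')" for f w
    using that by (simp add: ar_Comp)
  show ?thesis
  proof (rule couniversalI)
    fix w g assume w: "w \<in> Obj C" and g [simp]: "hom_type D g = Some (ob F w, z')"
    have "hom_type D (inv_arr D h \<cdot>\<^bsub>D\<^esub> g) = Some (ob F w, z)" by simp
    then obtain f where f [simp]: "hom_type C f = Some (w, b)" and ef: "e \<cdot>\<^bsub>D\<^esub> ar F f = inv_arr D h \<cdot>\<^bsub>D\<^esub> g"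
      using couniversal_lift[OF e w] by metis
    have "hom_type C (inv_arr C k \<cdot>\<^bsub>C\<^esub> f) = Some (w, b')" by simp
    moreover from shift[OF this] have "(h \<cdot>\<^bsub>D\<^esub> e \<cdot>\<^bsub>D\<^esub> ar F k) \<cdot>\<^bsub>D\<^esub> ar F (inv_arr C k \<cdot>\<^bsub>C\<^esub> f) = g"
      by (simp add: ef)
    ultimately show "\<exists>f. hom_type C f = Some (w, b') \<and> (h \<cdot>\<^bsub>D\<^esub> e \<cdot>\<^bsub>D\<^esub> ar F k) \<cdot>\<^bsub>D\<^esub> ar F f = g"
      by blast
  next
    fix w f g assume f: "hom_type C f = Some (w, b')" and g: "hom_type C g = Some (w, b')"
      and eq: "(h \<cdot>\<^bsub>D\<^esub> e \<cdot>\<^bsub>D\<^esub> ar F k) \<cdot>\<^bsub>D\<^esub> ar F f = (h \<cdot>\<^bsub>D\<^esub> e \<cdot>\<^bsub>D\<^esub> ar F k) \<cdot>\<^bsub>D\<^esub> ar F g"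
    have kf: "hom_type C (k \<cdot>\<^bsub>C\<^esub> f) = Some (w, b)" "hom_type C (k \<cdot>\<^bsub>C\<^esub> g) = Some (w, b)" using f g by simp_all
    have t: "hom_type D (e \<cdot>\<^bsub>D\<^esub> ar F (k \<cdot>\<^bsub>C\<^esub> f)) = Some (ob F w, z)"
      "hom_type D (e \<cdot>\<^bsub>D\<^esub> ar F (k \<cdot>\<^bsub>C\<^esub> g)) = Some (ob F w, z)" using kf by simp_all
    have "e \<cdot>\<^bsub>D\<^esub> ar F (k \<cdot>\<^bsub>C\<^esub> f) = e \<cdot>\<^bsub>D\<^esub> ar F (k \<cdot>\<^bsub>C\<^esub> g)"
      using eq unfolding shift[OF f] shift[OF g] by (rule target.iso_cancel_left[OF h t])
    then have "k \<cdot>\<^bsub>C\<^esub> f = k \<cdot>\<^bsub>C\<^esub> g" by (rule couniversal_unique[OF e kf])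
    then show "f = g" by (rule source.iso_cancel_left[OF k f g])
  qed simp_all
qed

context ambidextrous_functor
begin

lemma couniversal_of_iso:
  assumes "iso_arr C f" "hom_type C f = Some (b, ob I z)" "z \<in> Obj D"
  shows "couniversal C D R b z (\<epsilon>r z \<cdot>\<^bsub>D\<^esub> ar R f)"
proof -
  have "couniversal C D R (ob I z) z (\<epsilon>r z)"
  proof (rule R.couniversalI)
    fix w g assume w: "w \<in> Obj C" and g: "hom_type D g = Some (ob R w, z)"
    obtain f where "hom_type C f = Some (w, ob I z)" "\<epsilon>r z \<cdot>\<^bsub>D\<^esub> ar R f = g"
      using induced_lift[OF induced_I[OF assms(3)] w g] .
    then show "\<exists>f. hom_type C f = Some (w, ob I z) \<and> \<epsilon>r z \<cdot>\<^bsub>D\<^esub> ar R f = g" by blast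
  next
    show "f = g" if "hom_type C f = Some (w, ob I z)" "hom_type C g = Some (w, ob I z)"
      "\<epsilon>r z \<cdot>\<^bsub>D\<^esub> ar R f = \<epsilon>r z \<cdot>\<^bsub>D\<^esub> ar R g" for w f g
      by (rule induced_unique[OF induced_I[OF assms(3)] that])
  qed (use assms(3) in simp_all)
  from R.couniversal_transport[OF this assms(1,2), of "Idn D z" z] show ?thesis
    using assms by simp
qed

lemma couniversal_iso:
  assumes e: "couniversal C D R b z e"
  obtains f where "iso_arr C f" "hom_type C f = Some (b, ob I z)" "e = \<epsilon>r z \<cdot>\<^bsub>D\<^esub> ar R f"
proof -
  note [simp] = couniversal_type[OF e]
  obtain f where f [simp]: "hom_type C f = Some (b, ob I z)" and ef: "\<epsilon>r z \<cdot>\<^bsub>D\<^esub> ar R f = e"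
    using induced_lift[OF induced_I[OF couniversal_type(2)[OF e]] couniversal_type(1,3)[OF e]] .
  have Iz: "ob I z \<in> Obj C" "hom_type D (\<epsilon>r z) = Some (ob R (ob I z), z)" by simp_all
  obtain g where g [simp]: "hom_type C g = Some (ob I z, b)" and eg: "e \<cdot>\<^bsub>D\<^esub> ar R g = \<epsilon>r z"
    using couniversal_lift[OF e Iz] .
  have "e \<cdot>\<^bsub>D\<^esub> ar R (g \<cdot>\<^bsub>C\<^esub> f) = (e \<cdot>\<^bsub>D\<^esub> ar R g) \<cdot>\<^bsub>D\<^esub> ar R f" by (simp add: R.ar_Comp)
  also have "\<dots> = e \<cdot>\<^bsub>D\<^esub> ar R (Idn C b)" unfolding eg ef by simp
  finally have gf: "g \<cdot>\<^bsub>C\<^esub> f = Idn C b" by (rule R.couniversal_unique[OF e, rotated -1]) simp_all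
  have "\<epsilon>r z \<cdot>\<^bsub>D\<^esub> ar R (f \<cdot>\<^bsub>C\<^esub> g) = (\<epsilon>r z \<cdot>\<^bsub>D\<^esub> ar R f) \<cdot>\<^bsub>D\<^esub> ar R g" by (simp add: R.ar_Comp)
  also have "\<dots> = \<epsilon>r z \<cdot>\<^bsub>D\<^esub> ar R (Idn C (ob I z))" unfolding eg ef by simp
  finally have fg: "f \<cdot>\<^bsub>C\<^esub> g = Idn C (ob I z)"
    by (rule induced_unique[OF induced_I[OF couniversal_type(2)[OF e]], rotated -1]) simp_all
  show thesis by (rule that[OF C.iso_arrI[OF f g gf fg] f ef[symmetric]])
qed

text \<open>For representations of a finite group and the restriction to a subgroup, this is the relative trace,
  which sends \<open>h\<close> to the sum of its conjugates by representatives of the cosets.\<close>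

definition trace :: "'o \<Rightarrow> 'o \<Rightarrow> 'n \<Rightarrow> 'm" where
  "trace x y h = \<epsilon>l y \<cdot>\<^bsub>C\<^esub> ar I h \<cdot>\<^bsub>C\<^esub> \<eta>r x"

lemma trace_type [simp]:
  "\<lbrakk>x \<in> Obj C; y \<in> Obj C; hom_type D h = Some (ob R x, ob R y)\<rbrakk> \<Longrightarrow> hom_type C (trace x y h) = Some (x, y)"
  by (simp add: trace_def)

lemma trace_left:
  assumes "x \<in> Obj C" "hom_type D h = Some (ob R x, ob R y)" "hom_type C k = Some (y, y')"
  shows "k \<cdot>\<^bsub>C\<^esub> trace x y h = trace x y' (ar R k \<cdot>\<^bsub>D\<^esub> h)"
proof -
  note [simp] = assms C.Obj_of_type[OF assms(3)]
  have "k \<cdot>\<^bsub>C\<^esub> trace x y h = (k \<cdot>\<^bsub>C\<^esub> \<epsilon>l y) \<cdot>\<^bsub>C\<^esub> ar I h \<cdot>\<^bsub>C\<^esub> \<eta>r x" by (simp add: trace_def)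
  also have "\<dots> = (\<epsilon>l y' \<cdot>\<^bsub>C\<^esub> ar I (ar R k)) \<cdot>\<^bsub>C\<^esub> ar I h \<cdot>\<^bsub>C\<^esub> \<eta>r x" by (simp only: unit_naturality(2)[OF assms(3)])
  finally show ?thesis by (simp add: trace_def I.ar_Comp)
qed

lemma trace_right:
  assumes "y \<in> Obj C" "hom_type D h = Some (ob R x, ob R y)" "hom_type C k = Some (x', x)"
  shows "trace x y h \<cdot>\<^bsub>C\<^esub> k = trace x' y (h \<cdot>\<^bsub>D\<^esub> ar R k)"
proof -
  note [simp] = assms C.Obj_of_type[OF assms(3)]
  have "trace x y h \<cdot>\<^bsub>C\<^esub> k = \<epsilon>l y \<cdot>\<^bsub>C\<^esub> ar I h \<cdot>\<^bsub>C\<^esub> (\<eta>r x \<cdot>\<^bsub>C\<^esub> k)" by (simp add: trace_def)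
  also have "\<dots> = \<epsilon>l y \<cdot>\<^bsub>C\<^esub> ar I h \<cdot>\<^bsub>C\<^esub> (ar I (ar R k) \<cdot>\<^bsub>C\<^esub> \<eta>r x')" by (simp only: unit_naturality(3)[OF assms(3)])
  finally show ?thesis by (simp add: trace_def I.ar_Comp)
qed

text \<open>The idempotent \<open>n \<cdot> e\<close> of \<open>R b\<close> splits off the summand \<open>z\<close> from which \<open>b\<close> is induced, so that its
  conjugates form a decomposition of the identity of \<open>b\<close>.\<close>

lemma trace_induced:
  assumes a: "induced b z e n"
  shows "trace b b (n \<cdot>\<^bsub>D\<^esub> e) = Idn C b"
proof -
  obtain k where k: "z \<in> Obj D" "b \<in> Obj C" "hom_type D n = Some (z, ob R b)" "hom_type D e = Some (ob R b, z)"
    "iso_arr C k" "hom_type C k = Some (b, ob I z)" "e = \<epsilon>r z \<cdot>\<^bsub>D\<^esub> ar R k" "ar R k \<cdot>\<^bsub>D\<^esub> n = \<eta>l z"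
    using a by (rule inducedE)
  note [simp] = k(1-6)
  have "k \<cdot>\<^bsub>C\<^esub> trace b b (n \<cdot>\<^bsub>D\<^esub> e) = trace b (ob I z) ((ar R k \<cdot>\<^bsub>D\<^esub> n) \<cdot>\<^bsub>D\<^esub> e)"
    by (subst trace_left) simp_all
  also have "\<dots> = (\<epsilon>l (ob I z) \<cdot>\<^bsub>C\<^esub> ar I (\<eta>l z)) \<cdot>\<^bsub>C\<^esub> ar I e \<cdot>\<^bsub>C\<^esub> \<eta>r b"
    unfolding k(8) by (simp add: trace_def I.ar_Comp)
  also have "\<dots> = ar I (\<epsilon>r z \<cdot>\<^bsub>D\<^esub> ar R k) \<cdot>\<^bsub>C\<^esub> \<eta>r b"
    using left.triangle_left[OF k(1)] by (simp add: k(7)[symmetric])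
  also have "\<dots> = k \<cdot>\<^bsub>C\<^esub> Idn C b"
    using right_transpose_unique[OF k(1,6)] by simp
  finally show ?thesis by (rule C.iso_cancel_left[OF k(5,6), rotated -1]) simp_all
qed

end

section \<open>Restriction functors of a Mackey 2-functor\<close>

context gpd_2functor
begin

lemma cat_category: "finite_groupoid G \<Longrightarrow> category (cat M G)"
  using cat_additive additive_category.axioms(1) by blast

lemma res_is_functor: "gpd_functor H G u \<Longrightarrow> is_functor (cat M G) (cat M H) (res M u)"
  using res_functor additive_functor.axioms(1) by blast

lemma res_id1_simps:
  assumes "finite_groupoid G"
  shows "X \<in> Obj (cat M G) \<Longrightarrow> ob (res M (id1 G)) X = X"
    "hom_type (cat M G) f = Some (X, Y) \<Longrightarrow> ar (res M (id1 G)) f = f"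
  using res_id1[OF assms] hom_typeD[of "cat M G" f X Y] by (auto simp: functors_agree_def)

lemma res_comp1_simps:
  assumes "gpd_functor K H v" "gpd_functor H G u"
  shows "X \<in> Obj (cat M G) \<Longrightarrow> ob (res M (u \<circ>1 v)) X = ob (res M v) (ob (res M u) X)"
    "hom_type (cat M G) f = Some (X, Y) \<Longrightarrow> ar (res M (u \<circ>1 v)) f = ar (res M v) (ar (res M u) f)"
  using res_comp1[OF assms] hom_typeD[of "cat M G" f X Y] by (auto simp: functors_agree_def comp_fun_def)

lemma res2_simps:
  assumes a: "gpd_nat_trans u v \<alpha>" and u: "gpd_functor H G u"
  shows "X \<in> Obj (cat M G) \<Longrightarrow> hom_type (cat M H) (res2 M \<alpha> X) = Some (ob (res M u) X, ob (res M v) X)"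
    "hom_type (cat M G) f = Some (X, Y) \<Longrightarrow>
      res2 M \<alpha> Y \<cdot>\<^bsub>cat M H\<^esub> ar (res M u) f = ar (res M v) f \<cdot>\<^bsub>cat M H\<^esub> res2 M \<alpha> X"
    "X \<in> Obj (cat M G) \<Longrightarrow> inverses (cat M H) (res2 M \<alpha> X) (res2 M (inv2 \<alpha>) X)"
proof -
  have [simp]: "src u = H" "tgt u = G" using u by (simp_all add: gpd_functorD)
  interpret a: nat_trans "cat M G" "cat M H" "res M u" "res M v" "res2 M \<alpha>"
    using res2_nat_trans[OF a] by simp
  note inv = gpd_nat_trans_inv2[OF a]
  have v: "is_cell1 v" "tgt v = G" "src v = H" using a by (auto simp: gpd_nat_trans_def)
  show t: "X \<in> Obj (cat M G) \<Longrightarrow> hom_type (cat M H) (res2 M \<alpha> X) = Some (ob (res M u) X, ob (res M v) X)" for X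
    by simp
  show "hom_type (cat M G) f = Some (X, Y) \<Longrightarrow>
      res2 M \<alpha> Y \<cdot>\<^bsub>cat M H\<^esub> ar (res M u) f = ar (res M v) f \<cdot>\<^bsub>cat M H\<^esub> res2 M \<alpha> X"
    using a.naturality by simp
  show "inverses (cat M H) (res2 M \<alpha> X) (res2 M (inv2 \<alpha>) X)" if X: "X \<in> Obj (cat M G)"
  proof -
    interpret b: nat_trans "cat M G" "cat M H" "res M v" "res M u" "res2 M (inv2 \<alpha>)"
      using res2_nat_trans[OF inv(1)] v by simp
    have "res2 M (inv2 \<alpha>) X \<cdot>\<^bsub>cat M H\<^esub> res2 M \<alpha> X = Idn (cat M H) (ob (res M u) X)"
      using res2_vcomp2[OF a inv(1), of X] res2_id2[of u X] X gpd_functorD(8)[OF u] by (simp add: inv(2))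
    moreover have "res2 M \<alpha> X \<cdot>\<^bsub>cat M H\<^esub> res2 M (inv2 \<alpha>) X = Idn (cat M H) (ob (res M v) X)"
      using res2_vcomp2[OF inv(1) a, of X] res2_id2[of v X] X v by (simp add: inv(3))
    ultimately show ?thesis
      using X by (simp add: a.F.target.inverses_iff[of _ "ob (res M u) X" "ob (res M v) X"])
  qed
qed

lemma res2_whisker:
  assumes a: "gpd_nat_trans u v \<alpha>" and u: "gpd_functor H G u" and w: "gpd_functor K H w" and X: "X \<in> Obj (cat M G)"
  shows "res2 M (hcomp2 \<alpha> (id2 w)) X = ar (res M w) (res2 M \<alpha> X)"
proof -
  have st: "src u = H" "tgt u = G" "src w = K" "tgt w = H" using u w by (simp_all add: gpd_functorD)
  interpret w: is_functor "cat M H" "cat M K" "res M w" by (rule res_is_functor[OF w])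
  note t = res2_simps(1)[OF a u X]
  have v: "ob (res M v) X \<in> Obj (cat M H)" by (rule w.source.Obj_of_type(2)[OF t])
  have "res2 M (hcomp2 \<alpha> (id2 w)) X
      = res2 M (id2 w) (ob (res M v) X) \<cdot>\<^bsub>cat M K\<^esub> ar (res M w) (res2 M \<alpha> X)"
    using res2_hcomp2[OF gpd_nat_trans_id2[OF w] a] X by (simp add: st)
  also have "res2 M (id2 w) (ob (res M v) X) = Idn (cat M K) (ob (res M w) (ob (res M v) X))"
    using res2_id2[OF gpd_functorD(8)[OF w], of "ob (res M v) X"] v by (simp add: st)
  finally show ?thesis using t v by simp
qed

text \<open>Restriction along an equivalence is fully faithful, because \<open>\<theta>\<close> and \<open>\<rho>\<close> induce natural
  isomorphisms between the composites of restrictions and the identities.\<close>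

lemma res_faithful:
  assumes w: "gpd_functor L P w" and v: "gpd_functor P L v" and \<theta>: "gpd_nat_trans (w \<circ>1 v) (id1 P) \<theta>"
    and f: "hom_type (cat M P) f = Some (X, Y)" and g: "hom_type (cat M P) g = Some (X, Y)"
    and eq: "ar (res M w) f = ar (res M w) g"
  shows "f = g"
proof -
  note P = gpd_functorD(1)[OF v] and wv = gpd_functor_comp1[OF v w]
  interpret P: category "cat M P" by (rule cat_category[OF P])
  have XY [simp]: "X \<in> Obj (cat M P)" "Y \<in> Obj (cat M P)" using f by (simp_all add: P.Obj_of_type)
  have iso: "iso_arr (cat M P) (res2 M \<theta> X)"
    by (rule P.inverses_iso_arr(1)[OF res2_simps(3)[OF \<theta> wv XY(1)]])
  have t: "hom_type (cat M P) (res2 M \<theta> X) = Some (ob (res M (w \<circ>1 v)) X, X)"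
    using res2_simps(1)[OF \<theta> wv XY(1)] by (simp add: res_id1_simps[OF P])
  have "h \<cdot>\<^bsub>cat M P\<^esub> res2 M \<theta> X = res2 M \<theta> Y \<cdot>\<^bsub>cat M P\<^esub> ar (res M v) (ar (res M w) h)"
    if h: "hom_type (cat M P) h = Some (X, Y)" for h
    using res2_simps(2)[OF \<theta> wv h] by (simp add: res_id1_simps(2)[OF P h] res_comp1_simps(2)[OF v w h])
  then have "f \<cdot>\<^bsub>cat M P\<^esub> res2 M \<theta> X = g \<cdot>\<^bsub>cat M P\<^esub> res2 M \<theta> X" using f g eq by simp
  then show ?thesis by (rule P.iso_cancel_right[OF iso t f g])
qed

lemma res_full:
  assumes w: "gpd_functor L P w" and v: "gpd_functor P L v" and \<theta>: "gpd_nat_trans (w \<circ>1 v) (id1 P) \<theta>"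
    and \<rho>: "gpd_nat_trans (v \<circ>1 w) (id1 L) \<rho>"
    and X: "X \<in> Obj (cat M P)" and Y: "Y \<in> Obj (cat M P)"
    and h: "hom_type (cat M L) h = Some (ob (res M w) X, ob (res M w) Y)"
  obtains f where "hom_type (cat M P) f = Some (X, Y)" "ar (res M w) f = h"
proof -
  note P = gpd_functorD(1)[OF v] and wv = gpd_functor_comp1[OF v w]
  interpret w: is_functor "cat M P" "cat M L" "res M w" by (rule res_is_functor[OF w])
  interpret v: is_functor "cat M L" "cat M P" "res M v" by (rule res_is_functor[OF v])
  note [simp] = X Y h
  have iso [simp]: "iso_arr (cat M P) (res2 M \<theta> Z)" if "Z \<in> Obj (cat M P)" for Z
    by (rule w.source.inverses_iso_arr(1)[OF res2_simps(3)[OF \<theta> wv that]])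
  have t [simp]: "hom_type (cat M P) (res2 M \<theta> Z) = Some (ob (res M v) (ob (res M w) Z), Z)"
    if "Z \<in> Obj (cat M P)" for Z
    using res2_simps(1)[OF \<theta> wv that] that by (simp add: res_id1_simps[OF P] res_comp1_simps(1)[OF v w])
  define f where "f = res2 M \<theta> Y \<cdot>\<^bsub>cat M P\<^esub> ar (res M v) h \<cdot>\<^bsub>cat M P\<^esub> inv_arr (cat M P) (res2 M \<theta> X)"
  have f: "hom_type (cat M P) f = Some (X, Y)" by (simp add: f_def)
  have "ar (res M v) (ar (res M w) f) = ar (res M v) h"
  proof (rule w.source.iso_cancel_left[of "res2 M \<theta> Y"])
    have "res2 M \<theta> Y \<cdot>\<^bsub>cat M P\<^esub> ar (res M v) (ar (res M w) f) = f \<cdot>\<^bsub>cat M P\<^esub> res2 M \<theta> X"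
      using res2_simps(2)[OF \<theta> wv f] by (simp add: res_id1_simps(2)[OF P f] res_comp1_simps(2)[OF v w f])
    also have "\<dots> = res2 M \<theta> Y \<cdot>\<^bsub>cat M P\<^esub> ar (res M v) h"
      by (simp add: f_def)
    finally show "res2 M \<theta> Y \<cdot>\<^bsub>cat M P\<^esub> ar (res M v) (ar (res M w) f) = res2 M \<theta> Y \<cdot>\<^bsub>cat M P\<^esub> ar (res M v) h" .
  qed (use f in simp_all)
  then have "ar (res M w) f = h"
    by (rule res_faithful[OF v w \<rho>, rotated -1]) (use f in simp_all)
  with f show thesis by (rule that)
qed

end

section \<open>Base change\<close>

context mackey_2functor
begin

lemma ambidextrous:
  assumes "gpd_functor H G i" "faithful i"
  shows "ambidextrous_functor (cat M G) (cat M H) (res M i) (ind M i) (leta M i) (leps M i) (reta M i) (reps M i)"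
proof -
  interpret l: adjunction "cat M H" "cat M G" "ind M i" "res M i" "leta M i" "leps M i"
    by (rule left_adjunction[OF assms])
  interpret r: adjunction "cat M G" "cat M H" "res M i" "ind M i" "reta M i" "reps M i"
    by (rule right_adjunction[OF assms])
  show ?thesis by unfold_locales (rule special[OF assms])
qed

text \<open>The Mackey formula says that the arrow with the transpose given here is invertible. In this form it
  applies to every model of the induced object.\<close>

lemma couniversal_comma:
  assumes ii: "gpd_functor H G i" "faithful i" and u: "gpd_functor K G u"
    and e: "couniversal (cat M G) (cat M H) (res M i) B Z e"
  shows "couniversal (cat M K) (cat M (comma i u)) (res M (comma2 i u)) (ob (res M u) B) (ob (res M (comma1 i u)) Z)
    (ar (res M (comma1 i u)) e \<cdot>\<^bsub>cat M (comma i u)\<^esub> res2 M (inv2 (comma_cell i u)) B)"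
proof -
  interpret cospan i u H K G by unfold_locales (rule ii(1) u)+
  define P where "P = comma i u"
  define p where "p = comma1 i u"
  define q where "q = comma2 i u"
  define \<gamma> where "\<gamma> = comma_cell i u"
  note pq_defs = P_def p_def q_def \<gamma>_def
  have p: "gpd_functor P H p" and q: "gpd_functor P K q"
    using gpd_functor_comma by (simp_all add: pq_defs)
  have fq: "faithful q" using faithful_comma2[OF ii(2)] by (simp add: pq_defs)
  interpret i': ambidextrous_functor "cat M G" "cat M H" "res M i" "ind M i" "leta M i" "leps M i" "reta M i" "reps M i"
    by (rule ambidextrous[OF ii])
  interpret q': ambidextrous_functor "cat M K" "cat M P" "res M q" "ind M q" "leta M q" "leps M q" "reta M q" "reps M q"
    by (rule ambidextrous[OF q fq])
  interpret p': is_functor "cat M H" "cat M P" "res M p" by (rule res_is_functor[OF p])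
  interpret u': is_functor "cat M G" "cat M K" "res M u" by (rule res_is_functor[OF u])
  have ip: "gpd_functor P G (i \<circ>1 p)" and uq: "gpd_functor P G (u \<circ>1 q)"
    using gpd_functor_comp1[OF p ii(1)] gpd_functor_comp1[OF q u] .
  have \<gamma>': "gpd_nat_trans (u \<circ>1 q) (i \<circ>1 p) (inv2 \<gamma>)"
    using gpd_nat_trans_inv2(1)[OF gpd_nat_trans_comma_cell] by (simp add: pq_defs)
  have t [simp]: "hom_type (cat M P) (res2 M (inv2 \<gamma>) Y) = Some (ob (res M q) (ob (res M u) Y), ob (res M p) (ob (res M i) Y))"
    if "Y \<in> Obj (cat M G)" for Y
    using res2_simps(1)[OF \<gamma>' uq that] that by (simp add: res_comp1_simps(1)[OF q u] res_comp1_simps(1)[OF p ii(1)])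
  note [simp] = couniversal_type[OF e]
  let ?I = "ob (ind M i) Z"
  let ?r = "rmate M i u p q (inv2 \<gamma>) Z"
  let ?b = "\<lambda>Y e. ar (res M p) e \<cdot>\<^bsub>cat M P\<^esub> res2 M (inv2 \<gamma>) Y"
  have "inverses (cat M K) (lmate M i u p q \<gamma> Z) ?r"
    using mackey_formula[OF iso_comma_comma ii(2), of Z] by (simp add: pq_defs)
  then have r: "iso_arr (cat M K) ?r" by (rule q'.C.inverses_iso_arr)
  have r_eq: "?r = ar (ind M q) (?b ?I (reps M i Z)) \<cdot>\<^bsub>cat M K\<^esub> reta M q (ob (res M u) ?I)"
    by (simp add: rmate_def Let_def q'.I.ar_Comp)
  have rt: "hom_type (cat M K) ?r = Some (ob (res M u) ?I, ob (ind M q) (ob (res M p) Z))"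
    by (simp add: r_eq)
  have "reps M q (ob (res M p) Z) \<cdot>\<^bsub>cat M P\<^esub> ar (res M q) ?r = ?b ?I (reps M i Z)"
    unfolding r_eq by (rule q'.right_transpose) simp_all
  with q'.couniversal_of_iso[OF r rt] have
    c: "couniversal (cat M K) (cat M P) (res M q) (ob (res M u) ?I) (ob (res M p) Z) (?b ?I (reps M i Z))"
    by simp
  obtain f where f [simp]: "iso_arr (cat M G) f" "hom_type (cat M G) f = Some (B, ?I)"
    and ef: "e = reps M i Z \<cdot>\<^bsub>cat M H\<^esub> ar (res M i) f"
    using i'.couniversal_iso[OF e] .
  have "couniversal (cat M K) (cat M P) (res M q) (ob (res M u) B) (ob (res M p) Z)
      (Idn (cat M P) (ob (res M p) Z) \<cdot>\<^bsub>cat M P\<^esub> ?b ?I (reps M i Z) \<cdot>\<^bsub>cat M P\<^esub> ar (res M q) (ar (res M u) f))"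
    by (rule q'.R.couniversal_transport[OF c]) simp_all
  also have "Idn (cat M P) (ob (res M p) Z) \<cdot>\<^bsub>cat M P\<^esub> ?b ?I (reps M i Z) \<cdot>\<^bsub>cat M P\<^esub> ar (res M q) (ar (res M u) f)
      = ar (res M p) (reps M i Z) \<cdot>\<^bsub>cat M P\<^esub> (res2 M (inv2 \<gamma>) ?I \<cdot>\<^bsub>cat M P\<^esub> ar (res M (u \<circ>1 q)) f)"
    by (simp add: res_comp1_simps(2)[OF q u f(2)])
  also have "\<dots> = ?b B e"
    unfolding res2_simps(2)[OF \<gamma>' uq f(2)] ef by (simp add: res_comp1_simps(2)[OF p ii(1) f(2)] p'.ar_Comp)
  finally show ?thesis by (simp only: pq_defs)
qed

text \<open>The functor \<open>w\<close> into the iso-comma groupoid is an equivalence, and the 2-cell of the iso-comma square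
  becomes the identity along \<open>w\<close>. Hence \<open>e\<close> is restricted to \<open>L\<close> in two steps: first to the
  iso-comma groupoid, where the Mackey formula applies, and then along the fully faithful \<open>w\<^sup>*\<close>.\<close>

lemma couniversal_base_change:
  assumes sq: "weak_pullback i u H K G p q L" and i: "faithful i"
    and e: "couniversal (cat M G) (cat M H) (res M i) B Z e"
  shows "couniversal (cat M K) (cat M L) (res M q) (ob (res M u) B) (ob (res M p) Z) (ar (res M p) e)"
proof -
  interpret sq: weak_pullback i u H K G p q L by (rule sq)
  define P where "P = comma i u"
  define p' where "p' = comma1 i u"
  define q' where "q' = comma2 i u"
  define \<gamma> where "\<gamma> = comma_cell i u"
  define w where "w = sq.w"
  note defs = P_def p'_def q'_def \<gamma>_def w_def
  have p': "gpd_functor P H p'" and q': "gpd_functor P K q'" and w: "gpd_functor L P w"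
    using sq.gpd_functor_comma sq.gpd_functor_w by (simp_all add: defs)
  have pw: "p' \<circ>1 w = p" and qw: "q' \<circ>1 w = q" using sq.comma_w by (simp_all add: defs)
  obtain v \<theta> \<rho> where v: "gpd_functor P L v" and \<theta>: "gpd_nat_trans (w \<circ>1 v) (id1 P) \<theta>" and \<rho>: "gpd_nat_trans (v \<circ>1 w) (id1 L) \<rho>"
    unfolding defs by (rule sq.w_quasi_inverse)
  interpret Rp: is_functor "cat M H" "cat M P" "res M p'" by (rule res_is_functor[OF p'])
  interpret Rq: is_functor "cat M K" "cat M P" "res M q'" by (rule res_is_functor[OF q'])
  interpret Rw: is_functor "cat M P" "cat M L" "res M w" by (rule res_is_functor[OF w])
  interpret Rq': is_functor "cat M K" "cat M L" "res M q" by (rule res_is_functor[OF sq.q])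
  interpret Ru: is_functor "cat M G" "cat M K" "res M u" by (rule res_is_functor[OF sq.u])
  interpret Ri: is_functor "cat M G" "cat M H" "res M i" by (rule res_is_functor[OF sq.i])
  note [simp] = couniversal_type[OF e]
  have \<gamma>': "gpd_nat_trans (u \<circ>1 q') (i \<circ>1 p') (inv2 \<gamma>)"
    using gpd_nat_trans_inv2(1)[OF sq.gpd_nat_trans_comma_cell] by (simp add: defs)
  have uq': "gpd_functor P G (u \<circ>1 q')" by (rule gpd_functor_comp1[OF q' sq.u])
  have t [simp]: "hom_type (cat M P) (res2 M (inv2 \<gamma>) B) = Some (ob (res M q') (ob (res M u) B), ob (res M p') (ob (res M i) B))"
    using res2_simps(1)[OF \<gamma>' uq', of B] by (simp add: res_comp1_simps(1)[OF q' sq.u] res_comp1_simps(1)[OF p' sq.i])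
  let ?e = "ar (res M p') e \<cdot>\<^bsub>cat M P\<^esub> res2 M (inv2 \<gamma>) B"
  have c: "couniversal (cat M K) (cat M P) (res M q') (ob (res M u) B) (ob (res M p') Z) ?e"
    using couniversal_comma[OF sq.i i sq.u e] by (simp add: defs)
  note qo = res_comp1_simps[OF w q', unfolded qw] and po = res_comp1_simps[OF w p', unfolded pw]
  have "ar (res M w) (res2 M (inv2 \<gamma>) B) = res2 M (id2 (u \<circ>1 q)) B"
    using res2_whisker[OF \<gamma>' uq' w, of B] sq.comma_cell_w by (simp add: defs)
  also have "\<dots> = Idn (cat M L) (ob (res M (u \<circ>1 q)) B)"
    using res2_id2[OF gpd_functorD(8)[OF gpd_functor_comp1[OF sq.q sq.u]], of B] by simp
  finally have we: "ar (res M p) e = ar (res M w) ?e"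
    by (simp add: Rw.ar_Comp po(2)[OF couniversal_type(3)[OF e]] res_comp1_simps(1)[OF sq.q sq.u] qo(1))
      (simp add: res_comp1_simps(1)[OF sq.p sq.i, unfolded sq.commutes, symmetric] flip: po(1) qo(1)
        res_comp1_simps(1)[OF sq.q sq.u])
  show ?thesis unfolding we
  proof (rule Rq'.couniversalI)
    show "ob (res M u) B \<in> Obj (cat M K)" "ob (res M p) Z \<in> Obj (cat M L)"
      by (simp_all add: po(1))
    show "hom_type (cat M L) (ar (res M w) ?e) = Some (ob (res M q) (ob (res M u) B), ob (res M p) Z)"
      by (simp add: po(1) qo(1))
  next
    fix X g assume X [simp]: "X \<in> Obj (cat M K)" and g: "hom_type (cat M L) g = Some (ob (res M q) X, ob (res M p) Z)"
    have g': "hom_type (cat M L) g = Some (ob (res M w) (ob (res M q') X), ob (res M w) (ob (res M p') Z))"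
      using g by (simp add: po(1) qo(1))
    obtain h where h: "hom_type (cat M P) h = Some (ob (res M q') X, ob (res M p') Z)" "ar (res M w) h = g"
      by (rule res_full[OF w v \<theta> \<rho> _ _ g']) simp_all
    obtain f where f: "hom_type (cat M K) f = Some (X, ob (res M u) B)" "?e \<cdot>\<^bsub>cat M P\<^esub> ar (res M q') f = h"
      using couniversal_lift[OF c X h(1)] .
    have "ar (res M w) ?e \<cdot>\<^bsub>cat M L\<^esub> ar (res M q) f = ar (res M w) (?e \<cdot>\<^bsub>cat M P\<^esub> ar (res M q') f)"
      unfolding qo(2)[OF f(1)] using f(1) by (simp add: Rw.ar_Comp)
    then show "\<exists>f. hom_type (cat M K) f = Some (X, ob (res M u) B) \<and> ar (res M w) ?e \<cdot>\<^bsub>cat M L\<^esub> ar (res M q) f = g"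
      using f h(2) by metis
  next
    fix X f g assume f: "hom_type (cat M K) f = Some (X, ob (res M u) B)" and g: "hom_type (cat M K) g = Some (X, ob (res M u) B)"
      and eq: "ar (res M w) ?e \<cdot>\<^bsub>cat M L\<^esub> ar (res M q) f = ar (res M w) ?e \<cdot>\<^bsub>cat M L\<^esub> ar (res M q) g"
    have shift: "ar (res M w) ?e \<cdot>\<^bsub>cat M L\<^esub> ar (res M q) h = ar (res M w) (?e \<cdot>\<^bsub>cat M P\<^esub> ar (res M q') h)"
      if "hom_type (cat M K) h = Some (X, ob (res M u) B)" for h
      unfolding qo(2)[OF that] using that by (simp add: Rw.ar_Comp)
    have "?e \<cdot>\<^bsub>cat M P\<^esub> ar (res M q') f = ?e \<cdot>\<^bsub>cat M P\<^esub> ar (res M q') g"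
      by (rule res_faithful[OF w v \<theta> _ _ eq[unfolded shift[OF f] shift[OF g]]]) (use f g in simp_all)
    then show "f = g" by (rule Rq.couniversal_unique[OF c f g])
  qed
qed

end

section \<open>The component of the diagonal\<close>

context ambidextrous_functor
begin

text \<open>By \<open>trace_induced\<close>, every arrow through an induced object is a trace.\<close>

lemma trace_factor:
  assumes a: "induced b z e n" and u: "hom_type C u = Some (x, b)" and v: "hom_type C v = Some (b, y)"
  shows "v \<cdot>\<^bsub>C\<^esub> u = trace x y ((ar R v \<cdot>\<^bsub>D\<^esub> n) \<cdot>\<^bsub>D\<^esub> e \<cdot>\<^bsub>D\<^esub> ar R u)"
proof -
  note [simp] = induced_type[OF a] u v C.Obj_of_type[OF u] C.Obj_of_type[OF v]
  have "v \<cdot>\<^bsub>C\<^esub> u = v \<cdot>\<^bsub>C\<^esub> trace b b (n \<cdot>\<^bsub>D\<^esub> e) \<cdot>\<^bsub>C\<^esub> u" by (simp add: trace_induced[OF a])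
  also have "trace b b (n \<cdot>\<^bsub>D\<^esub> e) \<cdot>\<^bsub>C\<^esub> u = trace x b ((n \<cdot>\<^bsub>D\<^esub> e) \<cdot>\<^bsub>D\<^esub> ar R u)"
    by (rule trace_right) simp_all
  also have "v \<cdot>\<^bsub>C\<^esub> \<dots> = trace x y (ar R v \<cdot>\<^bsub>D\<^esub> (n \<cdot>\<^bsub>D\<^esub> e) \<cdot>\<^bsub>D\<^esub> ar R u)"
    by (rule trace_left) simp_all
  finally show ?thesis by simp
qed

end

context mackey_2functor
begin

text \<open>The trace for the restriction along \<open>i\<close>, named by \<open>i\<close> alone so that traces along several functors
  can be composed.\<close>

definition tr :: "'a cell1 \<Rightarrow> 'o \<Rightarrow> 'o \<Rightarrow> 'm \<Rightarrow> 'm" where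
  "tr i X Y h = leps M i Y \<cdot>\<^bsub>cat M (tgt i)\<^esub> ar (ind M i) h \<cdot>\<^bsub>cat M (tgt i)\<^esub> reta M i X"

lemma trace_eq:
  assumes "gpd_functor H G i" "faithful i"
  shows "ambidextrous_functor.trace (cat M G) (ind M i) (leps M i) (reta M i) = tr i"
proof -
  interpret ambidextrous_functor "cat M G" "cat M H" "res M i" "ind M i" "leta M i" "leps M i" "reta M i" "reps M i"
    by (rule ambidextrous[OF assms])
  show ?thesis using assms(1) by (auto simp: trace_def tr_def gpd_functorD fun_eq_iff)
qed

text \<open>The iterated trace factors through \<open>q\<^sub>! d\<^sub>!\<close> of the target of \<open>h\<close>. The agreement of the two
  pseudofunctors \<open>i \<mapsto> i\<^sub>!\<close> and \<open>i \<mapsto> i\<^sub>*\<close> on composites says exactly that this object is induced along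
  \<open>q \<circ>1 d\<close>.\<close>

lemma tr_comp1:
  assumes d: "gpd_functor L P d" "faithful d" and q: "gpd_functor P K q" "faithful q" and qd: "faithful (q \<circ>1 d)"
    and X: "X \<in> Obj (cat M K)" and Y: "Y \<in> Obj (cat M K)"
    and h: "hom_type (cat M L) h = Some (ob (res M (q \<circ>1 d)) X, ob (res M (q \<circ>1 d)) Y)"
  shows "tr q X Y (tr d (ob (res M q) X) (ob (res M q) Y) h) = tr (q \<circ>1 d) X Y h"
proof -
  let ?C = "cat M K" and ?D = "cat M P" and ?E = "cat M L" and ?w = "q \<circ>1 d"
  have w: "gpd_functor L K ?w" by (rule gpd_functor_comp1[OF d(1) q(1)])
  interpret d: ambidextrous_functor ?D ?E "res M d" "ind M d" "leta M d" "leps M d" "reta M d" "reps M d"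
    by (rule ambidextrous[OF d])
  interpret q: ambidextrous_functor ?C ?D "res M q" "ind M q" "leta M q" "leps M q" "reta M q" "reps M q"
    by (rule ambidextrous[OF q])
  interpret w: ambidextrous_functor ?C ?E "res M ?w" "ind M ?w" "leta M ?w" "leps M ?w" "reta M ?w" "reps M ?w"
    by (rule ambidextrous[OF w qd])
  note wo [simp] = res_comp1_simps(1)[OF d(1) q(1)] and wa = res_comp1_simps(2)[OF d(1) q(1)]
  note [simp] = X Y
  define Z where "Z = ob (res M d) (ob (res M q) Y)"
  have Z [simp]: "Z \<in> Obj ?E" by (simp add: Z_def)
  note h' [simp] = h[simplified, folded Z_def]
  define l where "l = lind_comp M q d Z"
  define r where "r = rind_comp M q d Z"
  have lr: "inverses ?C l r" unfolding l_def r_def by (rule ind_comp_agree[OF d(1) q(1) d(2) q(2) Z])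
  define b where "b = ob (ind M q) (ob (ind M d) Z)"
  define e where "e = reps M d Z \<cdot>\<^bsub>?E\<^esub> ar (res M d) (reps M q (ob (ind M d) Z))"
  define n where "n = ar (res M d) (leta M q (ob (ind M d) Z)) \<cdot>\<^bsub>?E\<^esub> leta M d Z"
  have b [simp]: "b \<in> Obj ?C" by (simp add: b_def)
  have e [simp]: "hom_type ?E e = Some (ob (res M ?w) b, Z)" and n [simp]: "hom_type ?E n = Some (Z, ob (res M ?w) b)"
    by (simp_all add: e_def n_def b_def)
  have st: "tgt q = K" using q(1) by (simp add: gpd_functorD)
  have r_eq: "r = ar (ind M ?w) e \<cdot>\<^bsub>?C\<^esub> reta M ?w b"
    using e by (simp add: r_def rind_comp_def Let_def e_def b_def w.I.ar_Comp st)
  have l_eq: "l = leps M ?w b \<cdot>\<^bsub>?C\<^esub> ar (ind M ?w) n"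
    using n by (simp add: l_def lind_comp_def Let_def n_def b_def w.I.ar_Comp st)
  have lt: "hom_type ?C l = Some (ob (ind M ?w) Z, b)" by (simp add: l_eq)
  have rt: "hom_type ?C r = Some (b, ob (ind M ?w) Z)" by (simp add: r_eq)
  have lr': "r \<cdot>\<^bsub>?C\<^esub> l = Idn ?C (ob (ind M ?w) Z)" "iso_arr ?C r"
    using lr lt q.C.inverses_iso_arr[OF lr] by (simp_all add: q.C.inverses_iff[OF lt])
  have ind: "w.induced b Z e n"
    unfolding w.induced_def
  proof (intro conjI exI[of _ r])
    show "e = reps M ?w Z \<cdot>\<^bsub>?E\<^esub> ar (res M ?w) r" unfolding r_eq by (rule w.right_transpose[symmetric]) simp_all
    have "ar (res M ?w) r \<cdot>\<^bsub>?E\<^esub> n = ar (res M ?w) r \<cdot>\<^bsub>?E\<^esub> ar (res M ?w) l \<cdot>\<^bsub>?E\<^esub> leta M ?w Z"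
      unfolding l_eq using w.left_transpose[OF b n] by simp
    also have "\<dots> = ar (res M ?w) (r \<cdot>\<^bsub>?C\<^esub> l) \<cdot>\<^bsub>?E\<^esub> leta M ?w Z"
      by (simp add: w.R.ar_Comp[OF lt rt] w.R.type_ar[OF lt] w.R.type_ar[OF rt] lt rt)
    also have "\<dots> = leta M ?w Z" unfolding lr' using w.R.ar_Idn[of "ob (ind M ?w) Z"] by simp
    finally show "ar (res M ?w) r \<cdot>\<^bsub>?E\<^esub> n = leta M ?w Z" .
  qed (use rt lr' in simp_all)
  \<comment> \<open>The two halves of the iterated trace, which meet in \<open>b\<close>.\<close>
  define u where "u = ar (ind M q) (ar (ind M d) h \<cdot>\<^bsub>?D\<^esub> reta M d (ob (res M q) X)) \<cdot>\<^bsub>?C\<^esub> reta M q X"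
  define v where "v = leps M q Y \<cdot>\<^bsub>?C\<^esub> ar (ind M q) (leps M d (ob (res M q) Y))"
  have u: "hom_type ?C u = Some (X, b)" by (simp add: u_def b_def)
  have v: "hom_type ?C v = Some (b, Y)" by (simp add: v_def b_def Z_def)
  have "e \<cdot>\<^bsub>?E\<^esub> ar (res M ?w) u
      = reps M d Z \<cdot>\<^bsub>?E\<^esub> ar (res M d) (reps M q (ob (ind M d) Z) \<cdot>\<^bsub>?D\<^esub> ar (res M q) u)"
    unfolding wa[OF u] using u by (simp add: e_def b_def d.R.ar_Comp)
  also have "reps M q (ob (ind M d) Z) \<cdot>\<^bsub>?D\<^esub> ar (res M q) u = ar (ind M d) h \<cdot>\<^bsub>?D\<^esub> reta M d (ob (res M q) X)"
    unfolding u_def by (rule q.right_transpose) simp_all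
  also have "reps M d Z \<cdot>\<^bsub>?E\<^esub> ar (res M d) \<dots> = h" by (rule d.right_transpose) simp_all
  finally have eu: "e \<cdot>\<^bsub>?E\<^esub> ar (res M ?w) u = h" .
  have "ar (res M ?w) v \<cdot>\<^bsub>?E\<^esub> n
      = ar (res M d) (ar (res M q) v \<cdot>\<^bsub>?D\<^esub> leta M q (ob (ind M d) Z)) \<cdot>\<^bsub>?E\<^esub> leta M d Z"
    unfolding wa[OF v] using v by (simp add: n_def b_def d.R.ar_Comp)
  also have "ar (res M q) v \<cdot>\<^bsub>?D\<^esub> leta M q (ob (ind M d) Z) = leps M d (ob (res M q) Y)"
    unfolding v_def by (rule q.left_transpose) (simp_all add: Z_def)
  also have "ar (res M d) \<dots> \<cdot>\<^bsub>?E\<^esub> leta M d Z = Idn ?E Z"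
    using d.left.triangle_right[of "ob (res M q) Y"] by (simp add: Z_def)
  finally have vn: "ar (res M ?w) v \<cdot>\<^bsub>?E\<^esub> n = Idn ?E Z" .
  have "tr q X Y (tr d (ob (res M q) X) (ob (res M q) Y) h) = v \<cdot>\<^bsub>?C\<^esub> u"
    unfolding trace_eq[OF d, symmetric] trace_eq[OF q, symmetric]
    by (simp add: d.trace_def q.trace_def u_def v_def q.I.ar_Comp Z_def[symmetric])
  also have "\<dots> = tr ?w X Y h"
    using w.trace_factor[OF ind u v] unfolding eu vn trace_eq[OF w qd] by simp
  finally show ?thesis .
qed

lemma tr_id1:
  assumes G: "finite_groupoid G" and h: "hom_type (cat M G) h = Some (X, Y)"
  shows "tr (id1 G) X Y h = h"
proof -
  note w = gpd_functor_id1[OF G] faithful_id1[OF G]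
  interpret ambidextrous_functor "cat M G" "cat M G" "res M (id1 G)" "ind M (id1 G)" "leta M (id1 G)"
    "leps M (id1 G)" "reta M (id1 G)" "reps M (id1 G)" by (rule ambidextrous[OF w])
  note [simp] = h C.Obj_of_type[OF h] res_id1_simps(1)[OF G]
  have "trace X Y h = (leps M (id1 G) Y \<cdot>\<^bsub>cat M G\<^esub> ar (ind M (id1 G)) (ar (res M (id1 G)) h)) \<cdot>\<^bsub>cat M G\<^esub> reta M (id1 G) X"
    by (simp add: trace_def res_id1_simps(2)[OF G h])
  also have "\<dots> = h \<cdot>\<^bsub>cat M G\<^esub> leps M (id1 G) X \<cdot>\<^bsub>cat M G\<^esub> reta M (id1 G) X"
    unfolding unit_naturality(2)[OF h] by simp
  also have "leps M (id1 G) X \<cdot>\<^bsub>cat M G\<^esub> reta M (id1 G) X = Idn (cat M G) X"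
    using ind_id_agree[OF G, of X] by (simp add: C.inverses_iff)
  finally show ?thesis unfolding trace_eq[OF w] by simp
qed

text \<open>When the pullback of \<open>d\<close> along itself is trivial, base change shows that the counit of \<open>d\<^sup>* \<stileturn> d\<^sub>*\<close>
  is invertible. Then the section \<open>leta\<close> of \<open>reps\<close> is its inverse, and the idempotent in \<open>trace_induced\<close> is the
  identity.\<close>

lemma tr_diagonal_Idn:
  assumes d: "gpd_functor H P d" "faithful d" and sq: "weak_pullback d d H H P (id1 H) (id1 H) H"
    and B: "couniversal (cat M P) (cat M H) (res M d) B Z e"
  shows "tr d B B (Idn (cat M H) (ob (res M d) B)) = Idn (cat M P) B"
proof -
  let ?C = "cat M P" and ?D = "cat M H"
  note H = gpd_functorD(1)[OF d(1)]
  interpret d: ambidextrous_functor ?C ?D "res M d" "ind M d" "leta M d" "leps M d" "reta M d" "reps M d"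
    by (rule ambidextrous[OF d])
  interpret J: is_functor ?D ?D "res M (id1 H)" by (rule res_is_functor[OF gpd_functor_id1[OF H]])
  obtain f where f [simp]: "iso_arr ?C f" "hom_type ?C f = Some (B, ob (ind M d) Z)" and ef: "e = reps M d Z \<cdot>\<^bsub>?D\<^esub> ar (res M d) f"
    using d.couniversal_iso[OF B] .
  note [simp] = couniversal_type[OF B]
  let ?I = "ob (ind M d) Z"
  note id_ob = res_id1_simps(1)[OF H] and id_ar = res_id1_simps(2)[OF H]
  have "couniversal ?C ?D (res M d) ?I Z (reps M d Z)"
    using d.couniversal_of_iso[of "Idn ?C ?I" ?I Z] by simp
  from couniversal_base_change[OF sq d(2) this]
  have c: "couniversal ?D ?D (res M (id1 H)) (ob (res M d) ?I) Z (reps M d Z)"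
    by (simp add: id_ob id_ar)
  have "leta M d Z \<cdot>\<^bsub>?D\<^esub> reps M d Z = Idn ?D (ob (res M d) ?I)"
  proof (rule J.couniversal_unique[OF c])
    have "reps M d Z \<cdot>\<^bsub>?D\<^esub> leta M d Z \<cdot>\<^bsub>?D\<^esub> reps M d Z = (reps M d Z \<cdot>\<^bsub>?D\<^esub> leta M d Z) \<cdot>\<^bsub>?D\<^esub> reps M d Z"
      by simp
    also have "\<dots> = reps M d Z" using d.special[of Z] by simp
    finally show "reps M d Z \<cdot>\<^bsub>?D\<^esub> ar (res M (id1 H)) (leta M d Z \<cdot>\<^bsub>?D\<^esub> reps M d Z)
        = reps M d Z \<cdot>\<^bsub>?D\<^esub> ar (res M (id1 H)) (Idn ?D (ob (res M d) ?I))"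
      by (simp add: id_ob id_ar)
  qed simp_all
  then have tI: "d.trace ?I ?I (Idn ?D (ob (res M d) ?I)) = Idn ?C ?I"
    using d.trace_induced[OF d.induced_I[of Z]] by simp
  have "f \<cdot>\<^bsub>?C\<^esub> d.trace B B (Idn ?D (ob (res M d) B)) = d.trace B ?I (ar (res M d) f)"
    by (subst d.trace_left) simp_all
  also have "\<dots> = d.trace ?I ?I (Idn ?D (ob (res M d) ?I)) \<cdot>\<^bsub>?C\<^esub> f"
    by (subst d.trace_right) simp_all
  also have "\<dots> = f \<cdot>\<^bsub>?C\<^esub> Idn ?C B" unfolding tI by simp
  finally have "d.trace B B (Idn ?D (ob (res M d) B)) = Idn ?C B"
    by (rule d.C.iso_cancel_left[OF f, rotated -1]) simp_all
  then show ?thesis unfolding trace_eq[OF d] .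
qed

text \<open>Hence an arrow that factors through the image of \<open>d\<^sub>*\<close> can be recovered from its restriction along
  \<open>d\<close>.\<close>

lemma tr_of_factorization:
  assumes d: "gpd_functor H P d" "faithful d" and sq: "weak_pullback d d H H P (id1 H) (id1 H) H"
    and B: "couniversal (cat M P) (cat M H) (res M d) B Z e"
    and h: "hom_type (cat M P) h = Some (X, B)" and k: "hom_type (cat M P) k = Some (B, Y)"
  shows "k \<cdot>\<^bsub>cat M P\<^esub> h = tr d X Y (ar (res M d) (k \<cdot>\<^bsub>cat M P\<^esub> h))"
proof -
  let ?C = "cat M P" and ?D = "cat M H"
  interpret d: ambidextrous_functor ?C ?D "res M d" "ind M d" "leta M d" "leps M d" "reta M d" "reps M d"
    by (rule ambidextrous[OF d])
  note [simp] = h k d.C.Obj_of_type[OF h] d.C.Obj_of_type[OF k]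
  have t: "d.trace B B (Idn ?D (ob (res M d) B)) = Idn ?C B"
    using tr_diagonal_Idn[OF d sq B] unfolding trace_eq[OF d] .
  have "k \<cdot>\<^bsub>?C\<^esub> h = k \<cdot>\<^bsub>?C\<^esub> d.trace B B (Idn ?D (ob (res M d) B)) \<cdot>\<^bsub>?C\<^esub> h" unfolding t by simp
  also have "d.trace B B (Idn ?D (ob (res M d) B)) \<cdot>\<^bsub>?C\<^esub> h = d.trace X B (ar (res M d) h)"
    by (subst d.trace_right) simp_all
  also have "k \<cdot>\<^bsub>?C\<^esub> \<dots> = d.trace X Y (ar (res M d) (k \<cdot>\<^bsub>?C\<^esub> h))"
    by (subst d.trace_left) (simp_all add: d.R.ar_Comp)
  finally show ?thesis unfolding trace_eq[OF d] .
qed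

end

text \<open>For the inclusion of a subgroup, the components of \<open>P\<close> correspond to the double cosets, and the
  diagonal \<open>d\<close> is equivalent to the inclusion of the component of the trivial double coset. The
  transformation \<open>\<theta>\<close> goes from \<open>q\<^sup>* i\<^sup>*\<close> to \<open>p\<^sup>* i\<^sup>*\<close> and restricts to the identity along \<open>d\<close>.\<close>

locale mackey_diagonal = mackey_2functor M + diagonal i H G
  for M :: "('a, 'o, 'm, 'z) mackey_data_scheme" and i :: "'a cell1" and H G :: "'a gpd"
begin

abbreviation "P \<equiv> comma i i"
abbreviation "p \<equiv> comma1 i i"
abbreviation "q \<equiv> comma2 i i"
abbreviation "\<gamma> \<equiv> comma_cell i i"
abbreviation "\<theta> \<equiv> res2 M (inv2 \<gamma>)"

lemmas pq = gpd_functor_comma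
lemmas dq = sq.gpd_functor_w
lemmas fq = faithful_comma2[OF faithful]

sublocale ri: ambidextrous_functor "cat M G" "cat M H" "res M i" "ind M i" "leta M i" "leps M i" "reta M i" "reps M i"
  by (rule ambidextrous[OF i faithful])

sublocale rq: ambidextrous_functor "cat M H" "cat M P" "res M q" "ind M q" "leta M q" "leps M q" "reta M q" "reps M q"
  by (rule ambidextrous[OF pq(2) fq])

sublocale rd: ambidextrous_functor "cat M P" "cat M H" "res M d" "ind M d" "leta M d" "leps M d" "reta M d" "reps M d"
  by (rule ambidextrous[OF dq faithful_d])

sublocale rp: is_functor "cat M H" "cat M P" "res M p"
  by (rule res_is_functor[OF pq(1)])

lemma ob_d [simp]:
  "X \<in> Obj (cat M H) \<Longrightarrow> ob (res M d) (ob (res M p) X) = X" "X \<in> Obj (cat M H) \<Longrightarrow> ob (res M d) (ob (res M q) X) = X"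
  using res_comp1_simps(1)[OF dq pq(1), of X] res_comp1_simps(1)[OF dq pq(2), of X] res_id1_simps(1)[OF gpds(1), of X]
  by (simp_all add: sq.comma_w)

lemma ar_d [simp]:
  assumes "hom_type (cat M H) f = Some (X, Y)"
  shows "ar (res M d) (ar (res M p) f) = f" "ar (res M d) (ar (res M q) f) = f"
  using res_comp1_simps(2)[OF dq pq(1) assms] res_comp1_simps(2)[OF dq pq(2) assms] res_id1_simps(2)[OF gpds(1) assms]
  by (simp_all add: sq.comma_w)

lemma \<theta>_inv: "gpd_nat_trans (i \<circ>1 q) (i \<circ>1 p) (inv2 \<gamma>)" "gpd_functor P G (i \<circ>1 q)"
  using gpd_nat_trans_inv2(1)[OF gpd_nat_trans_comma_cell] gpd_functor_comp1[OF pq(2) u] by simp_all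

lemma \<theta>_type [simp]:
  assumes "X \<in> Obj (cat M G)"
  shows "hom_type (cat M P) (\<theta> X) = Some (ob (res M q) (ob (res M i) X), ob (res M p) (ob (res M i) X))"
    "hom_type (cat M P) (res2 M \<gamma> X) = Some (ob (res M p) (ob (res M i) X), ob (res M q) (ob (res M i) X))"
  using res2_simps(1)[OF \<theta>_inv assms] res2_simps(1)[OF gpd_nat_trans_comma_cell gpd_functor_comp1[OF pq(1) i] assms] assms
  by (simp_all add: res_comp1_simps(1)[OF pq(1) i] res_comp1_simps(1)[OF pq(2) i])

lemma \<theta>_natural:
  assumes "hom_type (cat M G) f = Some (X, Y)"
  shows "\<theta> Y \<cdot>\<^bsub>cat M P\<^esub> ar (res M q) (ar (res M i) f) = ar (res M p) (ar (res M i) f) \<cdot>\<^bsub>cat M P\<^esub> \<theta> X"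
  using res2_simps(2)[OF \<theta>_inv assms]
  by (simp add: res_comp1_simps(2)[OF pq(1) i assms] res_comp1_simps(2)[OF pq(2) i assms])

lemma \<theta>_d [simp]:
  assumes X [simp]: "X \<in> Obj (cat M G)"
  shows "ar (res M d) (\<theta> X) = Idn (cat M H) (ob (res M i) X)"
    "ar (res M d) (res2 M \<gamma> X) = Idn (cat M H) (ob (res M i) X)"
proof -
  have "ar (res M d) (\<theta> X) = res2 M (id2 (i \<circ>1 id1 H)) X"
    using res2_whisker[OF \<theta>_inv dq X] sq.comma_cell_w by simp
  also have "\<dots> = Idn (cat M H) (ob (res M i) X)"
    using res2_id2[OF gpd_functorD(8)[OF i], of X] by (simp add: comp1_id1[OF i])
  finally show 1: "ar (res M d) (\<theta> X) = Idn (cat M H) (ob (res M i) X)" .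
  have "\<theta> X \<cdot>\<^bsub>cat M P\<^esub> res2 M \<gamma> X = Idn (cat M P) (ob (res M p) (ob (res M i) X))"
    using res2_simps(3)[OF gpd_nat_trans_comma_cell gpd_functor_comp1[OF pq(1) i] X]
    by (simp add: rq.D.inverses_iff[OF \<theta>_type(2)[OF X]])
  then have "ar (res M d) (\<theta> X \<cdot>\<^bsub>cat M P\<^esub> res2 M \<gamma> X) = Idn (cat M H) (ob (res M i) X)" by simp
  then show "ar (res M d) (res2 M \<gamma> X) = Idn (cat M H) (ob (res M i) X)"
    by (simp add: rd.R.ar_Comp 1)
qed

text \<open>The two mates in the Mackey formula identify \<open>i\<^sup>* i\<^sub>* Z\<close> with \<open>q\<^sub>* p\<^sup>* Z\<close> by means of the left and of the
  right adjoints; by assumption they are inverse to each other.\<close>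

lemma induced_mackey:
  assumes Z [simp]: "Z \<in> Obj (cat M H)"
  shows "rq.induced (ob (res M i) (ob (ind M i) Z)) (ob (res M p) Z)
     (ar (res M p) (reps M i Z) \<cdot>\<^bsub>cat M P\<^esub> \<theta> (ob (ind M i) Z))
     (res2 M \<gamma> (ob (ind M i) Z) \<cdot>\<^bsub>cat M P\<^esub> ar (res M p) (leta M i Z))"
    (is "rq.induced ?b ?z ?e ?n")
proof -
  let ?l = "lmate M i i p q \<gamma> Z" and ?r = "rmate M i i p q (inv2 \<gamma>) Z"
  have lr: "inverses (cat M H) ?l ?r" using mackey_formula[OF iso_comma_comma faithful, of Z] by simp
  have l: "?l = leps M q ?b \<cdot>\<^bsub>cat M H\<^esub> ar (ind M q) ?n" by (simp add: lmate_def Let_def rq.I.ar_Comp)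
  have r: "?r = ar (ind M q) ?e \<cdot>\<^bsub>cat M H\<^esub> reta M q ?b" by (simp add: rmate_def Let_def rq.I.ar_Comp)
  have lt: "hom_type (cat M H) ?l = Some (ob (ind M q) ?z, ?b)" and rt: "hom_type (cat M H) ?r = Some (?b, ob (ind M q) ?z)"
    unfolding l r by simp_all
  have lr': "?r \<cdot>\<^bsub>cat M H\<^esub> ?l = Idn (cat M H) (ob (ind M q) ?z)" "iso_arr (cat M H) ?r"
    using lr lt ri.D.inverses_iso_arr[OF lr] by (simp_all add: ri.D.inverses_iff[OF lt])
  have e: "reps M q ?z \<cdot>\<^bsub>cat M P\<^esub> ar (res M q) ?r = ?e" unfolding r by (rule rq.right_transpose) simp_all
  have n: "ar (res M q) ?l \<cdot>\<^bsub>cat M P\<^esub> leta M q ?z = ?n" unfolding l by (rule rq.left_transpose) simp_all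
  have "ar (res M q) ?r \<cdot>\<^bsub>cat M P\<^esub> ?n = ar (res M q) ?r \<cdot>\<^bsub>cat M P\<^esub> ar (res M q) ?l \<cdot>\<^bsub>cat M P\<^esub> leta M q ?z"
    unfolding n ..
  also have "\<dots> = ar (res M q) (?r \<cdot>\<^bsub>cat M H\<^esub> ?l) \<cdot>\<^bsub>cat M P\<^esub> leta M q ?z"
    by (simp add: rq.R.ar_Comp[OF lt rt] lt rt)
  also have "\<dots> = leta M q ?z" unfolding lr' by simp
  finally show ?thesis
    unfolding rq.induced_def using rt lr' e by (intro conjI exI[of _ ?r]) simp_all
qed

text \<open>The transpose of the unit is supported on the diagonal. To see this, start from the arrow \<open>w\<close> whose
  transpose is the right hand side: by \<open>trace_factor\<close> it is a trace along \<open>q\<close> of a trace along \<open>d\<close>,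
  and a trace along \<open>q \<circ>1 d\<close> does nothing, as this functor is the identity of \<open>H\<close>.\<close>

lemma mackey_unit:
  assumes Z [simp]: "Z \<in> Obj (cat M H)"
  shows "(ar (res M p) (reps M i Z) \<cdot>\<^bsub>cat M P\<^esub> \<theta> (ob (ind M i) Z)) \<cdot>\<^bsub>cat M P\<^esub> ar (res M q) (leta M i Z)
    = tr d (ob (res M q) Z) (ob (res M p) Z) (Idn (cat M H) Z)"
proof -
  let ?b = "ob (res M i) (ob (ind M i) Z)" and ?z = "ob (res M p) Z"
  let ?e = "ar (res M p) (reps M i Z) \<cdot>\<^bsub>cat M P\<^esub> \<theta> (ob (ind M i) Z)"
  let ?n = "res2 M \<gamma> (ob (ind M i) Z) \<cdot>\<^bsub>cat M P\<^esub> ar (res M p) (leta M i Z)"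
  note ind = induced_mackey[OF Z] and tq = trace_eq[OF pq(2) fq] and td = trace_eq[OF dq faithful_d]
  define t where "t = tr d (ob (res M q) Z) (ob (res M p) Z) (Idn (cat M H) Z)"
  have t [simp]: "hom_type (cat M P) t = Some (ob (res M q) Z, ?z)" unfolding t_def td[symmetric] by simp
  obtain w where w [simp]: "hom_type (cat M H) w = Some (Z, ?b)" and ew: "?e \<cdot>\<^bsub>cat M P\<^esub> ar (res M q) w = t"
    using rq.induced_lift[OF ind Z t] .
  have dn: "ar (res M d) ?n = leta M i Z" by (simp add: rd.R.ar_Comp)
  have "w = tr q Z ?b (?n \<cdot>\<^bsub>cat M P\<^esub> t)"
    using rq.trace_factor[OF ind w, of "Idn (cat M H) ?b" ?b] ew unfolding tq by simp
  also have "?n \<cdot>\<^bsub>cat M P\<^esub> t = tr d (ob (res M q) Z) (ob (res M q) ?b) (leta M i Z)"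
    unfolding t_def td[symmetric] by (subst rd.trace_left) (simp_all add: dn[simplified])
  also have "tr q Z ?b \<dots> = leta M i Z"
    using tr_comp1[OF dq faithful_d pq(2) fq, of Z ?b "leta M i Z"] tr_id1[OF gpds(1), of "leta M i Z" Z ?b]
    by (simp add: sq.comma_w faithful_id1[OF gpds(1)] res_id1_simps(1)[OF gpds(1)])
  finally show ?thesis using ew by (simp add: t_def)
qed

text \<open>The couniversal arrow \<open>E\<close> identifies \<open>B\<close> with \<open>i\<^sub>* Z\<close>. Whether this identification carries \<open>N\<close> to the
  unit of \<open>i\<^sub>! \<stileturn> i\<^sup>*\<close> can be tested on transposes, which are arrows \<open>q\<^sup>* Z \<rightarrow> p\<^sup>* Z\<close>. The transpose of
  the unit is the trace of the identity, and so is that of \<open>N\<close> if it factors through the image of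
  \<open>d\<^sub>*\<close>, since its restriction along \<open>d\<close> is \<open>E \<cdot> N\<close>, the identity.\<close>

lemma induced_of_couniversal:
  assumes B: "couniversal (cat M G) (cat M H) (res M i) B Z E" and N: "hom_type (cat M H) N = Some (Z, ob (res M i) B)"
    and EN: "E \<cdot>\<^bsub>cat M H\<^esub> N = Idn (cat M H) Z"
    and B': "couniversal (cat M P) (cat M H) (res M d) B' Z' e'"
    and h: "hom_type (cat M P) h = Some (ob (res M q) Z, B')" and k: "hom_type (cat M P) k = Some (B', ob (res M p) Z)"
    and c: "ar (res M p) E \<cdot>\<^bsub>cat M P\<^esub> \<theta> B \<cdot>\<^bsub>cat M P\<^esub> ar (res M q) N = k \<cdot>\<^bsub>cat M P\<^esub> h"
  shows "ri.induced B Z E N"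
proof -
  note [simp] = couniversal_type[OF B] N
  obtain f where f [simp]: "iso_arr (cat M G) f" "hom_type (cat M G) f = Some (B, ob (ind M i) Z)"
    and Ef: "E = reps M i Z \<cdot>\<^bsub>cat M H\<^esub> ar (res M i) f"
    using ri.couniversal_iso[OF B] .
  let ?n = "ar (res M i) f \<cdot>\<^bsub>cat M H\<^esub> N"
  let ?e = "ar (res M p) (reps M i Z) \<cdot>\<^bsub>cat M P\<^esub> \<theta> (ob (ind M i) Z)"
  have "ar (res M d) (ar (res M p) E \<cdot>\<^bsub>cat M P\<^esub> \<theta> B \<cdot>\<^bsub>cat M P\<^esub> ar (res M q) N) = Idn (cat M H) Z"
    using EN by (simp add: rd.R.ar_Comp)
  then have c': "ar (res M p) E \<cdot>\<^bsub>cat M P\<^esub> \<theta> B \<cdot>\<^bsub>cat M P\<^esub> ar (res M q) N = tr d (ob (res M q) Z) (ob (res M p) Z) (Idn (cat M H) Z)"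
    using tr_of_factorization[OF dq faithful_d weak_pullback_d B' h k] unfolding c by simp
  have "?e \<cdot>\<^bsub>cat M P\<^esub> ar (res M q) ?n
      = ar (res M p) (reps M i Z) \<cdot>\<^bsub>cat M P\<^esub> (\<theta> (ob (ind M i) Z) \<cdot>\<^bsub>cat M P\<^esub> ar (res M q) (ar (res M i) f)) \<cdot>\<^bsub>cat M P\<^esub> ar (res M q) N"
    by (simp add: rq.R.ar_Comp)
  also have "\<dots> = ar (res M p) E \<cdot>\<^bsub>cat M P\<^esub> \<theta> B \<cdot>\<^bsub>cat M P\<^esub> ar (res M q) N"
    unfolding \<theta>_natural[OF f(2)] Ef by (simp add: rp.ar_Comp)
  also have "\<dots> = ?e \<cdot>\<^bsub>cat M P\<^esub> ar (res M q) (leta M i Z)" unfolding c' by (rule mackey_unit[symmetric]) simp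
  finally have "?n = leta M i Z"
    by (rule rq.induced_unique[OF induced_mackey, rotated -1]) simp_all
  then show ?thesis unfolding ri.induced_def using f Ef by (intro conjI exI[of _ f]) simp_all
qed

end

section \<open>The projection formula\<close>

context green_2functor
begin

text \<open>The preservation of inductions by the external product: the transpose of this arrow is the mate that
  is assumed to be invertible.\<close>

lemma couniversal_ext:
  assumes i1: "gpd_functor H1 G1 i1" "faithful i1" and i2: "gpd_functor H2 G2 i2" "faithful i2"
    and X: "X \<in> Obj (cat M H1)" and Y: "Y \<in> Obj (cat M H2)"
  shows "couniversal (cat M (gpd_prod G1 G2)) (cat M (gpd_prod H1 H2)) (res M (prod1 i1 i2))
    (ext_ob M G1 G2 (ob (ind M i1) X) (ob (ind M i2) Y)) (ext_ob M H1 H2 X Y)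
    (ext_ar M H1 H2 (reps M i1 X) (reps M i2 Y) \<cdot>\<^bsub>cat M (gpd_prod H1 H2)\<^esub>
      ext_res_iso M i1 i2 (ob (ind M i1) X) (ob (ind M i2) Y))"
proof -
  let ?w = "prod1 i1 i2" and ?C = "cat M (gpd_prod G1 G2)" and ?D = "cat M (gpd_prod H1 H2)"
  note G = gpd_functorD(2)[OF i1(1)] gpd_functorD(2)[OF i2(1)]
  note H = gpd_functorD(1)[OF i1(1)] gpd_functorD(1)[OF i2(1)]
  note w = gpd_functor_prod1[OF i1(1) i2(1)] faithful_prod1[OF i1 i2]
  note pG = gpd_functor_proj[OF G] and pH = gpd_functor_proj[OF H]
  note pp = proj_prod1[OF i1(1) i2(1)]
  interpret a1: ambidextrous_functor "cat M G1" "cat M H1" "res M i1" "ind M i1" "leta M i1" "leps M i1" "reta M i1" "reps M i1"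
    by (rule ambidextrous[OF i1])
  interpret a2: ambidextrous_functor "cat M G2" "cat M H2" "res M i2" "ind M i2" "leta M i2" "leps M i2" "reta M i2" "reps M i2"
    by (rule ambidextrous[OF i2])
  interpret w: ambidextrous_functor ?C ?D "res M ?w" "ind M ?w" "leta M ?w" "leps M ?w" "reta M ?w" "reps M ?w"
    by (rule ambidextrous[OF w])
  interpret ws: strong_monoidal_functor ?C "tens M (gpd_prod G1 G2)" ?D "tens M (gpd_prod H1 H2)" "res M ?w" "mult M ?w" "munit M ?w"
    by (rule res_monoidal[OF w(1)])
  interpret g1: is_functor "cat M G1" ?C "res M (proj1 G1 G2)" by (rule res_is_functor[OF pG(1)])
  interpret g2: is_functor "cat M G2" ?C "res M (proj2 G1 G2)" by (rule res_is_functor[OF pG(2)])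
  interpret h1: is_functor "cat M H1" ?D "res M (proj1 H1 H2)" by (rule res_is_functor[OF pH(1)])
  interpret h2: is_functor "cat M H2" ?D "res M (proj2 H1 H2)" by (rule res_is_functor[OF pH(2)])
  note [simp] = X Y
  have st: "src i1 = H1" "tgt i1 = G1" "src i2 = H2" "tgt i2 = G2" using i1 i2 by (simp_all add: gpd_functorD)
  let ?X = "ob (ind M i1) X" and ?Y = "ob (ind M i2) Y"
  have o [simp]: "ob (res M ?w) (ob (res M (proj1 G1 G2)) ?X) = ob (res M (proj1 H1 H2)) (ob (res M i1) ?X)"
    "ob (res M ?w) (ob (res M (proj2 G1 G2)) ?Y) = ob (res M (proj2 H1 H2)) (ob (res M i2) ?Y)"
    using res_comp1_simps(1)[OF w(1) pG(1), of ?X] res_comp1_simps(1)[OF w(1) pG(2), of ?Y]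
      res_comp1_simps(1)[OF pH(1) i1(1), of ?X] res_comp1_simps(1)[OF pH(2) i2(1), of ?Y]
    by (simp_all add: pp)
  let ?b = "ext_ob M G1 G2 ?X ?Y" and ?z = "ext_ob M H1 H2 X Y"
  let ?e = "ext_ar M H1 H2 (reps M i1 X) (reps M i2 Y) \<cdot>\<^bsub>?D\<^esub> ext_res_iso M i1 i2 ?X ?Y"
  have b [simp]: "?b \<in> Obj ?C" and z [simp]: "?z \<in> Obj ?D" by (simp_all add: ext_ob_def)
  have e [simp]: "hom_type ?D ?e = Some (ob (res M ?w) ?b, ?z)"
    by (simp add: ext_ob_def ext_ar_def ext_res_iso_def st)
  have r_eq: "ext_rmate M i1 i2 X Y = ar (ind M ?w) ?e \<cdot>\<^bsub>?C\<^esub> reta M ?w ?b"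
    by (simp add: ext_rmate_def Let_def st ext_ob_def ext_ar_def ext_res_iso_def w.I.ar_Comp)
  have r: "hom_type ?C (ext_rmate M i1 i2 X Y) = Some (?b, ob (ind M ?w) ?z)" unfolding r_eq by simp
  show ?thesis
    using w.couniversal_of_iso[OF ext_preserves_ind[OF i1 i2 X Y] r z] unfolding r_eq w.right_transpose[OF b e] .
qed

text \<open>The external product is pulled back along the diagonal of \<open>G\<close>. Up to the monoidal structure of the
  restriction functors this turns \<open>i1 \<times> i2\<close> into a pullback of \<open>i1\<close> and \<open>i2\<close>, and external products
  into tensor products.\<close>

lemma couniversal_tensor_ind:
  assumes sq: "weak_pullback i1 i2 H1 H2 G p1 p2 L" and i1: "faithful i1" and i2: "faithful i2"
    and X [simp]: "X \<in> Obj (cat M H1)" and Y [simp]: "Y \<in> Obj (cat M H2)"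
  defines "r \<equiv> i1 \<circ>1 p1"
  shows "couniversal (cat M G) (cat M L) (res M r) (ob (ind M i1) X \<otimes>\<^bsub>tens M G\<^esub> ob (ind M i2) Y)
    (ob (res M p1) X \<otimes>\<^bsub>tens M L\<^esub> ob (res M p2) Y)
    ((ar (res M p1) (reps M i1 X) \<odot>\<^bsub>tens M L\<^esub> ar (res M p2) (reps M i2 Y))
      \<cdot>\<^bsub>cat M L\<^esub> inv_arr (cat M L) (mult M r (ob (ind M i1) X) (ob (ind M i2) Y)))"
proof -
  interpret sq: weak_pullback i1 i2 H1 H2 G p1 p2 L by (rule sq)
  note f = sq.i sq.u sq.p sq.q
  note G = gpd_functorD(2)[OF f(1)] and H = gpd_functorD(1)[OF f(1)] gpd_functorD(1)[OF f(2)]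
  let ?GG = "gpd_prod G G" and ?HH = "gpd_prod H1 H2"
  let ?w = "prod1 i1 i2" and ?s = "pairing p1 p2" and ?d = "diag G"
  let ?C = "cat M G" and ?D = "cat M L" and ?CC = "cat M ?GG" and ?DD = "cat M ?HH"
  note w = gpd_functor_prod1[OF f(1,2)] faithful_prod1[OF f(1) i1 f(2) i2]
  note d = gpd_functor_diag[OF G] and s = gpd_functor_pairing[OF f(3,4)]
  have r: "gpd_functor L G r" unfolding r_def by (rule gpd_functor_comp1[OF f(3,1)])
  have ws: "?w \<circ>1 ?s = ?d \<circ>1 r" unfolding r_def by (rule sq.prod_commutes)
  note pG = gpd_functor_proj[OF G G] and pH = gpd_functor_proj[OF H]
  have pd: "proj1 G G \<circ>1 ?d = id1 G" "proj2 G G \<circ>1 ?d = id1 G"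
    by (rule proj_pairing[OF gpd_functor_id1[OF G] gpd_functor_id1[OF G]])+
  note ps = proj_pairing[OF f(3,4)] and pw = proj_prod1[OF f(1,2)]
  interpret a1: ambidextrous_functor "cat M G" "cat M H1" "res M i1" "ind M i1" "leta M i1" "leps M i1" "reta M i1" "reps M i1"
    by (rule ambidextrous[OF f(1) i1])
  interpret a2: ambidextrous_functor "cat M G" "cat M H2" "res M i2" "ind M i2" "leta M i2" "leps M i2" "reta M i2" "reps M i2"
    by (rule ambidextrous[OF f(2) i2])
  interpret w: strong_monoidal_functor ?CC "tens M ?GG" ?DD "tens M ?HH" "res M ?w" "mult M ?w" "munit M ?w"
    by (rule res_monoidal[OF w(1)])
  interpret s: strong_monoidal_functor ?DD "tens M ?HH" ?D "tens M L" "res M ?s" "mult M ?s" "munit M ?s"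
    by (rule res_monoidal[OF s])
  interpret d: strong_monoidal_functor ?CC "tens M ?GG" ?C "tens M G" "res M ?d" "mult M ?d" "munit M ?d"
    by (rule res_monoidal[OF d])
  interpret r: strong_monoidal_functor ?C "tens M G" ?D "tens M L" "res M r" "mult M r" "munit M r"
    by (rule res_monoidal[OF r])
  interpret g1: is_functor "cat M G" ?CC "res M (proj1 G G)" by (rule res_is_functor[OF pG(1)])
  interpret g2: is_functor "cat M G" ?CC "res M (proj2 G G)" by (rule res_is_functor[OF pG(2)])
  interpret h1: is_functor "cat M H1" ?DD "res M (proj1 H1 H2)" by (rule res_is_functor[OF pH(1)])
  interpret h2: is_functor "cat M H2" ?DD "res M (proj2 H1 H2)" by (rule res_is_functor[OF pH(2)])
  interpret p1: is_functor "cat M H1" ?D "res M p1" by (rule res_is_functor[OF f(3)])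
  interpret p2: is_functor "cat M H2" ?D "res M p2" by (rule res_is_functor[OF f(4)])
  let ?X = "ob (ind M i1) X" and ?Y = "ob (ind M i2) Y"
  let ?gX = "ob (res M (proj1 G G)) ?X" and ?gY = "ob (res M (proj2 G G)) ?Y"
  let ?hX = "ob (res M (proj1 H1 H2)) X" and ?hY = "ob (res M (proj2 H1 H2)) Y"
  let ?kX = "ob (res M (proj1 H1 H2)) (ob (res M i1) ?X)" and ?kY = "ob (res M (proj2 H1 H2)) (ob (res M i2) ?Y)"
  have o1 [simp]: "ob (res M ?w) ?gX = ?kX" "ob (res M ?w) ?gY = ?kY"
    using res_comp1_simps(1)[OF w(1) pG(1), of ?X] res_comp1_simps(1)[OF w(1) pG(2), of ?Y]
      res_comp1_simps(1)[OF pH(1) f(1), of ?X] res_comp1_simps(1)[OF pH(2) f(2), of ?Y]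
    by (simp_all add: pw)
  have o2 [simp]: "ob (res M ?d) ?gX = ?X" "ob (res M ?d) ?gY = ?Y"
    using res_comp1_simps(1)[OF d pG(1), of ?X] res_comp1_simps(1)[OF d pG(2), of ?Y]
    by (simp_all add: pd res_id1_simps(1)[OF G])
  have o3 [simp]: "A \<in> Obj (cat M H1) \<Longrightarrow> ob (res M ?s) (ob (res M (proj1 H1 H2)) A) = ob (res M p1) A"
     "B \<in> Obj (cat M H2) \<Longrightarrow> ob (res M ?s) (ob (res M (proj2 H1 H2)) B) = ob (res M p2) B" for A B
    using res_comp1_simps(1)[OF s pH(1), of A] res_comp1_simps(1)[OF s pH(2), of B]
    by (simp_all add: ps)
  have a3 [simp]: "ar (res M ?s) (ar (res M (proj1 H1 H2)) (reps M i1 X)) = ar (res M p1) (reps M i1 X)"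
     "ar (res M ?s) (ar (res M (proj2 H1 H2)) (reps M i2 Y)) = ar (res M p2) (reps M i2 Y)"
    using res_comp1_simps(2)[OF s pH(1) a1.type_units(4)[OF X]] res_comp1_simps(2)[OF s pH(2) a2.type_units(4)[OF Y]]
    by (simp_all add: ps)
  have ri: "r = i1 \<circ>1 p1" "r = i2 \<circ>1 p2" using sq.commutes by (simp_all add: r_def)
  have o4 [simp]: "ob (res M p1) (ob (res M i1) ?X) = ob (res M r) ?X" "ob (res M p2) (ob (res M i2) ?Y) = ob (res M r) ?Y"
    using res_comp1_simps(1)[OF f(3,1), folded ri, of ?X] res_comp1_simps(1)[OF f(4,2), folded ri, of ?Y] by simp_all
  let ?E = "ext_ar M H1 H2 (reps M i1 X) (reps M i2 Y) \<cdot>\<^bsub>?DD\<^esub> ext_res_iso M i1 i2 ?X ?Y"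
  have E: "?E = (ar (res M (proj1 H1 H2)) (reps M i1 X) \<odot>\<^bsub>tens M ?HH\<^esub> ar (res M (proj2 H1 H2)) (reps M i2 Y))
       \<cdot>\<^bsub>?DD\<^esub> inv_arr ?DD (mult M ?w ?gX ?gY)"
    by (simp add: ext_ar_def ext_res_iso_def)
  let ?a = "ar (res M p1) (reps M i1 X) \<odot>\<^bsub>tens M L\<^esub> ar (res M p2) (reps M i2 Y)"
  have c: "couniversal ?C ?D (res M r) (ob (res M ?d) (?gX \<otimes>\<^bsub>tens M ?GG\<^esub> ?gY))
      (ob (res M ?s) (?hX \<otimes>\<^bsub>tens M ?HH\<^esub> ?hY)) (ar (res M ?s) ?E)"
    using couniversal_base_change[OF sq.weak_pullback_diag w(2) couniversal_ext[OF f(1) i1 f(2) i2 X Y]]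
    by (simp add: ext_ob_def r_def)
  let ?h = "inv_arr ?D (mult M ?s ?hX ?hY)" and ?k = "mult M ?d ?gX ?gY"
  \<comment> \<open>The pulled back external products are tensor products by the monoidal structures of \<open>?d\<close> and \<open>?s\<close>.\<close>
  have c': "couniversal ?C ?D (res M r) (?X \<otimes>\<^bsub>tens M G\<^esub> ?Y) (ob (res M p1) X \<otimes>\<^bsub>tens M L\<^esub> ob (res M p2) Y)
      (?h \<cdot>\<^bsub>?D\<^esub> ar (res M ?s) ?E \<cdot>\<^bsub>?D\<^esub> ar (res M r) ?k)"
    by (rule r.couniversal_transport[OF c]) simp_all
  \<comment> \<open>As the square commutes strictly, the monoidal structure of the restriction along its diagonal is
    computed in two ways. This shows that all comparisons cancel except for that of \<open>r\<close>.\<close>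
  have "mult M (?w \<circ>1 ?s) ?gX ?gY = ar (res M ?s) (mult M ?w ?gX ?gY) \<cdot>\<^bsub>?D\<^esub> mult M ?s ?kX ?kY"
    using mult_comp1[OF s w(1), of ?gX ?gY] by simp
  moreover have "mult M (?d \<circ>1 r) ?gX ?gY = ar (res M r) ?k \<cdot>\<^bsub>?D\<^esub> mult M r ?X ?Y"
    using mult_comp1[OF r d, of ?gX ?gY] by simp
  ultimately have m: "ar (res M r) ?k \<cdot>\<^bsub>?D\<^esub> mult M r ?X ?Y
      = ar (res M ?s) (mult M ?w ?gX ?gY) \<cdot>\<^bsub>?D\<^esub> mult M ?s ?kX ?kY" unfolding ws by simp
  have rd: "ob (res M ?s) (ob (res M ?w) (?gX \<otimes>\<^bsub>tens M ?GG\<^esub> ?gY)) = ob (res M r) (ob (res M ?d) (?gX \<otimes>\<^bsub>tens M ?GG\<^esub> ?gY))"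
    using res_comp1_simps(1)[OF s w(1), of "?gX \<otimes>\<^bsub>tens M ?GG\<^esub> ?gY"] res_comp1_simps(1)[OF r d, of "?gX \<otimes>\<^bsub>tens M ?GG\<^esub> ?gY"]
    unfolding ws by simp
  have k [simp]: "hom_type ?D (ar (res M r) ?k) = Some (ob (res M r) (?X \<otimes>\<^bsub>tens M G\<^esub> ?Y), ob (res M ?s) (ob (res M ?w) (?gX \<otimes>\<^bsub>tens M ?GG\<^esub> ?gY)))"
    unfolding rd by simp
  have "ar (res M r) ?k = (ar (res M r) ?k \<cdot>\<^bsub>?D\<^esub> mult M r ?X ?Y) \<cdot>\<^bsub>?D\<^esub> inv_arr ?D (mult M r ?X ?Y)"
    by simp
  then have kk: "ar (res M r) ?k = ar (res M ?s) (mult M ?w ?gX ?gY) \<cdot>\<^bsub>?D\<^esub> mult M ?s ?kX ?kY \<cdot>\<^bsub>?D\<^esub> inv_arr ?D (mult M r ?X ?Y)"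
    unfolding m by simp
  have sE: "ar (res M ?s) ?E \<cdot>\<^bsub>?D\<^esub> ar (res M ?s) (mult M ?w ?gX ?gY)
      = ar (res M ?s) (ar (res M (proj1 H1 H2)) (reps M i1 X) \<odot>\<^bsub>tens M ?HH\<^esub> ar (res M (proj2 H1 H2)) (reps M i2 Y))"
    unfolding E by (simp add: s.ar_Comp s.ar_inv_arr)
  have nat: "?h \<cdot>\<^bsub>?D\<^esub> ar (res M ?s) (ar (res M (proj1 H1 H2)) (reps M i1 X) \<odot>\<^bsub>tens M ?HH\<^esub> ar (res M (proj2 H1 H2)) (reps M i2 Y))
      = ?a \<cdot>\<^bsub>?D\<^esub> inv_arr ?D (mult M ?s ?kX ?kY)"
    using s.inv_mult_natural[of "ar (res M (proj1 H1 H2)) (reps M i1 X)" ?kX ?hX "ar (res M (proj2 H1 H2)) (reps M i2 Y)" ?kY ?hY]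
    by simp
  have Et: "hom_type ?D (ar (res M ?s) ?E) = Some (ob (res M ?s) (ob (res M ?w) (?gX \<otimes>\<^bsub>tens M ?GG\<^esub> ?gY)), ob (res M ?s) (?hX \<otimes>\<^bsub>tens M ?HH\<^esub> ?hY))"
    unfolding E by simp
  have "?h \<cdot>\<^bsub>?D\<^esub> ar (res M ?s) ?E \<cdot>\<^bsub>?D\<^esub> ar (res M r) ?k
      = ?h \<cdot>\<^bsub>?D\<^esub> (ar (res M ?s) ?E \<cdot>\<^bsub>?D\<^esub> ar (res M ?s) (mult M ?w ?gX ?gY)) \<cdot>\<^bsub>?D\<^esub> mult M ?s ?kX ?kY \<cdot>\<^bsub>?D\<^esub> inv_arr ?D (mult M r ?X ?Y)"
    unfolding kk using Et by simp
  also have "\<dots> = (?h \<cdot>\<^bsub>?D\<^esub> ar (res M ?s) (ar (res M (proj1 H1 H2)) (reps M i1 X) \<odot>\<^bsub>tens M ?HH\<^esub> ar (res M (proj2 H1 H2)) (reps M i2 Y)))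
      \<cdot>\<^bsub>?D\<^esub> mult M ?s ?kX ?kY \<cdot>\<^bsub>?D\<^esub> inv_arr ?D (mult M r ?X ?Y)"
    unfolding sE by simp
  also have "\<dots> = ?a \<cdot>\<^bsub>?D\<^esub> inv_arr ?D (mult M r ?X ?Y)" unfolding nat by simp
  finally show ?thesis using c' by simp
qed

lemma couniversal_tensor:
  assumes sq: "weak_pullback i1 i2 H1 H2 G p1 p2 L" and i1: "faithful i1" and i2: "faithful i2"
    and e1: "couniversal (cat M G) (cat M H1) (res M i1) A X e1" and e2: "couniversal (cat M G) (cat M H2) (res M i2) B Y e2"
  shows "couniversal (cat M G) (cat M L) (res M (i1 \<circ>1 p1)) (A \<otimes>\<^bsub>tens M G\<^esub> B)
    (ob (res M p1) X \<otimes>\<^bsub>tens M L\<^esub> ob (res M p2) Y)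
    ((ar (res M p1) e1 \<odot>\<^bsub>tens M L\<^esub> ar (res M p2) e2) \<cdot>\<^bsub>cat M L\<^esub> inv_arr (cat M L) (mult M (i1 \<circ>1 p1) A B))"
proof -
  interpret sq: weak_pullback i1 i2 H1 H2 G p1 p2 L by (rule sq)
  note f = sq.i sq.u sq.p sq.q
  define r where "r = i1 \<circ>1 p1"
  have r: "gpd_functor L G r" unfolding r_def by (rule gpd_functor_comp1[OF f(3,1)])
  have ri: "r = i1 \<circ>1 p1" "r = i2 \<circ>1 p2" using sq.commutes by (simp_all add: r_def)
  let ?C = "cat M G" and ?D = "cat M L"
  interpret a1: ambidextrous_functor "cat M G" "cat M H1" "res M i1" "ind M i1" "leta M i1" "leps M i1" "reta M i1" "reps M i1"
    by (rule ambidextrous[OF f(1) i1])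
  interpret a2: ambidextrous_functor "cat M G" "cat M H2" "res M i2" "ind M i2" "leta M i2" "leps M i2" "reta M i2" "reps M i2"
    by (rule ambidextrous[OF f(2) i2])
  interpret r: strong_monoidal_functor ?C "tens M G" ?D "tens M L" "res M r" "mult M r" "munit M r"
    by (rule res_monoidal[OF r])
  interpret p1: is_functor "cat M H1" ?D "res M p1" by (rule res_is_functor[OF f(3)])
  interpret p2: is_functor "cat M H2" ?D "res M p2" by (rule res_is_functor[OF f(4)])
  obtain f1 where f1 [simp]: "iso_arr ?C f1" "hom_type ?C f1 = Some (A, ob (ind M i1) X)"
    and ef1: "e1 = reps M i1 X \<cdot>\<^bsub>cat M H1\<^esub> ar (res M i1) f1" using a1.couniversal_iso[OF e1] .
  obtain f2 where f2 [simp]: "iso_arr ?C f2" "hom_type ?C f2 = Some (B, ob (ind M i2) Y)"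
    and ef2: "e2 = reps M i2 Y \<cdot>\<^bsub>cat M H2\<^esub> ar (res M i2) f2" using a2.couniversal_iso[OF e2] .
  note [simp] = couniversal_type[OF e1] couniversal_type[OF e2]
  let ?X = "ob (ind M i1) X" and ?Y = "ob (ind M i2) Y"
  have o4 [simp]: "ob (res M p1) (ob (res M i1) ?X) = ob (res M r) ?X" "ob (res M p2) (ob (res M i2) ?Y) = ob (res M r) ?Y"
    "ob (res M p1) (ob (res M i1) A) = ob (res M r) A" "ob (res M p2) (ob (res M i2) B) = ob (res M r) B"
    using res_comp1_simps(1)[OF f(3,1), folded ri] res_comp1_simps(1)[OF f(4,2), folded ri] by simp_all
  have a4 [simp]: "ar (res M p1) (ar (res M i1) f1) = ar (res M r) f1" "ar (res M p2) (ar (res M i2) f2) = ar (res M r) f2"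
    using res_comp1_simps(2)[OF f(3,1), folded ri, OF f1(2)] res_comp1_simps(2)[OF f(4,2), folded ri, OF f2(2)] by simp_all
  note c = couniversal_tensor_ind[OF sq i1 i2 couniversal_type(2)[OF e1] couniversal_type(2)[OF e2], folded r_def]
  let ?e = "r.pair ?X ?Y (ar (res M p1) (reps M i1 X)) (ar (res M p2) (reps M i2 Y))"
  have e: "hom_type ?D ?e = Some (ob (res M r) (?X \<otimes>\<^bsub>tens M G\<^esub> ?Y), ob (res M p1) X \<otimes>\<^bsub>tens M L\<^esub> ob (res M p2) Y)"
    by simp
  have "couniversal ?C ?D (res M r) (A \<otimes>\<^bsub>tens M G\<^esub> B) (ob (res M p1) X \<otimes>\<^bsub>tens M L\<^esub> ob (res M p2) Y)
     (Idn ?D (ob (res M p1) X \<otimes>\<^bsub>tens M L\<^esub> ob (res M p2) Y) \<cdot>\<^bsub>?D\<^esub> ?e \<cdot>\<^bsub>?D\<^esub> ar (res M r) (f1 \<odot>\<^bsub>tens M G\<^esub> f2))"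
    by (rule r.couniversal_transport[OF c[folded r.pair_def]]) simp_all
  also have "Idn ?D (ob (res M p1) X \<otimes>\<^bsub>tens M L\<^esub> ob (res M p2) Y) \<cdot>\<^bsub>?D\<^esub> ?e \<cdot>\<^bsub>?D\<^esub> ar (res M r) (f1 \<odot>\<^bsub>tens M G\<^esub> f2)
      = ?e \<cdot>\<^bsub>?D\<^esub> ar (res M r) (f1 \<odot>\<^bsub>tens M G\<^esub> f2)" using e by simp
  also have "\<dots> = r.pair A B (ar (res M p1) e1) (ar (res M p2) e2)"
    by (simp add: r.pair_ar[of f1 "Some (A, ?X)" ?X f2 "Some (B, ?Y)" ?Y] ef1 ef2 p1.ar_Comp p2.ar_Comp)
  finally show ?thesis unfolding r.pair_def unfolding r_def .
qed

lemma couniversal_id1: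
  assumes G: "finite_groupoid G" and Y: "Y \<in> Obj (cat M G)"
  shows "couniversal (cat M G) (cat M G) (res M (id1 G)) Y Y (Idn (cat M G) Y)"
proof -
  interpret is_functor "cat M G" "cat M G" "res M (id1 G)" by (rule res_is_functor[OF gpd_functor_id1[OF G]])
  note [simp] = Y res_id1_simps(1)[OF G]
  show ?thesis
  proof (rule couniversalI)
    fix w g assume w: "w \<in> Obj (cat M G)" and "hom_type (cat M G) g = Some (ob (res M (id1 G)) w, Y)"
    then have g: "hom_type (cat M G) g = Some (w, Y)" by simp
    then show "\<exists>f. hom_type (cat M G) f = Some (w, Y) \<and> Idn (cat M G) Y \<cdot>\<^bsub>cat M G\<^esub> ar (res M (id1 G)) f = g"
      by (intro exI[of _ g]) (simp add: res_id1_simps(2)[OF G g])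
  next
    fix w f g assume f: "hom_type (cat M G) f = Some (w, Y)" and g: "hom_type (cat M G) g = Some (w, Y)"
      and "Idn (cat M G) Y \<cdot>\<^bsub>cat M G\<^esub> ar (res M (id1 G)) f = Idn (cat M G) Y \<cdot>\<^bsub>cat M G\<^esub> ar (res M (id1 G)) g"
    then show "f = g" by (simp add: res_id1_simps(2)[OF G f] res_id1_simps(2)[OF G g])
  qed simp_all
qed

text \<open>In \<open>couniversal_tensor\<close> one of the two functors is now an identity, so that the pullback is \<open>H\<close>.\<close>

lemma projection_couniversal:
  assumes i: "gpd_functor H G i" "faithful i" and X: "X \<in> Obj (cat M H)" and Y: "Y \<in> Obj (cat M G)"
  shows "couniversal (cat M G) (cat M H) (res M i) (ob (ind M i) X \<otimes>\<^bsub>tens M G\<^esub> Y) (X \<otimes>\<^bsub>tens M H\<^esub> ob (res M i) Y)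
      ((reps M i X \<odot>\<^bsub>tens M H\<^esub> Idn (cat M H) (ob (res M i) Y)) \<cdot>\<^bsub>cat M H\<^esub> inv_arr (cat M H) (mult M i (ob (ind M i) X) Y))"
    "couniversal (cat M G) (cat M H) (res M i) (Y \<otimes>\<^bsub>tens M G\<^esub> ob (ind M i) X) (ob (res M i) Y \<otimes>\<^bsub>tens M H\<^esub> X)
      ((Idn (cat M H) (ob (res M i) Y) \<odot>\<^bsub>tens M H\<^esub> reps M i X) \<cdot>\<^bsub>cat M H\<^esub> inv_arr (cat M H) (mult M i Y (ob (ind M i) X)))"
proof -
  note H = gpd_functorD(1)[OF i(1)] and G = gpd_functorD(2)[OF i(1)]
  interpret ambidextrous_functor "cat M G" "cat M H" "res M i" "ind M i" "leta M i" "leps M i" "reta M i" "reps M i"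
    by (rule ambidextrous[OF i])
  have e: "couniversal (cat M G) (cat M H) (res M i) (ob (ind M i) X) X (reps M i X)"
    using couniversal_of_iso[of "Idn (cat M G) (ob (ind M i) X)" "ob (ind M i) X" X] X by simp
  note idG = couniversal_id1[OF G Y] faithful_id1[OF G]
  note [simp] = X Y comp1_id1[OF i(1)] res_id1_simps(1)[OF H] res_id1_simps(2)[OF H type_units(4)[OF X]]
  show "couniversal (cat M G) (cat M H) (res M i) (ob (ind M i) X \<otimes>\<^bsub>tens M G\<^esub> Y) (X \<otimes>\<^bsub>tens M H\<^esub> ob (res M i) Y)
      ((reps M i X \<odot>\<^bsub>tens M H\<^esub> Idn (cat M H) (ob (res M i) Y)) \<cdot>\<^bsub>cat M H\<^esub> inv_arr (cat M H) (mult M i (ob (ind M i) X) Y))"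
    using couniversal_tensor[OF weak_pullback_id(1)[OF i(1)] i(2) idG(2) e idG(1)] by simp
  show "couniversal (cat M G) (cat M H) (res M i) (Y \<otimes>\<^bsub>tens M G\<^esub> ob (ind M i) X) (ob (res M i) Y \<otimes>\<^bsub>tens M H\<^esub> X)
      ((Idn (cat M H) (ob (res M i) Y) \<odot>\<^bsub>tens M H\<^esub> reps M i X) \<cdot>\<^bsub>cat M H\<^esub> inv_arr (cat M H) (mult M i Y (ob (ind M i) X)))"
    using couniversal_tensor[OF weak_pullback_id(2)[OF i(1)] idG(2) i(2) idG(1) e] by simp
qed

end

locale green_diagonal = green_2functor M + diagonal i H G
  for M :: "('a, 'o, 'm, 'z) green_data_scheme" and i :: "'a cell1" and H G :: "'a gpd"
begin

sublocale mackey_diagonal M i H G ..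

sublocale si: strong_monoidal_functor "cat M G" "tens M G" "cat M H" "tens M H" "res M i" "mult M i" "munit M i"
  by (rule res_monoidal[OF i])

sublocale sp: strong_monoidal_functor "cat M H" "tens M H" "cat M P" "tens M P" "res M p" "mult M p" "munit M p"
  by (rule res_monoidal[OF pq(1)])

sublocale sq: strong_monoidal_functor "cat M H" "tens M H" "cat M P" "tens M P" "res M q" "mult M q" "munit M q"
  by (rule res_monoidal[OF pq(2)])

lemma \<theta>_mult:
  assumes [simp]: "A \<in> Obj (cat M G)" "B \<in> Obj (cat M G)"
  shows "\<theta> (A \<otimes>\<^bsub>tens M G\<^esub> B) \<cdot>\<^bsub>cat M P\<^esub> ar (res M q) (mult M i A B) \<cdot>\<^bsub>cat M P\<^esub> mult M q (ob (res M i) A) (ob (res M i) B)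
    = ar (res M p) (mult M i A B) \<cdot>\<^bsub>cat M P\<^esub> mult M p (ob (res M i) A) (ob (res M i) B) \<cdot>\<^bsub>cat M P\<^esub> (\<theta> A \<odot>\<^bsub>tens M P\<^esub> \<theta> B)"
proof -
  have "\<theta> (A \<otimes>\<^bsub>tens M G\<^esub> B) \<cdot>\<^bsub>cat M P\<^esub> mult M (i \<circ>1 q) A B = mult M (i \<circ>1 p) A B \<cdot>\<^bsub>cat M P\<^esub> (\<theta> A \<odot>\<^bsub>tens M P\<^esub> \<theta> B)"
    using res2_mult[OF \<theta>_inv(1), of A B] gpd_functorD(3,4)[OF \<theta>_inv(2)] by simp
  then show ?thesis by (simp add: mult_comp1[OF pq(1) i] mult_comp1[OF pq(2) i])
qed

text \<open>The transformation \<open>\<theta>\<close> is monoidal, so that the transpose over \<open>P\<close> of a product is a product of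
  transposes.\<close>

lemma \<theta>_pair:
  assumes A: "A \<in> Obj (cat M G)" and B: "B \<in> Obj (cat M G)"
    and E: "hom_type (cat M H) E1 = Some (ob (res M i) A, z1)" "hom_type (cat M H) E2 = Some (ob (res M i) B, z2)"
    and N: "hom_type (cat M H) N1 = Some (w1, ob (res M i) A)" "hom_type (cat M H) N2 = Some (w2, ob (res M i) B)"
  shows "ar (res M p) (si.pair A B E1 E2) \<cdot>\<^bsub>cat M P\<^esub> \<theta> (A \<otimes>\<^bsub>tens M G\<^esub> B) \<cdot>\<^bsub>cat M P\<^esub> ar (res M q) (si.copair A B N1 N2)
    = mult M p z1 z2 \<cdot>\<^bsub>cat M P\<^esub>
      ((ar (res M p) E1 \<cdot>\<^bsub>cat M P\<^esub> \<theta> A \<cdot>\<^bsub>cat M P\<^esub> ar (res M q) N1) \<odot>\<^bsub>tens M P\<^esub> (ar (res M p) E2 \<cdot>\<^bsub>cat M P\<^esub> \<theta> B \<cdot>\<^bsub>cat M P\<^esub> ar (res M q) N2))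
      \<cdot>\<^bsub>cat M P\<^esub> inv_arr (cat M P) (mult M q w1 w2)"
proof -
  note [simp] = A B E N ri.D.Obj_of_type[OF E(1)] ri.D.Obj_of_type[OF E(2)] ri.D.Obj_of_type[OF N(1)] ri.D.Obj_of_type[OF N(2)]
  let ?P = "cat M P" and ?T = "tens M P" and ?a = "ob (res M i) A" and ?b = "ob (res M i) B"
  let ?EE = "ar (res M p) (E1 \<odot>\<^bsub>tens M H\<^esub> E2)" and ?NN = "ar (res M q) (N1 \<odot>\<^bsub>tens M H\<^esub> N2)"
  let ?ip = "ar (res M p) (inv_arr (cat M H) (mult M i A B))" and ?iq = "inv_arr ?P (mult M q w1 w2)"
  have E': "?EE \<cdot>\<^bsub>?P\<^esub> mult M p ?a ?b = mult M p z1 z2 \<cdot>\<^bsub>?P\<^esub> (ar (res M p) E1 \<odot>\<^bsub>?T\<^esub> ar (res M p) E2)"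
    using sp.mult_natural[of E1 ?a z1 E2 ?b z2] by simp
  have sqn: "?NN \<cdot>\<^bsub>?P\<^esub> mult M q w1 w2 = mult M q ?a ?b \<cdot>\<^bsub>?P\<^esub> (ar (res M q) N1 \<odot>\<^bsub>?T\<^esub> ar (res M q) N2)"
    using sq.mult_natural[of N1 w1 ?a N2 w2 ?b] by simp
  have "?NN = (?NN \<cdot>\<^bsub>?P\<^esub> mult M q w1 w2) \<cdot>\<^bsub>?P\<^esub> ?iq" by simp
  also have "\<dots> = mult M q ?a ?b \<cdot>\<^bsub>?P\<^esub> (ar (res M q) N1 \<odot>\<^bsub>?T\<^esub> ar (res M q) N2) \<cdot>\<^bsub>?P\<^esub> ?iq"
    unfolding sqn by simp
  finally have N': "?NN = mult M q ?a ?b \<cdot>\<^bsub>?P\<^esub> (ar (res M q) N1 \<odot>\<^bsub>?T\<^esub> ar (res M q) N2) \<cdot>\<^bsub>?P\<^esub> ?iq" .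
  have "ar (res M p) (si.pair A B E1 E2) \<cdot>\<^bsub>?P\<^esub> \<theta> (A \<otimes>\<^bsub>tens M G\<^esub> B) \<cdot>\<^bsub>?P\<^esub> ar (res M q) (si.copair A B N1 N2)
     = ?EE \<cdot>\<^bsub>?P\<^esub> ?ip \<cdot>\<^bsub>?P\<^esub> \<theta> (A \<otimes>\<^bsub>tens M G\<^esub> B) \<cdot>\<^bsub>?P\<^esub> ar (res M q) (mult M i A B) \<cdot>\<^bsub>?P\<^esub> ?NN"
    by (simp add: si.pair_def si.copair_def rp.ar_Comp rq.R.ar_Comp)
  also have "\<dots> = ?EE \<cdot>\<^bsub>?P\<^esub> ?ip \<cdot>\<^bsub>?P\<^esub> (\<theta> (A \<otimes>\<^bsub>tens M G\<^esub> B) \<cdot>\<^bsub>?P\<^esub> ar (res M q) (mult M i A B) \<cdot>\<^bsub>?P\<^esub> mult M q ?a ?b)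
      \<cdot>\<^bsub>?P\<^esub> (ar (res M q) N1 \<odot>\<^bsub>?T\<^esub> ar (res M q) N2) \<cdot>\<^bsub>?P\<^esub> ?iq"
    unfolding N' by simp
  also have "\<dots> = (?EE \<cdot>\<^bsub>?P\<^esub> mult M p ?a ?b) \<cdot>\<^bsub>?P\<^esub> (\<theta> A \<odot>\<^bsub>?T\<^esub> \<theta> B) \<cdot>\<^bsub>?P\<^esub> (ar (res M q) N1 \<odot>\<^bsub>?T\<^esub> ar (res M q) N2) \<cdot>\<^bsub>?P\<^esub> ?iq"
    unfolding \<theta>_mult[OF A B] by (simp add: rp.ar_inv_arr)
  also have "\<dots> = mult M p z1 z2 \<cdot>\<^bsub>?P\<^esub>
      ((ar (res M p) E1 \<cdot>\<^bsub>?P\<^esub> \<theta> A \<cdot>\<^bsub>?P\<^esub> ar (res M q) N1) \<odot>\<^bsub>?T\<^esub> (ar (res M p) E2 \<cdot>\<^bsub>?P\<^esub> \<theta> B \<cdot>\<^bsub>?P\<^esub> ar (res M q) N2))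
      \<cdot>\<^bsub>?P\<^esub> ?iq"
    unfolding E' by (simp add: sp.target.tar_merge)
  finally show ?thesis .
qed

lemma diagonal_factor:
  assumes z [simp]: "z \<in> Obj (cat M H)"
  obtains h k where "hom_type (cat M P) h = Some (ob (res M q) z, ob (ind M d) z)"
    "hom_type (cat M P) k = Some (ob (ind M d) z, ob (res M p) z)"
    "ar (res M p) (reps M i z) \<cdot>\<^bsub>cat M P\<^esub> \<theta> (ob (ind M i) z) \<cdot>\<^bsub>cat M P\<^esub> ar (res M q) (leta M i z) = k \<cdot>\<^bsub>cat M P\<^esub> h"
proof (rule that)
  show "hom_type (cat M P) (reta M d (ob (res M q) z)) = Some (ob (res M q) z, ob (ind M d) z)"
    "hom_type (cat M P) (leps M d (ob (res M p) z)) = Some (ob (ind M d) z, ob (res M p) z)"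
    using rd.type_units(2)[of "ob (res M p) z"] rd.type_units(3)[of "ob (res M q) z"] by simp_all
  then show "ar (res M p) (reps M i z) \<cdot>\<^bsub>cat M P\<^esub> \<theta> (ob (ind M i) z) \<cdot>\<^bsub>cat M P\<^esub> ar (res M q) (leta M i z)
    = leps M d (ob (res M p) z) \<cdot>\<^bsub>cat M P\<^esub> reta M d (ob (res M q) z)"
    using mackey_unit[OF z] dq by (simp add: tr_def gpd_functorD)
qed

text \<open>The universal property of the right adjoint is \<open>projection_couniversal\<close> for \<open>i\<close>. The transpose to be
  examined is the product of \<open>\<theta> b\<close> with the transpose of the unit. The latter factors through
  \<open>d\<^sub>* z\<close>, and the product of \<open>d\<^sub>* z\<close> with any object is in the image of \<open>d\<^sub>*\<close> by
  \<open>projection_couniversal\<close> for \<open>d\<close>.\<close>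

theorem projection_formula:
  assumes z [simp]: "z \<in> Obj (cat M H)" and b [simp]: "b \<in> Obj (cat M G)"
  defines "Z \<equiv> ob (ind M i) z" and "rb \<equiv> ob (res M i) b"
  shows "ri.induced (Z \<otimes>\<^bsub>tens M G\<^esub> b) (z \<otimes>\<^bsub>tens M H\<^esub> rb)
      (si.pair Z b (reps M i z) (Idn (cat M H) rb)) (si.copair Z b (leta M i z) (Idn (cat M H) rb))"
    "ri.induced (b \<otimes>\<^bsub>tens M G\<^esub> Z) (rb \<otimes>\<^bsub>tens M H\<^esub> z)
      (si.pair b Z (Idn (cat M H) rb) (reps M i z)) (si.copair b Z (Idn (cat M H) rb) (leta M i z))"
proof -
  let ?P = "cat M P" and ?T = "tens M P"
  have Z [simp]: "Z \<in> Obj (cat M G)" and rb [simp]: "rb \<in> Obj (cat M H)" by (simp_all add: Z_def rb_def)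
  have e [simp]: "hom_type (cat M H) (reps M i z) = Some (ob (res M i) Z, z)"
    and n [simp]: "hom_type (cat M H) (leta M i z) = Some (z, ob (res M i) Z)"
    and ob_rb [simp]: "ob (res M i) b = rb"
    by (simp_all add: Z_def rb_def)
  have en: "reps M i z \<cdot>\<^bsub>cat M H\<^esub> leta M i z = Idn (cat M H) z" by (rule ri.special) simp
  obtain h k where h [simp]: "hom_type ?P h = Some (ob (res M q) z, ob (ind M d) z)"
    and k [simp]: "hom_type ?P k = Some (ob (ind M d) z, ob (res M p) z)"
    and kh: "ar (res M p) (reps M i z) \<cdot>\<^bsub>?P\<^esub> \<theta> Z \<cdot>\<^bsub>?P\<^esub> ar (res M q) (leta M i z) = k \<cdot>\<^bsub>?P\<^esub> h"
    using diagonal_factor[OF z] unfolding Z_def .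
  have \<theta> [simp]: "hom_type ?P (\<theta> b) = Some (ob (res M q) rb, ob (res M p) rb)" using \<theta>_type(1)[OF b] by simp
  have prb: "ob (res M p) rb \<in> Obj ?P" by simp
  note cd = projection_couniversal[OF dq faithful_d z prb]
  note ci = projection_couniversal[OF i faithful z b, folded Z_def rb_def]
  let ?i = "Idn ?P (ob (res M p) rb)"
  show "ri.induced (Z \<otimes>\<^bsub>tens M G\<^esub> b) (z \<otimes>\<^bsub>tens M H\<^esub> rb)
      (si.pair Z b (reps M i z) (Idn (cat M H) rb)) (si.copair Z b (leta M i z) (Idn (cat M H) rb))"
  proof (rule induced_of_couniversal[OF ci(1)[folded si.pair_def] _ _ cd(1)])
    show "hom_type ?P ((h \<odot>\<^bsub>?T\<^esub> \<theta> b) \<cdot>\<^bsub>?P\<^esub> inv_arr ?P (mult M q z rb)) = Some (ob (res M q) (z \<otimes>\<^bsub>tens M H\<^esub> rb), ob (ind M d) z \<otimes>\<^bsub>?T\<^esub> ob (res M p) rb)"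
      "hom_type ?P (mult M p z rb \<cdot>\<^bsub>?P\<^esub> (k \<odot>\<^bsub>?T\<^esub> ?i)) = Some (ob (ind M d) z \<otimes>\<^bsub>?T\<^esub> ob (res M p) rb, ob (res M p) (z \<otimes>\<^bsub>tens M H\<^esub> rb))"
      by simp_all
    show "ar (res M p) (si.pair Z b (reps M i z) (Idn (cat M H) rb)) \<cdot>\<^bsub>?P\<^esub> \<theta> (Z \<otimes>\<^bsub>tens M G\<^esub> b) \<cdot>\<^bsub>?P\<^esub> ar (res M q) (si.copair Z b (leta M i z) (Idn (cat M H) rb))
      = (mult M p z rb \<cdot>\<^bsub>?P\<^esub> (k \<odot>\<^bsub>?T\<^esub> ?i)) \<cdot>\<^bsub>?P\<^esub> (h \<odot>\<^bsub>?T\<^esub> \<theta> b) \<cdot>\<^bsub>?P\<^esub> inv_arr ?P (mult M q z rb)"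
      by (simp add: \<theta>_pair[OF Z b, of _ z _ rb _ z _ rb] kh sp.target.tar_merge)
  qed (simp_all add: si.pair_def si.copair_def si.target.tar_merge en)
  show "ri.induced (b \<otimes>\<^bsub>tens M G\<^esub> Z) (rb \<otimes>\<^bsub>tens M H\<^esub> z)
      (si.pair b Z (Idn (cat M H) rb) (reps M i z)) (si.copair b Z (Idn (cat M H) rb) (leta M i z))"
  proof (rule induced_of_couniversal[OF ci(2)[folded si.pair_def] _ _ cd(2)])
    show "hom_type ?P ((\<theta> b \<odot>\<^bsub>?T\<^esub> h) \<cdot>\<^bsub>?P\<^esub> inv_arr ?P (mult M q rb z)) = Some (ob (res M q) (rb \<otimes>\<^bsub>tens M H\<^esub> z), ob (res M p) rb \<otimes>\<^bsub>?T\<^esub> ob (ind M d) z)"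
      "hom_type ?P (mult M p rb z \<cdot>\<^bsub>?P\<^esub> (?i \<odot>\<^bsub>?T\<^esub> k)) = Some (ob (res M p) rb \<otimes>\<^bsub>?T\<^esub> ob (ind M d) z, ob (res M p) (rb \<otimes>\<^bsub>tens M H\<^esub> z))"
      by simp_all
    show "ar (res M p) (si.pair b Z (Idn (cat M H) rb) (reps M i z)) \<cdot>\<^bsub>?P\<^esub> \<theta> (b \<otimes>\<^bsub>tens M G\<^esub> Z) \<cdot>\<^bsub>?P\<^esub> ar (res M q) (si.copair b Z (Idn (cat M H) rb) (leta M i z))
      = (mult M p rb z \<cdot>\<^bsub>?P\<^esub> (?i \<odot>\<^bsub>?T\<^esub> k)) \<cdot>\<^bsub>?P\<^esub> (\<theta> b \<odot>\<^bsub>?T\<^esub> h) \<cdot>\<^bsub>?P\<^esub> inv_arr ?P (mult M q rb z)"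
      by (simp add: \<theta>_pair[OF b Z, of _ rb _ z _ rb _ z] kh sp.target.tar_merge)
  qed (simp_all add: si.pair_def si.copair_def si.target.tar_merge en)
qed

sublocale ambidextrous_projection "cat M G" "tens M G" "cat M H" "tens M H" "res M i" "mult M i" "munit M i"
  "ind M i" "leta M i" "leps M i" "reta M i" "reps M i"
  by unfold_locales (fact projection_formula)+

end

section \<open>The special Frobenius algebra of a faithful functor\<close>

theorem theorem1p2:
  fixes M :: "('a, 'o, 'm) green_data" and H G :: "'a gpd" and i :: "'a cell1"
  assumes "green_2functor M" and "gpd_functor H G i" and "faithful i"
  shows "special_frobenius_algebra (cat M G) (tens M G)
           (A_ob M i) (A_mult M i) (A_unit M i) (A_comult M i) (A_counit M i)
    \<and> (\<exists>B \<mu> \<iota> \<delta> \<epsilon>.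
        commutative_frobenius_algebra (center (cat M G) (tens M G)) (center_tensor (cat M G) (tens M G))
          (center_braiding (cat M G) (tens M G)) B \<mu> \<iota> \<delta> \<epsilon>
        \<and> ob center_forget B = A_ob M i
        \<and> ar center_forget \<mu> = A_mult M i \<and> ar center_forget \<iota> = A_unit M i
        \<and> ar center_forget \<delta> = A_comult M i \<and> ar center_forget \<epsilon> = A_counit M i)"
proof -
  interpret green_2functor M by (rule assms(1))
  interpret green_diagonal M i H G
    by unfold_locales (rule assms)+
  have A: "A_ob M i = A" and m: "A_mult M i = mu" and u: "A_unit M i = iota" and c: "A_comult M i = delta" and e: "A_counit M i = epsilon"
    by (simp_all add: A_ob_def A_mult_def A_unit_def A_comult_def A_counit_def lax_mult_def lax_unit_def
      colax_mult_def colax_unit_def mu_def iota_def delta_def epsilon_def Let_def)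
  show ?thesis
    unfolding A m u c e
    by (rule conjI[OF special_frobenius_A], rule exI, rule exI, rule exI, rule exI, rule exI, rule conjI[OF commutative_frobenius_A])
      (simp add: center_forget_def)
qed

end
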